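(* Let $q$ be a power of a prime. If the finite separable extensions $K/\mathbb{F}_q(T)$ and $L/\mathbb{F}_q(T)$ are arithmetically equivalent over $\mathbb{F}_q(T)$, then they have the same Weil zeta function.
   Context: For a finite separable extension $K$ of $\mathbb{F}_q(T)$, let $\mathcal{O}_K$ be the integral closure of $\mathbb{F}_q[T]$ in $K$; the splitting type $f_K(\mathfrak{p})$ of a non-zero prime $\mathfrak{p}$ of $\mathbb{F}_q[T]$ is the non-decreasing tuple of inertia degrees over $\mathfrak{p}$ of the primes of $\mathcal{O}_K$ above $\mathfrak{p}$. $K$ and $L$ are arithmetically equivalent over $\mathbb{F}_q(T)$ if $f_K(\mathfrak{p})=f_L(\mathfrak{p})$ for all non-zero primes $\mathfrak{p}$ of $\mathbb{F}_q[T]$ outside a set of Dirichlet density zero. The Weil zeta function of $K$, with field of constants $\mathbb{F}_{q^r}$, is $\zeta_K(s)=\sum_I \mathrm{N}(I)^{-s}$ ($s\in\mathbb{C}$), the sum running over the effective divisors $I$ of $K$ (all places included), where $\mathrm{N}(I)=q^{r\deg I}$ is the absolute norm, degrees being taken over the field of constants $\mathbb{F}_{q^r}$. *)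

theory Defs
  imports
    "HOL-Analysis.Analysis"
    "HOL-Algebra.Algebraic_Closure_Type"
begin

text \<open>
  The field \<open>\<bbbF>\<^sub>q\<close> is a finite field type \<open>'k\<close> with \<open>q = CARD('k)\<close>, and
  \<open>\<bbbF>\<^sub>q[T]\<close>, \<open>\<bbbF>\<^sub>q(T)\<close> are \<open>'k poly\<close>, \<open>'k poly fract\<close>. An extension of \<open>\<bbbF>\<^sub>q(T)\<close> is
  a field type \<open>'a\<close> with a ring homomorphism \<open>\<iota> :: 'k poly fract \<Rightarrow> 'a\<close>. Subrings of
  \<open>'a\<close> are treated as structures through their carrier sets.
\<close>

abbreviation subring_of_type :: "'a::comm_ring_1 set \<Rightarrow> 'a ring" where
  "subring_of_type A \<equiv> ring_of_type_algebra\<lparr>carrier := A\<rparr>"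

text \<open>
  The dimension of \<open>B/P\<close> over the image of \<open>A\<close> in \<open>B/P\<close>, for \<open>A \<subseteq> B\<close>; it is meaningful
  if that image is a field, i.e. if \<open>P \<inter> A\<close> is a maximal ideal of \<open>A\<close>.
\<close>
definition residue_degree :: "'a::comm_ring_1 set \<Rightarrow> 'a set \<Rightarrow> 'a set \<Rightarrow> nat" where
  "residue_degree A B P =
     (let R = subring_of_type B; Q = R Quot P
      in ring.dim Q ((\<lambda>a. P +>\<^bsub>R\<^esub> a) ` A) (carrier Q))"


subsection \<open>Finite separable extensions of the rational function field\<close>

definition separable_poly :: "'f::field poly \<Rightarrow> bool" where
  "separable_poly p \<longleftrightarrow> coprime p (pderiv p)"

definition finite_separable_extension ::
    "('k::{field,finite} poly fract \<Rightarrow> 'a::field) \<Rightarrow> bool" where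
  "finite_separable_extension \<iota> \<longleftrightarrow>
     \<iota> \<in> ring_hom ring_of_type_algebra ring_of_type_algebra \<and>
     ring.finite_dimension ring_of_type_algebra (range \<iota>) UNIV \<and>
     (\<forall>x. \<exists>p. Polynomial.lead_coeff p = 1 \<and> Factorial_Ring.irreducible p \<and>
            poly (map_poly \<iota> p) x = 0 \<and> separable_poly p)"

definition poly_embed :: "('k::{field,finite} poly fract \<Rightarrow> 'a::field) \<Rightarrow> 'k poly \<Rightarrow> 'a" where
  "poly_embed \<iota> f = \<iota> (to_fract f)"

definition const_embed :: "('k::{field,finite} poly fract \<Rightarrow> 'a::field) \<Rightarrow> 'k \<Rightarrow> 'a" where
  "const_embed \<iota> c = poly_embed \<iota> [:c:]"


subsection \<open>Splitting types and arithmetic equivalence\<close>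

definition integral_closure :: "('k::{field,finite} poly fract \<Rightarrow> 'a::field) \<Rightarrow> 'a set" where
  "integral_closure \<iota> =
     {x. \<exists>p. Polynomial.lead_coeff p = 1 \<and> poly (map_poly (poly_embed \<iota>) p) x = 0}"

definition base_primes :: "'k::{field,finite} poly set set" where
  "base_primes = {p. primeideal p ring_of_type_algebra \<and> p \<noteq> {0}}"

definition primes_above ::
    "('k::{field,finite} poly fract \<Rightarrow> 'a::field) \<Rightarrow> 'k poly set \<Rightarrow> 'a set set" where
  "primes_above \<iota> p =
     {P. primeideal P (subring_of_type (integral_closure \<iota>)) \<and> poly_embed \<iota> -` P = p}"

definition inertia_degree ::
    "('k::{field,finite} poly fract \<Rightarrow> 'a::field) \<Rightarrow> 'a set \<Rightarrow> nat" where
  "inertia_degree \<iota> P = residue_degree (range (poly_embed \<iota>)) (integral_closure \<iota>) P"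

text \<open>
  For a finite separable extension and a non-zero prime \<open>p\<close>, the set \<open>primes_above \<iota> p\<close> is
  finite, so \<open>mset_set\<close> never takes its default value.
\<close>
definition splitting_type ::
    "('k::{field,finite} poly fract \<Rightarrow> 'a::field) \<Rightarrow> 'k poly set \<Rightarrow> nat list" where
  "splitting_type \<iota> p =
     sorted_list_of_multiset (image_mset (inertia_degree \<iota>) (mset_set (primes_above \<iota> p)))"

definition base_norm :: "'k::{field,finite} poly set \<Rightarrow> nat" where
  "base_norm p = card (carrier (ring_of_type_algebra Quot p))"

definition has_dirichlet_density :: "'k::{field,finite} poly set set \<Rightarrow> real \<Rightarrow> bool" where
  "has_dirichlet_density S d \<longleftrightarrow> S \<subseteq> base_primes \<and>
     ((\<lambda>s::real. (\<Sum>\<^sub>\<infinity>p\<in>S. real (base_norm p) powr - s) /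
                 (\<Sum>\<^sub>\<infinity>p\<in>base_primes. real (base_norm (p :: 'k poly set)) powr - s))
        \<longlongrightarrow> d) (at_right 1)"

definition arithmetically_equivalent ::
    "('k::{field,finite} poly fract \<Rightarrow> 'a::field) \<Rightarrow> ('k poly fract \<Rightarrow> 'b::field) \<Rightarrow> bool" where
  "arithmetically_equivalent \<iota> \<kappa> \<longleftrightarrow>
     (\<exists>S. has_dirichlet_density S 0 \<and>
          (\<forall>p \<in> base_primes - S. splitting_type \<iota> p = splitting_type \<kappa> p))"


subsection \<open>Places, effective divisors and the Weil zeta function\<close>

definition constant_field :: "('k::{field,finite} poly fract \<Rightarrow> 'a::field) \<Rightarrow> 'a set" where
  "constant_field \<iota> = {x. \<exists>p. p \<noteq> 0 \<and> poly (map_poly (const_embed \<iota>) p) x = 0}"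

text \<open>The field of constants has \<open>q\<^sup>r\<close> elements for \<open>r = constant_degree \<iota>\<close>.\<close>
definition constant_degree :: "('k::{field,finite} poly fract \<Rightarrow> 'a::field) \<Rightarrow> nat" where
  "constant_degree \<iota> =
     ring.dim ring_of_type_algebra (range (const_embed \<iota>)) (constant_field \<iota>)"

text \<open>
  A place is represented by its valuation ring \<open>V\<close>; the place itself, as the maximal ideal,
  is the set of non-units of \<open>V\<close>.
\<close>
definition places :: "('k::{field,finite} poly fract \<Rightarrow> 'a::field) \<Rightarrow> 'a set set" where
  "places \<iota> = {V. subring V ring_of_type_algebra \<and> range (const_embed \<iota>) \<subseteq> V \<and> V \<noteq> UNIV \<and>
                   (\<forall>x. x \<in> V \<or> inverse x \<in> V)}"

definition place_degree ::
    "('k::{field,finite} poly fract \<Rightarrow> 'a::field) \<Rightarrow> 'a set \<Rightarrow> nat" where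
  "place_degree \<iota> V = residue_degree (constant_field \<iota>) V (V - Units (subring_of_type V))"

text \<open>Effective divisors are finite formal sums of places, i.e. multisets.\<close>
definition effective_divisors ::
    "('k::{field,finite} poly fract \<Rightarrow> 'a::field) \<Rightarrow> 'a set multiset set" where
  "effective_divisors \<iota> = {D. set_mset D \<subseteq> places \<iota>}"

definition divisor_degree ::
    "('k::{field,finite} poly fract \<Rightarrow> 'a::field) \<Rightarrow> 'a set multiset \<Rightarrow> nat" where
  "divisor_degree \<iota> D = (\<Sum>V\<in>#D. place_degree \<iota> V)"

definition divisor_norm ::
    "('k::{field,finite} poly fract \<Rightarrow> 'a::field) \<Rightarrow> 'a set multiset \<Rightarrow> nat" where
  "divisor_norm \<iota> D = CARD('k) ^ (constant_degree \<iota> * divisor_degree \<iota> D)"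

text \<open>
  The series converges absolutely exactly for \<open>Re s > 1\<close>; elsewhere \<open>infsum\<close> takes the
  value \<open>0\<close>.
\<close>
definition weil_zeta :: "('k::{field,finite} poly fract \<Rightarrow> 'a::field) \<Rightarrow> complex \<Rightarrow> complex" where
  "weil_zeta \<iota> s = (\<Sum>\<^sub>\<infinity>D\<in>effective_divisors \<iota>. of_nat (divisor_norm \<iota> D) powr - s)"

end

(*
  Places of K correspond to Frobenius orbits of points, i.e. of homomorphisms from an integral
  closure to the algebraic closure of F_q, and the points over t fixed by Frob^n are counted by
  the character of the Galois group on the embeddings of K, evaluated at a Frobenius element.
  So it suffices that K and L have the same character: then their fixed points agree in the charts
  T and 1/T, and there is a norm-preserving bijection of places.
  Let W be an orbit of generators, given by a plane curve f(T, X) = 0. The logarithmic count of its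
  points is -ln(1 - v) + O(1): from above by the norms of polynomials, from below by counting
  functions in boxes by their zeros. Hence averages of characters over Frobenius elements are group
  averages (this replaces Chebotarev's theorem). For the squared difference of the two characters,
  which vanishes at the Frobenius elements outside a set of density zero, the average is zero, so
  the characters coincide.
*)
theory Submission
  imports Defs "Jordan_Normal_Form.Char_Poly"
begin


section \<open>The norm of a polynomial modulo a monic polynomial\<close>

hide_const (open) Determinants.det up_ring.coeff up_ring.monom Polynomials.degree Polynomials.lead_coeff
 Divisibility.prime Divisibility.irreducible Coset.order Module.smult UnivPoly.deg
no_notation var ("X\<index>")

text \<open>Arithmetic equivalence says nothing about a set of primes of density zero, about
  ramification or about the places over infinity, while the zeta function needs every place. The
  permutation character of the Galois group on the embeddings bridges this gap: averaged over an
  inertia group, it gives the exact number of Frobenius-fixed points over every t, ramified or not,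
  in either chart. To compare the two characters only sums of products of them are needed, and a
  product is again a permutation character, that of the pairs of embeddings. So equidistribution is
  required only for the number of fixed elements of a finite stable set W. Its group average is the
  number of orbits (Burnside), and each orbit is an irreducible curve over k(T), contributing one
  term -ln(1 - v) with v = q^(1 - s). Density zero is measured against the same -ln(1 - v), so
  bounded errors are harmless and neither the genus nor a functional equation enters. Points are
  homomorphisms rather than prime ideals so that Frobenius acts on them and residue degrees become
  periods.\<close>

lemma poly_map_poly_lessThan:
 fixes e :: "'r::zero => 's::comm_ring_1"
 assumes "e 0 = 0" "!!i. n <= i ==> coeff r i = 0"
 shows "poly (map_poly e r) x = (\<Sum>j<n. e (coeff r j) * x ^ j)"
proof -
 have "!!i. n <= i ==> coeff (map_poly e r) i = 0" using assms by (simp add: coeff_map_poly)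
 then have d: "map_poly e r = 0 \<or> degree (map_poly e r) < n" by (metis leI leading_coeff_0_iff)
 show ?thesis
 proof (cases "map_poly e r = 0")
  case True
  then have "e (coeff r j) = 0" for j using coeff_map_poly[of e r j] assms by simp
  then show ?thesis using True by simp
 next
  case False
  then have "{..degree (map_poly e r)} <= {..<n}" using d by auto
  then have "poly (map_poly e r) x = (\<Sum>j<n. coeff (map_poly e r) j * x ^ j)" unfolding poly_altdef by (intro sum.mono_neutral_left) (auto simp: coeff_eq_0)
  then show ?thesis using assms by (simp add: coeff_map_poly)
 qed
qed

text \<open>Multiplication by X on R[X]/(f) for monic f, on representatives of degree below n: only
  the coefficient at n - 1 overflows, so one multiple of f is subtracted.\<close>

definition mul_X :: "'r::comm_ring_1 poly => 'r poly => 'r poly" where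
 "mul_X f r = pCons 0 r - smult (coeff r (degree f - 1)) f"

text \<open>Row i holds the residue of X^i b modulo f, so for monic f and reduced b this is the
  matrix of multiplication by b on R[X]/(f), and its determinant is the resultant of f and b. No
  division in R occurs, which allows both R = k[T] and R = F[s][Y].\<close>

definition norm_mat :: "'r::comm_ring_1 poly => 'r poly => 'r mat" where
 "norm_mat f b = mat (degree f) (degree f) (%(i, j). coeff ((mul_X f ^^ i) b) j)"

definition poly_norm :: "'r::comm_ring_1 poly => 'r poly => 'r" where
 "poly_norm f b = Determinant.det (norm_mat f b)"

text \<open>Phrased by coefficients, so that it is an additive condition for every n, including n =
  0, and exactly q^n polynomials over k satisfy it.\<close>

definition deg_less :: "nat => 'r::zero poly => bool" where
 "deg_less n b \<longleftrightarrow> (\<forall>i\<ge>n. coeff b i = 0)"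

lemma deg_less_iff: "0 < n ==> deg_less n b \<longleftrightarrow> degree b < n"
 unfolding deg_less_def by (metis coeff_0 coeff_eq_0 leI le_less_trans degree_0 leading_coeff_0_iff order_less_le_trans)

lemma norm_mat_carrier [simp]: "norm_mat f b \<in> carrier_mat (degree f) (degree f)"
 unfolding norm_mat_def by simp

lemma deg_less_mul_X:
 assumes "lead_coeff f = 1" "degree f > 0" "deg_less (degree f) r"
 shows "deg_less (degree f) (mul_X f r)"
 unfolding deg_less_def
proof (intro allI impI)
 fix i assume i: "degree f <= i"
 show "coeff (mul_X f r) i = 0"
 proof (cases "i = degree f")
  case True
  then show ?thesis using assms unfolding mul_X_def by (cases "degree f") auto
 next
  case False
  then show ?thesis using assms i unfolding mul_X_def deg_less_def by (cases i) (auto simp: coeff_eq_0)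
 qed
qed

lemma deg_less_mul_X_pow:
 assumes "lead_coeff f = 1" "degree f > 0" "deg_less (degree f) r"
 shows "deg_less (degree f) ((mul_X f ^^ i) r)"
 by (induction i) (simp_all add: assms deg_less_mul_X)

lemma (in comm_ring_hom) poly_mul_X_pow:
 assumes "poly (map_poly hom f) x = 0"
 shows "poly (map_poly hom ((mul_X f ^^ i) r)) x = x ^ i * poly (map_poly hom r) x"
proof (induction i)
 case (Suc i)
 have "poly (map_poly hom (mul_X f p)) x = x * poly (map_poly hom p) x" for p
 proof -
  have "map_poly hom (mul_X f p) = pCons 0 (map_poly hom p) - smult (hom (coeff p (degree f - 1))) (map_poly hom f)"
   unfolding mul_X_def by (rule poly_eqI) (simp add: coeff_map_poly coeff_pCons hom_distribs split: nat.split)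
  then show ?thesis using assms by simp
 qed
 then show ?case using Suc by (simp add: mult.assoc)
qed simp

lemma (in comm_ring_hom) hom_poly_norm: 
 "hom (poly_norm f b) = Determinant.det (map_mat hom (norm_mat f b))" unfolding poly_norm_def by (simp add: hom_det)

lemma (in comm_ring_hom) norm_mat_row:
 assumes "lead_coeff f = 1" "degree f > 0" "deg_less (degree f) b" "poly (map_poly hom f) x = 0" "i < degree f"
 shows "(\<Sum>j<degree f. hom (norm_mat f b $$ (i, j)) * x ^ j) = x ^ i * poly (map_poly hom b) x"
proof -
 have "poly (map_poly hom ((mul_X f ^^ i) b)) x = (\<Sum>j<degree f. hom (coeff ((mul_X f ^^ i) b) j) * x ^ j)"
  by (rule poly_map_poly_lessThan) (use deg_less_mul_X_pow[OF assms(1-3)] in \<open>simp_all add: deg_less_def\<close>)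
 then show ?thesis using poly_mul_X_pow[OF assms(4)] assms(5) unfolding norm_mat_def by simp
qed

text \<open>At a common root x of f and b, the vector of powers of x lies in the kernel of the
  matrix.\<close>

lemma poly_norm_root_eq_0:
 fixes e :: "'r::comm_ring_1 => 's::idom"
 assumes "comm_ring_hom e" "lead_coeff f = 1" "degree f > 0" "deg_less (degree f) b"
  "poly (map_poly e f) x = 0" "poly (map_poly e b) x = 0"
 shows "e (poly_norm f b) = 0"
proof -
 interpret comm_ring_hom e by fact
 let ?n = "degree f" let ?M = "map_mat e (norm_mat f b)" let ?v = "Matrix.vec ?n (%j. x ^ j)"
 have "?M *\<^sub>v ?v = 0\<^sub>v ?n"
 proof (rule eq_vecI)
  fix i assume "i < dim_vec (0\<^sub>v ?n)"
  then have i: "i < ?n" by simp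
  have "vec_index (?M *\<^sub>v ?v) i = (\<Sum>j<?n. e (norm_mat f b $$ (i, j)) * x ^ j)"
   using i carrier_matD[OF norm_mat_carrier[of f b]] by (simp add: scalar_prod_def row_def atLeast0LessThan)
  then show "vec_index (?M *\<^sub>v ?v) i = vec_index (0\<^sub>v ?n) i" using norm_mat_row[OF assms(2-5) i] assms(6) i by simp
 qed (use carrier_matD[OF norm_mat_carrier[of f b]] in simp)
 moreover have "?v ~= 0\<^sub>v ?n"
 proof
  assume "?v = 0\<^sub>v ?n"
  then have "vec_index ?v 0 = vec_index (0\<^sub>v ?n) 0" by simp
  then show False using assms(3) by simp
 qed
 moreover have "?M \<in> carrier_mat ?n ?n" "?v \<in> carrier_vec ?n" by auto
 ultimately have "Determinant.det ?M = 0" using det_0_iff_vec_prod_zero[of ?M ?n] by blast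
 then show ?thesis by (simp add: hom_poly_norm)
qed

text \<open>The Vandermonde matrix V of the roots diagonalises multiplication by b: M V = V D, with
  the values of b at the roots on the diagonal of D.\<close>

lemma poly_norm_prod:
 fixes e :: "'r::comm_ring_1 => 's::idom" and x :: "nat => 's"
 assumes "comm_ring_hom e" "lead_coeff f = 1" "degree f > 0" "deg_less (degree f) b"
  "!!i. i < degree f ==> poly (map_poly e f) (x i) = 0" "inj_on x {..<degree f}"
 shows "e (poly_norm f b) = (\<Prod>i<degree f. poly (map_poly e b) (x i))"
proof -
 interpret comm_ring_hom e by fact
 let ?n = "degree f" let ?M = "map_mat e (norm_mat f b)"
 let ?V = "mat ?n ?n (%(j, k). x k ^ j)"
 let ?D = "mat ?n ?n (%(j, k). if j = k then poly (map_poly e b) (x k) else 0)"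
 have dn: "dim_row (norm_mat f b) = ?n" "dim_col (norm_mat f b) = ?n" using carrier_matD[OF norm_mat_carrier[of f b]] by auto
 have MV: "?M * ?V = ?V * ?D"
 proof (rule eq_matI)
  fix i k assume "i < dim_row (?V * ?D)" "k < dim_col (?V * ?D)"
  then have ik: "i < ?n" "k < ?n" by auto
  have "(?M * ?V) $$ (i, k) = (\<Sum>j<?n. e (norm_mat f b $$ (i, j)) * x k ^ j)" using ik dn by (simp add: scalar_prod_def row_def col_def atLeast0LessThan)
  also have "... = x k ^ i * poly (map_poly e b) (x k)" using norm_mat_row[OF assms(2-4) assms(5)[OF ik(2)] ik(1)] .
  also have "... = (\<Sum>j<?n. x j ^ i * (if j = k then poly (map_poly e b) (x k) else 0))" using ik by (simp add: if_distrib[of "%z. _ * z"] sum.delta cong: if_cong)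
  also have "... = (?V * ?D) $$ (i, k)" using ik by (simp add: scalar_prod_def row_def col_def atLeast0LessThan)
  finally show "(?M * ?V) $$ (i, k) = (?V * ?D) $$ (i, k)" .
 qed (use dn in simp_all)
 have c: "?M \<in> carrier_mat ?n ?n" "?V \<in> carrier_mat ?n ?n" "?D \<in> carrier_mat ?n ?n" by auto
 have eq: "Determinant.det ?M * Determinant.det ?V = Determinant.det ?V * Determinant.det ?D" using det_mult[OF c(1,2)] det_mult[OF c(2,3)] MV by (simp only:)
 \<comment> \<open>A kernel vector of the transposed Vandermonde matrix would be a nonzero
   polynomial of degree below n with n distinct roots.\<close>
 have "Determinant.det ?V ~= 0"
 proof
  assume "Determinant.det ?V = 0"
  then have "Determinant.det (transpose_mat ?V) = 0" by (simp add: det_transpose[of _ ?n])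
  then obtain v where v: "v \<in> carrier_vec ?n" "v ~= 0\<^sub>v ?n" "transpose_mat ?V *\<^sub>v v = 0\<^sub>v ?n"
   using det_0_iff_vec_prod_zero[of "transpose_mat ?V" ?n] by auto
  define p where "p = (\<Sum>j<?n. monom (vec_index v j) j)"
  have c: "coeff p j = (if j < ?n then vec_index v j else 0)" for j unfolding p_def by (simp add: coeff_sum sum.delta)
  have "poly p (x k) = 0" if "k < ?n" for k
  proof -
   have "vec_index (transpose_mat ?V *\<^sub>v v) k = (\<Sum>j<?n. x k ^ j * vec_index v j)" using that v(1) by (simp add: scalar_prod_def row_def atLeast0LessThan)
   then have "(\<Sum>j<?n. vec_index v j * x k ^ j) = 0" using v(3) that by (simp add: mult.commute)
   then show ?thesis unfolding p_def by (simp add: poly_sum poly_monom)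
  qed
  then have sub: "x ` {..<?n} <= {z. poly p z = 0}" by auto
  have "p ~= 0"
  proof
   assume "p = 0"
   then have "vec_index v j = 0" if "j < ?n" for j using c[of j] that by simp
   then show False using v(1,2) by (auto intro!: eq_vecI)
  qed
  then have "?n <= degree p" using card_mono[OF poly_roots_finite sub] card_poly_roots_bound[of p] card_image[OF assms(6)] by simp
  moreover have "degree p <= ?n - 1" by (rule degree_le) (use c in auto)
  ultimately show False using assms(3) by simp
 qed
 then have "Determinant.det ?M = Determinant.det ?D" using eq by simp
 also have "... = prod_list (diag_mat ?D)" by (rule det_upper_triangular[of _ ?n]) (auto simp: upper_triangular_def)
 also have "... = (\<Prod>i<?n. poly (map_poly e b) (x i))" by (simp add: prod_list_diag_prod atLeast0LessThan)
 finally show ?thesis by (simp add: hom_poly_norm)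
qed

text \<open>Row 0 of adj(M) M = det(M) 1 writes the constant det(M) as a combination of the residues
  X^i b, so the norm lies in the ideal (b, f).\<close>

lemma poly_norm_combination:
 fixes f :: "'r::comm_ring_1 poly"
 assumes "lead_coeff f = 1" "degree f > 0" "deg_less (degree f) b"
 obtains v w where "v * b = [:poly_norm f b:] + w * f"
proof -
 let ?n = "degree f" let ?M = "norm_mat f b" let ?A = "adj_mat ?M"
 have row: "EX w. (mul_X f ^^ i) b = monom 1 i * b + w * f" for i
 proof (induction i)
  case 0
  show ?case by (rule exI[of _ 0]) simp
 next
  case (Suc i)
  then obtain w where w: "(mul_X f ^^ i) b = monom 1 i * b + w * f" by blast
  show ?case
  proof (rule exI)
   have "(mul_X f ^^ Suc i) b = monom 1 1 * (mul_X f ^^ i) b - [:coeff ((mul_X f ^^ i) b) (?n - 1):] * f" unfolding funpow.simps o_def mul_X_def by (simp add: monom_Suc)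
   also have "... = (monom 1 1 * monom 1 i) * b + (monom 1 1 * w - [:coeff ((mul_X f ^^ i) b) (?n - 1):]) * f" unfolding w by (simp add: algebra_simps)
   also have "monom (1::'r) 1 * monom 1 i = monom 1 (Suc i)" by (simp add: mult_monom)
   finally show "(mul_X f ^^ Suc i) b = monom 1 (Suc i) * b + (monom 1 1 * w - [:coeff ((mul_X f ^^ i) b) (?n - 1):]) * f" .
  qed
 qed
 then obtain w where w: "!!i. (mul_X f ^^ i) b = monom 1 i * b + w i * f" by metis
 have Mc: "?M \<in> carrier_mat ?n ?n" and Ac: "?A \<in> carrier_mat ?n ?n" using adj_mat(1)[OF norm_mat_carrier] by auto
 have AM: "?A * ?M = poly_norm f b \<cdot>\<^sub>m 1\<^sub>m ?n" unfolding poly_norm_def using adj_mat(3)[OF norm_mat_carrier] .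
 have "(\<Sum>i<?n. smult (?A $$ (0, i)) ((mul_X f ^^ i) b)) = [:poly_norm f b:]"
 proof (rule poly_eqI)
  fix j
  show "coeff (\<Sum>i<?n. smult (?A $$ (0, i)) ((mul_X f ^^ i) b)) j = coeff [:poly_norm f b:] j"
  proof (cases "j < ?n")
   case True
   have "(?A * ?M) $$ (0, j) = (\<Sum>i<?n. ?A $$ (0, i) * ?M $$ (i, j))"
    using True assms(2) carrier_matD[OF Mc] carrier_matD[OF Ac] by (simp add: scalar_prod_def row_def col_def atLeast0LessThan)
   also have "... = (\<Sum>i<?n. ?A $$ (0, i) * coeff ((mul_X f ^^ i) b) j)" using True by (intro sum.cong) (simp_all add: norm_mat_def)
   finally show ?thesis unfolding AM using True assms(2) by (cases j) (simp_all add: coeff_sum)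
  next
   case False
   then show ?thesis using deg_less_mul_X_pow[OF assms] assms(2) by (cases j) (auto simp: coeff_sum deg_less_def)
  qed
 qed
 moreover have "(\<Sum>i<?n. smult (?A $$ (0, i)) ((mul_X f ^^ i) b))
   = (\<Sum>i<?n. smult (?A $$ (0, i)) (monom 1 i)) * b + (\<Sum>i<?n. smult (?A $$ (0, i)) (w i)) * f"
  by (simp add: w smult_add_right sum.distrib sum_distrib_right)
 ultimately have "(\<Sum>i<?n. smult (?A $$ (0, i)) (monom 1 i)) * b = [:poly_norm f b:] + (- (\<Sum>i<?n. smult (?A $$ (0, i)) (w i))) * f" by (simp add: algebra_simps)
 then show ?thesis by (rule that)
qed

text \<open>Weights: the coefficient of \<open>X\<^sup>i\<close> is charged \<open>C * i\<close> in addition to its degree in \<open>T\<close>.\<close>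

definition weight_le :: "nat => int => 'r::zero poly poly => bool" where
 "weight_le C w b \<longleftrightarrow> (ALL i. coeff b i ~= 0 --> int (degree (coeff b i)) + int C * int i <= w)"

text \<open>By the hypothesis on f no term of f weighs more than X^n, so replacing X^n by lower
  terms does not raise the weight, and each multiplication by X costs at most C.\<close>

lemma weight_le_mul_X_pow:
 fixes f b :: "'r::idom poly poly"
 assumes "!!k. k < degree f ==> degree (coeff f k) <= C * (degree f - k)" "lead_coeff f = 1" "degree f > 0" "weight_le C w b"
 shows "weight_le C (w + int C * int i) ((mul_X f ^^ i) b)"
proof (induction i)
 case (Suc i)
 define r where "r = (mul_X f ^^ i) b"
 define c where "c = coeff r (degree f - 1)"
 have step: "weight_le C (w + int C * int (Suc i)) (mul_X f r)" unfolding weight_le_def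
 proof (intro allI impI)
  fix k assume nz: "coeff (mul_X f r) k ~= 0"
  have bd: "int (degree u) + int C * int k <= w + int C * int (Suc i)" if unz: "u ~= 0" and "u = coeff (pCons 0 r) k \<or> u = c * coeff f k" for u using that(2)
  proof
   assume u: "u = coeff (pCons 0 r) k"
   then obtain k' where k: "k = Suc k'" using unz by (cases k) auto
   then have "int (degree u) + int C * int k' <= w + int C * int i" using Suc u unz unfolding weight_le_def r_def[symmetric] by simp
   then show ?thesis by (simp add: k algebra_simps)
  next
   assume u: "u = c * coeff f k"
   then have c0: "c ~= 0" and f0: "coeff f k ~= 0" using unz by auto
   then have k: "k <= degree f" by (simp add: le_degree)
   have "degree (coeff f k) <= C * (degree f - k)" using assms(1,2) k by (cases "k = degree f") auto
   then have "int (degree (coeff f k)) <= int C * (int (degree f) - int k)" using k by (metis of_nat_diff of_nat_le_iff of_nat_mult)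
   moreover have "int (degree c) + int C * int (degree f - 1) <= w + int C * int i" using Suc c0 unfolding weight_le_def r_def[symmetric] c_def by blast
   moreover have "int (degree u) = int (degree c) + int (degree (coeff f k))" using c0 f0 u by (simp add: degree_mult_eq)
   ultimately show ?thesis using assms(3) by (simp add: algebra_simps of_nat_diff)
  qed
  have e: "coeff (mul_X f r) k = coeff (pCons 0 r) k - c * coeff f k" unfolding mul_X_def c_def by simp
  show "int (degree (coeff (mul_X f r) k)) + int C * int k <= w + int C * int (Suc i)"
  proof (cases "coeff (pCons 0 r) k = 0 \<or> c * coeff f k = 0")
   case True
   then have "degree (coeff (mul_X f r) k) = degree (coeff (pCons 0 r) k) & coeff (pCons 0 r) k ~= 0
      \<or> degree (coeff (mul_X f r) k) = degree (c * coeff f k) & c * coeff f k ~= 0"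
    using e nz by auto
   then show ?thesis using bd by metis
  next
   case False
   have "degree (coeff (mul_X f r) k) <= max (degree (coeff (pCons 0 r) k)) (degree (c * coeff f k))" unfolding e by (rule degree_diff_le_max)
   then show ?thesis using bd[of "coeff (pCons 0 r) k"] bd[of "c * coeff f k"] False by (auto simp: max_def split: if_splits)
  qed
 qed
 then show ?case by (simp add: r_def)
qed (use assms in simp)

text \<open>In each term of the Leibniz expansion the charges C i of the rows and C p(i) of the
  columns cancel because p is a permutation; n factors of weight at most w remain.\<close>

lemma degree_poly_norm_le:
 fixes f b :: "'r::idom poly poly"
 assumes "!!k. k < degree f ==> degree (coeff f k) <= C * (degree f - k)" "lead_coeff f = 1" "degree f > 0" "weight_le C (int w) b"
 shows "degree (poly_norm f b) <= degree f * w"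
proof -
 let ?n = "degree f" let ?M = "norm_mat f b"
 have det: "poly_norm f b = (SUM p:{p. p permutes {0..<?n}}. signof p * (\<Prod>i=0..<?n. ?M $$ (i, p i)))" unfolding poly_norm_def by (rule det_def'[OF norm_mat_carrier])
 have "degree (signof p * (\<Prod>i=0..<?n. ?M $$ (i, p i))) <= ?n * w" if p: "p permutes {0..<?n}" for p
 proof (cases "\<exists>i<?n. ?M $$ (i, p i) = 0")
  case True
  then have "(\<Prod>i=0..<?n. ?M $$ (i, p i)) = 0" by (auto intro!: prod_zero)
  then show ?thesis by (simp only: mult_zero_right degree_0)
 next
  case False
  have ent: "int (degree (?M $$ (i, p i))) + int C * int (p i) <= int w + int C * int i" if i: "i < ?n" for i
  proof -
   have "p i < ?n" using p i by (metis atLeastLessThan_iff permutes_in_image zero_le)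
   then have "?M $$ (i, p i) = coeff ((mul_X f ^^ i) b) (p i)" using i by (simp add: norm_mat_def)
   then show ?thesis using weight_le_mul_X_pow[OF assms, of i] False i unfolding weight_le_def by metis
  qed
  have "int (degree (\<Prod>i=0..<?n. ?M $$ (i, p i))) <= (\<Sum>i=0..<?n. int (degree (?M $$ (i, p i))))"
   using degree_prod_sum_le[of "{0..<?n}" "%i. ?M $$ (i, p i)"] by (simp flip: of_nat_sum)
  also have "... <= (\<Sum>i=0..<?n. int w + int C * int i - int C * int (p i))" by (rule sum_mono) (use ent in force)
  also have "... = int ?n * int w + int C * (\<Sum>i=0..<?n. int i) - int C * (\<Sum>i=0..<?n. int (p i))" by (simp add: sum.distrib sum_subtractf sum_distrib_left)
  also have "(\<Sum>i=0..<?n. int (p i)) = (\<Sum>i=0..<?n. int i)" using sum.permute[OF p, of int] by (simp add: o_def)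
  finally have "degree (\<Prod>i=0..<?n. ?M $$ (i, p i)) <= ?n * w" by (simp flip: of_nat_mult)
  moreover have "degree (signof p :: 'r poly) = 0" by (cases "signof p = (1 :: 'r poly)") (auto simp: sign_def)
  ultimately show ?thesis using degree_mult_le[of "signof p" "\<Prod>i=0..<?n. ?M $$ (i, p i)"] by linarith
 qed
 then show ?thesis unfolding det by (intro degree_sum_le) (auto simp: finite_permutations)
qed


section \<open>Periods and Frobenius\<close>

definition per :: "('y => 'y) => 'y => nat" where
 "per \<phi> y = (LEAST d. 0 < d & (\<phi> ^^ d) y = y)"

definition periodic :: "('y => 'y) => 'y => bool" where
 "periodic \<phi> y \<longleftrightarrow> (\<exists>d>0. (\<phi> ^^ d) y = y)"

definition orb :: "('y => 'y) => 'y => 'y set" where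
 "orb \<phi> y = range (%i. (\<phi> ^^ i) y)"

lemma per_pos_fixed:
 assumes "periodic \<phi> y"
 shows "0 < per \<phi> y" "(\<phi> ^^ per \<phi> y) y = y"
 using LeastI_ex[of "%d. 0 < d & (\<phi> ^^ d) y = y"] assms unfolding per_def periodic_def by auto

lemma funpow_mult_fixed: "(\<phi> ^^ d) y = y ==> (\<phi> ^^ (d * k)) y = y"
 by (induction k) (simp_all add: funpow_add)

lemma funpow_fixed_iff:
 assumes "periodic \<phi> y"
 shows "(\<phi> ^^ m) y = y \<longleftrightarrow> per \<phi> y dvd m"
proof
 let ?d = "per \<phi> y"
 assume m: "(\<phi> ^^ m) y = y"
 have "(\<phi> ^^ (m mod ?d + ?d * (m div ?d))) y = y" using m by simp
 then have r: "(\<phi> ^^ (m mod ?d)) y = y" using funpow_mult_fixed[OF per_pos_fixed(2)[OF assms], of "m div ?d"] by (simp only: funpow_add o_def)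
 show "?d dvd m"
 proof (rule ccontr)
  assume "\<not> ?d dvd m"
  then have "0 < m mod ?d" by (simp add: dvd_eq_mod_eq_0)
  then have "?d <= m mod ?d" unfolding per_def[of \<phi> y, symmetric] using r by (metis (mono_tags, lifting) Least_le per_def)
  then show False using mod_less_divisor[OF per_pos_fixed(1)[OF assms], of m] by simp
 qed
next
 assume "per \<phi> y dvd m"
 then show "(\<phi> ^^ m) y = y" using funpow_mult_fixed[OF per_pos_fixed(2)[OF assms]] by (auto elim: dvdE)
qed

lemma funpow_mod_per:
 assumes "periodic \<phi> y"
 shows "(\<phi> ^^ i) y = (\<phi> ^^ (i mod per \<phi> y)) y"
proof -
 have "(\<phi> ^^ (i mod per \<phi> y + per \<phi> y * (i div per \<phi> y))) y = (\<phi> ^^ (i mod per \<phi> y)) y"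
  by (simp only: funpow_add o_def funpow_mult_fixed[OF per_pos_fixed(2)[OF assms]])
 then show ?thesis by simp
qed

lemma orb_eq:
 assumes "periodic \<phi> y"
 shows "orb \<phi> y = (%i. (\<phi> ^^ i) y) ` {..<per \<phi> y}"
 unfolding orb_def using funpow_mod_per[OF assms] per_pos_fixed(1)[OF assms] by (force simp: image_iff)

lemma funpow_return:
 assumes "periodic \<phi> y"
 obtains j where "(\<phi> ^^ j) ((\<phi> ^^ i) y) = y"
proof -
 let ?d = "per \<phi> y"
 have "(\<phi> ^^ (?d * i)) y = y" using funpow_mult_fixed[OF per_pos_fixed(2)[OF assms]] .
 moreover have "?d * i = (?d * i - i) + i" using per_pos_fixed(1)[OF assms] by simp
 ultimately have "(\<phi> ^^ (?d * i - i)) ((\<phi> ^^ i) y) = y" by (metis funpow_add o_apply)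
 then show ?thesis by (rule that)
qed

lemma inj_on_funpow:
 assumes "periodic \<phi> y"
 shows "inj_on (%i. (\<phi> ^^ i) y) {..<per \<phi> y}"
proof -
 have "i = k" if le: "i <= k" "k < per \<phi> y" and eq: "(\<phi> ^^ i) y = (\<phi> ^^ k) y" for i k
 proof -
  obtain j where j: "(\<phi> ^^ j) ((\<phi> ^^ i) y) = y" using funpow_return[OF assms] .
  have "(\<phi> ^^ (j + i)) y = y" using j by (simp add: funpow_add)
  moreover have "(\<phi> ^^ (j + k)) y = y" using j eq by (simp add: funpow_add)
  ultimately have "per \<phi> y dvd (j + k) - (j + i)" using funpow_fixed_iff[OF assms] by (metis dvd_diff_nat)
  then show ?thesis using le by (auto dest: dvd_imp_le)
 qed
 then show ?thesis unfolding inj_on_def by (metis lessThan_iff nat_le_linear)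
qed

lemma card_orb: "periodic \<phi> y ==> card (orb \<phi> y) = per \<phi> y"
 by (simp add: orb_eq card_image inj_on_funpow)

lemma finite_orb: "periodic \<phi> y ==> finite (orb \<phi> y)"
 by (simp add: orb_eq)

lemma orb_self: "y \<in> orb \<phi> y"
 unfolding orb_def by (metis funpow_0 rangeI)

lemma orb_in: "z \<in> orb \<phi> y \<longleftrightarrow> (EX i. z = (\<phi> ^^ i) y)"
 unfolding orb_def by auto

lemma orb_eqI:
 assumes "periodic \<phi> y" "z \<in> orb \<phi> y"
 shows "orb \<phi> z = orb \<phi> y"
proof -
 obtain i where i: "z = (\<phi> ^^ i) y" using assms(2) by (auto simp: orb_in)
 obtain j where j: "(\<phi> ^^ j) z = y" using funpow_return[OF assms(1), of i] i by blast
 show ?thesis unfolding orb_def using i j by (auto simp: image_iff) (metis funpow_add o_apply)+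
qed

lemma periodic_funpow: "periodic \<phi> y ==> periodic \<phi> ((\<phi> ^^ i) y)"
 unfolding periodic_def by (metis add.commute funpow_add o_apply)

lemma per_funpow:
 assumes "periodic \<phi> y"
 shows "per \<phi> ((\<phi> ^^ i) y) = per \<phi> y"
proof -
 have "(\<phi> ^^ i) y \<in> orb \<phi> y" unfolding orb_in by blast
 then show ?thesis using orb_eqI[OF assms] card_orb[OF assms] card_orb[OF periodic_funpow[OF assms, of i]] by metis
qed

section \<open>Frobenius on the algebraic closure of a finite field\<close>

lemma power_CARD_eq_same:
 fixes x :: "'k::{field,finite}"
 shows "x ^ CARD('k) = x"
proof (cases "x = 0")
 case False
 have "(PROD y:UNIV - {0}. x * y) = (PROD y:UNIV - {0}. y)" by (rule prod.reindex_bij_witness[of _ "%y. y / x" "%y. x * y"]) (use False in auto)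
 then have "x ^ (CARD('k) - 1) = 1" by (simp add: prod.distrib)
 moreover have "CARD('k) = Suc (CARD('k) - 1)" using zero_less_card_finite[where 'a='k] by simp
 ultimately show ?thesis by (metis mult.right_neutral power_Suc)
next
 case True
 then show ?thesis using zero_less_card_finite[where 'a='k] by (simp add: power_0_left)
qed

lemma CARD_ge_2: "2 <= CARD('k::{field,finite})"
 using card_mono[of UNIV "{0::'k, 1}"] by simp

text \<open>(X + 1)^q - X^q - 1 has degree below q but vanishes at all q elements of the field, so
  it is zero. This makes Frobenius additive without writing q as a power of a prime.\<close>

lemma choose_CARD_eq_0:
 assumes "0 < i" "i < CARD('k::{field,finite})"
 shows "of_nat (CARD('k) choose i) = (0::'k)"
proof -
 let ?q = "CARD('k)"
 define p :: "'k poly" where "p = (SUM i:{0<..<?q}. monom (of_nat (?q choose i)) i)"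
 have "poly p x = 0" for x
 proof -
  have "(x + 1) ^ ?q = (\<Sum>i\<le>?q. of_nat (?q choose i) * x ^ i)" by (simp add: binomial_ring)
  also have "{..?q} = insert 0 (insert ?q {0<..<?q})" by auto
  also have "(SUM i:insert 0 (insert ?q {0<..<?q}). of_nat (?q choose i) * x ^ i)
    = 1 + (x ^ ?q + (SUM i:{0<..<?q}. of_nat (?q choose i) * x ^ i))"
   using zero_less_card_finite[where 'a='k] by (subst sum.insert; simp)+
  finally have "(SUM i:{0<..<?q}. of_nat (?q choose i) * x ^ i) = 0" by (simp add: power_CARD_eq_same)
  then show ?thesis unfolding p_def by (simp add: poly_sum poly_monom)
 qed
 then have "{x. poly p x = 0} = UNIV" by auto
 moreover have "degree p <= ?q - 1" unfolding p_def by (intro degree_sum_le) (auto intro: order_trans[OF degree_monom_le])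
 ultimately have "p = 0" using card_poly_roots_bound[of p] assms by (cases "p = 0") auto
 then have "coeff p i = 0" by simp
 then show ?thesis unfolding p_def using assms by (simp add: coeff_sum sum.delta)
qed

lemma power_CARD_add:
 fixes h :: "'k::{field,finite} => 'a::field"
 assumes "field_hom h"
 shows "(x + (y :: 'a)) ^ CARD('k) = x ^ CARD('k) + y ^ CARD('k)"
proof -
 interpret h: field_hom h by fact
 let ?q = "CARD('k)"
 have "(x + y) ^ ?q = (\<Sum>i\<le>?q. of_nat (?q choose i) * x ^ i * y ^ (?q - i))" by (rule binomial_ring)
 also have "... = (SUM i:{0, ?q}. of_nat (?q choose i) * x ^ i * y ^ (?q - i))"
 proof (rule sum.mono_neutral_right)
  show "ALL i:{..?q} - {0, ?q}. of_nat (?q choose i) * x ^ i * y ^ (?q - i) = 0"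
  proof
   fix i assume "i \<in> {..?q} - {0, ?q}"
   then have "of_nat (?q choose i) = (0::'k)" by (intro choose_CARD_eq_0) auto
   then have "h (of_nat (?q choose i)) = 0" by simp
   then have "of_nat (?q choose i) = (0::'a)" by (simp add: h.hom_of_nat)
   then show "of_nat (?q choose i) * x ^ i * y ^ (?q - i) = 0" by simp
  qed
 qed auto
 also have "... = y ^ ?q + x ^ ?q" using zero_less_card_finite[where 'a='k] by simp
 finally show ?thesis by simp
qed

definition frob :: "'k::{field,finite} alg_closure => 'k alg_closure" where
 "frob x = x ^ CARD('k)"

lemma to_ac_hom: "field_hom (to_ac :: 'k::field => 'k alg_closure)"
 by unfold_locales auto

interpretation to_ac: field_hom "to_ac :: 'k::field => 'k alg_closure" by (rule to_ac_hom)

lemma frob_add: "frob (x + y) = frob x + frob (y :: 'k::{field,finite} alg_closure)"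
 unfolding frob_def by (rule power_CARD_add[OF to_ac_hom])

lemma frob_hom: "field_hom (frob :: 'k::{field,finite} alg_closure => _)"
proof
 show "frob (0 :: 'k alg_closure) = 0" using zero_less_card_finite[where 'a='k] by (simp add: frob_def)
qed (simp_all add: frob_add, simp_all add: frob_def power_mult_distrib)

interpretation frob: field_hom "frob :: 'k::{field,finite} alg_closure => _" by (rule frob_hom)

lemma frob_pow_hom: "field_hom ((frob :: 'k::{field,finite} alg_closure => _) ^^ n)"
proof -
 have "(frob ^^ n) (x + y) = (frob ^^ n) x + (frob ^^ n) y & (frob ^^ n) (x * y) = (frob ^^ n) x * (frob ^^ n) y
   & (frob ^^ n) 0 = (0 :: 'k alg_closure) & (frob ^^ n) 1 = (1 :: 'k alg_closure)" for x y :: "'k alg_closure"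
  by (induction n) (simp_all add: frob.hom_add frob.hom_mult)
 then show ?thesis by unfold_locales auto
qed

interpretation frob_pow: field_hom "(frob :: 'k::{field,finite} alg_closure => _) ^^ n" by (rule frob_pow_hom)

lemma frob_pow_eq: "(frob ^^ n) x = (x :: 'k::{field,finite} alg_closure) ^ (CARD('k) ^ n)"
 by (induction n) (simp_all add: frob_def power_mult[symmetric] mult.commute)

lemma frob_to_ac [simp]: "frob (to_ac c) = to_ac c"
 by (simp add: frob_def power_CARD_eq_same flip: to_ac_power)

lemma frob_pow_to_ac [simp]: "(frob ^^ n) (to_ac c) = to_ac c"
 by (induction n) simp_all

definition fix_poly :: "nat => 'k::{field,finite} alg_closure poly" where
 "fix_poly n = monom 1 (CARD('k) ^ n) - monom 1 1"

lemma poly_fix_poly: "poly (fix_poly n) x = (frob ^^ n) x - x"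
 by (simp add: fix_poly_def poly_monom frob_pow_eq)

lemma fix_poly_nonzero: "0 < n ==> fix_poly n ~= (0 :: 'k::{field,finite} alg_closure poly)"
 and degree_fix_poly: "0 < n ==> degree (fix_poly n :: 'k alg_closure poly) <= CARD('k) ^ n"
proof -
 assume n: "0 < n"
 have "1 < CARD('k) ^ n" using n CARD_ge_2[where 'k='k] by (intro one_less_power) auto
 then have "coeff (fix_poly n :: 'k alg_closure poly) (CARD('k) ^ n) = 1" by (simp add: fix_poly_def)
 then show "fix_poly n ~= (0 :: 'k::{field,finite} alg_closure poly)" by force
 show "degree (fix_poly n :: 'k alg_closure poly) <= CARD('k) ^ n" unfolding fix_poly_def using \<open>1 < CARD('k) ^ n\<close>
  by (intro degree_diff_le order_trans[OF degree_monom_le]) auto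
qed

lemma card_frob_fixed_le:
 assumes "0 < n"
 shows "finite {x :: 'k::{field,finite} alg_closure. (frob ^^ n) x = x}"
  "card {x :: 'k alg_closure. (frob ^^ n) x = x} <= CARD('k) ^ n"
proof -
 have e: "{x :: 'k alg_closure. (frob ^^ n) x = x} = {x. poly (fix_poly n) x = 0}" by (simp add: poly_fix_poly)
 show "finite {x :: 'k alg_closure. (frob ^^ n) x = x}" unfolding e by (rule poly_roots_finite[OF fix_poly_nonzero[OF assms]])
 show "card {x :: 'k alg_closure. (frob ^^ n) x = x} <= CARD('k) ^ n"
  unfolding e using card_poly_roots_bound[OF fix_poly_nonzero[OF assms, where 'k='k]] degree_fix_poly[OF assms, where 'k='k] by (meson order_trans)
qed

text \<open>By counting: the q constants are fixed, and X^q - X has at most q roots.\<close>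

lemma frob_fixed_iff: "frob x = x \<longleftrightarrow> x \<in> range (to_ac :: 'k::{field,finite} => _)"
proof -
 have "range (to_ac :: 'k => _) = {x. (frob ^^ 1) x = x}" by (rule card_seteq) (use card_frob_fixed_le[of 1, where 'k='k] card_image[OF inj_to_ac[where 'a='k]] in auto)
 then show ?thesis by auto
qed

definition ev :: "'k::field alg_closure => 'k poly => 'k alg_closure" where
 "ev t p = poly (map_poly to_ac p) t"

lemma ev_hom: "comm_ring_hom (ev t)"
proof -
 interpret m: map_poly_comm_ring_hom "to_ac :: 'a => 'a alg_closure" ..
 show ?thesis unfolding ev_def by unfold_locales (simp_all add: m.hom_add m.hom_mult)
qed

interpretation ev: comm_ring_hom "ev t" for t by (rule ev_hom)

lemma ev_const [simp]: "ev t [:c:] = to_ac c"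
 by (cases "c = 0") (simp_all add: ev_def)

lemma ev_T [simp]: "ev t [:0, 1:] = t"
 by (simp add: ev_def)

lemma frob_ev: "(frob ^^ n) (ev t p) = ev ((frob ^^ n) t) p"
proof -
 have "(frob ^^ n) (ev t p) = poly (map_poly (frob ^^ n) (map_poly to_ac p)) ((frob ^^ n) t)" unfolding ev_def by (simp add: frob_pow.poly_map_poly)
 also have "map_poly (frob ^^ n) (map_poly to_ac p) = map_poly to_ac p" by (simp add: map_poly_map_poly o_def)
 finally show ?thesis unfolding ev_def .
qed

text \<open>All iterates of x are roots of one nonzero polynomial over k, so two of them coincide,
  and injectivity of Frobenius cancels the common iterations.\<close>

lemma periodic_frob: "periodic frob (x :: 'k::{field,finite} alg_closure)"
proof -
 obtain p :: "'k poly" where p: "p ~= 0" "ev x p = 0" unfolding ev_def by (rule alg_closure_algebraic)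
 have "range (%i. (frob ^^ i) x) <= {z. poly (map_poly to_ac p) z = 0}" using frob_ev[of _ x p] p(2) by (auto simp: ev_def[symmetric])
 then have "finite (range (%i. (frob ^^ i) x))" by (rule finite_subset) (use p(1) in \<open>auto intro!: poly_roots_finite\<close>)
 then have "\<not> inj (%i. (frob ^^ i) x)" using finite_imageD infinite_UNIV_nat by blast
 then obtain i j where ij: "(frob ^^ i) x = (frob ^^ j) x" "i ~= j" unfolding inj_def by blast
 have *: "\<exists>d>0. (frob ^^ d) x = x" if "(frob ^^ i) x = (frob ^^ j) x" "i < j" for i j
 proof -
  have "(frob ^^ i) ((frob ^^ (j - i)) x) = (frob ^^ i) x" using that funpow_add[of i "j - i" frob] by (metis le_add_diff_inverse less_imp_le o_apply)
  then have "(frob ^^ (j - i)) x = x" using frob_pow.injectivity by blast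
  then show ?thesis using that(2) by (metis zero_less_diff)
 qed
 show ?thesis unfolding periodic_def using *[of i j] *[of j i] ij by (metis linorder_neqE_nat)
qed

abbreviation fper :: "'k::{field,finite} alg_closure => nat" where
 "fper \<equiv> per frob"

lemma finite_fper: "finite {x :: 'k::{field,finite} alg_closure. fper x = d}"
 and card_fper_le: "card {x :: 'k::{field,finite} alg_closure. fper x = d} <= CARD('k) ^ d"
proof -
 have sub: "{x :: 'k alg_closure. fper x = d} <= {x. (frob ^^ d) x = x}" if "0 < d" using per_pos_fixed(2)[OF periodic_frob] by auto
 have em: "{x :: 'k alg_closure. fper x = d} = {}" if "d = 0" using per_pos_fixed(1)[OF periodic_frob[where 'k='k]] that by force
 show "finite {x :: 'k::{field,finite} alg_closure. fper x = d}"
 proof (cases "d = 0")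
  case True
  show ?thesis unfolding em[OF True] by (rule finite.emptyI)
 next
  case False
  then show ?thesis using finite_subset[OF sub card_frob_fixed_le(1)] by blast
 qed
 show "card {x :: 'k::{field,finite} alg_closure. fper x = d} <= CARD('k) ^ d"
 proof (cases "d = 0")
  case True
  show ?thesis unfolding em[OF True] by simp
 next
  case False
  then show ?thesis using card_mono[OF card_frob_fixed_le(1) sub] card_frob_fixed_le(2)[of d, where 'k='k] by fastforce
 qed
qed

lemma frob_invariant_poly:
 assumes "map_poly frob P = P"
 obtains f :: "'k::{field,finite} poly" where "P = map_poly to_ac f"
proof
 show "P = map_poly to_ac (map_poly of_ac P)"
 proof (rule poly_eqI)
  fix i
  have "frob (coeff P i) = coeff P i" using assms coeff_map_poly[of frob P i] by simp
  then show "coeff P i = coeff (map_poly to_ac (map_poly of_ac P)) i" by (simp add: coeff_map_poly frob_fixed_iff to_ac_of_ac)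
 qed
qed

text \<open>This is the minimal polynomial of t over k, built as a product over the orbit: Frobenius
  permutes the factors cyclically, so the coefficients lie in k. It replaces irreducible polynomials
  throughout.\<close>

lemma ex_poly_roots_orb:
 fixes t :: "'k::{field,finite} alg_closure"
 obtains f :: "'k poly" where "!!z. ev z f = 0 \<longleftrightarrow> z \<in> orb frob t" "lead_coeff f = 1" "degree f = fper t"
proof -
 let ?d = "fper t"
 define P where "P = (\<Prod>i<?d. [:- (frob ^^ i) t, 1:])"
 interpret f: map_poly_comm_ring_hom "frob :: 'k alg_closure => _" ..
 have "map_poly frob P = (\<Prod>i<?d. [:- (frob ^^ Suc i) t, 1:])" unfolding P_def by (simp add: f.hom_prod hom_distribs)
 also have "... = P"
 proof -
  have "0 < ?d" using per_pos_fixed(1)[OF periodic_frob] .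
  then obtain n where n: "?d = Suc n" by (cases ?d) auto
  have "(\<Prod>i<Suc n. [:- (frob ^^ Suc i) t, 1:]) = (\<Prod>i<n. [:- (frob ^^ Suc i) t, 1:]) * [:- t, 1:]" using per_pos_fixed(2)[OF periodic_frob, of t] n by simp
  also have "... = (\<Prod>i<Suc n. [:- (frob ^^ i) t, 1:])" by (subst prod.lessThan_Suc_shift) (simp add: mult.commute)
  finally show ?thesis unfolding P_def n .
 qed
 finally obtain f :: "'k poly" where f: "P = map_poly to_ac f" by (rule frob_invariant_poly)
 show ?thesis
 proof
  show "ev z f = 0 \<longleftrightarrow> z \<in> orb frob t" for z unfolding ev_def f[symmetric] orb_eq[OF periodic_frob] P_def by (auto simp: poly_prod)
  have "lead_coeff P = 1" unfolding P_def by (simp add: lead_coeff_prod)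
  then show "lead_coeff f = 1" unfolding f by (simp add: coeff_map_poly)
  have "degree P = ?d" unfolding P_def by (simp add: degree_prod_eq_sum_degree)
  then show "degree f = ?d" unfolding f by simp
 qed
qed

lemma conj_imp_orb:
 assumes "!!p. ev t p = 0 ==> ev t' p = 0"
 shows "t' \<in> orb frob (t :: 'k::{field,finite} alg_closure)"
 using ex_poly_roots_orb[of t] assms orb_self by metis

lemma ev_eq_0_orb: "t' \<in> orb frob t ==> ev t' p = 0 \<longleftrightarrow> ev t p = 0"
 by (metis frob_ev frob_pow.hom_0_iff orb_in)


section \<open>Hensel lifting in power series rings\<close>

lemma fps_X_power_dvdI:
 fixes g :: "'a::comm_ring_1 fps"
 assumes "!!i. i < n ==> fps_nth g i = 0"
 shows "fps_X ^ n dvd g"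
proof
 show "g = fps_X ^ n * Abs_fps (%i. fps_nth g (i + n))" using assms by (intro fps_ext) (simp add: fps_X_power_mult_nth)
qed

lemma fps_X_power_dvdD:
 fixes g :: "'a::comm_ring_1 fps"
 assumes "fps_X ^ n dvd g" "i < n"
 shows "fps_nth g i = 0"
 using assms by (auto simp: fps_X_power_mult_nth)

lemma poly_Taylor2:
 fixes F :: "'a::idom poly"
 shows "EX r. poly F (x + h) = poly F x + h * poly (pderiv F) x + h\<^sup>2 * r"
proof (induction F)
 case (pCons a p)
 then obtain r where r: "poly p (x + h) = poly p x + h * poly (pderiv p) x + h\<^sup>2 * r" by blast
 show ?case by (rule exI[of _ "x * r + poly (pderiv p) x + h * r"])
    (unfold poly_pCons r pderiv_pCons, simp add: algebra_simps power2_eq_square)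
qed simp

lemma diff_dvd_poly_diff: "(x - y) dvd poly F x - poly F (y :: 'a::comm_ring_1)"
proof (induction F)
 case (pCons a p)
 have "poly (pCons a p) x - poly (pCons a p) y = (x - y) * poly p x + y * (poly p x - poly p y)" by (simp add: algebra_simps)
 then show ?case using pCons by (metis dvd_add dvd_mult dvd_triv_left)
qed simp

lemma fps_nth_0_hom: "comm_ring_hom (%a. fps_nth a 0)"
 by unfold_locales auto

interpretation fps0: comm_ring_hom "%a. fps_nth a 0" by (rule fps_nth_0_hom)

lemma map_poly_pderiv:
 fixes e :: "'r::idom => 's::idom"
 assumes "comm_ring_hom e"
 shows "map_poly e (pderiv F) = pderiv (map_poly e F)"
proof -
 interpret comm_ring_hom e by fact
 have "e (of_nat n) = of_nat n" for n by (induction n) (simp_all add: hom_add)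
 then show ?thesis by (intro poly_eqI) (simp add: coeff_map_poly coeff_pderiv hom_mult hom_add)
qed

text \<open>Newton iteration with the derivative frozen at its constant term D: step k corrects only
  the coefficient of X^(k + 1), so every coefficient becomes stationary and the diagonal of the
  sequence is the root.\<close>

theorem Hensel:
 fixes F :: "'a::field fps poly"
 assumes root: "poly (map_poly (%a. fps_nth a 0) F) z = 0"
  and simple: "poly (pderiv (map_poly (%a. fps_nth a 0) F)) z ~= 0"
 obtains \<zeta> where "poly F \<zeta> = 0" "fps_nth \<zeta> 0 = z"
proof -
 define D where "D = poly (pderiv (map_poly (%a. fps_nth a 0) F)) z"
 define a where "a = rec_nat (fps_const z) (%k a. a - fps_const (fps_nth (poly F a) (Suc k) / D) * fps_X ^ Suc k)"
 have a0: "a 0 = fps_const z" by (simp add: a_def)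
 have aS: "a (Suc k) = a k + fps_X ^ Suc k * fps_const (- (fps_nth (poly F (a k)) (Suc k) / D))" for k by (simp add: a_def algebra_simps flip: fps_const_neg)
 have c0: "fps_nth (poly G x) 0 = poly (map_poly (%a. fps_nth a 0) G) (fps_nth x 0)" for G and x :: "'a fps" by (rule fps0.poly_map_poly[symmetric])
 have az: "fps_nth (a k) 0 = z" for k by (induction k) (simp_all add: a0 aS mult.assoc)
 have dv: "fps_X ^ Suc k dvd poly F (a k)" for k
 proof (induction k)
  case 0
  show ?case using c0[of F "a 0"] root by (intro fps_X_power_dvdI) (simp add: a0)
 next
  case (Suc k)
  then obtain u where u: "poly F (a k) = fps_X ^ Suc k * u" by (auto elim: dvdE)
  define c where "c = fps_nth (poly F (a k)) (Suc k) / D"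
  define h where "h = fps_X ^ Suc k * fps_const (- c)"
  obtain r where r: "poly F (a k + h) = poly F (a k) + h * poly (pderiv F) (a k) + h\<^sup>2 * r" using poly_Taylor2 by blast
  have "poly F (a k + h) = fps_X ^ Suc k * (u + fps_const (- c) * poly (pderiv F) (a k) + fps_X * (fps_X ^ k * fps_const (- c) * fps_const (- c) * r))"
   unfolding r u by (simp add: h_def algebra_simps power2_eq_square)
  moreover have "fps_X ^ 1 dvd u + fps_const (- c) * poly (pderiv F) (a k) + fps_X * (fps_X ^ k * fps_const (- c) * fps_const (- c) * r)"
  proof (rule fps_X_power_dvdI)
   fix i :: nat assume "i < 1"
   have "fps_nth u 0 = fps_nth (poly F (a k)) (Suc k)" unfolding u by (simp add: fps_X_power_mult_nth del: power_Suc)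
   moreover have "fps_nth (poly (pderiv F) (a k)) 0 = D" unfolding c0 D_def az by (simp add: map_poly_pderiv[OF fps_nth_0_hom])
   ultimately show "fps_nth (u + fps_const (- c) * poly (pderiv F) (a k) + fps_X * (fps_X ^ k * fps_const (- c) * fps_const (- c) * r)) i = 0"
    using \<open>i < 1\<close> simple by (simp add: c_def D_def)
  qed
  ultimately have "fps_X ^ Suc k * fps_X ^ 1 dvd poly F (a k + h)" by (metis mult_dvd_mono dvd_refl)
  then show ?case by (simp add: aS h_def c_def mult.commute)
 qed
 define \<zeta> where "\<zeta> = Abs_fps (%n. fps_nth (a n) n)"
 have stable: "fps_nth (a (i + k)) i = fps_nth (a i) i" for i k by (induction k) (simp_all add: aS fps_X_power_mult_nth del: power_Suc)
 have "poly F \<zeta> = 0"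
 proof (rule fps_ext)
  fix n
  have "fps_X ^ Suc n dvd \<zeta> - a n"
  proof (rule fps_X_power_dvdI)
   fix i assume "i < Suc n"
   then have "n = i + (n - i)" by simp
   then show "fps_nth (\<zeta> - a n) i = 0" using stable[of i "n - i"] by (simp add: \<zeta>_def)
  qed
  then have "fps_X ^ Suc n dvd poly F \<zeta> - poly F (a n)" using diff_dvd_poly_diff dvd_trans by blast
  then have "fps_X ^ Suc n dvd poly F \<zeta>" using dv[of n] by (metis diff_add_cancel dvd_add)
  then have "fps_nth (poly F \<zeta>) n = 0" by (rule fps_X_power_dvdD) simp
  then show "fps_nth (poly F \<zeta>) n = fps_nth 0 n" by simp
 qed
 moreover have "fps_nth \<zeta> 0 = z" by (simp add: \<zeta>_def az)
 ultimately show ?thesis by (rule that)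
qed

lemma simple_root_if_card_roots:
 fixes p :: "'a::field poly"
 assumes "card {x. poly p x = 0} = degree p" "0 < degree p" "poly p z = 0"
 shows "poly (pderiv p) z ~= 0"
proof
 assume d: "poly (pderiv p) z = 0"
 obtain g where g: "p = [:- z, 1:] * g" using assms(3) by (metis dvdE poly_eq_0_iff_dvd)
 have g0: "g ~= 0" using assms(2) g by auto
 have "pderiv p = g + [:- z, 1:] * pderiv g" unfolding g pderiv_mult by (simp add: pderiv_pCons)
 then have "poly g z = 0" using d by simp
 then have "{x. poly p x = 0} <= {x. poly g x = 0}" using g by auto
 then have "degree p <= degree g" using card_mono[OF poly_roots_finite[OF g0]] card_poly_roots_bound[OF g0] assms(1) by (metis order_trans)
 moreover have "degree p = Suc (degree g)" unfolding g by (subst degree_mult_eq) (use g0 in auto)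
 ultimately show False by simp
qed

section \<open>Taylor expansion at a point and Frobenius on coefficients\<close>

definition fps_frob :: "'k::{field,finite} alg_closure fps => 'k alg_closure fps" where
 "fps_frob g = Abs_fps (%n. frob (fps_nth g n))"

lemma fps_frob_hom: "comm_ring_hom (fps_frob :: 'k::{field,finite} alg_closure fps => _)"
proof
 show "fps_frob (x * y) = fps_frob x * fps_frob y" for x y :: "'k alg_closure fps" by (rule fps_ext) (simp add: fps_frob_def fps_mult_nth frob.hom_sum frob.hom_mult)
 show "fps_frob 1 = (1 :: 'k alg_closure fps)" by (rule fps_ext) (simp add: fps_frob_def)
qed (rule fps_ext, simp add: fps_frob_def frob.hom_add)+

interpretation fps_frob: comm_ring_hom "fps_frob :: 'k::{field,finite} alg_closure fps => _" by (rule fps_frob_hom)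

lemma subdegree_fps_frob: "subdegree (fps_frob g) = subdegree g"
 unfolding subdegree_def fps_frob_def by (simp add: fps_eq_iff)

text \<open>The expansion of p in the local parameter T - t, obtained by substituting t + X for
  T.\<close>

definition taylor :: "'k::field alg_closure => 'k poly => 'k alg_closure fps" where
 "taylor t p = fps_of_poly (pcompose (map_poly to_ac p) [:t, 1:])"

lemma taylor_hom: "comm_ring_hom (taylor t)"
proof -
 interpret m: map_poly_comm_ring_hom "to_ac :: 'a => 'a alg_closure" ..
 show ?thesis unfolding taylor_def by unfold_locales (simp_all add: m.hom_add m.hom_mult pcompose_add pcompose_mult fps_of_poly_add fps_of_poly_mult)
qed

interpretation taylor: comm_ring_hom "taylor t" for t by (rule taylor_hom)

lemma taylor_nth_0 [simp]: "fps_nth (taylor t p) 0 = ev t p"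
 unfolding taylor_def ev_def by (simp add: poly_0_coeff_0[symmetric] poly_pcompose)

lemma taylor_eq_0_iff [simp]: "taylor t p = 0 \<longleftrightarrow> p = 0"
proof
 assume "taylor t p = 0"
 then have "pcompose (map_poly to_ac p) [:t, 1:] = 0" unfolding taylor_def by simp
 then have "map_poly to_ac p = 0" using pcompose_eq_0[of "map_poly to_ac p" "[:t, 1:]"] by simp
 then show "p = 0" by simp
qed simp

lemma fps_frob_taylor: "fps_frob (taylor t p) = taylor (frob t) p"
proof (induction p)
 case (pCons c p)
 have t: "taylor s (pCons c p) = fps_const (to_ac c) + (fps_const s + fps_X) * taylor s p" for s
 proof -
  have "map_poly to_ac (pCons c p) = pCons (to_ac c) (map_poly to_ac p)" by (rule poly_eqI) (simp add: coeff_map_poly coeff_pCons split: nat.split)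
  then show ?thesis unfolding taylor_def by (simp add: pcompose_pCons fps_of_poly_add fps_of_poly_mult fps_of_poly_pCons fps_of_poly_const algebra_simps)
 qed
 have "fps_frob (fps_const s) = fps_const (frob s)" for s :: "'a alg_closure" by (rule fps_ext) (simp add: fps_frob_def)
 moreover have "fps_frob fps_X = (fps_X :: 'a alg_closure fps)" by (rule fps_ext) (simp add: fps_frob_def)
 ultimately show ?case unfolding t by (simp add: fps_frob.hom_add fps_frob.hom_mult pCons)
qed simp

lemma subdegree_taylor_le_order:
 assumes "p ~= 0"
 shows "subdegree (taylor t p) <= order t (map_poly to_ac p)"
proof -
 let ?P = "map_poly to_ac p" let ?g = "pcompose ?P [:t, 1:]"
 define k where "k = subdegree (taylor t p)"
 have "coeff ?g i = 0" if "i < k" for i using that nth_less_subdegree_zero[of i "taylor t p"] unfolding k_def taylor_def by simp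
 then have "monom 1 k dvd ?g" by (simp add: monom_1_dvd_iff')
 then obtain h where h: "?g = monom 1 k * h" by (auto elim: dvdE)
 have "?P = pcompose ?g [:- t, 1:]" by (simp add: pcompose_assoc[symmetric] pcompose_pCons)
 also have "... = [:- t, 1:] ^ k * pcompose h [:- t, 1:]" unfolding h by (simp add: pcompose_mult monom_altdef pcompose_hom.hom_power pcompose_pCons)
 finally have "[:- t, 1:] ^ k dvd ?P" by (rule dvdI)
 then show ?thesis using assms by (simp add: order_divides k_def)
qed

lemma poly_div_monic:
 fixes f :: "'r::comm_ring_1 poly"
 assumes "lead_coeff f = 1" "0 < degree f"
 obtains Q R where "h = Q * f + R" "deg_less (degree f) R"
proof -
 obtain Q R where QR: "pseudo_divmod h f = (Q, R)" by fastforce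
 have "f ~= 0" using assms(2) by auto
 from pseudo_divmod[OF this QR] show ?thesis using assms by (intro that[of Q R]) (auto simp: mult.commute deg_less_iff)
qed

lemma deg_less_monic_mult_eq_0:
 fixes f :: "'r::idom poly"
 assumes "lead_coeff f = 1" "0 < degree f" "deg_less (degree f) (w * f)"
 shows "w = 0"
proof (rule ccontr)
 assume "w ~= 0"
 then have "degree (w * f) = degree w + degree f" using assms(2) by (subst degree_mult_eq) auto
 then show False using assms(2,3) by (simp add: deg_less_iff)
qed

lemma ev_eq_0_imp_dvd:
 fixes t :: "'k::{field,finite} alg_closure"
 assumes "!!z. ev z p = 0 \<longleftrightarrow> z \<in> orb frob t" "lead_coeff p = 1" "degree p = fper t" "ev t g = 0"
 shows "p dvd g"
proof -
 have dp: "0 < degree p" using assms(3) per_pos_fixed(1)[OF periodic_frob, of t] by simp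
 obtain Q R where QR: "g = Q * p + R" "deg_less (degree p) R" using poly_div_monic[OF assms(2) dp] .
 have "ev z R = 0" if "z \<in> orb frob t" for z using that assms(1)[of z] assms(4) ev_eq_0_orb[OF that, of g] QR(1) by (simp add: ev.hom_add ev.hom_mult)
 then have sub: "orb frob t <= {z. poly (map_poly to_ac R) z = 0}" unfolding ev_def by auto
 have "R = 0"
 proof (rule ccontr)
  assume "R ~= 0"
  then have R: "map_poly to_ac R ~= 0" by simp
  have "fper t <= degree R" using card_mono[OF poly_roots_finite[OF R] sub] card_poly_roots_bound[OF R] card_orb[OF periodic_frob, of t] by simp
  then show False using QR(2) assms(3) dp by (simp add: deg_less_iff)
 qed
 then show ?thesis using QR(1) by simp
qed


section \<open>Points on a plane curve\<close>

definition frob2 :: "'k::{field,finite} alg_closure \<times> 'k alg_closure => 'k alg_closure \<times> 'k alg_closure" where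
 "frob2 = map_prod frob frob"

lemma frob2_pow: "(frob2 ^^ n) (t, z) = ((frob ^^ n) t, (frob ^^ n) z)"
 by (induction n) (simp_all add: frob2_def)

lemma periodic_frob2: "periodic frob2 y"
proof -
 obtain t z where y: "y = (t, z)" by fastforce
 have "(frob2 ^^ (fper t * fper z)) y = y" unfolding y frob2_pow using funpow_fixed_iff[OF periodic_frob, of _ t] funpow_fixed_iff[OF periodic_frob, of _ z] by simp
 moreover have "0 < fper t * fper z" using per_pos_fixed(1)[OF periodic_frob, of t] per_pos_fixed(1)[OF periodic_frob, of z] by simp
 ultimately show ?thesis unfolding periodic_def by blast
qed

lemma fper_dvd_frob2: "fper t dvd per frob2 (t, z)"
 using per_pos_fixed(2)[OF periodic_frob2, of "(t, z)"] funpow_fixed_iff[OF periodic_frob, of _ t] by (simp add: frob2_pow)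

definition evp :: "'k::field alg_closure \<times> 'k alg_closure => 'k poly poly => 'k alg_closure" where
 "evp y b = poly (map_poly (ev (fst y)) b) (snd y)"

lemma evp_hom: "comm_ring_hom (evp y)"
proof -
 interpret m: map_poly_comm_ring_hom "ev (fst y)" ..
 show ?thesis unfolding evp_def by unfold_locales (simp_all add: m.hom_add m.hom_mult)
qed

interpretation evp: comm_ring_hom "evp y" for y by (rule evp_hom)

lemma frob_evp: "(frob ^^ n) (evp y b) = evp ((frob2 ^^ n) y) b"
proof -
 obtain t z where y: "y = (t, z)" by fastforce
 have "(frob ^^ n) (evp y b) = poly (map_poly (frob ^^ n) (map_poly (ev t) b)) ((frob ^^ n) z)" unfolding evp_def y by (simp add: frob_pow.poly_map_poly)
 also have "map_poly (frob ^^ n) (map_poly (ev t) b) = map_poly (ev ((frob ^^ n) t)) b" by (simp add: map_poly_map_poly o_def frob_ev)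
 finally show ?thesis unfolding evp_def y frob2_pow by simp
qed

text \<open>The curve f(T, X) = 0 over the T-line without the zeros of \<Delta>.
  \<open>norm_nz\<close> stands for irreducibility: a nonzero norm means that multiplication by b is
  injective, so k[T][X]/(f) is a domain.\<close>

locale curve =
 fixes f :: "'k::{field,finite} poly poly" and \<Delta> :: "'k poly"
 assumes lead: "lead_coeff f = 1" and deg: "0 < degree f" and Delta: "\<Delta> ~= 0"
  and separable: "!!t. ev t \<Delta> ~= 0 ==> card {z. poly (map_poly (ev t) f) z = 0} = degree f"
  and norm_nz: "!!b. b ~= 0 ==> deg_less (degree f) b ==> poly_norm f b ~= 0"
begin

abbreviation "n \<equiv> degree f"

definition points where
 "points = {y. ev (fst y) \<Delta> ~= 0 & evp y f = 0}"

definition fibre where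
 "fibre t = {z. poly (map_poly (ev t) f) z = 0}"

lemma lead_map:
 assumes "comm_ring_hom (e :: _ => 's::comm_ring_1)"
 shows "lead_coeff (map_poly e f) = 1" "degree (map_poly e f) = n"
proof -
 interpret comm_ring_hom e by fact
 have "coeff (map_poly e f) n = 1" using lead by (simp add: coeff_map_poly)
 moreover have "degree (map_poly e f) <= n" by (rule degree_map_poly_le)
 ultimately show "degree (map_poly e f) = n" by (metis le_antisym le_degree zero_neq_one)
 then show "lead_coeff (map_poly e f) = 1" using \<open>coeff (map_poly e f) n = 1\<close> by simp
qed

lemma fibre_finite: "finite (fibre t)" and card_fibre_le: "card (fibre t) <= n"
proof -
 have nz: "map_poly (ev t) f ~= 0" using lead_map[OF ev_hom[of t]] deg by fastforce
 show "finite (fibre t)" unfolding fibre_def by (rule poly_roots_finite[OF nz])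
 show "card (fibre t) <= n" unfolding fibre_def using card_poly_roots_bound[OF nz] lead_map(2)[OF ev_hom[of t]] by simp
qed

lemma card_fibre: "ev t \<Delta> ~= 0 ==> card (fibre t) = n"
 unfolding fibre_def by (rule separable)

lemma points_iff: "(t, z) \<in> points \<longleftrightarrow> ev t \<Delta> ~= 0 & z \<in> fibre t"
 unfolding points_def fibre_def evp_def by simp

lemma frob2_points: "(frob2 ^^ i) y \<in> points \<longleftrightarrow> y \<in> points"
proof -
 have "fst ((frob2 ^^ i) y) = (frob ^^ i) (fst y)" by (cases y) (simp add: frob2_pow)
 then show ?thesis unfolding points_def by (simp add: frob_evp[symmetric] frob_ev[symmetric])
qed

lemma ex_branch:
 assumes "(t, z) \<in> points"
 shows "\<exists>\<zeta>. poly (map_poly (taylor t) f) \<zeta> = 0 & fps_nth \<zeta> 0 = z"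
proof -
 have e: "map_poly (%a. fps_nth a 0) (map_poly (taylor t) f) = map_poly (ev t) f" by (simp add: map_poly_map_poly o_def)
 have "poly (map_poly (ev t) f) z = 0" using assms unfolding points_iff fibre_def by simp
 moreover have "poly (pderiv (map_poly (ev t) f)) z ~= 0" using assms separable lead_map(2)[OF ev_hom[of t]] deg
  by (intro simple_root_if_card_roots) (auto simp: points_iff fibre_def)
 ultimately obtain \<zeta> where "poly (map_poly (taylor t) f) \<zeta> = 0" "fps_nth \<zeta> 0 = z" using Hensel[of "map_poly (taylor t) f" z] unfolding e by blast
 then show ?thesis by blast
qed

definition branch where
 "branch y = (SOME \<zeta>. poly (map_poly (taylor (fst y)) f) \<zeta> = 0 & fps_nth \<zeta> 0 = snd y)"

lemma branch:
 assumes "y \<in> points"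
 shows "poly (map_poly (taylor (fst y)) f) (branch y) = 0" "fps_nth (branch y) 0 = snd y"
 using someI_ex[OF ex_branch[of "fst y" "snd y"]] assms unfolding branch_def by auto

text \<open>The n points of the fibre have distinct branches, distinguished by their constant terms,
  and a monic polynomial of degree n has no further roots among the power series.\<close>

lemma branch_unique:
 assumes t: "ev t \<Delta> ~= 0" and \<zeta>: "poly (map_poly (taylor t) f) \<zeta> = 0"
 shows "(t, fps_nth \<zeta> 0) \<in> points" "branch (t, fps_nth \<zeta> 0) = \<zeta>"
proof -
 let ?R = "{x. poly (map_poly (taylor t) f) x = 0}"
 have nz: "map_poly (taylor t) f ~= 0" using lead_map[OF taylor_hom[of t]] deg by fastforce
 have br: "branch (t, z) \<in> ?R" "fps_nth (branch (t, z)) 0 = z" if "z \<in> fibre t" for z using branch[of "(t, z)"] that t by (auto simp: points_iff)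
 have inj: "inj_on (%z. branch (t, z)) (fibre t)" by (rule inj_on_inverseI[of _ "%a. fps_nth a 0"]) (use br in auto)
 have "(%z. branch (t, z)) ` fibre t = ?R"
 proof (rule card_seteq[OF poly_roots_finite[OF nz]])
  show "card ?R <= card ((%z. branch (t, z)) ` fibre t)" using card_poly_roots_bound[OF nz] lead_map(2)[OF taylor_hom[of t]] card_fibre[OF t] by (simp add: card_image[OF inj])
 qed (use br in auto)
 then obtain z where z: "z \<in> fibre t" "\<zeta> = branch (t, z)" using \<zeta> by blast
 then show "(t, fps_nth \<zeta> 0) \<in> points" "branch (t, fps_nth \<zeta> 0) = \<zeta>" using br t by (auto simp: points_iff)
qed

text \<open>The function b expanded along the branch through y; T - t serves as local parameter
  since the curve is unramified there.\<close>

definition germ where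
 "germ y b = poly (map_poly (taylor (fst y)) b) (branch y)"

lemma germ_hom: "comm_ring_hom (germ y)"
proof -
 interpret m: map_poly_comm_ring_hom "taylor (fst y)" ..
 show ?thesis unfolding germ_def by unfold_locales (simp_all add: m.hom_add m.hom_mult)
qed

sublocale germ: comm_ring_hom "germ y" for y by (rule germ_hom)

lemma germ_f: "y \<in> points ==> germ y f = 0"
 unfolding germ_def by (rule branch(1))

lemma germ_const: "germ y [:a:] = taylor (fst y) a"
 unfolding germ_def by (cases "a = 0") simp_all

lemma germ_nth_0:
 assumes "y \<in> points"
 shows "fps_nth (germ y b) 0 = evp y b"
proof -
 have "fps_nth (germ y b) 0 = poly (map_poly (%a. fps_nth a 0) (map_poly (taylor (fst y)) b)) (fps_nth (branch y) 0)"
  unfolding germ_def by (rule fps0.poly_map_poly[symmetric])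
 also have "map_poly (%a. fps_nth a 0) (map_poly (taylor (fst y)) b) = map_poly (ev (fst y)) b" by (simp add: map_poly_map_poly o_def)
 finally show ?thesis using branch(2)[OF assms] by (simp add: evp_def)
qed

definition val where
 "val y b = subdegree (germ y b)"

text \<open>Frobenius on the coefficients of the branch at y produces a root of f over the
  expansions at the Frobenius image of t; by uniqueness of branches it is the branch at
  \<open>frob2 y\<close>.\<close>

lemma germ_frob2:
 assumes "y \<in> points"
 shows "germ (frob2 y) b = fps_frob (germ y b)"
proof -
 obtain t z where y: "y = (t, z)" by fastforce
 have m: "map_poly fps_frob (map_poly (taylor t) b) = map_poly (taylor (frob t)) b" for b by (simp add: map_poly_map_poly o_def fps_frob_taylor)
 have h: "fps_frob (poly (map_poly (taylor t) b) \<zeta>) = poly (map_poly (taylor (frob t)) b) (fps_frob \<zeta>)" for b \<zeta>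
  unfolding m[symmetric] by (rule fps_frob.poly_map_poly[symmetric])
 have "poly (map_poly (taylor (frob t)) f) (fps_frob (branch y)) = 0" using branch(1)[OF assms] h[of f "branch y"] y by simp
 moreover have "ev (frob t) \<Delta> ~= 0" using assms frob_ev[of 1 t \<Delta>] y frob.hom_0_iff[of "ev t \<Delta>"] by (simp add: points_iff del: frob.hom_0_iff)
 ultimately have "branch (frob t, fps_nth (fps_frob (branch y)) 0) = fps_frob (branch y)" by (rule branch_unique(2)[rotated])
 moreover have "fps_nth (fps_frob (branch y)) 0 = frob z" using branch(2)[OF assms] y by (simp add: fps_frob_def)
 ultimately show ?thesis unfolding germ_def using h y by (simp add: frob2_def)
qed

lemma val_orb:
 assumes "y \<in> points" "y' \<in> orb frob2 y"
 shows "val y' b = val y b"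
proof -
 have "val ((frob2 ^^ i) y) b = val y b" for i
 proof (induction i)
  case (Suc i)
  then show ?case using germ_frob2[of "(frob2 ^^ i) y" b] assms(1) frob2_points[of i y] by (simp add: val_def subdegree_fps_frob)
 qed simp
 then show ?thesis using assms(2) by (auto simp: orb_in)
qed

lemma taylor_norm:
 assumes t: "ev t \<Delta> ~= 0" and b: "deg_less n b"
 shows "taylor t (poly_norm f b) = (PROD z:fibre t. germ (t, z) b)"
proof -
 obtain h where h: "bij_betw h {..<n} (fibre t)" using ex_bij_betw_nat_finite[OF fibre_finite[of t]] card_fibre[OF t] by (auto simp: atLeast0LessThan)
 have pt: "(t, h i) \<in> points" if "i < n" for i using t bij_betwE[OF h] that by (auto simp: points_iff)
 have "taylor t (poly_norm f b) = (\<Prod>i<n. poly (map_poly (taylor t) b) (branch (t, h i)))"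
 proof (rule poly_norm_prod[OF taylor_hom lead deg b])
  show "poly (map_poly (taylor t) f) (branch (t, h i)) = 0" if "i < n" for i using branch(1)[OF pt[OF that]] by simp
  show "inj_on (%i. branch (t, h i)) {..<n}"
  proof (rule inj_onI)
   fix i j assume ij: "i \<in> {..<n}" "j \<in> {..<n}" and eq: "branch (t, h i) = branch (t, h j)"
   have bh: "fps_nth (branch (t, h k)) 0 = h k" if "k < n" for k using branch(2)[OF pt[OF that]] by simp
   have "h i = h j" using ij bh[of i] bh[of j] unfolding eq by (metis lessThan_iff)
   then show "i = j" using bij_betw_imp_inj_on[OF h] ij by (simp add: inj_on_def)
  qed
 qed
 also have "... = (\<Prod>i<n. germ (t, h i) b)" by (simp add: germ_def)
 also have "... = (PROD z:fibre t. germ (t, z) b)" by (rule prod.reindex_bij_betw[OF h])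
 finally show ?thesis .
qed

lemma germ_nonzero:
 assumes "y \<in> points" "b ~= 0" "deg_less n b"
 shows "germ y b ~= 0"
proof
 assume z: "germ y b = 0"
 obtain t z where y: "y = (t, z)" by fastforce
 have "(PROD z:fibre t. germ (t, z) b) = 0" using assms(1) z fibre_finite[of t] y by (intro prod_zero) (auto simp: points_iff)
 then show False using taylor_norm[of t b] norm_nz[OF assms(2,3)] assms y by (simp add: points_iff)
qed

lemma val_pos:
 assumes "y \<in> points" "b ~= 0" "deg_less n b" "evp y b = 0"
 shows "1 <= val y b"
proof (rule ccontr)
 assume "\<not> 1 <= val y b"
 then have "subdegree (germ y b) = 0" unfolding val_def by simp
 then show False using nth_subdegree_nonzero[OF germ_nonzero[OF assms(1-3)]] germ_nth_0[OF assms(1), of b] assms(4) by simp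
qed

text \<open>A Bezout inequality: over each t the orders of b add up to the order of its norm at t,
  and the norm has no more zeros than its degree.\<close>

lemma sum_val_le:
 assumes Y: "finite Y" "Y <= points" and b: "b ~= 0" "deg_less n b"
 shows "(SUM y:Y. val y b) <= degree (poly_norm f b)"
proof -
 let ?N = "map_poly to_ac (poly_norm f b)"
 have N: "?N ~= 0" using norm_nz[OF b] by simp
 have "(SUM y:Y. val y b) <= (SUM y:Sigma (fst ` Y) fibre. val y b)" using Y fibre_finite by (intro sum_mono2) (force simp: points_iff)+
 also have "... = (SUM t:fst ` Y. SUM z:fibre t. val (t, z) b)" using Y(1) fibre_finite by (subst sum.Sigma) auto
 also have "... <= (SUM t:fst ` Y. order t ?N)"
 proof (rule sum_mono)
  fix t assume "t \<in> fst ` Y"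
  then have t: "ev t \<Delta> ~= 0" using Y(2) by (force simp: points_iff)
  have nz: "germ (t, z) b ~= 0" if "z \<in> fibre t" for z using germ_nonzero[OF _ b] t that by (simp add: points_iff)
  have sp: "subdegree (PROD z:A. germ (t, z) b) = (SUM z:A. val (t, z) b)"
   if "finite A" "A <= fibre t" for A using that
  proof (induction A rule: finite_induct)
   case (insert z A)
   then show ?case using nz by (auto simp: val_def subset_iff prod_zero_iff intro!: subdegree_mult trans[OF subdegree_mult])
  qed simp
  have "(SUM z:fibre t. val (t, z) b) = subdegree (taylor t (poly_norm f b))" unfolding taylor_norm[OF t b(2)] using sp[OF fibre_finite] by simp
  also have "... <= order t ?N" by (rule subdegree_taylor_le_order[OF norm_nz[OF b]])
  finally show "(SUM z:fibre t. val (t, z) b) <= order t ?N" .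
 qed
 also have "... = (SUM t:{t\<in>fst ` Y. poly ?N t = 0}. order t ?N)" using Y(1) by (intro sum.mono_neutral_right) (auto simp: order_0I)
 also have "... <= (\<Sum>t | poly ?N t = 0. order t ?N)" using poly_roots_finite[OF N] by (intro sum_mono2) auto
 also have "... <= degree ?N" by (rule sum_order_le_degree[OF N])
 finally show ?thesis by simp
qed

end


section \<open>The Mertens bound for the number of points\<close>

definition box :: "(nat => 'r::comm_monoid_add set) => 'r poly set" where
 "box S = {b. ALL i. coeff b i \<in> S i}"

lemma box_card:
 assumes "!!i. n <= i ==> S i = {0}" "!!i. finite (S i)"
 shows "finite (box S)" "card (box S) = (\<Prod>i<n. card (S i))"
proof -
 have "bij_betw (%b. restrict (coeff b) {..<n}) (box S) (PiE {..<n} S)"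
 proof (rule bij_betwI)
  show "(%b. restrict (coeff b) {..<n}) \<in> box S \<rightarrow> PiE {..<n} S" unfolding box_def by auto
  have c: "coeff (\<Sum>i<n. monom (g i) i) j = (if j < n then g j else 0)" for j g by (simp add: coeff_sum sum.delta)
  show "(%g. \<Sum>i<n. monom (g i) i) \<in> PiE {..<n} S \<rightarrow> box S" unfolding box_def using assms(1) by (auto simp: c)
  show "(\<Sum>i<n. monom (restrict (coeff b) {..<n} i) i) = b" if "b \<in> box S" for b
  proof (rule poly_eqI)
   fix j
   have "coeff b j \<in> S j" using that unfolding box_def by blast
   then show "coeff (\<Sum>i<n. monom (restrict (coeff b) {..<n} i) i) j = coeff b j" using assms(1)[of j] by (auto simp: c)
  qed
  show "restrict (coeff (\<Sum>i<n. monom (g i) i)) {..<n} = g" if "g \<in> PiE {..<n} S" for g using that by (intro ext) (auto simp: c PiE_def extensional_def)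
 qed
 then show "finite (box S)" "card (box S) = (\<Prod>i<n. card (S i))" using assms(2) by (auto simp: bij_betw_finite bij_betw_same_card card_PiE finite_PiE)
qed

lemma card_deg_less:
 "finite {p :: 'k::{field,finite} poly. deg_less N p}" "card {p :: 'k poly. deg_less N p} = CARD('k) ^ N"
proof -
 have e: "{p :: 'k poly. deg_less N p} = box (%i. if i < N then UNIV else {0})" unfolding box_def deg_less_def by (auto simp: leI)
 show "finite {p :: 'k poly. deg_less N p}" "card {p :: 'k poly. deg_less N p} = CARD('k) ^ N" unfolding e using box_card[of N "%i. if i < N then UNIV else {0::'k}"] by auto
qed

lemma deg_less_add: "deg_less N a ==> deg_less N b ==> deg_less N (a + b :: 'r::comm_ring_1 poly)"
 and deg_less_diff: "deg_less N a ==> deg_less N b ==> deg_less N (a - b :: 'r::comm_ring_1 poly)"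
 by (simp_all add: deg_less_def)

text \<open>Abel summation; since the weights decrease, a bound from above on the partial sums is
  enough.\<close>

lemma sum_weighted_le:
 fixes a w :: "nat => real"
 assumes S: "!!M. (\<Sum>d=1..M. a d) <= K" and w: "!!d. 1 <= d ==> w (Suc d) <= w d" "!!d. 0 <= w d" and K: "0 <= K"
 shows "(\<Sum>d=1..N. a d * w d) <= K * w 1"
proof (cases "N = 0")
 case False
 have "(\<Sum>d=1..N. a d * w d) <= K * (w 1 - w N) + (\<Sum>d=1..N. a d) * w N" using False
 proof (induction N)
  case (Suc N)
  show ?case
  proof (cases "N = 0")
   case False
   have "(\<Sum>d=1..N. a d) * (w N - w (Suc N)) <= K * (w N - w (Suc N))" using S[of N] w(1)[of N] False by (intro mult_right_mono) auto
   then show ?thesis using Suc False by (simp add: algebra_simps)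
  qed simp
 qed simp
 also have "... <= K * (w 1 - w N) + K * w N" using S[of N] w(2)[of N] by (intro add_left_mono mult_right_mono)
 finally show ?thesis by (simp add: algebra_simps)
qed (use K w(2)[of 1] in simp)

text \<open>Each nonempty fibre of h is a translate of the kernel within W.\<close>

lemma card_kernel_ge:
 fixes h :: "'b::ab_group_add => 'c::ab_group_add"
 assumes W: "finite W" "!!a b. a \<in> W ==> b \<in> W ==> a - b \<in> W" and h: "!!a b. h (a - b) = h a - h b"
  and V: "finite V" "h ` W <= V"
 shows "card W <= card V * card {a \<in> W. h a = 0}"
proof -
 let ?K = "{a \<in> W. h a = 0}"
 have "card {a \<in> W. h a = v} <= card ?K" for v
 proof (cases "EX a0:W. h a0 = v")
  case True
  then obtain a0 where a0: "a0 \<in> W" "h a0 = v" by blast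
  show ?thesis by (rule card_inj_on_le[of "%a. a - a0"]) (use W a0 h in \<open>auto simp: inj_on_def\<close>)
 next
  case False
  then have e: "{a \<in> W. h a = v} = {}" by auto
  show ?thesis unfolding e by simp
 qed
 moreover have "W = (\<Union>v\<in>V. {a \<in> W. h a = v})" using V(2) by auto
 then have "card W <= (SUM v:V. card {a \<in> W. h a = v})" using card_UN_le[OF V(1), of "%v. {a \<in> W. h a = v}"] by simp
 ultimately show ?thesis using sum_bounded_above[of V "%v. card {a \<in> W. h a = v}" "card ?K"] by (simp add: mult.commute)
qed

context curve
begin

definition count :: "nat => nat" where
 "count d = card {y \<in> points. per frob2 y = d}"

text \<open>Any charge per power of X under which no term of f outweighs X^n; \<open>1 <= C\<close>
  gives X itself positive weight, so that weight 0 means constant.\<close>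

definition slope :: nat where
 "slope = (SOME C. 1 <= C & (\<forall>k<n. degree (coeff f k) <= C * (n - k)))"

lemma slope: "1 <= slope" "!!k. k < n ==> degree (coeff f k) <= slope * (n - k)"
proof -
 define A where "A = Max ((%k. degree (coeff f k)) ` {..n})"
 have "degree (coeff f k) <= Suc A * (n - k)" if "k < n" for k
 proof -
  have "degree (coeff f k) <= A" unfolding A_def using that by (intro Max_ge) auto
  also have "... <= Suc A * 1" by simp
  also have "... <= Suc A * (n - k)" by (rule mult_le_mono2) (use that in simp)
  finally show ?thesis .
 qed
 then have "EX C. 1 <= C & (\<forall>k<n. degree (coeff f k) <= C * (n - k))" by (intro exI[of _ "Suc A"]) auto
 then have "1 <= slope & (\<forall>k<n. degree (coeff f k) <= slope * (n - k))" unfolding slope_def by (rule someI_ex)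
 then show "1 <= slope" "!!k. k < n ==> degree (coeff f k) <= slope * (n - k)" by auto
qed

lemma finite_points_per: "finite {y \<in> points. per frob2 y = d}" and count_le: "count d <= n * CARD('k) ^ d"
proof -
 let ?F = "{t :: 'k alg_closure. (frob ^^ d) t = t}"
 have sub: "{y \<in> points. per frob2 y = d} <= Sigma ?F fibre"
 proof
  fix y assume y: "y \<in> {y \<in> points. per frob2 y = d}"
  obtain t z where tz: "y = (t, z)" by fastforce
  have "(frob ^^ d) t = t" using y tz fper_dvd_frob2[of t z] funpow_fixed_iff[OF periodic_frob, of d t] by simp
  then show "y \<in> Sigma ?F fibre" using y tz by (auto simp: points_iff)
 qed
 have e: "{y \<in> points. per frob2 y = d} = {}" if "d = 0" using per_pos_fixed(1)[OF periodic_frob2] that by force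
 have fin: "finite (Sigma ?F fibre)" if "0 < d" using card_frob_fixed_le(1)[OF that] fibre_finite by auto
 show "finite {y \<in> points. per frob2 y = d}"
 proof (cases "d = 0")
  case True
  show ?thesis unfolding e[OF True] by simp
 qed (use finite_subset[OF sub fin] in blast)
 show "count d <= n * CARD('k) ^ d"
 proof (cases "d = 0")
  case True
  show ?thesis unfolding count_def e[OF True] by simp
 next
  case False
  have "count d <= card (Sigma ?F fibre)" unfolding count_def using False by (intro card_mono fin sub) simp
  also have "... = (SUM t:?F. card (fibre t))" using card_frob_fixed_le(1)[of d] False fibre_finite by (intro card_SigmaI) auto
  also have "... <= card ?F * n" using sum_bounded_above[of ?F "%t. card (fibre t)" n] card_fibre_le by simp
  also have "... <= CARD('k) ^ d * n" using card_frob_fixed_le(2)[of d] False by (intro mult_le_mono1) simp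
  finally show ?thesis by (simp add: mult.commute)
 qed
qed

definition low where
 "low M = {y \<in> points. per frob2 y <= M}"

lemma low_UN: "low M = (\<Union>d\<in>{1..M}. {y \<in> points. per frob2 y = d})"
proof -
 have "1 <= per frob2 y" for y :: "'k alg_closure \<times> 'k alg_closure" using per_pos_fixed(1)[OF periodic_frob2, of y] by simp
 then show ?thesis unfolding low_def by auto
qed

lemma finite_low: "finite (low M)"
 unfolding low_UN using finite_points_per by auto

lemma sum_low: "(SUM y:low M. g (per frob2 y)) = (\<Sum>d=1..M. real (count d) * g d)"
 unfolding low_UN using finite_points_per by (subst sum.UNION_disjoint) (auto simp: count_def)

text \<open>Double counting of the pairs (y, b) with b(y) = 0, for y of period at most M and b in a
  box W of at least q^M functions. Evaluation at y takes at most q^per(y) values, so at least |W| /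
  q^per(y) elements of W vanish at y, while a nonzero b has at most n m zeros by the degree of its
  norm. As n m = M + O(1), dividing by |W| gives the bound.\<close>

lemma mertens_upper: "\<exists>K\<ge>0. ALL M. (\<Sum>d=1..M. real (count d) / real CARD('k) ^ d - 1) <= K"
proof -
 define c where "c = (\<Sum>i<n. slope * i)"
 have q2: "2 <= CARD('k)" by (rule CARD_ge_2)
 have "(\<Sum>d=1..M. real (count d) / real CARD('k) ^ d - 1) <= real (c + n + 2 * n)" for M
 proof -
  \<comment> \<open>The least m with n m > M + c. Here c is the dimension lost to the charges
    \<open>slope * i\<close>, so W has at least q^M elements, yet n m exceeds M + c by at most
    n.\<close>
  define m where "m = Suc ((M + c) div n)"
  define S where "S = (%i. if i < n then {p :: 'k poly. deg_less (m - slope * i) p} else {0})"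
  define W where "W = box S"
  have "n * ((M + c) div n) <= M + c" by simp
  moreover have "M + c < n * m" unfolding m_def using deg by (metis dividend_less_times_div mult.commute mult_Suc_right)
  ultimately have nm: "M + c < n * m" "n * m <= M + c + n" unfolding m_def by auto
  have S0: "S i = {0}" if "n <= i" for i using that by (simp add: S_def)
  have fS: "finite (S i)" for i using card_deg_less(1)[where 'k='k] by (simp add: S_def)
  have Sdiff: "a - b \<in> S i" if "a \<in> S i" "b \<in> S i" for a b i using that by (cases "i < n") (simp_all add: S_def deg_less_diff)
  have W: "finite W" "card W = (\<Prod>i<n. card (S i))" unfolding W_def using box_card[of n S, OF S0 fS] by auto
  have "card W = CARD('k) ^ (\<Sum>i<n. m - slope * i)" unfolding W(2) by (simp add: S_def card_deg_less(2) power_sum)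
  moreover have "n * m - c <= (\<Sum>i<n. m - slope * i)"
  proof -
   have "n * m = (\<Sum>i<n. m)" by simp
   also have "... <= (\<Sum>i<n. (m - slope * i) + slope * i)" by (rule sum_mono) simp
   finally show ?thesis unfolding c_def by (simp add: sum.distrib)
  qed
  ultimately have cW: "CARD('k) ^ M <= card W" using nm q2 by (simp add: power_increasing)
  have Wdiff: "a - b \<in> W" if "a \<in> W" "b \<in> W" for a b using that Sdiff unfolding W_def box_def by simp
  have Wdeg: "deg_less n b" if "b \<in> W" for b using that S0 unfolding W_def box_def deg_less_def by blast
  have Wwt: "weight_le slope (int m) b" if "b \<in> W" for b unfolding weight_le_def
  proof (intro allI impI)
   fix i assume nz: "coeff b i ~= 0"
   have "coeff b i \<in> S i" using that unfolding W_def box_def by blast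
   then have dl: "deg_less (m - slope * i) (coeff b i)" using nz by (auto simp: S_def split: if_splits)
   then have p: "0 < m - slope * i" using nz unfolding deg_less_def by (metis le0 leading_coeff_0_iff not_gr_zero)
   then have "degree (coeff b i) < m - slope * i" using dl by (simp add: deg_less_iff)
   then have "degree (coeff b i) + slope * i <= m" by simp
   then show "int (degree (coeff b i)) + int slope * int i <= int m" by (simp flip: of_nat_mult of_nat_add)
  qed
  have zeros: "card {y \<in> low M. evp y b = 0} <= n * m" if b: "b \<in> W" "b ~= 0" for b
  proof -
   have "card {y \<in> low M. evp y b = 0} = (SUM y:{y \<in> low M. evp y b = 0}. 1)" by simp
   also have "... <= (SUM y:{y \<in> low M. evp y b = 0}. val y b)" using val_pos[OF _ b(2) Wdeg[OF b(1)]] by (intro sum_mono) (auto simp: low_def)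
   also have "... <= degree (poly_norm f b)"
   proof (rule sum_val_le[OF _ _ b(2) Wdeg[OF b(1)]])
    show "finite {y \<in> low M. evp y b = 0}" using finite_low by simp
   qed (auto simp: low_def)
   also have "... <= n * m" using degree_poly_norm_le[OF slope(2) lead deg Wwt[OF b(1)]] by simp
   finally show ?thesis .
  qed
  have ker: "real (card W) / real CARD('k) ^ per frob2 y <= real (card {b \<in> W. evp y b = 0})" if "y \<in> low M" for y
  proof -
   let ?d = "per frob2 y"
   have d: "0 < ?d" by (rule per_pos_fixed(1)[OF periodic_frob2])
   have "card W <= card {x :: 'k alg_closure. (frob ^^ ?d) x = x} * card {b \<in> W. evp y b = 0}"
   proof (rule card_kernel_ge[OF W(1) Wdiff _ card_frob_fixed_le(1)[OF d]])
    show "evp y (a - b) = evp y a - evp y b" for a b by (rule evp.hom_minus)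
    show "evp y ` W <= {x. (frob ^^ ?d) x = x}" using frob_evp[of ?d y] per_pos_fixed(2)[OF periodic_frob2, of y] by auto
   qed
   also have "... <= CARD('k) ^ ?d * card {b \<in> W. evp y b = 0}" by (intro mult_le_mono1 card_frob_fixed_le(2) d)
   finally have "card W <= CARD('k) ^ ?d * card {b \<in> W. evp y b = 0}" .
   then have "real (card W) <= real CARD('k) ^ ?d * real (card {b \<in> W. evp y b = 0})" by (simp flip: of_nat_power of_nat_mult)
   then show ?thesis using q2 by (simp add: field_simps)
  qed
  have z0: "0 \<in> W" using Wdiff W(1) cW q2 by (metis all_not_in_conv card.empty diff_self le_zero_eq power_not_zero rel_simps(76) not_numeral_le_zero)
  have "(SUM y:low M. real (card W) / real CARD('k) ^ per frob2 y) <= (SUM y:low M. real (card {b \<in> W. evp y b = 0}))" by (rule sum_mono) (rule ker)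
  also have "... = real (SUM y:low M. SUM b:W. if evp y b = 0 then 1 else 0)" using W(1) by (simp add: sum.If_cases Int_def)
  also have "(SUM y:low M. SUM b:W. if evp y b = 0 then 1 else (0::nat)) = (SUM b:W. SUM y:low M. if evp y b = 0 then 1 else 0)" by (rule sum.swap)
  also have "... = (SUM b:W. card {y \<in> low M. evp y b = 0})" using finite_low by (simp add: sum.If_cases Int_def)
  also have "... = card (low M) + (SUM b:W - {0}. card {y \<in> low M. evp y b = 0})" using z0 W(1) by (simp add: sum.remove)
  also have "real ... <= real (card (low M)) + real (card W) * real (n * m)"
  proof -
   have "(SUM b:W - {0}. card {y \<in> low M. evp y b = 0}) <= card (W - {0}) * (n * m)"
    using sum_bounded_above[of "W - {0}" "%b. card {y \<in> low M. evp y b = 0}" "n * m"] zeros by auto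
   also have "... <= card W * (n * m)" using W(1) by (intro mult_le_mono1 card_mono) auto
   finally show ?thesis by (simp flip: of_nat_mult of_nat_add)
  qed
  finally have main: "(SUM y:low M. real (card W) / real CARD('k) ^ per frob2 y) <= real (card (low M)) + real (card W) * real (n * m)" .
  \<comment> \<open>The function b = 0 vanishes at every point of \<open>low M\<close>; geometric
    growth bounds this contribution by 2 n |W|.\<close>
  have "card (low M) <= (\<Sum>d=1..M. count d)" unfolding low_UN count_def by (rule card_UN_le) simp
  also have "... <= (\<Sum>d=1..M. n * CARD('k) ^ d)" by (rule sum_mono) (rule count_le)
  also have "... <= 2 * n * CARD('k) ^ M"
  proof (induction M)
   case (Suc M)
   have "2 * (n * CARD('k) ^ M) <= CARD('k) * (n * CARD('k) ^ M)" using q2 by (rule mult_le_mono1)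
   with Suc have "(\<Sum>d=1..M. n * CARD('k) ^ d) <= CARD('k) * (n * CARD('k) ^ M)" by linarith
   then show ?case by (simp add: mult.left_commute)
  qed simp
  also have "... <= 2 * n * card W" using cW by simp
  finally have lowW: "real (card (low M)) <= real (2 * n) * real (card W)" by (metis of_nat_le_iff of_nat_mult)
  have Wpos: "0 < real (card W)" using cW q2 by (metis of_nat_0_less_iff power_eq_0_iff le_zero_eq neq0_conv rel_simps(76) not_numeral_le_zero)
  have "real (card W) * (\<Sum>d=1..M. real (count d) / real CARD('k) ^ d) = (SUM y:low M. real (card W) / real CARD('k) ^ per frob2 y)"
   by (subst sum_low[of "%d. real (card W) / real CARD('k) ^ d"]) (simp add: sum_distrib_left mult.commute)
  also have "... <= real (card W) * (real (2 * n) + real (n * m))" using main lowW by (simp add: algebra_simps)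
  finally have "(\<Sum>d=1..M. real (count d) / real CARD('k) ^ d) <= real (2 * n) + real (n * m)" using Wpos by simp
  also have "... <= real (2 * n) + real (M + c + n)" using nm(2) by (metis add_left_mono of_nat_le_iff)
  finally show ?thesis by (simp add: sum_subtractf)
 qed
 then show ?thesis by (intro exI[of _ "real (c + n + 2 * n)"]) auto
qed

end



section \<open>Boxes of functions that are determined by their zeros\<close>

lemma weight_le_diff:
 fixes a b :: "'r::idom poly poly"
 assumes "weight_le C w a" "weight_le C w b"
 shows "weight_le C w (a - b)"
 unfolding weight_le_def
proof (intro allI impI)
 fix i assume nz: "coeff (a - b) i ~= 0"
 show "int (degree (coeff (a - b) i)) + int C * int i <= w"
 proof (cases "coeff a i = 0 \<or> coeff b i = 0")
  case True
  then show ?thesis using assms nz unfolding weight_le_def by (auto simp: degree_minus)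
 next
  case False
  then have "int (degree (coeff a i)) + int C * int i <= w" "int (degree (coeff b i)) + int C * int i <= w" using assms unfolding weight_le_def by auto
  moreover have "degree (coeff (a - b) i) <= max (degree (coeff a i)) (degree (coeff b i))" using degree_diff_le_max by simp
  ultimately show ?thesis by (simp add: max_def split: if_splits)
 qed
qed

lemma weight_le_sum:
 fixes g :: "'i => 'r::idom poly poly"
 assumes "!!i. i \<in> A ==> weight_le C w (g i)"
 shows "weight_le C w (sum g A)"
 using assms
proof (induction A rule: infinite_finite_induct)
 case (insert x A)
 have z: "weight_le C w (0 :: 'r poly poly)" by (simp add: weight_le_def)
 then have "weight_le C w (0 - sum g A)" using z insert by (intro weight_le_diff) auto
 then have "weight_le C w (g x - (0 - sum g A))" using z insert by (intro weight_le_diff) auto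
 then show ?case using insert by simp
qed (simp_all add: weight_le_def)

lemma weight_le_mult:
 fixes a b :: "'r::idom poly poly"
 assumes "weight_le C v a" "weight_le C w b"
 shows "weight_le C (v + w) (a * b)"
proof -
 have "a * b = (\<Sum>i\<le>degree a. monom (coeff a i) i * b)" by (subst (1) poly_as_sum_of_monoms[symmetric]) (simp add: sum_distrib_right)
 moreover have "weight_le C (v + w) (monom c i * b)" if c: "c = coeff a i" for c i unfolding weight_le_def
 proof (intro allI impI)
  fix j assume nz: "coeff (monom c i * b) j ~= 0"
  then have ij: "i <= j" and e: "coeff (monom c i * b) j = c * coeff b (j - i)" by (auto simp: coeff_monom_mult split: if_splits)
  have "c ~= 0" "coeff b (j - i) ~= 0" using nz e by auto
  then have "int (degree c) + int C * int i <= v" "int (degree (coeff b (j - i))) + int C * int (j - i) <= w"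
   "degree (c * coeff b (j - i)) = degree c + degree (coeff b (j - i))" using assms c unfolding weight_le_def by (auto simp: degree_mult_eq)
  then show "int (degree (coeff (monom c i * b) j)) + int C * int j <= v + w" unfolding e using ij by (simp add: of_nat_diff algebra_simps)
 qed
 ultimately show ?thesis using weight_le_sum by (metis (no_types, lifting))
qed

context curve
begin

text \<open>Cancelling the leading term of H subtracts G f for a monomial G; as f weighs no more
  than X^n, the product stays within the weight s.\<close>

lemma weight_division:
 assumes "weight_le slope s H"
 shows "EX Q R. H = Q * f + R & deg_less n R & weight_le slope s R"
 using assms
proof (induction "degree H" arbitrary: H rule: less_induct)
 case less
 show ?case
 proof (cases "degree H < n")
  case True
  then show ?thesis using less(2) deg by (intro exI[of _ 0] exI[of _ H]) (simp add: deg_less_iff)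
 next
  case False
  define k where "k = degree H"
  define G where "G = monom (lead_coeff H) (k - n)"
  have H0: "H ~= 0" using False deg by auto
  have wf: "weight_le slope (int slope * int n) f" unfolding weight_le_def
  proof (intro allI impI)
   fix i assume "coeff f i ~= 0"
   then have i: "i <= n" by (rule le_degree)
   then have "degree (coeff f i) <= slope * (n - i)" using slope(2)[of i] lead by (cases "i = n") auto
   then have "degree (coeff f i) + slope * i <= slope * (n - i) + slope * i" by simp
   also have "... = slope * n" using i by (simp flip: add_mult_distrib2)
   finally show "int (degree (coeff f i)) + int slope * int i <= int slope * int n" by (simp flip: of_nat_mult of_nat_add)
  qed
  have "int (degree (lead_coeff H)) + int slope * int k <= s" using less(2) H0 unfolding weight_le_def k_def by simp
  then have "weight_le slope (s - int slope * int n) G" using False unfolding weight_le_def G_def by (auto simp: k_def of_nat_diff algebra_simps)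
  then have wG: "weight_le slope s (G * f)" using weight_le_mult[OF _ wf] by fastforce
  have dG: "degree (G * f) = k" "coeff (G * f) k = lead_coeff H"
  proof -
   have "G ~= 0" "f ~= 0" using H0 deg by (auto simp: G_def)
   then show d: "degree (G * f) = k" using False by (subst degree_mult_eq) (auto simp: G_def k_def degree_monom_eq)
   have "lead_coeff (G * f) = lead_coeff H" using lead by (simp add: lead_coeff_mult G_def H0 degree_monom_eq)
   then show "coeff (G * f) k = lead_coeff H" unfolding d .
  qed
  have dl: "degree (H - G * f) < degree H"
  proof -
   have "0 < k" using False deg by (simp add: k_def)
   moreover have "degree (H - G * f) <= k" using dG k_def by (intro degree_diff_le) auto
   moreover have "coeff (H - G * f) k = 0" using dG k_def by simp
   ultimately show ?thesis unfolding k_def by (metis degree_0 leading_coeff_0_iff le_neq_implies_less)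
  qed
  obtain Q R where "H - G * f = Q * f + R" "deg_less n R" "weight_le slope s R" using less(1)[OF dl weight_le_diff[OF less(2) wG]] by blast
  then show ?thesis by (intro exI[of _ "Q + G"] exI[of _ R]) (auto simp: algebra_simps)
 qed
qed

abbreviation "\<delta> \<equiv> degree \<Delta>"

text \<open>Every element of the box is 1 modulo \<Delta>, hence equal to 1 over the excluded t. The
  term \<open>monom 1 (m - \<delta>)\<close> fixes the degree m and the leading coefficient of
  \<open>coeff b 0\<close>, and all other coefficients weigh strictly less than m, so the behaviour
  at infinity is dictated by this one coefficient.\<close>

definition lower_coeffs where
 "lower_coeffs m i = (if i = 0 then (%c. 1 + \<Delta> * (monom 1 (m - \<delta>) + c)) ` {c. deg_less (m - \<delta>) c}
   else if i < n then (%c. \<Delta> * c) ` {c. deg_less (m - \<delta> - slope * i) c} else {0})"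

definition lower_box where
 "lower_box m = box (lower_coeffs m)"

text \<open>Large enough that m - \<delta> - slope i is positive for all i < n, so no subtraction in
  the box is truncated.\<close>

definition m0 :: nat where "m0 = Suc (\<delta> + slope * n)"

lemma card_lower_box:
 assumes "m0 <= m"
 shows "finite (lower_box m)" "card (lower_box m) * CARD('k) ^ (n * \<delta> + (\<Sum>i<n. slope * i)) = CARD('k) ^ (n * m)"
proof -
 have fin: "finite (lower_coeffs m i)" for i unfolding lower_coeffs_def using card_deg_less(1)[where 'k='k] by simp
 have S0: "lower_coeffs m i = {0}" if "n <= i" for i using that deg by (auto simp: lower_coeffs_def)
 show "finite (lower_box m)" unfolding lower_box_def using box_card(1)[OF S0 fin] .
 have c: "card (lower_coeffs m i) = CARD('k) ^ (m - \<delta> - slope * i)" if "i < n" for i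
 proof -
  have "inj_on (%c. 1 + \<Delta> * (monom 1 (m - \<delta>) + c)) A" "inj_on (%c. \<Delta> * c) A" for A using Delta by (auto simp: inj_on_def)
  then show ?thesis using that card_deg_less(2)[where 'k='k] by (simp add: lower_coeffs_def card_image)
 qed
 have "card (lower_box m) = (\<Prod>i<n. CARD('k) ^ (m - \<delta> - slope * i))" unfolding lower_box_def using box_card(2)[of n "lower_coeffs m", OF S0 fin] by (simp add: c)
 also have "... = CARD('k) ^ (\<Sum>i<n. m - \<delta> - slope * i)" by (simp add: power_sum)
 finally have "card (lower_box m) = CARD('k) ^ (\<Sum>i<n. m - \<delta> - slope * i)" .
 moreover have "(\<Sum>i<n. m - \<delta> - slope * i) + (n * \<delta> + (\<Sum>i<n. slope * i)) = n * m"
 proof -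
  have "m - \<delta> - slope * i + (\<delta> + slope * i) = m" if "i < n" for i
  proof -
   have "slope * i <= slope * n" using that by simp
   then show ?thesis using assms unfolding m0_def by linarith
  qed
  then have "(\<Sum>i<n. m - \<delta> - slope * i + (\<delta> + slope * i)) = (\<Sum>i<n. m)" by (intro sum.cong) auto
  then show ?thesis by (simp add: sum.distrib)
 qed
 ultimately show "card (lower_box m) * CARD('k) ^ (n * \<delta> + (\<Sum>i<n. slope * i)) = CARD('k) ^ (n * m)" by (simp add: power_add[symmetric])
qed

context
 fixes m b
 assumes m: "m0 <= m" and b: "b \<in> lower_box m"
begin

lemma lower_box_coeff_0: "degree (coeff b 0) = m" "lead_coeff (coeff b 0) = lead_coeff \<Delta>"
proof -
 have "coeff b 0 \<in> lower_coeffs m 0" using b unfolding lower_box_def box_def by blast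
 then obtain c where c: "coeff b 0 = 1 + \<Delta> * (monom 1 (m - \<delta>) + c)" "deg_less (m - \<delta>) c" by (auto simp: lower_coeffs_def)
 have m1: "0 < m - \<delta>" using m unfolding m0_def by simp
 then have "degree c < degree (monom (1::'k) (m - \<delta>))" using c(2) by (simp add: deg_less_iff degree_monom_eq)
 then have g: "degree (monom 1 (m - \<delta>) + c) = m - \<delta>" "lead_coeff (monom 1 (m - \<delta>) + c) = 1" by (auto simp: degree_add_eq_left degree_monom_eq coeff_eq_0)
 then have g0: "monom 1 (m - \<delta>) + c ~= 0" by (metis leading_coeff_0_iff zero_neq_one)
 have d: "degree (\<Delta> * (monom 1 (m - \<delta>) + c)) = m" using Delta g0 g(1) m1 by (subst degree_mult_eq) auto
 then have lt: "degree (1 :: 'k poly) < degree (\<Delta> * (monom 1 (m - \<delta>) + c))" using m1 by simp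
 show "degree (coeff b 0) = m" unfolding c(1) using lt d by (simp add: degree_add_eq_right)
 show "lead_coeff (coeff b 0) = lead_coeff \<Delta>" unfolding c(1) using lead_coeff_add_le[OF lt] g(2) by (simp add: lead_coeff_mult)
qed

lemma lower_box_coeff_pos:
 assumes "0 < i" "coeff b i ~= 0"
 shows "degree (coeff b i) + slope * i < m" "i < n" "\<Delta> dvd coeff b i"
proof -
 have i: "coeff b i \<in> lower_coeffs m i" using b unfolding lower_box_def box_def by blast
 then show n: "i < n" using assms by (auto simp: lower_coeffs_def split: if_splits)
 then obtain c where c: "coeff b i = \<Delta> * c" "deg_less (m - \<delta> - slope * i) c" using i assms(1) by (auto simp: lower_coeffs_def)
 then show "\<Delta> dvd coeff b i" by simp
 have c0: "c ~= 0" using c assms(2) by auto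
 have "slope * i <= slope * n" using n by simp
 then have p: "0 < m - \<delta> - slope * i" using m unfolding m0_def by linarith
 have "degree (coeff b i) = \<delta> + degree c" using Delta c0 c(1) by (simp add: degree_mult_eq)
 moreover have "degree c < m - \<delta> - slope * i" using c(2) p by (simp add: deg_less_iff)
 ultimately show "degree (coeff b i) + slope * i < m" by simp
qed

lemma lower_box_basic: "b ~= 0" "deg_less n b" "weight_le slope (int m) b"
proof -
 have "0 < m" using m unfolding m0_def by simp
 then show "b ~= 0" using lower_box_coeff_0(1) by auto
 show "deg_less n b" unfolding deg_less_def using lower_box_coeff_pos(2) deg by (metis leD le_less_trans le0 neq0_conv)
 show "weight_le slope (int m) b" unfolding weight_le_def
 proof (intro allI impI)
  fix i assume "coeff b i ~= 0"
  then have "degree (coeff b i) + slope * i <= m" using lower_box_coeff_0(1) lower_box_coeff_pos(1)[of i] by (cases "i = 0") auto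
  then show "int (degree (coeff b i)) + int slope * int i <= int m" by (simp flip: of_nat_mult of_nat_add)
 qed
qed

lemma lower_box_at_bad:
 assumes "ev t \<Delta> = 0"
 shows "map_poly (ev t) b = 1"
proof (rule poly_eqI)
 fix i
 show "coeff (map_poly (ev t) b) i = coeff 1 i"
 proof (cases "i = 0")
  case True
  have "coeff b 0 \<in> lower_coeffs m 0" using b unfolding lower_box_def box_def by blast
  then show ?thesis using assms True by (auto simp: lower_coeffs_def coeff_map_poly ev.hom_add ev.hom_mult)
 next
  case False
  then show ?thesis using lower_box_coeff_pos(3)[of i] assms by (cases "coeff b i = 0") (auto simp: coeff_map_poly ev.hom_mult elim!: dvdE)
 qed
qed

end

text \<open>
 If \<open>b\<close> and \<open>b'\<close> have the same zeros, then \<open>b / b'\<close> has neither zeros nor poles over the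
 affine line, including the bad points, where both functions are \<open>1\<close>.
\<close>
lemma same_val_quotient:
 assumes m: "m0 <= m" "b \<in> lower_box m" and m': "m0 <= m'" "b' \<in> lower_box m'"
  and val: "!!y. y \<in> points ==> val y b = val y b'"
 obtains \<eta> w where "b = b' * \<eta> + w * f" "deg_less n \<eta>" "\<eta> ~= 0"
proof -
 note bb = lower_box_basic[OF m] and bb' = lower_box_basic[OF m']
 \<comment> \<open>The denominators a of b / b' modulo f. The norm of b' is one; the aim is one of
   degree 0.\<close>
 define P where "P = (%a. a ~= 0 & (\<exists>\<eta> w. deg_less n \<eta> & [:a:] * b = b' * \<eta> + w * f))"
 have "EX a. P a"
 proof -
  obtain v w where vw: "v * b' = [:poly_norm f b':] + w * f" using poly_norm_combination[OF lead deg bb'(2)] .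
  obtain Q R where QR: "v * b = Q * f + R" "deg_less n R" using poly_div_monic[OF lead deg] .
  have "[:poly_norm f b':] * b = (v * b' - w * f) * b" using vw by simp
  also have "... = b' * R + (b' * Q - w * b) * f" using arg_cong[OF QR(1), of "%x. b' * x"] by (simp add: algebra_simps)
  finally show ?thesis using norm_nz[OF bb'(1,2)] QR(2) unfolding P_def by blast
 qed
 then obtain a where a: "P a" "!!a'. P a' ==> degree a <= degree a'" using ex_has_least_nat[of P _ degree] by blast
 then obtain \<eta> w where a0: "a ~= 0" and g: "deg_less n \<eta>" and eq: "[:a:] * b = b' * \<eta> + w * f" unfolding P_def by blast
 have g0: "\<eta> ~= 0"
 proof
  assume "\<eta> = 0"
  then have e: "w * f = [:a:] * b" using eq by simp
  have "deg_less n ([:a:] * b)" using bb(2) by (simp add: deg_less_def)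
  then have "w = 0" unfolding e[symmetric] by (rule deg_less_monic_mult_eq_0[OF lead deg])
  then show False using e a0 bb(1) by simp
 qed
 \<comment> \<open>At a zero t of a the numerator \<eta> vanishes identically over t: at an excluded
   t because b' is 1 there, otherwise because \<eta> has the order of a at each of the n points over
   t, while its degree is below n. Then w vanishes over t too, and dividing by the minimal
   polynomial of t gives a denominator of smaller degree.\<close>
 have "degree a = 0"
 proof (rule ccontr)
  assume da: "degree a ~= 0"
  then have "0 < degree (map_poly to_ac a)" by simp
  then obtain t where t: "ev t a = 0" unfolding ev_def using alg_closed_imp_poly_has_root by blast
  interpret mt: map_poly_comm_ring_hom "ev t" ..
  have eqt: "map_poly (ev t) b' * map_poly (ev t) \<eta> + map_poly (ev t) w * map_poly (ev t) f = 0"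
  proof -
   have "map_poly (ev t) [:a:] = 0" by (rule poly_eqI) (simp add: coeff_map_poly coeff_pCons t split: nat.split)
   then show ?thesis using arg_cong[OF eq, of "map_poly (ev t)"] unfolding mt.hom_add mt.hom_mult by simp
  qed
  have gt: "deg_less n (map_poly (ev t) \<eta>)" using g by (simp add: deg_less_def coeff_map_poly)
  have lt: "lead_coeff (map_poly (ev t) f) = 1" "degree (map_poly (ev t) f) = n" using lead_map[OF ev_hom[of t]] by auto
  have gt0: "map_poly (ev t) \<eta> = 0"
  proof (cases "ev t \<Delta> = 0")
   case True
   have e: "(- map_poly (ev t) w) * map_poly (ev t) f = map_poly (ev t) \<eta>" using eqt lower_box_at_bad[OF m' True] by (simp add: add_eq_0_iff)
   then have "- map_poly (ev t) w = 0" using gt lt deg by (intro deg_less_monic_mult_eq_0[of "map_poly (ev t) f"]) auto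
   then show ?thesis using e by simp
  next
   case False
   have z: "poly (map_poly (ev t) \<eta>) z = 0" if "z \<in> fibre t" for z
   proof -
    have y: "(t, z) \<in> points" using that False by (simp add: points_iff)
    have "taylor t a * germ (t, z) b = germ (t, z) b' * germ (t, z) \<eta>"
     using arg_cong[OF eq, of "germ (t, z)"] germ_f[OF y] by (simp add: germ.hom_add germ.hom_mult germ_const del: mult_pCons_left)
    moreover have "taylor t a ~= 0" "germ (t, z) b ~= 0" "germ (t, z) b' ~= 0" "germ (t, z) \<eta> ~= 0" using a0 germ_nonzero[OF y] bb bb' g g0 by auto
    ultimately have "subdegree (taylor t a) + val (t, z) b = val (t, z) b' + val (t, z) \<eta>" unfolding val_def by (metis subdegree_mult)
    then have "val (t, z) \<eta> = subdegree (taylor t a)" using val[OF y] by simp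
    moreover have "0 < subdegree (taylor t a)"
    proof (rule ccontr)
     assume "\<not> 0 < subdegree (taylor t a)"
     moreover have "taylor t a ~= 0" using a0 by simp
     ultimately show False using nth_subdegree_nonzero[of "taylor t a"] t by simp
    qed
    ultimately have "fps_nth (germ (t, z) \<eta>) 0 = 0" unfolding val_def by (intro nth_less_subdegree_zero) simp
    then show ?thesis using germ_nth_0[OF y] by (simp add: evp_def)
   qed
   show ?thesis
   proof (rule ccontr)
    assume nz: "map_poly (ev t) \<eta> ~= 0"
    have "n <= degree (map_poly (ev t) \<eta>)" using card_mono[OF poly_roots_finite[OF nz], of "fibre t"] card_poly_roots_bound[OF nz] card_fibre[OF False] z by fastforce
    then show False using gt deg by (simp add: deg_less_iff)
   qed
  qed
  have "map_poly (ev t) f ~= 0" using lt(1) by fastforce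
  then have wt0: "map_poly (ev t) w = 0" using eqt gt0 by simp
  obtain p where p: "!!z. ev z p = 0 \<longleftrightarrow> z \<in> orb frob t" "lead_coeff p = 1" "degree p = fper t" using ex_poly_roots_orb[of t] by blast
  have pd: "[:p:] dvd h" if "map_poly (ev t) h = 0" for h
  proof -
   have "ev t (coeff h i) = 0" for i using arg_cong[OF that, of "%x. coeff x i"] by (simp add: coeff_map_poly)
   then show ?thesis unfolding const_poly_dvd_iff using ev_eq_0_imp_dvd[OF p] by blast
  qed
  obtain \<eta>1 where g1: "\<eta> = [:p:] * \<eta>1" using pd[OF gt0] by (rule dvdE)
  obtain w1 where w1: "w = [:p:] * w1" using pd[OF wt0] by (rule dvdE)
  obtain a1 where a1: "a = p * a1" using ev_eq_0_imp_dvd[OF p t] by (rule dvdE)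
  have p0: "p ~= 0" using p(2) by auto
  have "[:p:] * ([:a1:] * b) = [:p:] * (b' * \<eta>1 + w1 * f)" using eq unfolding g1 w1 a1 by (simp add: algebra_simps flip: smult_smult)
  then have "[:a1:] * b = b' * \<eta>1 + w1 * f" using p0 by (metis mult_left_cancel pCons_eq_0_iff)
  moreover have "deg_less n \<eta>1" using g p0 unfolding g1 deg_less_def by simp
  moreover have "a1 ~= 0" using a0 a1 by auto
  ultimately have "P a1" unfolding P_def by blast
  then have "degree a <= degree a1" by (rule a(2))
  moreover have "degree a = degree p + degree a1" using a1 a0 by (simp add: degree_mult_eq)
  moreover have "0 < degree p" using p(3) per_pos_fixed(1)[OF periodic_frob, of t] by simp
  ultimately show False by simp
 qed
 then obtain c where c: "a = [:c:]" by (rule degree_eq_zeroE)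
 have c0: "c ~= 0" using a0 c by auto
 let ?d = "[:[:inverse c:]:]"
 have "?d * ([:a:] * b) = b" using c0 by (simp add: c flip: one_pCons)
 then have "b = b' * (?d * \<eta>) + (?d * w) * f" using eq by (metis distrib_left mult.assoc mult.left_commute)
 moreover have "deg_less n (?d * \<eta>)" using g by (simp add: deg_less_def)
 moreover have "?d * \<eta> ~= 0" using g0 c0 by (simp add: no_zero_divisors)
 ultimately show ?thesis by (rule that)
qed

text \<open>Let \<eta> reach its maximal weight s at X^j. Modulo f, b is \<open>coeff b' 0\<close>
  times \<eta> plus a remainder from the other terms of b', which weighs at most m' - 1 + s. So the
  term of weight m' + s at X^j is not cancelled, and b has weight at least m' + s.\<close>

lemma quotient_weight:
 assumes m: "m0 <= m" "b \<in> lower_box m" and m': "m0 <= m'" "b' \<in> lower_box m'"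
  and eq: "b = b' * \<eta> + w * f" and g: "deg_less n \<eta>" "\<eta> ~= 0"
 shows "!!i. coeff \<eta> i ~= 0 ==> m' + (degree (coeff \<eta> i) + slope * i) <= m"
proof -
 define u where "u = (%i. degree (coeff \<eta> i) + slope * i)"
 define I where "I = {i. coeff \<eta> i ~= 0}"
 have I: "finite I" "I ~= {}"
 proof -
  have "I <= {..degree \<eta>}" unfolding I_def using le_degree[of \<eta>] by blast
  then show "finite I" by (rule finite_subset) simp
  have "degree \<eta> \<in> I" unfolding I_def using g(2) by simp
  then show "I ~= {}" by blast
 qed
 define s where "s = Max (u ` I)"
 have us: "u i <= s" if "i \<in> I" for i unfolding s_def using I that by (intro Max_ge) auto
 have "s \<in> u ` I" unfolding s_def using I by (intro Max_in) auto
 then obtain j where j: "j \<in> I" "u j = s" by blast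
 define b'' where "b'' = b' - [:coeff b' 0:]"
 have wg: "weight_le slope (int s) \<eta>" unfolding weight_le_def
 proof (intro allI impI)
  fix i assume "coeff \<eta> i ~= 0"
  then have "degree (coeff \<eta> i) + slope * i <= s" using us[of i] unfolding I_def u_def by simp
  then show "int (degree (coeff \<eta> i)) + int slope * int i <= int s" by (simp flip: of_nat_mult of_nat_add)
 qed
 have wb: "weight_le slope (int m' - 1) b''" unfolding weight_le_def
 proof (intro allI impI)
  fix i assume nz: "coeff b'' i ~= 0"
  then have i: "0 < i" by (cases i) (auto simp: b''_def)
  then have e: "coeff b'' i = coeff b' i" by (cases i) (auto simp: b''_def)
  have "degree (coeff b' i) + slope * i < m'" using lower_box_coeff_pos(1)[OF m' i] nz e by simp
  then have "int (degree (coeff b' i) + slope * i) <= int m' - 1" by linarith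
  then show "int (degree (coeff b'' i)) + int slope * int i <= int m' - 1" unfolding e by simp
 qed
 obtain Q R where QR: "b'' * \<eta> = Q * f + R" "deg_less n R" "weight_le slope (int m' - 1 + int s) R" using weight_division[OF weight_le_mult[OF wb wg]] by blast
 have "b = [:coeff b' 0:] * \<eta> + b'' * \<eta> + w * f" unfolding eq b''_def by (simp add: algebra_simps)
 then have "b - [:coeff b' 0:] * \<eta> - R = (Q + w) * f" unfolding QR(1) by (simp add: algebra_simps)
 moreover have "deg_less n (b - [:coeff b' 0:] * \<eta> - R)" using lower_box_basic(2)[OF m] g(1) QR(2) by (simp add: deg_less_def)
 ultimately have "Q + w = 0" using deg_less_monic_mult_eq_0[OF lead deg] by metis
 then have bR: "b = [:coeff b' 0:] * \<eta> + R" using \<open>b - [:coeff b' 0:] * \<eta> - R = (Q + w) * f\<close> by (simp add: algebra_simps)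
 define p where "p = coeff b' 0 * coeff \<eta> j"
 have cj: "coeff b j = p + coeff R j" unfolding bR p_def by simp
 have b0: "coeff b' 0 ~= 0" using lower_box_coeff_0(1)[OF m'] m'(1) unfolding m0_def by auto
 have dp: "degree p + slope * j = m' + s" using b0 j lower_box_coeff_0(1)[OF m'] unfolding p_def I_def u_def by (simp add: degree_mult_eq)
 have dR: "degree (coeff R j) < degree p" if "coeff R j ~= 0"
 proof -
  have "int (degree (coeff R j)) + int slope * int j <= int m' - 1 + int s" using QR(3) that unfolding weight_le_def by blast
  also have "... = int (degree p) + int slope * int j - 1" using arg_cong[OF dp, of int] by simp
  finally show ?thesis by simp
 qed
 have p0: "p ~= 0" using b0 j unfolding p_def I_def by simp
 have db: "degree (coeff b j) = degree p" "coeff b j ~= 0"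
 proof -
  show d: "degree (coeff b j) = degree p" unfolding cj using dR by (cases "coeff R j = 0") (auto simp: degree_add_eq_left)
  show "coeff b j ~= 0"
  proof
   assume z: "coeff b j = 0"
   then have "p = - coeff R j" using cj by (simp add: eq_neg_iff_add_eq_0)
   then show False using dR p0 by (cases "coeff R j = 0") (auto simp: degree_minus)
  qed
 qed
 have "int (degree (coeff b j)) + int slope * int j <= int m" using lower_box_basic(3)[OF m] db(2) unfolding weight_le_def by blast
 then have "degree (coeff b j) + slope * j <= m" by (simp flip: of_nat_mult of_nat_add)
 then have "m' + s <= m" using db(1) dp by simp
 then show "m' + (degree (coeff \<eta> i) + slope * i) <= m" if "coeff \<eta> i ~= 0" for i using us[of i] that unfolding I_def u_def by simp
qed

text \<open>The weight estimate for b / b' together with that for b' / b forces m = m' and a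
  constant quotient; the prescribed leading coefficient then makes the constant 1.\<close>

lemma same_val_imp_eq:
 assumes m: "m0 <= m" "b \<in> lower_box m" and m': "m0 <= m'" "b' \<in> lower_box m'"
  and val: "!!y. y \<in> points ==> val y b = val y b'"
 shows "b = b'"
proof -
 obtain \<eta> w where g: "b = b' * \<eta> + w * f" "deg_less n \<eta>" "\<eta> ~= 0" using same_val_quotient[OF m m' val] .
 obtain \<eta>' w' where g': "b' = b * \<eta>' + w' * f" "deg_less n \<eta>'" "\<eta>' ~= 0" using same_val_quotient[OF m' m val[symmetric]] by blast
 have le: "m' + (degree (coeff \<eta> i) + slope * i) <= m" if "coeff \<eta> i ~= 0" for i using quotient_weight[OF m m' g that] .
 obtain i where "coeff \<eta>' i ~= 0" using g'(3) by (auto simp: poly_eq_iff)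
 then have mm: "m <= m'" using quotient_weight[OF m' m g', of i] by simp
 have z: "degree (coeff \<eta> i) = 0 & i = 0" if "coeff \<eta> i ~= 0" for i using le[OF that] mm slope(1) by (cases i) auto
 obtain c where c: "coeff \<eta> 0 = [:c:]" using z[of 0] by (cases "coeff \<eta> 0 = 0") (auto elim: degree_eq_zeroE)
 have gc: "\<eta> = [:[:c:]:]" by (rule poly_eqI) (use z c in \<open>auto simp: coeff_pCons split: nat.split\<close>)
 have "b - b' * \<eta> = w * f" using g(1) by simp
 moreover have "deg_less n (b - b' * \<eta>)" unfolding gc using lower_box_basic(2)[OF m] lower_box_basic(2)[OF m'] by (simp add: deg_less_def)
 ultimately have "w = 0" using deg_less_monic_mult_eq_0[OF lead deg] by metis
 then have e: "b = smult [:c:] b'" using g(1) gc by simp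
 have "c ~= 0" using e lower_box_basic(1)[OF m] by auto
 then have "lead_coeff \<Delta> = c * lead_coeff \<Delta>" using lower_box_coeff_0[OF m] lower_box_coeff_0[OF m'] unfolding e by (simp add: lead_coeff_smult)
 then have "c = 1" using Delta by simp
 then show ?thesis using e by (simp flip: one_pCons)
qed

end


section \<open>The logarithmic count of the points of a curve\<close>

lemma sum_power_div_le_ln:
 fixes v :: real
 assumes "0 <= v" "v < 1"
 shows "(\<Sum>d=1..N. v ^ d / real d) <= - ln (1 - v)"
proof -
 have t: "(-1) ^ n * (1 / real (n + 1)) * ((1 - v) - 1) ^ Suc n = - (v ^ Suc n / real (Suc n))" for n
 proof -
  have "(-1) ^ n * (-1) ^ n = (1::real)" by (simp flip: power_mult_distrib)
  moreover have "((1 - v) - 1) ^ Suc n = - ((-1) ^ n * v ^ Suc n)" using power_minus[of v "Suc n"] by simp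
  ultimately show ?thesis by (simp add: mult.assoc[symmetric] del: power_Suc)
 qed
 have "ln (1 - v) = (\<Sum>n. - (v ^ Suc n / real (Suc n)))" using ln_series[of "1 - v"] assms unfolding t by (cases "v = 0") auto
 moreover have s: "summable (%n. v ^ Suc n / real (Suc n))"
 proof (rule summable_comparison_test')
  show "summable (%n. v ^ n)" using assms by (intro summable_geometric) auto
  show "norm (v ^ Suc n / real (Suc n)) <= v ^ n" for n
  proof -
   have "v ^ Suc n / real (Suc n) <= v ^ Suc n / 1" using assms by (intro divide_left_mono) auto
   also have "... <= v ^ n" using assms by (simp add: mult_left_le_one_le)
   finally show ?thesis using assms by simp
  qed
 qed
 ultimately have "(\<Sum>n. v ^ Suc n / real (Suc n)) = - ln (1 - v)" by (simp add: suminf_minus)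
 moreover have "(\<Sum>n<N. v ^ Suc n / real (Suc n)) <= (\<Sum>n. v ^ Suc n / real (Suc n))" using assms by (intro sum_le_suminf[OF s]) auto
 moreover have "(\<Sum>n<N. v ^ Suc n / real (Suc n)) = (\<Sum>d=1..N. v ^ d / real d)" by (rule sum.reindex_bij_witness[of _ "%d. d - 1" Suc]) auto
 ultimately show ?thesis by simp
qed

context curve
begin

text \<open>An orbit of size d contains d points, so this is the sum of (v/q)^d over all Frobenius
  orbits: the logarithm of the Euler product up to a bounded error, with v = q^(1 - s). The term d =
  0 is 0 by division by zero.\<close>

definition log_count :: "real => real" where
 "log_count v = (\<Sum>d. real (count d) * (v / CARD('k)) ^ d / real d)"

text \<open>Abel summation of the Mertens bound against the decreasing weights v^d / d; comparison
  with the series of -ln(1 - v) supplies the main term.\<close>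

lemma log_count_summable_upper:
 "EX K. ALL v:{0..<1}. summable (%d. real (count d) * (v / CARD('k)) ^ d / real d) & log_count v <= - ln (1 - v) + K"
proof -
 obtain K where K: "0 <= K" "!!M. (\<Sum>d=1..M. real (count d) / real CARD('k) ^ d - 1) <= K" using mertens_upper by blast
 show ?thesis
 proof (intro exI ballI)
  fix v :: real assume "v \<in> {0..<1}"
  then have v: "0 <= v" "v < 1" by auto
  let ?g = "%d. real (count d) * (v / CARD('k)) ^ d / real d"
  have le: "(\<Sum>d<N. ?g d) <= - ln (1 - v) + K" for N
  proof -
   have w: "v ^ Suc d / real (Suc d) <= v ^ d / real d" if "1 <= d" for d using v that by (intro frac_le) (auto simp: mult_left_le_one_le)
   have "(\<Sum>d=1..N. (real (count d) / real CARD('k) ^ d - 1) * (v ^ d / real d)) <= K * (v ^ 1 / real 1)" using v by (intro sum_weighted_le K w) auto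
   also have "... <= K" using v K by (simp add: mult_left_le)
   finally have "(\<Sum>d=1..N. ?g d) - (\<Sum>d=1..N. v ^ d / real d) <= K" by (simp add: algebra_simps power_divide sum_subtractf)
   moreover have "(\<Sum>d<N. ?g d) <= (\<Sum>d=1..N. ?g d)"
   proof -
    have "(\<Sum>d<N. ?g d) <= (SUM d:insert 0 {1..N}. ?g d)" using v by (intro sum_mono2) auto
    then show ?thesis by simp
   qed
   ultimately show ?thesis using sum_power_div_le_ln[OF v, of N] by linarith
  qed
  have s: "summable ?g" using v by (intro summableI_nonneg_bounded[OF _ le]) auto
  then show "summable ?g & log_count v <= - ln (1 - v) + K" unfolding log_count_def using le by (auto intro!: suminf_le_const)
 qed
qed

definition orbits where
 "orbits D = orb frob2 ` low D"

lemma orbits: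
 assumes "\<omega> \<in> orbits D"
 shows "finite \<omega>" "\<omega> <= low D" "!!y. y \<in> \<omega> ==> orb frob2 y = \<omega>" "\<omega> ~= {}" "!!y. y \<in> \<omega> ==> per frob2 y = card \<omega>"
proof -
 obtain y where y: "y \<in> low D" "\<omega> = orb frob2 y" using assms unfolding orbits_def by blast
 show "finite \<omega>" "\<omega> ~= {}" unfolding y(2) using finite_orb[OF periodic_frob2, of y] orb_self[of y frob2] by blast+
 show "\<omega> <= low D" unfolding y(2)
 proof
  fix z assume "z \<in> orb frob2 y"
  then obtain i where "z = (frob2 ^^ i) y" by (auto simp: orb_in simp del: split_paired_Ex)
  then show "z \<in> low D" using y(1) frob2_points[of i y] per_funpow[OF periodic_frob2, of i y] by (simp add: low_def)
 qed
 show *: "orb frob2 z = \<omega>" if "z \<in> \<omega>" for z using orb_eqI[OF periodic_frob2] that unfolding y(2) by blast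
 show "per frob2 z = card \<omega>" if "z \<in> \<omega>" for z using *[OF that] card_orb[OF periodic_frob2, of z] by simp
qed

lemma sum_orbits: "(\<Sum>\<omega>\<in>orbits D. SUM y:\<omega>. g y) = (SUM y:low D. g y)"
proof -
 have e: "\<Union> (orbits D) = low D"
 proof
  show "\<Union> (orbits D) <= low D" using orbits(2) by (rule Union_least)
  show "low D <= \<Union> (orbits D)" unfolding orbits_def using orb_self by (fast intro: UnionI)
 qed
 have 1: "ALL A:orbits D. finite A" using orbits(1) by blast
 have 2: "ALL A:orbits D. ALL B:orbits D. A ~= B --> A \<inter> B = {}" using orbits(3) by blast
 show ?thesis using sum.Union_disjoint[OF 1 2, of g] unfolding e by (simp only: o_def)
qed

lemma sum_orbits_card: "(\<Sum>\<omega>\<in>orbits D. g (card \<omega>)) = (\<Sum>d=1..D. real (count d) * (g d / real d))"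
proof -
 have "(\<Sum>\<omega>\<in>orbits D. g (card \<omega>)) = (\<Sum>\<omega>\<in>orbits D. SUM y:\<omega>. g (per frob2 y) / real (per frob2 y))"
 proof (rule sum.cong[OF refl])
  fix \<omega> assume \<omega>: "\<omega> \<in> orbits D"
  have "(SUM y:\<omega>. g (per frob2 y) / real (per frob2 y)) = (SUM y:\<omega>. g (card \<omega>) / real (card \<omega>))"
   using orbits(5)[OF \<omega>] by (intro sum.cong) auto
  then show "g (card \<omega>) = (SUM y:\<omega>. g (per frob2 y) / real (per frob2 y))" using orbits(1,4)[OF \<omega>] by simp
 qed
 then show ?thesis unfolding sum_orbits using sum_low[of "%d. g d / real d" D] by simp
qed

text \<open>By \<open>same_val_imp_eq\<close> an element of a box is determined by its orders at all
  points, so the boxes of all levels embed into the effective divisors, level m having degree at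
  most n m. Since v^(n m) is |box m| u^(n m) up to a constant factor, the sum is at most a constant
  times the Euler product over orbits.\<close>

lemma exp_log_count_ge:
 assumes v: "0 <= v" "v < 1" and s: "summable (%d. real (count d) * (v / CARD('k)) ^ d / real d)"
 shows "(\<Sum>m=m0..M. v ^ (n * m)) <= real CARD('k) ^ (n * \<delta> + (\<Sum>i<n. slope * i)) * exp (log_count v + 2 * n)"
proof -
 define c where "c = n * \<delta> + (\<Sum>i<n. slope * i)"
 define u where "u = v / CARD('k)"
 define D where "D = n * M"
 define BB where "BB = Sigma {m0..M} lower_box"
 define \<Phi> where "\<Phi> = (%(m :: nat, b). restrict (%\<omega>. val (SOME y. y \<in> \<omega>) b) (orbits D))"
 have q2: "2 <= real CARD('k)" using CARD_ge_2[where 'k='k] by (metis of_nat_le_iff of_nat_numeral)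
 have u: "0 <= u" "u <= 1 / real CARD('k)" "u <= 1/2" "u <= 1"
 proof -
  show "0 <= u" "u <= 1 / real CARD('k)" unfolding u_def using v q2 by (auto simp: divide_right_mono)
  moreover have "1 / real CARD('k) <= 1 / 2" using q2 by (intro divide_left_mono) auto
  ultimately show "u <= 1/2" by (rule_tac order_trans)
  then show "u <= 1" by simp
 qed
 have finO: "finite (orbits D)" unfolding orbits_def using finite_low by simp
 have rep: "(SOME y. y \<in> \<omega>) \<in> \<omega>" if "\<omega> \<in> orbits D" for \<omega> using orbits(4)[OF that] some_in_eq by blast
 have val_rep: "val (SOME y. y \<in> \<omega>) b = val y b" if "\<omega> \<in> orbits D" "y \<in> \<omega>" for \<omega> y b
 proof -
  have "y \<in> points" using that orbits(2) unfolding low_def by blast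
  moreover have "(SOME y. y \<in> \<omega>) \<in> orb frob2 y" using rep orbits(3) that by blast
  ultimately show ?thesis by (rule val_orb)
 qed
 have BBd: "(SUM y:Y. val y b) <= n * m & n * m <= D" if "(m, b) \<in> BB" "finite Y" "Y <= points" for m b Y
 proof -
  have m: "m0 <= m" "b \<in> lower_box m" "m <= M" using that(1) unfolding BB_def by auto
  have "(SUM y:Y. val y b) <= degree (poly_norm f b)" by (rule sum_val_le[OF that(2,3) lower_box_basic(1,2)[OF m(1,2)]])
  also have "... <= n * m" by (rule degree_poly_norm_le[OF slope(2) lead deg lower_box_basic(3)[OF m(1,2)]])
  finally show ?thesis using m(3) unfolding D_def by simp
 qed
 \<comment> \<open>Orders are constant on an orbit, so a zero whose orbit has more than D points
   would exceed the bound n m on the total order.\<close>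
 have far: "val y b = 0" if "(m, b) \<in> BB" "y \<in> points" "y \<notin> low D" for m b y
 proof (rule ccontr)
  assume nz: "val y b ~= 0"
  have \<omega>: "finite (orb frob2 y)" "orb frob2 y <= points"
  proof -
   show "finite (orb frob2 y)" by (rule finite_orb[OF periodic_frob2])
   show "orb frob2 y <= points" using frob2_points[of _ y] that(2) unfolding orb_def by blast
  qed
  have "per frob2 y = (SUM z:orb frob2 y. 1)" using card_orb[OF periodic_frob2, of y] by simp
  also have "... <= (SUM z:orb frob2 y. val z b)" using nz val_orb[OF that(2)] by (intro sum_mono) fastforce
  also have "... <= D" using BBd[OF that(1) \<omega>] by simp
  finally show False using that(2,3) unfolding low_def by simp
 qed
 have inj: "inj_on \<Phi> BB"
 proof (rule inj_onI, clarify)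
  fix m b m' b' assume mb: "(m, b) \<in> BB" and mb': "(m', b') \<in> BB" and eq: "\<Phi> (m, b) = \<Phi> (m', b')"
  have l: "m0 <= m" "b \<in> lower_box m" "m0 <= m'" "b' \<in> lower_box m'" using mb mb' unfolding BB_def by auto
  have "val y b = val y b'" if y: "y \<in> points" for y
  proof (cases "y \<in> low D")
   case True
   then have \<omega>: "orb frob2 y \<in> orbits D" unfolding orbits_def by blast
   show ?thesis using fun_cong[OF eq, of "orb frob2 y"] \<omega> val_rep[OF \<omega> orb_self] unfolding \<Phi>_def by simp
  qed (use far[OF mb y] far[OF mb' y] in simp)
  then have e: "b = b'" by (rule same_val_imp_eq[OF l])
  then show "m = m' & b = b'" using lower_box_coeff_0(1)[OF l(1,2)] lower_box_coeff_0(1)[OF l(3,4)] by simp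
 qed
 have img: "\<Phi> ` BB <= PiE (orbits D) (%_. {..D})"
 proof (clarify, rule PiE_I)
  fix m b \<omega> assume mb: "(m, b) \<in> BB" and \<omega>: "\<omega> \<in> orbits D"
  have "{SOME y. y \<in> \<omega>} <= points" using rep[OF \<omega>] orbits(2)[OF \<omega>] unfolding low_def by auto
  then show "\<Phi> (m, b) \<omega> \<in> {..D}" using BBd[OF mb, of "{SOME y. y \<in> \<omega>}"] \<omega> by (simp add: \<Phi>_def)
 qed (simp add: \<Phi>_def)
 have finB: "finite BB" unfolding BB_def using card_lower_box(1) by (intro finite_SigmaI) auto
 \<comment> \<open>The orders add up to at most n m and u <= 1, so the monomial of the divisor is at
   least u^(n m).\<close>
 have wt: "u ^ (n * m) <= (\<Prod>\<omega>\<in>orbits D. (u ^ card \<omega>) ^ \<Phi> (m, b) \<omega>)" if mb: "(m, b) \<in> BB" for m b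
 proof -
  have "(\<Sum>\<omega>\<in>orbits D. card \<omega> * \<Phi> (m, b) \<omega>) = (\<Sum>\<omega>\<in>orbits D. SUM y:\<omega>. val y b)"
  proof (rule sum.cong[OF refl])
   fix \<omega> assume \<omega>: "\<omega> \<in> orbits D"
   have "(SUM y:\<omega>. val y b) = (SUM y:\<omega>. \<Phi> (m, b) \<omega>)" using val_rep[OF \<omega>] \<omega> by (intro sum.cong) (simp_all add: \<Phi>_def)
   then show "card \<omega> * \<Phi> (m, b) \<omega> = (SUM y:\<omega>. val y b)" by simp
  qed
  also have "... <= n * m" unfolding sum_orbits using BBd[OF mb finite_low[of D]] by (simp add: low_def)
  finally have "u ^ (n * m) <= u ^ (\<Sum>\<omega>\<in>orbits D. card \<omega> * \<Phi> (m, b) \<omega>)" using u by (intro power_decreasing) auto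
  then show ?thesis by (simp add: power_sum power_mult)
 qed
 have cs: "CARD('k) ^ c * card (lower_box m) = CARD('k) ^ (n * m)" if "m \<in> {m0..M}" for m using card_lower_box(2)[of m] that unfolding c_def by (simp add: mult.commute)
 have "(\<Sum>m=m0..M. v ^ (n * m)) = (\<Sum>m=m0..M. real CARD('k) ^ c * (real (card (lower_box m)) * u ^ (n * m)))"
 proof (rule sum.cong[OF refl])
  fix m assume "m \<in> {m0..M}"
  then have "real CARD('k) ^ c * real (card (lower_box m)) = real CARD('k) ^ (n * m)" using arg_cong[OF cs, of m real] by simp
  moreover have "v ^ (n * m) = real CARD('k) ^ (n * m) * u ^ (n * m)" unfolding u_def by (simp add: power_divide)
  ultimately show "v ^ (n * m) = real CARD('k) ^ c * (real (card (lower_box m)) * u ^ (n * m))" by (metis mult.assoc)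
 qed
 also have "... = real CARD('k) ^ c * (\<Sum>m=m0..M. SUM b:lower_box m. u ^ (n * m))" by (simp add: sum_distrib_left)
 also have "(\<Sum>m=m0..M. SUM b:lower_box m. u ^ (n * m)) = (\<Sum>(m, b)\<in>BB. u ^ (n * m))" unfolding BB_def using card_lower_box(1) by (intro sum.Sigma) auto
 also have "... <= (\<Sum>(m, b)\<in>BB. \<Prod>\<omega>\<in>orbits D. (u ^ card \<omega>) ^ \<Phi> (m, b) \<omega>)" using wt by (intro sum_mono) auto
 also have "... = (SUM h:\<Phi> ` BB. \<Prod>\<omega>\<in>orbits D. (u ^ card \<omega>) ^ h \<omega>)" by (simp add: sum.reindex[OF inj] case_prod_beta)
 also have "... <= (SUM h:PiE (orbits D) (%_. {..D}). \<Prod>\<omega>\<in>orbits D. (u ^ card \<omega>) ^ h \<omega>)"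
  using u by (intro sum_mono2 img finite_PiE finO prod_nonneg) auto
 also have "... = (\<Prod>\<omega>\<in>orbits D. SUM k:{..D}. (u ^ card \<omega>) ^ k)" by (rule prod_sum_PiE[symmetric]) (use finO in auto)
 also have "... <= (\<Prod>\<omega>\<in>orbits D. exp (u ^ card \<omega> + 2 * (u ^ card \<omega>)\<^sup>2))"
 proof (rule prod_mono, intro conjI)
  fix \<omega> assume \<omega>: "\<omega> \<in> orbits D"
  define x where "x = u ^ card \<omega>"
  have "1 <= card \<omega>" using orbits(1,4)[OF \<omega>] by (simp add: Suc_le_eq card_gt_0_iff)
  then have "x <= u ^ 1" unfolding x_def using u by (intro power_decreasing) auto
  then have x: "0 <= x" "x <= 1/2" using u unfolding x_def by auto
  have "(SUM k:{..D}. x ^ k) * (1 - x) = 1 - x ^ Suc D" using sum_gp_basic[of x D] by (simp add: mult.commute)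
  also have "... <= 1" using x by simp
  finally have "(SUM k:{..D}. x ^ k) <= 1 / (1 - x)" using x by (simp add: field_simps)
  also have "... = exp (- ln (1 - x))" proof -
   have "exp (ln (1 - x)) = 1 - x" using x by simp
   then show ?thesis by (simp only: exp_minus divide_inverse mult_1_left)
  qed
  also have "... <= exp (x + 2 * x\<^sup>2)" using ln_one_minus_pos_lower_bound[OF x] by simp
  finally show "(SUM k:{..D}. (u ^ card \<omega>) ^ k) <= exp (u ^ card \<omega> + 2 * (u ^ card \<omega>)\<^sup>2)" unfolding x_def .
  show "0 <= (SUM k:{..D}. (u ^ card \<omega>) ^ k)" using u by (intro sum_nonneg) auto
 qed
 also have "... = exp ((\<Sum>\<omega>\<in>orbits D. u ^ card \<omega>) + 2 * (\<Sum>\<omega>\<in>orbits D. (u ^ card \<omega>)\<^sup>2))"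
  by (subst exp_sum[OF finO, symmetric]) (simp add: sum.distrib sum_distrib_left)
 \<comment> \<open>The second-order terms: q u <= 1 and u <= 1/2 give count(d) u^(2 d) <= n 2^(-d),
   whose sum over d is at most n; the factor 2 is that of -ln(1 - x) <= x + 2 x^2.\<close>
 also have "... <= exp (log_count v + 2 * n)"
 proof -
  have "(\<Sum>\<omega>\<in>orbits D. u ^ card \<omega>) = (\<Sum>d=1..D. real (count d) * (v / CARD('k)) ^ d / real d)"
   unfolding sum_orbits_card[of "%d. u ^ d"] by (simp add: u_def)
  also have "... <= log_count v" unfolding log_count_def using v by (intro sum_le_suminf[OF s]) auto
  finally have 1: "(\<Sum>\<omega>\<in>orbits D. u ^ card \<omega>) <= log_count v" .
  have "(\<Sum>\<omega>\<in>orbits D. (u ^ card \<omega>)\<^sup>2) = (\<Sum>d=1..D. real (count d) * ((u ^ d)\<^sup>2 / real d))" by (rule sum_orbits_card)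
  also have "... <= (\<Sum>d=1..D. real n * (1/2) ^ d)"
  proof (rule sum_mono)
   fix d assume d: "d \<in> {1..D}"
   have "real (count d) <= real n * real CARD('k) ^ d" using count_le[of d] by (simp flip: of_nat_mult of_nat_power)
   moreover have "(u ^ d)\<^sup>2 / real d <= (u ^ d)\<^sup>2 / 1" using d by (intro divide_left_mono) auto
   ultimately have "real (count d) * ((u ^ d)\<^sup>2 / real d) <= (real n * real CARD('k) ^ d) * (u ^ d * u ^ d)" by (intro mult_mono) (auto simp: power2_eq_square)
   also have "... = real n * ((real CARD('k) * u) ^ d * u ^ d)" by (simp add: power_mult_distrib)
   also have "... <= real n * (1 ^ d * (1/2) ^ d)" using u q2 by (intro mult_left_mono mult_mono power_mono) (auto simp: field_simps)
   finally show "real (count d) * ((u ^ d)\<^sup>2 / real d) <= real n * (1/2) ^ d" by simp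
  qed
  also have "... <= real n * 1"
  proof -
   have "(\<Sum>d=1..D. (1/2::real) ^ d) = 1 - (1/2) ^ D" by (induction D) (auto simp: field_simps)
   then show ?thesis by (simp add: sum_distrib_left[symmetric] mult_left_le)
  qed
  finally show ?thesis using 1 by simp
 qed
 finally show ?thesis unfolding c_def by (simp add: mult_left_mono)
qed

text \<open>For the lower bound the geometric sum tends to v^(n m0) / (1 - v^n), where 1 - v^n <= n
  (1 - v) by Bernoulli, and v >= 1/2 keeps v^(n m0) away from 0; A collects these constants.\<close>

theorem log_count_asymp:
 "EX K. ALL v:{1/2..<1}. summable (%d. real (count d) * (v / CARD('k)) ^ d / real d) & \<bar>log_count v + ln (1 - v)\<bar> <= K"
proof -
 obtain K1 where K: "ALL v:{0..<1}. summable (%d. real (count d) * (v / CARD('k)) ^ d / real d) & log_count v <= - ln (1 - v) + K1" using log_count_summable_upper ..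
 have K1: "summable (%d. real (count d) * (v / CARD('k)) ^ d / real d)" "log_count v <= - ln (1 - v) + K1"
  if "v \<in> {0..<1}" for v using bspec[OF K that] by auto
 define A where "A = real CARD('k) ^ (n * \<delta> + (\<Sum>i<n. slope * i)) * exp (2 * n) * real n * 2 ^ (n * m0)"
 have A: "0 < A" unfolding A_def using deg by simp
 have low: "- ln (1 - v) <= log_count v + ln A" if v: "v \<in> {1/2..<1}" for v
 proof -
  have v': "0 <= v" "v < 1" "v \<in> {0..<1}" "1/2 <= v" using v by auto
  define E where "E = real CARD('k) ^ (n * \<delta> + (\<Sum>i<n. slope * i)) * exp (log_count v + 2 * n)"
  have V: "0 <= v ^ n" "v ^ n < 1" using v' deg by (auto simp: power_less_one_iff)
  have "(v ^ n) ^ m0 - (v ^ n) ^ Suc M <= E * (1 - v ^ n)" if "m0 <= M" for M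
  proof -
   have "(\<Sum>m=m0..M. (v ^ n) ^ m) * (1 - v ^ n) = (v ^ n) ^ m0 - (v ^ n) ^ Suc M" using sum_gp_multiplied[OF that, of "v ^ n"] by (simp add: mult.commute)
   moreover have "(\<Sum>m=m0..M. (v ^ n) ^ m) <= E" using exp_log_count_ge[OF v'(1,2) K1(1)[OF v'(3)], of M] unfolding E_def by (simp add: power_mult)
   ultimately show ?thesis using V by (metis diff_ge_0_iff_ge less_eq_real_def mult_right_mono)
  qed
  moreover have "(%M. (v ^ n) ^ m0 - (v ^ n) ^ Suc M) \<longlonglongrightarrow> (v ^ n) ^ m0 - 0"
   using V by (intro tendsto_diff tendsto_const LIMSEQ_Suc LIMSEQ_power_zero) auto
  ultimately have lim: "(v ^ n) ^ m0 <= E * (1 - v ^ n)" by (intro LIMSEQ_le_const2[of _ "(v ^ n) ^ m0"]) auto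
  have "1 - v ^ n <= real n * (1 - v)" using Bernoulli_inequality[of "v - 1" n] v' by (simp add: algebra_simps)
  then have "E * (1 - v ^ n) <= E * (real n * (1 - v))" unfolding E_def by (intro mult_left_mono) auto
  moreover have "(1/2) ^ (n * m0) <= (v ^ n) ^ m0" using v' by (simp add: power_mult[symmetric] power_mono)
  ultimately have "(1/2) ^ (n * m0) <= E * (real n * (1 - v))" using lim by linarith
  then have "1 <= 2 ^ (n * m0) * (E * (real n * (1 - v)))" by (simp add: power_divide field_simps)
  also have "... = A * exp (log_count v) * (1 - v)" unfolding E_def A_def by (simp add: exp_add algebra_simps)
  finally have "ln 1 <= ln (A * exp (log_count v) * (1 - v))" using A v' by (subst ln_le_cancel_iff) auto
  then show ?thesis using A v' by (simp add: ln_mult)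
 qed
 show ?thesis
 proof (intro exI ballI conjI)
  fix v :: real assume v: "v \<in> {1/2..<1}"
  then have v0: "v \<in> {0..<1}" by auto
  show "summable (%d. real (count d) * (v / CARD('k)) ^ d / real d)" by (rule K1(1)[OF v0])
  show "\<bar>log_count v + ln (1 - v)\<bar> <= max K1 (ln A)" using low[OF v] K1(2)[OF v0] by linarith
 qed
qed

end


section \<open>Subrings and homomorphisms on them\<close>

text \<open>Subrings are sets within a type, so that integral closures, Galois extensions and
  valuation rings inside one field can be handled together; \<open>hom_on\<close> accordingly
  constrains sums and products only on the subring.\<close>

definition sring :: "'r::comm_ring_1 set => bool" where
 "sring B \<longleftrightarrow> 1 \<in> B & (ALL a:B. ALL b:B. a - b \<in> B & a * b \<in> B)"

definition hom_on :: "'r::comm_ring_1 set => ('r => 's::comm_ring_1) => bool" where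
 "hom_on B x \<longleftrightarrow> x 1 = 1 & (ALL a:B. ALL b:B. x (a + b) = x a + x b & x (a * b) = x a * x b)"

definition poly_over :: "'r::zero set => 'r poly set" where
 "poly_over B = {p. ALL i. coeff p i \<in> B}"

lemma poly_overD: "p \<in> poly_over B ==> coeff p i \<in> B"
 by (simp add: poly_over_def)

lemma sringI: "1 \<in> B ==> (!!a b. a \<in> B ==> b \<in> B ==> a - b \<in> B) ==> (!!a b. a \<in> B ==> b \<in> B ==> a * b \<in> B) ==> sring B"
 by (simp add: sring_def)

lemma sring_UNIV: "sring UNIV"
 by (simp add: sring_def)

lemma hom_on_subset: "hom_on B x ==> C <= B ==> hom_on C x"
 unfolding hom_on_def by blast

lemma hom_on_comp: "hom_on B x ==> hom_on C y ==> x ` B <= C ==> hom_on B (y o x)"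
 unfolding hom_on_def by (auto simp: image_subset_iff)

lemma comm_ring_hom_hom_on: "comm_ring_hom e ==> hom_on B e"
proof -
 assume "comm_ring_hom e"
 then interpret comm_ring_hom e .
 show ?thesis by (simp add: hom_on_def hom_add hom_mult)
qed

context
 fixes B :: "'r::comm_ring_1 set"
 assumes B: "sring B"
begin

lemma sring_1: "1 \<in> B" and sring_diff: "a \<in> B ==> b \<in> B ==> a - b \<in> B"
 and sring_mult: "a \<in> B ==> b \<in> B ==> a * b \<in> B"
 using B by (auto simp: sring_def)

lemma sring_0: "0 \<in> B"
 using sring_diff[OF sring_1 sring_1] by simp

lemma sring_uminus: "a \<in> B ==> - a \<in> B"
 using sring_diff[OF sring_0] by fastforce

lemma sring_add: "a \<in> B ==> b \<in> B ==> a + b \<in> B"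
 using sring_diff[of a "- b"] sring_uminus[of b] by simp

lemma sring_sum: "(!!i. i \<in> I ==> f i \<in> B) ==> sum f I \<in> B"
 by (induction I rule: infinite_finite_induct) (auto simp: sring_0 sring_add)

lemma sring_prod: "(!!i. i \<in> I ==> f i \<in> B) ==> prod f I \<in> B"
 by (induction I rule: infinite_finite_induct) (auto simp: sring_1 sring_mult)

lemma sring_power: "a \<in> B ==> a ^ n \<in> B"
 by (induction n) (auto simp: sring_1 sring_mult)

lemma sring_poly: "p \<in> poly_over B ==> z \<in> B ==> poly p z \<in> B"
 unfolding poly_altdef by (intro sring_sum sring_mult sring_power) (auto simp: poly_over_def)

lemma sring_poly_over: "sring (poly_over B)"
proof (rule sringI)
 show "1 \<in> poly_over B" by (simp add: poly_over_def sring_0 sring_1)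
 show "a - b \<in> poly_over B" if "a \<in> poly_over B" "b \<in> poly_over B" for a b using that by (simp add: poly_over_def sring_diff)
 show "a * b \<in> poly_over B" if "a \<in> poly_over B" "b \<in> poly_over B" for a b using that by (simp add: poly_over_def coeff_mult sring_sum sring_mult)
qed

lemma linear_poly_over: "a \<in> B ==> [:- a, 1:] \<in> poly_over B"
 by (simp add: poly_over_def coeff_pCons sring_0 sring_1 sring_uminus split: nat.split)

context
 fixes x :: "'r => 's::comm_ring_1"
 assumes x: "hom_on B x"
begin

lemma hom_on_1: "x 1 = 1" and hom_on_add: "a \<in> B ==> b \<in> B ==> x (a + b) = x a + x b"
 and hom_on_mult: "a \<in> B ==> b \<in> B ==> x (a * b) = x a * x b"
 using x by (auto simp: hom_on_def)

lemma hom_on_0: "x 0 = 0"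
 using hom_on_add[OF sring_0 sring_0] by simp

lemma hom_on_uminus: "a \<in> B ==> x (- a) = - x a"
 using hom_on_add[of a "- a"] sring_uminus[of a] hom_on_0 by (simp add: eq_neg_iff_add_eq_0 add.commute)

lemma hom_on_diff: "a \<in> B ==> b \<in> B ==> x (a - b) = x a - x b"
 using hom_on_add[of a "- b"] hom_on_uminus[of b] sring_uminus[of b] by simp

lemma hom_on_sum: "(!!i. i \<in> I ==> f i \<in> B) ==> x (sum f I) = (SUM i:I. x (f i))"
 by (induction I rule: infinite_finite_induct) (auto simp: hom_on_0 hom_on_add sring_sum)

lemma hom_on_prod: "(!!i. i \<in> I ==> f i \<in> B) ==> x (prod f I) = (PROD i:I. x (f i))"
 by (induction I rule: infinite_finite_induct) (auto simp: hom_on_1 hom_on_mult sring_prod)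

lemma hom_on_power: "a \<in> B ==> x (a ^ n) = x a ^ n"
 by (induction n) (auto simp: hom_on_1 hom_on_mult sring_power)

lemma coeff_map_poly_hom_on: "coeff (map_poly x p) i = x (coeff p i)"
 by (simp add: coeff_map_poly hom_on_0)

lemma hom_on_map_poly: "hom_on (poly_over B) (map_poly x)"
 unfolding hom_on_def
proof (intro conjI ballI)
 show "map_poly x 1 = 1" by (rule poly_eqI) (simp add: coeff_map_poly_hom_on hom_on_0 hom_on_1)
 fix a b assume ab: "a \<in> poly_over B" "b \<in> poly_over B"
 show "map_poly x (a + b) = map_poly x a + map_poly x b" using ab by (intro poly_eqI) (simp add: coeff_map_poly_hom_on hom_on_add poly_over_def)
 show "map_poly x (a * b) = map_poly x a * map_poly x b" using ab by (intro poly_eqI)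
   (simp add: coeff_map_poly_hom_on coeff_mult poly_over_def hom_on_sum sring_mult hom_on_mult)
qed

lemma hom_on_poly:
 assumes "p \<in> poly_over B" "z \<in> B"
 shows "x (poly p z) = poly (map_poly x p) (x z)"
proof -
 have "poly (map_poly x p) (x z) = (\<Sum>j<Suc (degree p). x (coeff p j) * x z ^ j)" by (rule poly_map_poly_lessThan) (auto simp: hom_on_0 coeff_eq_0)
 also have "... = x (\<Sum>j<Suc (degree p). coeff p j * z ^ j)" using assms by (subst hom_on_sum) (auto simp: poly_over_def sring_mult sring_power hom_on_mult hom_on_power)
 finally show ?thesis by (simp add: poly_altdef lessThan_Suc_atMost)
qed

lemma map_poly_linear: "a \<in> B ==> map_poly x [:- a, 1:] = [:- x a, 1:]"
 by (rule poly_eqI) (simp add: coeff_map_poly_hom_on coeff_pCons hom_on_1 hom_on_0 hom_on_uminus split: nat.split)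

end

end

lemma map_poly_prod_linear:
 assumes B: "sring B" and x: "hom_on B x" and f: "!!i. i \<in> I ==> f i \<in> B"
 shows "map_poly x (PROD i:I. [:- f i, 1:]) = (PROD i:I. [:- x (f i), 1:])"
proof -
 have "map_poly x (PROD i:I. [:- f i, 1:]) = (PROD i:I. map_poly x [:- f i, 1:])"
  by (rule hom_on_prod[OF sring_poly_over[OF B] hom_on_map_poly[OF B x]]) (use f linear_poly_over[OF B] in blast)
 also have "... = (PROD i:I. [:- x (f i), 1:])" by (rule prod.cong) (use f map_poly_linear[OF B x] in auto)
 finally show ?thesis .
qed

definition sfield :: "'e::field set => bool" where
 "sfield N \<longleftrightarrow> sring N & (ALL z:N. inverse z \<in> N)"

lemma sfield_sring: "sfield N ==> sring N"
 by (simp add: sfield_def)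

lemma hom_on_inj:
 assumes "sfield N" "hom_on N (x :: 'e::field => 'f::field)" "a \<in> N" "b \<in> N" "x a = x b"
 shows "a = b"
proof (rule ccontr)
 assume "a ~= b"
 moreover have "a - b \<in> N" "inverse (a - b) \<in> N" using assms(1,3,4) sring_diff[of N a b] by (auto simp: sfield_def)
 ultimately have "x (a - b) * x (inverse (a - b)) = 1" using hom_on_mult[OF sfield_sring[OF assms(1)] assms(2)] hom_on_1[OF sfield_sring[OF assms(1)] assms(2)]
  by (metis eq_iff_diff_eq_0 right_inverse)
 moreover have "x (a - b) = 0" using hom_on_diff[OF sfield_sring[OF assms(1)] assms(2-4)] assms(5) by simp
 ultimately show False by simp
qed



section \<open>Minimal polynomials, separable elements and primitive elements\<close>

lemma card_simple_roots:
 fixes p :: "'e::alg_closed_field poly"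
 assumes "p ~= 0" "!!z. poly p z = 0 ==> poly (pderiv p) z ~= 0"
 shows "card {z. poly p z = 0} = degree p"
proof -
 obtain A where A: "size A = degree p" "p = smult (lead_coeff p) (\<Prod>x\<in>#A. [:-x, 1:])" using alg_closed_imp_factorization[OF assms(1)] by blast
 have "count A z <= 1" for z
 proof (rule ccontr)
  assume c: "\<not> count A z <= 1"
  then have "z \<in># A" by (metis count_greater_zero_iff le_numeral_extra(1) neq0_conv zero_le_one)
  then obtain A' where A': "A = add_mset z A'" by (metis insert_DiffM)
  then have "z \<in># A'" using c by (metis One_nat_def Suc_le_eq count_add_mset count_eq_zero_iff neq0_conv not_le_imp_less not_less_eq_eq le0)
  then obtain A'' where A'': "A' = add_mset z A''" by (metis insert_DiffM)
  define r where "r = smult (lead_coeff p) (\<Prod>x\<in>#A''. [:-x, 1:])"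
  have pr: "p = [:-z, 1:] * ([:-z, 1:] * r)" using A(2) unfolding A' A'' r_def by (simp add: mult_smult_right)
  have "poly p z = 0" "poly (pderiv p) z = 0" unfolding pr pderiv_mult by auto
  then show False using assms(2) by blast
 qed
 then have "A = mset_set (set_mset A)"
  by (intro multiset_eqI) (metis count_greater_zero_iff count_mset_set' finite_set_mset le_antisym less_one not_gr_zero not_less count_eq_zero_iff linorder_le_less_linear)
 then have "size A = card (set_mset A)" by (metis size_mset_set)
 moreover have "set_mset A = {z. poly p z = 0}"
 proof -
  have "poly p z = lead_coeff p * (\<Prod>x\<in>#A. z - x)" for z by (subst A(2)) (simp add: poly_prod_mset image_mset.compositionality o_def)
  moreover have "lead_coeff p ~= 0" using assms(1) by simp
  ultimately show ?thesis by (auto simp: prod_mset_zero_iff)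
 qed
 ultimately show ?thesis using A(1) by simp
qed

lemma map_poly_pCons_0: "e 0 = 0 ==> map_poly e (pCons a H) = pCons (e a) (map_poly e H)"
 by (rule poly_eqI) (simp add: coeff_map_poly coeff_pCons split: nat.split)

definition evk :: "('f::field => 'e::field) => 'e => 'f poly => 'e" where
 "evk \<nu> x p = poly (map_poly \<nu> p) x"

definition minpoly_of :: "('f::field => 'e::field) => 'e => 'f poly => bool" where
 "minpoly_of \<nu> x m \<longleftrightarrow> lead_coeff m = 1 & (ALL p. evk \<nu> x p = 0 \<longleftrightarrow> m dvd p)"

text \<open>Any polynomial with x as a simple root may serve as witness; the minimal polynomial then
  inherits the simple root.\<close>

definition sepp :: "('f::field => 'e::field) => 'e => bool" where
 "sepp \<nu> x \<longleftrightarrow> (EX h. evk \<nu> x h = 0 & evk \<nu> x (pderiv h) ~= 0)"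

definition adj :: "('f::field => 'e::field) => 'e => 'e set" where
 "adj \<nu> x = range (evk \<nu> x)"

lemma evk_hom: "field_hom \<nu> ==> comm_ring_hom (evk \<nu> x)"
proof -
 assume "field_hom \<nu>"
 then interpret \<nu>: field_hom \<nu> .
 interpret m: map_poly_comm_ring_hom \<nu> ..
 show ?thesis unfolding evk_def by unfold_locales (simp_all add: m.hom_add m.hom_mult)
qed

lemma euclid_ideal:
 fixes P :: "'f::field poly => bool"
 assumes "P a" "a ~= 0" and ideal: "!!a b c. P a ==> P b ==> P (a - c * b)"
 obtains d where "P d" "lead_coeff d = 1" "ALL b. P b --> d dvd b"
proof -
 obtain d where d: "P d" "d ~= 0" "!!b. P b ==> b ~= 0 ==> degree d <= degree b" using ex_has_least_nat[of "%b. P b & b ~= 0" a degree] assms(1,2) by blast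
 have P0: "P 0" using ideal[OF d(1) d(1), of 1] by simp
 have P_mult: "P (c * b)" if "P b" for b c using ideal[OF P0 that, of "- c"] by simp
 have dv: "d dvd b" if "P b" for b
 proof (rule ccontr)
  assume "\<not> d dvd b"
  then have "b mod d ~= 0" by (simp add: dvd_eq_mod_eq_0)
  moreover have "P (b mod d)" using ideal[OF that d(1), of "b div d"] by (simp add: minus_div_mult_eq_mod)
  ultimately show False using d(3)[of "b mod d"] degree_mod_less[OF d(2), of b] by auto
 qed
 show ?thesis
 proof (rule that)
  show "P (smult (inverse (lead_coeff d)) d)" using P_mult[OF d(1), of "[:inverse (lead_coeff d):]"] by simp
  show "lead_coeff (smult (inverse (lead_coeff d)) d) = 1" using d(2) by (simp add: lead_coeff_smult)
  show "ALL b. P b --> smult (inverse (lead_coeff d)) d dvd b" using dv d(2) by (simp add: smult_dvd_iff)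
 qed
qed

context
 fixes \<nu> :: "'f::field => 'e::field"
 assumes \<nu>: "field_hom \<nu>"
begin

interpretation \<nu>: field_hom \<nu> by (rule \<nu>)
interpretation evk: comm_ring_hom "evk \<nu> x" for x by (rule evk_hom[OF \<nu>])

lemma ex_minpoly_of:
 assumes "evk \<nu> x p = 0" "p ~= 0"
 shows "EX m. minpoly_of \<nu> x m"
proof -
 obtain d where "evk \<nu> x d = 0" "lead_coeff d = 1" "ALL b. evk \<nu> x b = 0 --> d dvd b"
  by (rule euclid_ideal[of "%p. evk \<nu> x p = 0"]) (use assms in \<open>auto simp: evk.hom_mult evk.hom_minus\<close>)
 then show ?thesis unfolding minpoly_of_def by (auto simp: evk.hom_mult elim!: dvdE)
qed

lemma minpoly_of_root: "minpoly_of \<nu> x m ==> evk \<nu> x m = 0"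
 by (simp add: minpoly_of_def)

text \<open>The monic generator d of the ideal (p, m) does not vanish at x, so its cofactor in m
  does; by minimality the cofactor has the full degree of m, and d = 1.\<close>

lemma minpoly_of_bezout:
 assumes m: "minpoly_of \<nu> x m" and p: "evk \<nu> x p ~= 0"
 obtains u v where "u * p + v * m = 1"
proof -
 have m0: "m ~= 0" using m by (auto simp: minpoly_of_def)
 define P where "P = (%a. EX u v. a = u * p + v * m)"
 have Pm: "P m" unfolding P_def by (rule exI[of _ 0], rule exI[of _ 1]) simp
 have id: "P (a - c * b)" if ab: "P a" "P b" for a b c
 proof -
  obtain u v u' v' where "a = u * p + v * m" "b = u' * p + v' * m" using ab unfolding P_def by blast
  then have "a - c * b = (u - c * u') * p + (v - c * v') * m" by (simp add: algebra_simps)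
  then show ?thesis unfolding P_def by blast
 qed
 obtain d where d: "P d" "lead_coeff d = 1" "ALL b. P b --> d dvd b" using euclid_ideal[OF Pm m0 id] .
 have "P p" unfolding P_def by (rule exI[of _ 1], rule exI[of _ 0]) simp
 have dx: "evk \<nu> x d ~= 0"
 proof
  assume "evk \<nu> x d = 0"
  then show False using d(3)[rule_format, OF \<open>P p\<close>] p by (auto simp: evk.hom_mult elim!: dvdE)
 qed
 obtain e where e: "m = d * e" using d(3)[rule_format, OF Pm] by (rule dvdE)
 then have "evk \<nu> x e = 0" using minpoly_of_root[OF m] dx by (simp add: evk.hom_mult)
 then have "m dvd e" using m by (simp add: minpoly_of_def)
 then have "degree m <= degree e" using m0 e by (intro dvd_imp_degree_le) auto
 moreover have "degree m = degree d + degree e" using m0 e by (simp add: degree_mult_eq)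
 ultimately have "degree d = 0" by simp
 then obtain c where "d = [:c:]" by (rule degree_eq_zeroE)
 then have "d = 1" using d(2) by (simp add: one_pCons)
 then show ?thesis using d(1) that unfolding P_def by metis
qed

lemma sring_adj: "sring (adj \<nu> x)"
proof (rule sringI)
 show "1 \<in> adj \<nu> x" unfolding adj_def using evk.hom_one[of x] by (intro image_eqI[of _ _ 1]) auto
 fix a b assume "a \<in> adj \<nu> x" "b \<in> adj \<nu> x"
 then obtain p p' where "a = evk \<nu> x p" "b = evk \<nu> x p'" unfolding adj_def by blast
 then have "a - b = evk \<nu> x (p - p')" "a * b = evk \<nu> x (p * p')" by (simp_all add: evk.hom_minus evk.hom_mult)
 then show "a - b \<in> adj \<nu> x" "a * b \<in> adj \<nu> x" unfolding adj_def by auto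
qed

lemma evk_const [simp]: "evk \<nu> x [:c:] = \<nu> c"
 unfolding evk_def by (cases "c = 0") simp_all

lemma evk_X [simp]: "evk \<nu> x [:0, 1:] = x"
 unfolding evk_def by simp

lemma base_adj: "\<nu> c \<in> adj \<nu> x" and self_adj: "x \<in> adj \<nu> x"
 unfolding adj_def by (metis evk_const rangeI) (metis evk_X rangeI)

lemma sfield_adj:
 assumes "minpoly_of \<nu> x m"
 shows "sfield (adj \<nu> x)"
 unfolding sfield_def
proof (intro conjI ballI sring_adj)
 fix z assume "z \<in> adj \<nu> x"
 then obtain p where p: "z = evk \<nu> x p" unfolding adj_def by blast
 show "inverse z \<in> adj \<nu> x"
 proof (cases "z = 0")
  case True
  then show ?thesis using sring_0[OF sring_adj] by simp
 next
  case False
  then obtain u v where "u * p + v * m = 1" using minpoly_of_bezout[OF assms] p by blast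
  then have "evk \<nu> x (u * p + v * m) = 1" by simp
  then have "evk \<nu> x u * z = 1" using minpoly_of_root[OF assms] p by (simp add: evk.hom_add evk.hom_mult)
  then have "inverse z = evk \<nu> x u" by (metis inverse_unique mult.commute)
  then show ?thesis unfolding adj_def by simp
 qed
qed

lemma adj_subset:
 assumes "sring S" "x \<in> S" "!!c. \<nu> c \<in> S"
 shows "adj \<nu> x <= S"
proof -
 have "evk \<nu> x p \<in> S" for p unfolding evk_def using assms by (intro sring_poly) (auto simp: poly_over_def coeff_map_poly)
 then show ?thesis unfolding adj_def by auto
qed

lemma sepp_minpoly:
 assumes "sepp \<nu> x"
 obtains m where "minpoly_of \<nu> x m" "evk \<nu> x (pderiv m) ~= 0" "0 < degree m"
proof -
 obtain h where h: "evk \<nu> x h = 0" "evk \<nu> x (pderiv h) ~= 0" using assms unfolding sepp_def by blast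
 then have "h ~= 0" by auto
 then obtain m where m: "minpoly_of \<nu> x m" using ex_minpoly_of h(1) by blast
 then have "m dvd h" using h(1) unfolding minpoly_of_def by blast
 then obtain e where e: "h = m * e" by (rule dvdE)
 have "evk \<nu> x (pderiv m) ~= 0" using h(2) minpoly_of_root[OF m] unfolding e by (auto simp: pderiv_mult evk.hom_add evk.hom_mult)
 moreover have "0 < degree m"
 proof (rule ccontr)
  assume "\<not> 0 < degree m"
  then have "pderiv m = 0" by (simp add: pderiv_eq_0_iff degree_eq_zeroE) (metis degree_eq_zeroE pderiv_pCons pderiv_0 add_0 pCons_0_0)
  then show False using calculation by simp
 qed
 ultimately show ?thesis using that m by blast
qed

lemma minpoly_simple_roots:
 assumes m: "minpoly_of \<nu> x m" and d: "evk \<nu> x (pderiv m) ~= 0" and z: "evk \<nu> z m = 0"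
 shows "evk \<nu> z (pderiv m) ~= 0"
proof
 assume dz: "evk \<nu> z (pderiv m) = 0"
 obtain u v where "u * pderiv m + v * m = 1" using minpoly_of_bezout[OF m d] .
 then have "evk \<nu> z (u * pderiv m + v * m) = 1" by simp
 then show False using dz z by (simp add: evk.hom_add evk.hom_mult)
qed

end

lemma card_roots_minpoly:
 fixes \<nu> :: "'f::field => 'e::alg_closed_field"
 assumes \<nu>: "field_hom \<nu>" and m: "minpoly_of \<nu> x m" and d: "evk \<nu> x (pderiv m) ~= 0"
 shows "card {z. evk \<nu> z m = 0} = degree m"
proof -
 interpret \<nu>: field_hom \<nu> by fact
 have "m ~= 0" using m by (auto simp: minpoly_of_def)
 then have "card {z. poly (map_poly \<nu> m) z = 0} = degree (map_poly \<nu> m)" using minpoly_simple_roots[OF \<nu> m d]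
  by (intro card_simple_roots) (auto simp: evk_def map_poly_pderiv[OF \<nu>.comm_ring_hom_axioms])
 then show ?thesis unfolding evk_def by simp
qed

text \<open>The chain rule: for H(Y, s) with s the inner variable, these are the terms of order 0
  and 1 in s of H(g + b s, s).\<close>

lemma coeff_poly_linear:
 fixes \<nu> :: "'f::field => 'e::field" and H :: "'f poly poly"
 assumes "field_hom \<nu>"
 shows "coeff (poly (map_poly (map_poly \<nu>) H) [:g, b:]) 0 = evk \<nu> g (map_poly (%a. coeff a 0) H)"
  "coeff (poly (map_poly (map_poly \<nu>) H) [:g, b:]) 1
   = evk \<nu> g (map_poly (%a. coeff a 1) H) + b * evk \<nu> g (pderiv (map_poly (%a. coeff a 0) H))"
proof -
 interpret \<nu>: field_hom \<nu> by fact
 note pp = map_poly_pCons_0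
 have pd: "poly (map_poly \<nu> (pderiv (pCons c q))) g = poly (map_poly \<nu> q) g + g * poly (map_poly \<nu> (pderiv q)) g" for c q
 proof -
  have "evk \<nu> g (q + pCons 0 (pderiv q)) = evk \<nu> g q + evk \<nu> g (pCons 0 (pderiv q))"
  proof -
   interpret comm_ring_hom "evk \<nu> g" by (rule evk_hom[OF assms])
   show ?thesis by (rule hom_add)
  qed
  then show ?thesis by (simp add: evk_def pderiv_pCons pp)
 qed
 have 0: "coeff (poly (map_poly (map_poly \<nu>) H) [:g, b:]) 0 = evk \<nu> g (map_poly (%a. coeff a 0) H)" for H
  unfolding evk_def by (induction H) (simp_all add: pp coeff_map_poly)
 show "coeff (poly (map_poly (map_poly \<nu>) H) [:g, b:]) 0 = evk \<nu> g (map_poly (%a. coeff a 0) H)" by (rule 0)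
 show "coeff (poly (map_poly (map_poly \<nu>) H) [:g, b:]) 1
   = evk \<nu> g (map_poly (%a. coeff a 1) H) + b * evk \<nu> g (pderiv (map_poly (%a. coeff a 0) H))"
  unfolding evk_def One_nat_def
 proof (induction H)
  case (pCons a H)
  then show ?case using 0[of H] by (simp add: pp pd coeff_map_poly evk_def algebra_simps)
 qed simp
qed

text \<open>The constant c is deformed to c + s with a new variable s. The norm H(Y, s) of f(Y - (c
  + s) Z) modulo g(Z) vanishes identically at Y = a + (c + s) b = y + b s. Its coefficient of s
  reads w(y) + b h'(y) = 0, where h is H at s = 0, so b lies in F(y) as soon as h'(y) is
  nonzero.\<close>

lemma primitive_element_2:
 fixes \<nu> :: "'f::field => 'e::alg_closed_field"
 assumes \<nu>: "field_hom \<nu>" and inf: "infinite (UNIV :: 'f set)" and a: "sepp \<nu> a" and b: "sepp \<nu> b"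
 obtains c where "sepp \<nu> (a + \<nu> c * b)" "a \<in> adj \<nu> (a + \<nu> c * b)" "b \<in> adj \<nu> (a + \<nu> c * b)"
proof -
 interpret \<nu>: field_hom \<nu> by fact
 interpret m\<nu>: map_poly_comm_ring_hom \<nu> ..
 obtain f where f: "minpoly_of \<nu> a f" "evk \<nu> a (pderiv f) ~= 0" "0 < degree f" by (rule sepp_minpoly[OF \<nu> a])
 obtain g where g: "minpoly_of \<nu> b g" "evk \<nu> b (pderiv g) ~= 0" "0 < degree g" by (rule sepp_minpoly[OF \<nu> b])
 have lg: "lead_coeff g = 1" using g(1) by (simp add: minpoly_of_def)
 have f0: "map_poly \<nu> f ~= 0" using f(3) by auto
 have g0: "map_poly \<nu> g ~= 0" using g(3) by auto
 define Rf where "Rf = {z. evk \<nu> z f = 0}"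
 define Rg where "Rg = {z. evk \<nu> z g = 0}"
 have fin: "finite Rf" "finite Rg" unfolding Rf_def Rg_def evk_def using poly_roots_finite[OF f0] poly_roots_finite[OF g0] by auto
 \<comment> \<open>Excluded are the finitely many c for which a + c b - c z is a root of f for a
   root z of g other than b; z = b contributes only the value 0, through division by zero.\<close>
 have "finite (\<nu> -` (\<Union>z\<in>Rg. (%y. (y - a) / (b - z)) ` Rf))" by (rule finite_vimageI) (use fin \<nu>.injectivity in \<open>auto intro: injI\<close>)
 then obtain c where c: "c \<notin> \<nu> -` (\<Union>z\<in>Rg. (%y. (y - a) / (b - z)) ` Rf)" using inf ex_new_if_finite by blast
 define y where "y = a + \<nu> c * b"
 have sep: "evk \<nu> (y - \<nu> c * z) f ~= 0" if "z \<in> Rg" "z ~= b" for z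
 proof
  assume "evk \<nu> (y - \<nu> c * z) f = 0"
  then have "y - \<nu> c * z \<in> Rf" by (simp add: Rf_def)
  moreover have "\<nu> c = ((y - \<nu> c * z) - a) / (b - z)" using that(2) by (simp add: y_def field_simps)
  ultimately show False using c that(1) by blast
 qed
 have bg: "b \<in> Rg" using minpoly_of_root[OF \<nu> g(1)] by (simp add: Rg_def)

 \<comment> \<open>Three nested variables: Z outermost, then Y, then s. Here G is g(Z) and P is f(Y
   - (c + s) Z).\<close>
 define G :: "'f poly poly poly" where "G = map_poly (%c. [:[:c:]:]) g"
 define P :: "'f poly poly poly" where "P = pcompose (map_poly (%c. [:[:c:]:]) f) [:[:0, 1:], - [:[:c, 1:]:]:]"
 have cc: "[:[:d:]:] = (0 :: 'f poly poly) \<longleftrightarrow> d = 0" for d by simp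
 have dG: "degree G = degree g" unfolding G_def by (rule degree_map_poly) simp
 have lG: "lead_coeff G = 1" unfolding dG unfolding G_def using lg by (simp add: coeff_map_poly one_pCons)
 obtain Q R where QR: "P = Q * G + R" "deg_less (degree G) R" using poly_div_monic[OF lG] g(3) dG by metis
 define H where "H = poly_norm G R"

 have ev_G: "map_poly e G = map_poly (%c. e [:[:c:]:]) g" if "comm_ring_hom e" for e :: "'f poly poly => 'e poly"
 proof -
  interpret comm_ring_hom e by fact
  show ?thesis unfolding G_def by (simp add: map_poly_map_poly o_def)
 qed
 have ev_P: "poly (map_poly e P) x = poly (map_poly (%c. e [:[:c:]:]) f) (e [:0, 1:] - e [:[:c, 1:]:] * x)"
  if "comm_ring_hom e" for e :: "'f poly poly => 'e poly" and x
 proof -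
  interpret e: comm_ring_hom e by fact
  interpret me: map_poly_comm_ring_hom e ..
  have pc: "map_poly e (pcompose A B) = pcompose (map_poly e A) (map_poly e B)" for A B by (induction A) (simp_all add: pcompose_pCons me.hom_add me.hom_mult map_poly_pCons_0)
  have pl: "map_poly e [:A, B:] = [:e A, e B:]" for A B by (rule poly_eqI) (simp add: coeff_map_poly coeff_pCons split: nat.split)
  have "map_poly e (map_poly (%c. [:[:c:]:]) f) = map_poly (%c. e [:[:c:]:]) f" by (simp add: map_poly_map_poly o_def)
  moreover have "poly [:u, - v:] x = u - v * x" for u v :: "'e poly" by (simp add: mult.commute)
  ultimately show ?thesis unfolding P_def by (simp only: pc pl e.hom_uminus poly_pcompose)
 qed
 have const_poly: "poly (map_poly (%c. [:\<nu> c:]) p) [:z:] = [:evk \<nu> z p:]" for p z unfolding evk_def by (induction p) (simp_all add: map_poly_pCons)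

 \<comment> \<open>\<open>e1\<close> specialises Y to y + b s and keeps s; \<open>e0\<close> sets s
   to 0 and keeps Y.\<close>
 define e1 where "e1 = (%p. poly (map_poly (map_poly \<nu>) p) [:y, b:])"
 have e1: "comm_ring_hom e1"
 proof -
  interpret mm: map_poly_comm_ring_hom "map_poly \<nu>" ..
  show ?thesis unfolding e1_def by unfold_locales (simp_all add: mm.hom_add mm.hom_mult)
 qed
 define e0 where "e0 = map_poly (%a. \<nu> (coeff a 0))"
 have e0h: "comm_ring_hom (%a. \<nu> (coeff a 0))" by unfold_locales (simp_all add: \<nu>.hom_add \<nu>.hom_mult coeff_mult_0)
 have e0: "comm_ring_hom e0"
 proof -
  interpret comm_ring_hom "%a. \<nu> (coeff a 0)" by (rule e0h)
  interpret mm: map_poly_comm_ring_hom "%a. \<nu> (coeff a 0)" ..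
  show ?thesis unfolding e0_def by unfold_locales (simp_all add: mm.hom_add mm.hom_mult)
 qed
 have e1c: "e1 [:[:d:]:] = [:\<nu> d:]" and e0c: "e0 [:[:d:]:] = [:\<nu> d:]" for d unfolding e1_def e0_def by (simp_all add: map_poly_pCons_0)
 have e1X: "e1 [:0, 1:] = [:y, b:]" "e1 [:[:c, 1:]:] = [:\<nu> c, 1:]"
  and e0X: "e0 [:0, 1:] = [:0, 1:]" "e0 [:[:c, 1:]:] = [:\<nu> c:]"
  unfolding e1_def e0_def by (simp_all add: map_poly_pCons)

 have H1: "e1 H = 0" unfolding H_def
 proof (rule poly_norm_root_eq_0[OF e1 lG _ QR(2)])
  interpret e1: comm_ring_hom e1 by (rule e1)
  interpret me1: map_poly_comm_ring_hom e1 ..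
  show "0 < degree G" using dG g(3) by simp
  show G0: "poly (map_poly e1 G) [:b:] = 0" unfolding ev_G[OF e1] e1c const_poly using minpoly_of_root[OF \<nu> g(1)] by simp
  have "poly (map_poly e1 P) [:b:] = poly (map_poly (%c. [:\<nu> c:]) f) [:a:]" unfolding ev_P[OF e1] e1c e1X by (simp add: y_def)
  also have "... = 0" unfolding const_poly using minpoly_of_root[OF \<nu> f(1)] by simp
  finally show "poly (map_poly e1 R) [:b:] = 0" unfolding QR(1) using G0 by (simp add: me1.hom_add me1.hom_mult)
 qed
 define h where "h = map_poly (%a. coeff a 0) H"
 define w where "w = map_poly (%a. coeff a 1) H"
 have lin: "evk \<nu> y h = 0" "evk \<nu> y w + b * evk \<nu> y (pderiv h) = 0" using coeff_poly_linear[OF \<nu>, of H y b] H1 unfolding e1_def h_def w_def by simp_all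

 have hp: "map_poly \<nu> h = (PROD z:Rg. pcompose (map_poly \<nu> f) [:- (\<nu> c * z), 1:])"
 proof -
  interpret e0: comm_ring_hom e0 by (rule e0)
  interpret me0: map_poly_comm_ring_hom e0 ..
  have cR: "card Rg = degree G" unfolding Rg_def dG by (rule card_roots_minpoly[OF \<nu> g(1,2)])
  obtain \<beta> where \<beta>: "bij_betw \<beta> {..<degree G} Rg" using ex_bij_betw_nat_finite[OF fin(2)] unfolding cR by (auto simp: atLeast0LessThan)
  have rt: "\<beta> i \<in> Rg" if "i < degree G" for i using bij_betwE[OF \<beta>] that by simp
  have G0: "poly (map_poly e0 G) [:\<beta> i:] = 0" if "i < degree G" for i unfolding ev_G[OF e0] e0c const_poly using rt[OF that] by (simp add: Rg_def)
  have "e0 H = (\<Prod>i<degree G. poly (map_poly e0 R) [:\<beta> i:])" unfolding H_def by (rule poly_norm_prod[OF e0 lG _ QR(2)])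
    (use dG g(3) G0 bij_betw_imp_inj_on[OF \<beta>] in \<open>auto simp: inj_on_def\<close>)
  also have "... = (\<Prod>i<degree G. pcompose (map_poly \<nu> f) [:- (\<nu> c * \<beta> i), 1:])"
  proof (rule prod.cong[OF refl])
   fix i assume "i \<in> {..<degree G}"
   then have "poly (map_poly e0 P) [:\<beta> i:] = poly (map_poly e0 R) [:\<beta> i:]" unfolding QR(1) using G0[of i] by (simp add: me0.hom_add me0.hom_mult)
   moreover have "poly (map_poly e0 P) [:\<beta> i:] = poly (map_poly (%c. [:\<nu> c:]) f) [:- (\<nu> c * \<beta> i), 1:]"
    unfolding ev_P[OF e0] e0c e0X by (simp add: mult.commute)
   moreover have "... = pcompose (map_poly \<nu> f) [:- (\<nu> c * \<beta> i), 1:]" by (simp add: pcompose_altdef map_poly_map_poly o_def)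
   ultimately show "poly (map_poly e0 R) [:\<beta> i:] = pcompose (map_poly \<nu> f) [:- (\<nu> c * \<beta> i), 1:]" by simp
  qed
  also have "... = (PROD z:Rg. pcompose (map_poly \<nu> f) [:- (\<nu> c * z), 1:])" by (rule prod.reindex_bij_betw[OF \<beta>])
  moreover have "e0 H = map_poly \<nu> h" unfolding e0_def h_def by (simp add: map_poly_map_poly o_def)
  ultimately show ?thesis by simp
 qed
 \<comment> \<open>Among the factors f(Y - c z) of h only the one for z = b vanishes at y, by the
   choice of c, and it does so simply because a is a simple root of f.\<close>
 have hd: "evk \<nu> y (pderiv h) ~= 0"
 proof -
  define F where "F = (%z. pcompose (map_poly \<nu> f) [:- (\<nu> c * z), 1:])"
  have "map_poly \<nu> h = F b * (PROD z:Rg - {b}. F z)" unfolding hp F_def using fin bg by (subst prod.remove) auto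
  then have "poly (pderiv (map_poly \<nu> h)) y = poly (F b) y * poly (pderiv (PROD z:Rg - {b}. F z)) y + poly (PROD z:Rg - {b}. F z) y * poly (pderiv (F b)) y"
   by (simp add: pderiv_mult)
  moreover have "poly (F b) y = 0" using minpoly_of_root[OF \<nu> f(1)] by (simp add: F_def poly_pcompose y_def evk_def)
  moreover have "poly (pderiv (F b)) y ~= 0"
   using f(2) by (simp add: F_def pderiv_pcompose poly_pcompose y_def evk_def map_poly_pderiv[OF \<nu>.comm_ring_hom_axioms] pderiv_pCons)
  moreover have "poly (PROD z:Rg - {b}. F z) y ~= 0" using sep fin by (simp add: poly_prod F_def poly_pcompose evk_def)
  ultimately show ?thesis by (simp add: evk_def map_poly_pderiv[OF \<nu>.comm_ring_hom_axioms])
 qed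
 have sy: "sepp \<nu> y" unfolding sepp_def using lin(1) hd by blast
 then obtain my where my: "minpoly_of \<nu> y my" using sepp_minpoly[OF \<nu>] by blast
 note A = sfield_adj[OF \<nu> my] and S = sring_adj[OF \<nu>, of y]
 have "b = - evk \<nu> y w * inverse (evk \<nu> y (pderiv h))" using lin(2) hd by (simp add: field_simps add_eq_0_iff)
 moreover have "evk \<nu> y w \<in> adj \<nu> y" "evk \<nu> y (pderiv h) \<in> adj \<nu> y" by (auto simp: adj_def)
 ultimately have by': "b \<in> adj \<nu> y" using A S by (simp add: sring_mult sring_uminus sfield_def)
 have "a = y - \<nu> c * b" by (simp add: y_def)
 then have "a \<in> adj \<nu> y" using by' S base_adj[OF \<nu>] self_adj[OF \<nu>] by (metis sring_diff sring_mult)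
 then show ?thesis using that[of c] sy by' unfolding y_def by blast
qed


section \<open>Galois groups\<close>

lemma adj_mono:
 assumes "field_hom \<nu>" "x \<in> adj \<nu> y"
 shows "adj \<nu> x <= adj \<nu> y"
 using assms adj_subset[OF assms(1) sring_adj[OF assms(1)]] base_adj[OF assms(1)] by blast

text \<open>S records a property that survives the steps x + c y, so that the generator can be kept
  inside a prescribed subring.\<close>

lemma primitive_element_finite:
 fixes \<nu> :: "'f::field => 'e::alg_closed_field"
 assumes \<nu>: "field_hom \<nu>" and inf: "infinite (UNIV :: 'f set)" and "finite B" "!!b. b \<in> B ==> sepp \<nu> b"
  and S: "0 \<in> S" "!!x y c. x \<in> S ==> y \<in> B ==> x + \<nu> c * y \<in> S"
 shows "\<exists>\<eta>\<in>S. sepp \<nu> \<eta> & B <= adj \<nu> \<eta>"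
proof -
 have "\<exists>\<eta>\<in>S. sepp \<nu> \<eta> & C <= adj \<nu> \<eta>" if "C <= B" for C using finite_subset[OF that assms(3)] that
 proof (induction C rule: finite_induct)
  case empty
  interpret \<nu>: field_hom \<nu> by fact
  have "sepp \<nu> 0" unfolding sepp_def by (rule exI[of _ "[:0, 1:]"]) (simp add: evk_def pderiv_pCons)
  then show ?case using S(1) by blast
 next
  case (insert b C)
  then obtain \<eta> where g: "\<eta> \<in> S" "sepp \<nu> \<eta>" "C <= adj \<nu> \<eta>" by auto
  have b: "sepp \<nu> b" "b \<in> B" using insert assms(4) by auto
  obtain c where c: "sepp \<nu> (\<eta> + \<nu> c * b)" "\<eta> \<in> adj \<nu> (\<eta> + \<nu> c * b)" "b \<in> adj \<nu> (\<eta> + \<nu> c * b)"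
   using primitive_element_2[OF \<nu> inf g(2) b(1)] .
  then show ?case using S(2)[OF g(1) b(2), of c] g(3) adj_mono[OF \<nu> c(2)] by (intro bexI[of _ "\<eta> + \<nu> c * b"]) auto
 qed
 then show ?thesis by blast
qed

lemma ex_embedding:
 fixes \<nu> :: "'f::field => 'e::field" and \<nu>' :: "'f => 'd::field"
 assumes \<nu>: "field_hom \<nu>" "field_hom \<nu>'" and m: "minpoly_of \<nu> x m" and r: "evk \<nu>' r m = 0"
 obtains \<mu> where "hom_on (adj \<nu> x) \<mu>" "!!p. \<mu> (evk \<nu> x p) = evk \<nu>' r p"
proof -
 interpret e: comm_ring_hom "evk \<nu> x" by (rule evk_hom[OF \<nu>(1)])
 interpret e': comm_ring_hom "evk \<nu>' r" by (rule evk_hom[OF \<nu>(2)])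
 define \<mu> where "\<mu> = (%z. evk \<nu>' r (SOME p. z = evk \<nu> x p))"
 have \<mu>: "\<mu> (evk \<nu> x p) = evk \<nu>' r p" for p
 proof -
  define p' where "p' = (SOME p'. evk \<nu> x p = evk \<nu> x p')"
  have "evk \<nu> x p = evk \<nu> x p'" unfolding p'_def by (rule someI[of _ p]) simp
  then have "evk \<nu> x (p' - p) = 0" by (simp add: e.hom_minus)
  then have "m dvd p' - p" using m by (simp add: minpoly_of_def)
  then obtain u where "p' - p = m * u" by (rule dvdE)
  then have "evk \<nu>' r (p' - p) = 0" using r by (simp add: e'.hom_mult)
  then show ?thesis unfolding \<mu>_def p'_def[symmetric] by (simp add: e'.hom_minus)
 qed
 have "hom_on (adj \<nu> x) \<mu>" unfolding hom_on_def
 proof (intro conjI ballI)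
  show "\<mu> 1 = 1" using \<mu>[of 1] by simp
  fix a b assume "a \<in> adj \<nu> x" "b \<in> adj \<nu> x"
  then obtain p p' where ab: "a = evk \<nu> x p" "b = evk \<nu> x p'" unfolding adj_def by blast
  show "\<mu> (a + b) = \<mu> a + \<mu> b" using \<mu>[of "p + p'"] \<mu>[of p] \<mu>[of p'] by (simp add: ab e.hom_add e'.hom_add)
  show "\<mu> (a * b) = \<mu> a * \<mu> b" using \<mu>[of "p * p'"] \<mu>[of p] \<mu>[of p'] by (simp add: ab e.hom_mult e'.hom_mult)
 qed
 then show ?thesis using \<mu> by (rule that)
qed

lemma hom_on_evk:
 assumes "field_hom \<nu>" "sring N" "range \<nu> <= N" "hom_on N \<mu>" "!!c. \<mu> (\<nu> c) = \<nu>' c" "x \<in> N"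
 shows "\<mu> (evk \<nu> x p) = evk \<nu>' (\<mu> x) p"
proof -
 interpret \<nu>: field_hom \<nu> by fact
 have "map_poly \<mu> (map_poly \<nu> p) = map_poly \<nu>' p"
 proof (rule poly_eqI)
  fix i
  have "\<nu>' 0 = 0" using assms(5)[of 0] hom_on_0[OF assms(2,4)] by simp
  then show "coeff (map_poly \<mu> (map_poly \<nu> p)) i = coeff (map_poly \<nu>' p) i" using assms(5) by (simp add: coeff_map_poly_hom_on[OF assms(2,4)] coeff_map_poly)
 qed
 moreover have "map_poly \<nu> p \<in> poly_over N" using assms(3) by (auto simp: poly_over_def)
 ultimately show ?thesis unfolding evk_def using hom_on_poly[OF assms(2,4) _ assms(6)] by simp
qed

text \<open>Automorphisms are the identity off N, so that equality, composition and inverses are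
  those of plain functions.\<close>

definition gal :: "('f::field => 'e::field) => 'e set => ('e => 'e) set" where
 "gal \<nu> N = {\<mu>. hom_on N \<mu> & \<mu> ` N <= N & (ALL z. z \<notin> N --> \<mu> z = z) & (ALL c. \<mu> (\<nu> c) = \<nu> c)}"

text \<open>Write a fixed z as h(\<theta>) with h of degree below that of m. Every root of m is the
  image of \<theta> under some automorphism, so h - z vanishes at all the roots of m, has too many
  roots, and is zero; hence z is the constant coefficient of h.\<close>

lemma fixed_field:
 fixes \<nu> :: "'f::field => 'e::alg_closed_field"
 assumes \<nu>: "field_hom \<nu>" and m: "minpoly_of \<nu> \<theta> m" "evk \<nu> \<theta> (pderiv m) ~= 0" "0 < degree m"
  and N_def: "N = adj \<nu> \<theta>" and roots: "!!r. evk \<nu> r m = 0 ==> r \<in> N"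
 shows "finite (gal \<nu> N)" "z \<in> N ==> (!!\<mu>. \<mu> \<in> gal \<nu> N ==> \<mu> z = z) ==> z \<in> range \<nu>"
proof -
 interpret \<nu>: field_hom \<nu> by fact
 have N: "sfield N" "range \<nu> <= N" "\<theta> \<in> N" unfolding N_def using sfield_adj[OF \<nu> m(1)] base_adj[OF \<nu>] self_adj[OF \<nu>] by auto
 note sN = sfield_sring[OF N(1)]
 have lift_root: "\<exists>\<mu>\<in>gal \<nu> N. \<mu> \<theta> = r" if r: "evk \<nu> r m = 0" for r
 proof -
  obtain \<mu> where s: "hom_on N \<mu>" "!!p. \<mu> (evk \<nu> \<theta> p) = evk \<nu> r p" unfolding N_def using ex_embedding[OF \<nu> \<nu> m(1) r] by blast
  have sk: "\<mu> (\<nu> c) = \<nu> c" for c using s(2)[of "[:c:]"] by (simp add: evk_const[OF \<nu>])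
  have img: "\<mu> z \<in> N" if z: "z \<in> N" for z
  proof -
   obtain p where "z = evk \<nu> \<theta> p" using z unfolding N_def adj_def by blast
   then have "\<mu> z \<in> adj \<nu> r" using s(2) by (auto simp: adj_def)
   then show ?thesis using adj_mono[OF \<nu>, of r \<theta>] roots[OF r] unfolding N_def by blast
  qed
  define \<tau> where "\<tau> = (%z. if z \<in> N then \<mu> z else z)"
  have "hom_on N \<tau>" unfolding hom_on_def \<tau>_def using s(1) sring_1[OF sN] sring_add[OF sN] sring_mult[OF sN] by (auto simp: hom_on_def)
  then have "\<tau> \<in> gal \<nu> N" unfolding gal_def using img sk N(2) by (auto simp: \<tau>_def)
  moreover have "\<tau> \<theta> = r" using s(2)[of "[:0, 1:]"] N(3) by (simp add: \<tau>_def evk_X[OF \<nu>])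
  ultimately show ?thesis by blast
 qed
 have det: "\<mu> z = evk \<nu> (\<mu> \<theta>) p" if "\<mu> \<in> gal \<nu> N" "z = evk \<nu> \<theta> p" for \<mu> z p
  using hom_on_evk[OF \<nu> sN N(2), of \<mu> \<nu> \<theta> p] that N(3) by (auto simp: gal_def)
 have m0: "map_poly \<nu> m ~= 0" using m(3) by auto
 have "(%\<mu>. \<mu> \<theta>) ` gal \<nu> N <= {z. evk \<nu> z m = 0}" using det[of _ 0 m] minpoly_of_root[OF \<nu> m(1)] hom_on_0[OF sN] by (auto simp: gal_def)
 then have "finite ((%\<mu>. \<mu> \<theta>) ` gal \<nu> N)" by (rule finite_subset) (use poly_roots_finite[OF m0] in \<open>simp add: evk_def\<close>)
 moreover have "inj_on (%\<mu>. \<mu> \<theta>) (gal \<nu> N)"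
 proof (intro inj_onI ext)
  fix \<mu> \<tau> z assume st: "\<mu> \<in> gal \<nu> N" "\<tau> \<in> gal \<nu> N" "\<mu> \<theta> = \<tau> \<theta>"
  show "\<mu> z = \<tau> z"
  proof (cases "z \<in> N")
   case True
   then obtain p where "z = evk \<nu> \<theta> p" unfolding N_def adj_def by blast
   then show ?thesis using det st by metis
  qed (use st in \<open>auto simp: gal_def\<close>)
 qed
 ultimately show "finite (gal \<nu> N)" by (rule finite_imageD)
 assume z: "z \<in> N" "!!\<mu>. \<mu> \<in> gal \<nu> N ==> \<mu> z = z"
 obtain p where p: "z = evk \<nu> \<theta> p" using z(1) unfolding N_def adj_def by blast
 interpret e: comm_ring_hom "evk \<nu> \<theta>" by (rule evk_hom[OF \<nu>])
 define h where "h = p mod m"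
 have "p = p div m * m + h" by (simp add: h_def)
 then have zh: "z = evk \<nu> \<theta> h" using p minpoly_of_root[OF \<nu> m(1)] by (metis add_0 e.hom_add e.hom_mult mult_zero_right)
 have dh: "degree h < degree m" proof -
  have "m ~= 0" using m(3) by auto
  then show ?thesis using m(3) degree_mod_less[of m p] by (cases "p mod m = 0") (auto simp: h_def)
 qed
 define Q where "Q = map_poly \<nu> h - [:z:]"
 have "Q = 0"
 proof (rule ccontr)
  assume Q: "Q ~= 0"
  have sub: "{r. evk \<nu> r m = 0} <= {r. poly Q r = 0}"
  proof
   fix r assume "r \<in> {r. evk \<nu> r m = 0}"
   then obtain \<mu> where s: "\<mu> \<in> gal \<nu> N" "\<mu> \<theta> = r" using lift_root by blast
   have "evk \<nu> r h = z" using det[OF s(1) zh] z(2)[OF s(1)] s(2) by simp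
   then show "r \<in> {r. poly Q r = 0}" unfolding Q_def evk_def by simp
  qed
  have "degree m <= degree Q" using card_mono[OF poly_roots_finite[OF Q] sub] card_poly_roots_bound[OF Q] card_roots_minpoly[OF \<nu> m(1,2)] by simp
  moreover have "degree Q <= degree h" unfolding Q_def by (intro degree_diff_le) auto
  ultimately show False using dh by simp
 qed
 then have "coeff (map_poly \<nu> h) 0 = z" unfolding Q_def by simp
 then show "z \<in> range \<nu>" by (simp add: coeff_map_poly) (metis rangeI)
qed

text \<open>The last clause of \<open>generator\<close> is normality: every conjugate of \<theta>
  over the base lies in N.\<close>

locale galois =
 fixes \<nu> :: "'f::field => 'e::field" and N :: "'e set"
 assumes \<nu>: "field_hom \<nu>" and N: "sfield N" and base_N: "range \<nu> <= N"
  and fin_G: "finite (gal \<nu> N)"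
  and fixed: "!!z. z \<in> N ==> (!!\<mu>. \<mu> \<in> gal \<nu> N ==> \<mu> z = z) ==> z \<in> range \<nu>"
  and generator: "\<exists>\<theta>. sepp \<nu> \<theta> & N = adj \<nu> \<theta> & (ALL z. (ALL p. evk \<nu> \<theta> p = 0 --> evk \<nu> z p = 0) --> z \<in> N)"
begin

abbreviation "G \<equiv> gal \<nu> N"

lemmas sN = sfield_sring[OF N]

lemma G_hom: "\<mu> \<in> G ==> hom_on N \<mu>" and G_N: "\<mu> \<in> G ==> z \<in> N ==> \<mu> z \<in> N"
 and G_off: "\<mu> \<in> G ==> z \<notin> N ==> \<mu> z = z" and G_base: "\<mu> \<in> G ==> \<mu> (\<nu> c) = \<nu> c"
 unfolding gal_def by auto

lemma G_inj: "\<mu> \<in> G ==> inj \<mu>"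
proof (rule injI)
 fix a b assume s: "\<mu> \<in> G" "\<mu> a = \<mu> b"
 then show "a = b" using hom_on_inj[OF N G_hom, of \<mu> a b] G_N[of \<mu>] G_off[of \<mu>] by (cases "a \<in> N"; cases "b \<in> N") auto
qed

lemma G_id: "id \<in> G"
 unfolding gal_def hom_on_def by auto

lemma G_comp: "\<mu> \<in> G ==> \<tau> \<in> G ==> \<mu> o \<tau> \<in> G"
 unfolding gal_def by (auto intro!: hom_on_comp)

lemma G_inverse:
 assumes "\<mu> \<in> G"
 obtains \<tau> where "\<tau> \<in> G" "\<mu> o \<tau> = id" "\<tau> o \<mu> = id"
proof -
 have "(%\<tau>. \<mu> o \<tau>) ` G = G" using G_comp[OF assms] fun.inj_map[OF G_inj[OF assms]] by (intro endo_inj_surj fin_G) (auto intro: inj_on_subset)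
 then obtain \<tau> where t: "\<tau> \<in> G" "\<mu> o \<tau> = id" using G_id by (metis imageE)
 have "\<tau> o \<mu> = id"
 proof
  fix x
  have "\<mu> (\<tau> (\<mu> x)) = \<mu> x" using fun_cong[OF t(2), of "\<mu> x"] by simp
  then show "(\<tau> o \<mu>) x = id x" using injD[OF G_inj[OF assms]] by simp
 qed
 then show ?thesis using t that by blast
qed

lemma card_G_pos: "0 < card G"
 using fin_G G_id card_gt_0_iff by blast

lemma fixed_poly:
 assumes "P \<in> poly_over N" "!!\<mu>. \<mu> \<in> G ==> map_poly \<mu> P = P"
 obtains p where "P = map_poly \<nu> p"
proof
 interpret \<nu>: field_hom \<nu> by (rule \<nu>)
 show "P = map_poly \<nu> (map_poly (the_inv \<nu>) P)"
 proof (rule poly_eqI)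
  fix i
  have "\<mu> (coeff P i) = coeff P i" if "\<mu> \<in> G" for \<mu>
   using arg_cong[OF assms(2)[OF that], of "%p. coeff p i"] coeff_map_poly_hom_on[OF sN G_hom[OF that]] by simp
  then have "coeff P i \<in> range \<nu>" using fixed poly_overD[OF assms(1)] by blast
  then show "coeff P i = coeff (map_poly \<nu> (map_poly (the_inv \<nu>) P)) i"
  proof -
   have inj: "inj \<nu>" using \<nu>.injectivity by (auto intro: injI)
   have "the_inv \<nu> 0 = 0" using the_inv_f_f[OF inj, of 0] by simp
   then show ?thesis using \<open>coeff P i \<in> range \<nu>\<close> f_the_inv_into_f[OF inj] by (simp add: coeff_map_poly)
  qed
 qed
qed

definition conj :: "'e => 'e set" where
 "conj w = (%\<mu>. \<mu> w) ` G"

lemma conj_finite: "finite (conj w)" and conj_self: "w \<in> conj w"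
 and conj_N: "w \<in> N ==> conj w <= N"
 unfolding conj_def using fin_G G_id G_N by (auto intro: image_eqI[of _ _ id])

lemma conj_step: "\<mu> \<in> G ==> v \<in> conj w ==> \<mu> v \<in> conj w"
 unfolding conj_def using G_comp by (auto intro!: image_eqI[of _ _ "\<mu> o _"])

lemma conj_perm:
 assumes "\<mu> \<in> G"
 shows "bij_betw \<mu> (conj w) (conj w)"
proof -
 have "\<mu> ` conj w <= conj w" using conj_step[OF assms] by auto
 then show ?thesis using G_inj[OF assms] conj_finite by (metis bij_betw_def endo_inj_surj inj_on_subset subset_UNIV)
qed

lemma conj_eqI:
 assumes "v \<in> conj w"
 shows "conj v = conj w"
proof -
 obtain \<mu> where s: "\<mu> \<in> G" "v = \<mu> w" using assms unfolding conj_def by blast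
 obtain \<tau> where t: "\<tau> \<in> G" "\<tau> o \<mu> = id" using G_inverse[OF s(1)] .
 have w: "w = \<tau> v" using fun_cong[OF t(2), of w] s(2) by simp
 have "conj (\<mu> u) <= conj u" if "\<mu> \<in> G" for \<mu> u unfolding conj_def[of "\<mu> u"] using conj_step[OF _ conj_step[OF that conj_self]] by auto
 then have "conj v <= conj w" "conj w <= conj v" using s t w by metis+
 then show ?thesis by simp
qed

definition conj_poly :: "'e => 'e poly" where
 "conj_poly w = (PROD v:conj w. [:- v, 1:])"

lemma map_conj_poly:
 assumes "w \<in> N" "\<mu> \<in> G"
 shows "map_poly \<mu> (conj_poly w) = conj_poly w"
proof -
 have "map_poly \<mu> (conj_poly w) = (PROD v:conj w. [:- \<mu> v, 1:])" unfolding conj_poly_def using conj_N[OF assms(1)]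
  by (intro map_poly_prod_linear[OF sN G_hom[OF assms(2)]]) auto
 also have "... = conj_poly w" unfolding conj_poly_def by (rule prod.reindex_bij_betw[OF conj_perm[OF assms(2)]])
 finally show ?thesis .
qed

lemma conj_poly_over: "w \<in> N ==> conj_poly w \<in> poly_over N"
 unfolding conj_poly_def by (intro sring_prod[OF sring_poly_over[OF sN]] linear_poly_over[OF sN]) (use conj_N in auto)

lemma poly_conj_poly: "poly (conj_poly w) z = 0 \<longleftrightarrow> z \<in> conj w"
 unfolding conj_poly_def using conj_finite[of w] by (auto simp: poly_prod)

end

text \<open>The generator \<theta> is chosen in the ring R generated by B over the base. An
  embedding of the field of \<theta> maps B into B, as B is closed under conjugates, so it maps R
  into N; thus N contains all the conjugates of \<theta>.\<close>

lemma ex_galois: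
 fixes \<nu> :: "'f::field => 'e::alg_closed_field"
 assumes \<nu>: "field_hom \<nu>" and inf: "infinite (UNIV :: 'f set)" and B: "finite B" "!!b. b \<in> B ==> sepp \<nu> b"
  and conj: "!!b z. b \<in> B ==> (!!p. evk \<nu> b p = 0 ==> evk \<nu> z p = 0) ==> z \<in> B"
 obtains N where "galois \<nu> N" "B <= N"
proof -
 interpret \<nu>: field_hom \<nu> by fact
 define R where "R = \<Inter>{S. sring S & B <= S & range \<nu> <= S}"
 have R: "sring R" "B <= R" "range \<nu> <= R" unfolding R_def sring_def by auto
 obtain \<theta> where \<theta>: "\<theta> \<in> R" "sepp \<nu> \<theta>" "B <= adj \<nu> \<theta>"
  using primitive_element_finite[OF \<nu> inf B, of R] sring_0[OF R(1)] R sring_add[OF R(1)] sring_mult[OF R(1)] by (metis (no_types, lifting) range_subsetD subsetD)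
 obtain m where m: "minpoly_of \<nu> \<theta> m" "evk \<nu> \<theta> (pderiv m) ~= 0" "0 < degree m" using sepp_minpoly[OF \<nu> \<theta>(2)] .
 define N where "N = adj \<nu> \<theta>"
 have N: "sfield N" "range \<nu> <= N" "\<theta> \<in> N" unfolding N_def using sfield_adj[OF \<nu> m(1)] base_adj[OF \<nu>] self_adj[OF \<nu>] by auto
 note sN = sfield_sring[OF N(1)]
 have rN: "r \<in> N" if r: "evk \<nu> r m = 0" for r
 proof -
  obtain \<mu> where s: "hom_on N \<mu>" "!!p. \<mu> (evk \<nu> \<theta> p) = evk \<nu> r p" unfolding N_def using ex_embedding[OF \<nu> \<nu> m(1) r] by blast
  have sk: "\<mu> (\<nu> c) = \<nu> c" for c using s(2)[of "[:c:]"] by (simp add: evk_const[OF \<nu>])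
  define S where "S = {z \<in> N. \<mu> z \<in> N}"
  have "sring S" unfolding S_def by (rule sringI)
    (auto simp: sring_1[OF sN] sring_diff[OF sN] sring_mult[OF sN] hom_on_1[OF sN s(1)] hom_on_diff[OF sN s(1)] hom_on_mult[OF sN s(1)])
  moreover have "B <= S"
  proof
   fix b assume b: "b \<in> B"
   then have bN: "b \<in> N" using \<theta>(3) by (auto simp: N_def)
   have "evk \<nu> (\<mu> b) p = 0" if "evk \<nu> b p = 0" for p using hom_on_evk[OF \<nu> sN N(2) s(1) sk bN, of p] that hom_on_0[OF sN s(1)] by simp
   then have "\<mu> b \<in> B" using conj[OF b] by blast
   then show "b \<in> S" using bN \<theta>(3) by (auto simp: S_def N_def)
  qed
  moreover have "range \<nu> <= S" using N(2) sk by (auto simp: S_def)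
  ultimately have "\<theta> \<in> S" using \<theta>(1) unfolding R_def by blast
  then show ?thesis using s(2)[of "[:0, 1:]"] by (simp add: S_def evk_X[OF \<nu>])
 qed
 have "z \<in> N" if "ALL p. evk \<nu> \<theta> p = 0 --> evk \<nu> z p = 0" for z using rN that minpoly_of_root[OF \<nu> m(1)] by blast
 then have "galois \<nu> N" using \<nu> N(1,2) fixed_field[OF \<nu> m N_def rN] \<theta>(2) by (intro galois.intro exI[of _ \<theta>]) (auto simp: N_def)
 then show ?thesis using \<theta>(3) N_def that by blast
qed

section \<open>Embeddings of an extension into a Galois extension\<close>

definition embs :: "('f => 'a::field) => ('f::field => 'e::field) => 'e set => ('a => 'e) set" where
 "embs \<iota> \<nu> N = {j. field_hom j & (ALL c. j (\<iota> c) = \<nu> c) & range j <= N}"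

locale galois_emb = galois \<nu> N for \<nu> :: "'f::field => 'e::field" and N +
 fixes \<iota> :: "'f => 'a::field"
 assumes \<iota>: "field_hom \<iota>" and fin_J: "finite (embs \<iota> \<nu> N)" and J_ne: "embs \<iota> \<nu> N ~= {}"
  and transitive: "!!j j'. j \<in> embs \<iota> \<nu> N ==> j' \<in> embs \<iota> \<nu> N ==> \<exists>\<mu>\<in>gal \<nu> N. j' = \<mu> o j"
  and stabilizer: "!!j z. j \<in> embs \<iota> \<nu> N ==> z \<in> N ==> (!!\<mu>. \<mu> \<in> gal \<nu> N ==> \<mu> o j = j ==> \<mu> z = z) ==> z \<in> range j"
begin

abbreviation "J \<equiv> embs \<iota> \<nu> N"

lemma J_hom: "j \<in> J ==> field_hom j" and J_base: "j \<in> J ==> j (\<iota> c) = \<nu> c" and J_N: "j \<in> J ==> j z \<in> N"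
 unfolding embs_def by auto

lemma comp_J:
 assumes "\<mu> \<in> G" "j \<in> J"
 shows "\<mu> o j \<in> J"
proof -
 interpret field_hom j by (rule J_hom[OF assms(2)])
 note h = G_hom[OF assms(1)]
 have "field_hom (\<mu> o j)" by unfold_locales (simp_all add: hom_add hom_mult hom_on_0[OF sN h] hom_on_1[OF sN h]
    hom_on_add[OF sN h] hom_on_mult[OF sN h] J_N[OF assms(2)])
 then show ?thesis unfolding embs_def using assms J_base J_N G_base G_N by auto
qed

end

lemma ex_galois_emb:
 fixes \<iota> :: "'f::field => 'a::field" and \<nu> :: "'f => 'e::alg_closed_field"
 assumes "galois \<nu> N"
  and \<iota>: "field_hom \<iota>" and m: "minpoly_of \<iota> \<alpha> m" and gen: "adj \<iota> \<alpha> = UNIV"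
  and r: "evk \<nu> r m = 0" and roots: "!!z. evk \<nu> z m = 0 ==> z \<in> N"
 shows "galois_emb \<nu> N \<iota>"
proof (intro galois_emb.intro galois_emb_axioms.intro)
 interpret galois \<nu> N by fact
 show "galois \<nu> N" by fact
 interpret \<nu>: field_hom \<nu> by (rule \<nu>)
 interpret \<iota>: field_hom \<iota> by fact
 show "field_hom \<iota>" by fact
 let ?J = "embs \<iota> \<nu> N"
 have jev: "j (evk \<iota> \<alpha> p) = evk \<nu> (j \<alpha>) p" if "j \<in> ?J" for j p
 proof -
  interpret j: field_hom j using that by (simp add: embs_def)
  show ?thesis using that by (intro hom_on_evk[OF \<iota> sring_UNIV]) (auto simp: embs_def intro: comm_ring_hom_hom_on[OF j.comm_ring_hom_axioms])
 qed
 have j_root: "evk \<nu> (j \<alpha>) m = 0" if "j \<in> ?J" for j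
 proof -
  interpret j: field_hom j using that by (simp add: embs_def)
  show ?thesis using jev[OF that, of m] minpoly_of_root[OF \<iota> m] by simp
 qed
 have j_eq: "j = j'" if "j \<in> ?J" "j' \<in> ?J" "j \<alpha> = j' \<alpha>" for j j'
 proof
  fix z
  obtain p where "z = evk \<iota> \<alpha> p" using gen unfolding adj_def by blast
  then show "j z = j' z" using jev[OF that(1)] jev[OF that(2)] that(3) by simp
 qed
 have m0: "map_poly \<nu> m ~= 0" using m by (auto simp: minpoly_of_def)
 have "finite ((%j. j \<alpha>) ` ?J)" by (rule finite_subset[OF _ poly_roots_finite[OF m0]]) (use j_root in \<open>auto simp: evk_def\<close>)
 then show "finite ?J" by (rule finite_imageD) (auto intro!: inj_onI j_eq)
 show "?J ~= {}"
 proof -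
  obtain j where j: "hom_on (adj \<iota> \<alpha>) j" "!!p. j (evk \<iota> \<alpha> p) = evk \<nu> r p" using ex_embedding[OF \<iota> \<nu> m r] by blast
  then have h: "hom_on UNIV j" using gen by simp
  have "field_hom j" by unfold_locales (simp_all add: hom_on_0[OF sring_UNIV h] hom_on_1[OF sring_UNIV h] hom_on_add[OF sring_UNIV h] hom_on_mult[OF sring_UNIV h])
  moreover have "j (\<iota> c) = \<nu> c" for c using j(2)[of "[:c:]"] by (simp add: evk_const[OF \<iota>] evk_const[OF \<nu>])
  moreover have "j z \<in> N" for z
  proof -
   obtain p where "z = evk \<iota> \<alpha> p" using gen unfolding adj_def by blast
   then have "j z = evk \<nu> r p" using j(2) by simp
   moreover have "adj \<nu> r <= N" using adj_subset[OF \<nu> sN roots[OF r]] base_N by blast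
   ultimately show ?thesis unfolding adj_def by auto
  qed
  ultimately show ?thesis unfolding embs_def by blast
 qed
 have rN: "j \<alpha> \<in> N" if "j \<in> ?J" for j using that by (auto simp: embs_def)
 have cp: "EX p. conj_poly w = map_poly \<nu> p" if w: "w \<in> N" for w
 proof -
  obtain p where "conj_poly w = map_poly \<nu> p" using fixed_poly[OF conj_poly_over[OF w] map_conj_poly[OF w]] .
  then show ?thesis by blast
 qed
 have cjm: "\<mu> o j \<in> ?J" if "\<mu> \<in> gal \<nu> N" "j \<in> ?J" for \<mu> j
 proof -
  interpret j: field_hom j using that by (simp add: embs_def)
  note h = G_hom[OF that(1)]
  have jN: "j z \<in> N" for z using that(2) by (auto simp: embs_def)
  have "field_hom (\<mu> o j)" by unfold_locales (simp_all add: j.hom_add j.hom_mult hom_on_0[OF sN h] hom_on_1[OF sN h]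
     hom_on_add[OF sN h] hom_on_mult[OF sN h] jN)
  then show ?thesis using that G_base G_N jN unfolding embs_def by auto
 qed
 show "\<exists>\<mu>\<in>gal \<nu> N. j' = \<mu> o j" if jj: "j \<in> ?J" "j' \<in> ?J" for j j'
 proof -
  interpret j: field_hom j using jj by (simp add: embs_def)
  obtain p where p: "conj_poly (j \<alpha>) = map_poly \<nu> p" using cp[OF rN[OF jj(1)]] by blast
  have "evk \<nu> (j \<alpha>) p = 0" unfolding evk_def p[symmetric] using poly_conj_poly conj_self by blast
  then have "evk \<iota> \<alpha> p = 0" using jev[OF jj(1), of p] by simp
  then have "m dvd p" using m by (simp add: minpoly_of_def)
  then obtain u where u: "p = m * u" by (rule dvdE)
  interpret e: comm_ring_hom "evk \<nu> (j' \<alpha>)" by (rule evk_hom[OF \<nu>])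
  have "evk \<nu> (j' \<alpha>) p = 0" using j_root[OF jj(2)] u by (simp add: e.hom_mult)
  then have "j' \<alpha> \<in> conj (j \<alpha>)" unfolding evk_def p[symmetric] poly_conj_poly .
  then obtain \<mu> where "\<mu> \<in> gal \<nu> N" "j' \<alpha> = \<mu> (j \<alpha>)" unfolding conj_def by blast
  then show ?thesis using j_eq[OF jj(2) cjm[OF _ jj(1)]] by auto
 qed
 \<comment> \<open>The fixed field argument is repeated over the base j(K). There \<theta> still
   generates N, and its conjugates over j(K) are conjugates over the original base, so they lie in
   N.\<close>
 show "z \<in> range j" if j: "j \<in> ?J" and z: "z \<in> N" and st: "!!\<mu>. \<mu> \<in> gal \<nu> N ==> \<mu> o j = j ==> \<mu> z = z" for j z
 proof -
  have jh: "field_hom j" using j by (simp add: embs_def)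
  interpret j: field_hom j by (rule jh)
  obtain \<theta> where t: "sepp \<nu> \<theta>" "N = adj \<nu> \<theta>" "!!z. (ALL p. evk \<nu> \<theta> p = 0 --> evk \<nu> z p = 0) ==> z \<in> N" using generator by blast
  have ev: "evk j v (map_poly \<iota> p) = evk \<nu> v p" for v p
  proof -
   have "map_poly j (map_poly \<iota> p) = map_poly \<nu> p" by (rule poly_eqI) (use j in \<open>simp add: coeff_map_poly embs_def\<close>)
   then show ?thesis by (simp add: evk_def)
  qed
  obtain h where "evk \<nu> \<theta> h = 0" "evk \<nu> \<theta> (pderiv h) ~= 0" using t(1) unfolding sepp_def by blast
  then have "sepp j \<theta>" unfolding sepp_def by (intro exI[of _ "map_poly \<iota> h"]) (simp add: ev flip: map_poly_pderiv[OF \<iota>.comm_ring_hom_axioms])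
  then obtain mj where mj: "minpoly_of j \<theta> mj" "evk j \<theta> (pderiv mj) ~= 0" "0 < degree mj" by (rule sepp_minpoly[OF jh])
  have tN: "\<theta> \<in> N" unfolding t(2) by (rule self_adj[OF \<nu>])
  have "adj j \<theta> <= N" by (rule adj_subset[OF jh sN tN]) (use j in \<open>auto simp: embs_def\<close>)
  moreover have "N <= adj j \<theta>" unfolding t(2) adj_def using ev[of \<theta>] by (auto simp flip: ev)
  ultimately have Nj: "N = adj j \<theta>" by blast
  interpret e: comm_ring_hom "evk j v" for v by (rule evk_hom[OF jh])
  have rt: "v \<in> N" if v: "evk j v mj = 0" for v
  proof (rule t(3), intro allI impI)
   fix p assume "evk \<nu> \<theta> p = 0"
   then have "mj dvd map_poly \<iota> p" using mj(1) ev[of \<theta> p] by (simp add: minpoly_of_def)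
   then show "evk \<nu> v p = 0" using v by (auto simp: e.hom_mult ev[symmetric] elim!: dvdE)
  qed
  have fz: "\<mu> z = z" if s: "\<mu> \<in> gal j N" for \<mu>
  proof (rule st)
   have jc: "\<mu> (j c) = j c" for c using s by (simp add: gal_def)
   then show "\<mu> o j = j" by auto
   have "\<mu> (\<nu> c) = \<nu> c" for c using jc[of "\<iota> c"] j by (simp add: embs_def)
   then show "\<mu> \<in> gal \<nu> N" using s by (simp add: gal_def)
  qed
  show ?thesis using fixed_field(2)[OF jh mj Nj rt z] fz by blast
 qed
qed


section \<open>Integral closures\<close>

definition intcl :: "('k::field poly => 'e::field) => 'e set => 'e set" where
 "intcl e N = {z \<in> N. EX p. lead_coeff p = 1 & poly (map_poly e p) z = 0}"

locale poly_emb = comm_ring_hom e for e :: "'k::{field,finite} poly => 'e::field" +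
 assumes inj0: "e a = 0 ==> a = 0"
begin

lemma e_inj [simp]: "e a = e b \<longleftrightarrow> a = b"
 using inj0[of "a - b"] by (auto simp: hom_minus)

lemma e_eq_0 [simp]: "e a = 0 \<longleftrightarrow> a = 0"
 using inj0 by auto

lemma map_e_eq_0 [simp]: "map_poly e p = 0 \<longleftrightarrow> p = 0"
 by (auto simp: poly_eq_iff coeff_map_poly)

definition span :: "'i set => ('i => 'e) => 'e set" where
 "span I v = {SUM i:I. e (c i) * v i | c. True}"

lemma span_sum_mem: "(SUM i:I. e (c i) * v i) \<in> span I v"
 unfolding span_def by blast

lemma span_base: "finite I ==> i \<in> I ==> v i \<in> span I v"
proof -
 assume I: "finite I" "i \<in> I"
 have "(SUM j:I. e (if j = i then 1 else 0) * v j) = (SUM j:I. if j = i then v j else 0)" by (intro sum.cong) auto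
 then show ?thesis using span_sum_mem[of "%j. if j = i then 1 else 0" v I] I by (simp add: sum.delta)
qed

lemma span_add: "a \<in> span I v ==> b \<in> span I v ==> a + b \<in> span I v"
proof -
 assume "a \<in> span I v" "b \<in> span I v"
 then obtain c d where "a = (SUM i:I. e (c i) * v i)" "b = (SUM i:I. e (d i) * v i)" unfolding span_def by blast
 then show ?thesis using span_sum_mem[of "%i. c i + d i" v I] by (simp add: hom_add distrib_right sum.distrib)
qed

lemma span_smult: "a \<in> span I v ==> e b * a \<in> span I v"
proof -
 assume "a \<in> span I v"
 then obtain c where "a = (SUM i:I. e (c i) * v i)" unfolding span_def by blast
 then show ?thesis using span_sum_mem[of "%i. b * c i" v I] by (simp add: hom_mult sum_distrib_left mult.assoc)
qed

lemma span_sum: "(!!k. k \<in> A ==> f k \<in> span I v) ==> sum f A \<in> span I v"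
proof (induction A rule: infinite_finite_induct)
 have z: "0 \<in> span I v" using span_sum_mem[of "%_. 0" v I] by simp
 case (insert x A)
 then show ?case by (simp add: span_add)
qed (use span_sum_mem[of "%_. 0" v I] in auto)

lemma span_stable:
 assumes "!!i. i \<in> I ==> x * v i \<in> span I v" "a \<in> span I v"
 shows "x * a \<in> span I v"
proof -
 obtain c where "a = (SUM i:I. e (c i) * v i)" using assms(2) unfolding span_def by blast
 then have "x * a = (SUM i:I. e (c i) * (x * v i))" by (simp add: sum_distrib_left mult.left_commute)
 then show ?thesis using assms(1) by (auto intro!: span_sum span_smult)
qed

text \<open>The determinant trick: the vector of the v_i is an eigenvector for x of a matrix over
  k[T], so x is a root of its characteristic polynomial, which is monic over k[T].\<close>

lemma span_integral:
 assumes I: "finite I" "i0 \<in> I" "v i0 ~= 0" and x: "!!i. i \<in> I ==> x * v i \<in> span I v"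
 shows "EX p. lead_coeff p = 1 & poly (map_poly e p) x = 0"
proof -
 define n where "n = card I"
 obtain h where h: "bij_betw h {..<n} I" using ex_bij_betw_nat_finite[OF I(1)] unfolding n_def by (auto simp: atLeast0LessThan)
 have "ALL i:I. EX c. x * v i = (SUM j:I. e (c j) * v j)" using x unfolding span_def by blast
 then obtain c where c: "!!i. i \<in> I ==> x * v i = (SUM j:I. e (c i j) * v j)" by metis
 define M where "M = mat n n (%(i, j). c (h i) (h j))"
 have M: "M \<in> carrier_mat n n" by (simp add: M_def)
 define w where "w = Matrix.vec n (%i. v (h i))"
 have hI: "h i \<in> I" if "i < n" for i using bij_betwE[OF h] that by simp
 have "map_mat e M *\<^sub>v w = x \<cdot>\<^sub>v w"
 proof (rule eq_vecI)
  fix i assume "i < dim_vec (x \<cdot>\<^sub>v w)"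
  then have i: "i < n" by (simp add: w_def)
  have "vec_index (map_mat e M *\<^sub>v w) i = (\<Sum>j<n. e (c (h i) (h j)) * v (h j))" using i by (simp add: M_def w_def scalar_prod_def row_def atLeast0LessThan)
  also have "... = x * v (h i)" unfolding c[OF hI[OF i]] by (rule sum.reindex_bij_betw[OF h])
  finally show "vec_index (map_mat e M *\<^sub>v w) i = vec_index (x \<cdot>\<^sub>v w) i" using i by (simp add: w_def)
 qed (simp add: M_def w_def)
 moreover have "w ~= 0\<^sub>v n"
 proof
  assume w0: "w = 0\<^sub>v n"
  obtain i where i: "i < n" "h i = i0" using h I(2) by (auto simp: bij_betw_def image_iff)
  have "vec_index w i = 0" using w0 i by simp
  then show False using i I(3) by (simp add: w_def)
 qed
 ultimately have "eigenvalue (map_mat e M) x" unfolding eigenvalue_def eigenvector_def by (intro exI[of _ w]) (simp add: M_def w_def)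
 then have "poly (char_poly (map_mat e M)) x = 0" using eigenvalue_root_char_poly[of "map_mat e M" n x] M by simp
 then have "poly (map_poly e (char_poly M)) x = 0" by (simp add: char_poly_hom[OF M])
 then show ?thesis using degree_monic_char_poly[OF M] by (intro exI[of _ "char_poly M"]) simp
qed

lemma monic_root_power:
 assumes "lead_coeff p = 1" "poly (map_poly e p) x = 0"
 shows "0 < degree p" "x ^ degree p = - (\<Sum>k<degree p. e (coeff p k) * x ^ k)"
proof -
 have s: "poly (map_poly e p) x = (\<Sum>k<Suc (degree p). e (coeff p k) * x ^ k)" by (rule poly_map_poly_lessThan) (auto simp: coeff_eq_0)
 then have eq: "(\<Sum>k<degree p. e (coeff p k) * x ^ k) + x ^ degree p = 0" using assms by simp
 then show "x ^ degree p = - (\<Sum>k<degree p. e (coeff p k) * x ^ k)" by (simp add: eq_neg_iff_add_eq_0 add.commute)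
 show "0 < degree p" using eq by (cases "degree p") auto
qed

text \<open>The span of the monomials x^i y^j below the two degrees is stable under x and under y,
  hence under x - y and x y.\<close>

lemma sring_integral: "sring {z. EX p. lead_coeff p = 1 & poly (map_poly e p) z = 0}"
proof (rule sringI)
 show "1 \<in> {z. EX p. lead_coeff p = 1 & poly (map_poly e p) z = 0}" by (auto intro!: exI[of _ "[:- 1, 1:]"] simp: map_poly_pCons_0 hom_uminus)
 fix x y assume "x \<in> {z. EX p. lead_coeff p = 1 & poly (map_poly e p) z = 0}" "y \<in> {z. EX p. lead_coeff p = 1 & poly (map_poly e p) z = 0}"
 then obtain p r where p: "lead_coeff p = 1" "poly (map_poly e p) x = 0" and r: "lead_coeff r = 1" "poly (map_poly e r) y = 0" by blast
 note P = monic_root_power[OF p] and R = monic_root_power[OF r]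
 define I where "I = {..<degree p} \<times> {..<degree r}"
 define v where "v = (%(i, j). x ^ i * y ^ j)"
 have I: "finite I" "(0, 0) \<in> I" "v (0, 0) ~= 0" using P R by (auto simp: I_def v_def)
 have vI: "x ^ i * y ^ j \<in> span I v" if "i < degree p" "j < degree r" for i j using span_base[OF I(1), of "(i, j)" v] that by (simp add: I_def v_def)
 have xs: "x * v i \<in> span I v" if i: "i \<in> I" for i
 proof -
  obtain a b where ab: "i = (a, b)" "a < degree p" "b < degree r" using i by (auto simp: I_def)
  show ?thesis
  proof (cases "Suc a < degree p")
   case True
   then show ?thesis using vI[OF True ab(3)] by (simp add: ab v_def mult.assoc)
  next
   case False
   then have "degree p = Suc a" using ab by simp
   then have "x * v i = x ^ degree p * y ^ b" by (simp add: ab v_def mult.assoc)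
   also have "... = (\<Sum>k<degree p. e (- coeff p k) * (x ^ k * y ^ b))" unfolding P(2) by (simp add: sum_distrib_right hom_uminus sum_negf mult.assoc)
   finally show ?thesis using vI ab(3) by (auto intro!: span_sum span_smult)
  qed
 qed
 have ys: "y * v i \<in> span I v" if i: "i \<in> I" for i
 proof -
  obtain a b where ab: "i = (a, b)" "a < degree p" "b < degree r" using i by (auto simp: I_def)
  show ?thesis
  proof (cases "Suc b < degree r")
   case True
   then show ?thesis using vI[OF ab(2) True] by (simp add: ab v_def mult.left_commute)
  next
   case False
   then have "degree r = Suc b" using ab by simp
   then have "y * v i = x ^ a * y ^ degree r" by (simp add: ab v_def mult.left_commute)
   also have "... = (\<Sum>k<degree r. e (- coeff r k) * (x ^ a * y ^ k))" unfolding R(2) by (simp add: sum_distrib_left hom_uminus sum_negf mult.left_commute)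
   finally show ?thesis using vI ab(2) by (auto intro!: span_sum span_smult)
  qed
 qed
 have "(x - y) * v i \<in> span I v" if "i \<in> I" for i using span_add[OF xs[OF that] span_smult[OF ys[OF that], of "-1"]] by (simp add: hom_uminus left_diff_distrib)
 then show "x - y \<in> {z. EX p. lead_coeff p = 1 & poly (map_poly e p) z = 0}" using span_integral[of I "(0, 0)" v, OF I] by blast
 have "(x * y) * v i \<in> span I v" if "i \<in> I" for i using span_stable[OF xs ys[OF that]] by (simp add: mult.assoc)
 then show "x * y \<in> {z. EX p. lead_coeff p = 1 & poly (map_poly e p) z = 0}" using span_integral[of I "(0, 0)" v, OF I] by blast
qed

text \<open>Seidenberg's Horner coefficients.\<close>

definition horner :: "'k poly poly => 'e => nat => 'e" where
 "horner p x k = (SUM i:{k..degree p}. e (coeff p i) * x ^ (i - k))"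

text \<open>Multiplication by the Horner coefficient preserves the span of 1, x, ..., x^(n-1): on
  x^j with j < k the exponents stay below n at once, and for j >= k the relation p(x) = 0 first
  replaces the upper part of p by minus its lower part.\<close>

lemma horner_integral:
 assumes p: "poly (map_poly e p) x = 0" "0 < degree p" and k: "k <= degree p"
 shows "EX r. lead_coeff r = 1 & poly (map_poly e r) (horner p x k) = 0"
proof -
 define n where "n = degree p"
 have s: "(\<Sum>i<Suc n. e (coeff p i) * x ^ i) = 0" using p(1) poly_map_poly_lessThan[of e "Suc n" p x] by (simp add: coeff_eq_0 n_def)
 have vI: "x ^ j \<in> span {..<n} (%j. x ^ j)" if "j < n" for j using span_base[of "{..<n}" j "%j. x ^ j"] that by simp
 have "horner p x k * x ^ j \<in> span {..<n} (%j. x ^ j)" if j: "j \<in> {..<n}" for j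
 proof (cases "j < k")
  case True
  have "horner p x k * x ^ j = (SUM i:{k..n}. e (coeff p i) * x ^ (i - k + j))"
   unfolding horner_def n_def[symmetric] sum_distrib_right by (intro sum.cong refl) (simp only: power_add mult.assoc)
  moreover have "i - k + j < n" if "i \<in> {k..n}" for i using that True by auto
  ultimately show ?thesis using vI by (auto intro!: span_sum span_smult)
 next
  case False
  have "{..<Suc n} = {..<k} \<union> {k..n}" "{..<k} \<inter> {k..n} = {}" using k by (auto simp: n_def)
  then have z: "(\<Sum>i<k. e (coeff p i) * x ^ i) + (SUM i:{k..n}. e (coeff p i) * x ^ i) = 0"
   using s sum.union_disjoint[of "{..<k}" "{k..n}" "%i. e (coeff p i) * x ^ i"] by simp
  have "x ^ k * horner p x k = (SUM i:{k..n}. e (coeff p i) * x ^ i)" unfolding horner_def n_def[symmetric] sum_distrib_left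
   by (intro sum.cong refl) (simp add: mult.left_commute flip: power_add)
  also have "... = (\<Sum>i<k. e (- coeff p i) * x ^ i)" using z by (simp add: hom_uminus sum_negf eq_neg_iff_add_eq_0 add.commute)
  finally have h: "x ^ k * horner p x k = (\<Sum>i<k. e (- coeff p i) * x ^ i)" .
  have "horner p x k * x ^ j = x ^ k * horner p x k * x ^ (j - k)" using False by (simp add: mult.commute mult.left_commute flip: power_add)
  also have "... = (\<Sum>i<k. e (- coeff p i) * x ^ (i + (j - k)))" unfolding h by (simp add: sum_distrib_right power_add mult.assoc)
  finally have "horner p x k * x ^ j = (\<Sum>i<k. e (- coeff p i) * x ^ (i + (j - k)))" .
  moreover have "i + (j - k) < n" if "i \<in> {..<k}" for i using that False j by auto
  ultimately show ?thesis using vI by (auto intro!: span_sum span_smult)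
 qed
 then show ?thesis using p(2) by (intro span_integral[of "{..<n}" 0 "%j. x ^ j"]) (auto simp: n_def)
qed

lemma horner_step:
 assumes "k < degree p"
 shows "horner p x k = e (coeff p k) + x * horner p x (Suc k)"
proof -
 have "{k..degree p} = insert k {Suc k..degree p}" using assms by auto
 then have "horner p x k = e (coeff p k) + (SUM i:{Suc k..degree p}. e (coeff p i) * x ^ (i - k))" unfolding horner_def by simp
 also have "(SUM i:{Suc k..degree p}. e (coeff p i) * x ^ (i - k)) = x * horner p x (Suc k)" unfolding horner_def sum_distrib_left
 proof (rule sum.cong[OF refl])
  fix i assume "i \<in> {Suc k..degree p}"
  then have "i - k = Suc (i - Suc k)" by auto
  then show "e (coeff p i) * x ^ (i - k) = x * (e (coeff p i) * x ^ (i - Suc k))" by (simp add: mult.left_commute)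
 qed
 finally show ?thesis .
qed

lemma horner_top: "horner p x (degree p) = e (lead_coeff p)"
 by (simp add: horner_def)

text \<open>Let d generate the ideal of denominators of z and let e(d) z = e(a). The integral
  equation yields d | a^n, so a zero t of d is a zero of a, and the minimal polynomial of t cancels
  from both, against the choice of d.\<close>

lemma integral_fraction:
 assumes z: "lead_coeff p = 1" "poly (map_poly e p) z = 0" and b: "b ~= 0" "e b * z = e a"
 shows "z \<in> range e"
proof -
 define P where "P = (%b. EX a. e b * z = e a)"
 have Pd: "P (u - c * v)" if uv: "P u" "P v" for u v c
 proof -
  obtain x y where "e u * z = e x" "e v * z = e y" using uv unfolding P_def by blast
  then have "e (u - c * v) * z = e (x - c * y)" by (simp add: hom_minus hom_mult left_diff_distrib mult.assoc)
  then show ?thesis unfolding P_def by blast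
 qed
 have Pb: "P b" using b(2) unfolding P_def by blast
 obtain d where d: "P d" "lead_coeff d = 1" "ALL b. P b --> d dvd b" by (rule euclid_ideal[of P b, OF Pb b(1)]) (use Pd in blast)+
 have d0: "d ~= 0" using d(2) by auto
 obtain a where a: "e d * z = e a" using d(1) unfolding P_def by blast
 define n where "n = degree p"
 note Z = monic_root_power[OF z]
 have dvd: "d dvd a ^ n"
 proof -
  obtain n' where n: "n = Suc n'" using Z(1) unfolding n_def by (cases "degree p") auto
  have "e (a ^ n) = e d ^ n * z ^ n" unfolding a[symmetric] power_mult_distrib[symmetric] by (simp add: hom_power a)
  also have "... = - (\<Sum>k<n. e d ^ n * (e (coeff p k) * z ^ k))" using Z(2) unfolding n_def by (simp add: sum_distrib_left)
  also have "(\<Sum>k<n. e d ^ n * (e (coeff p k) * z ^ k)) = (\<Sum>k<n. e (d * (d ^ (n - 1 - k) * coeff p k * a ^ k)))"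
  proof (rule sum.cong[OF refl])
   fix k assume "k \<in> {..<n}"
   then have "n = Suc (n - 1 - k) + k" by auto
   then have "e d ^ n = e d * e d ^ (n - 1 - k) * e d ^ k" by (metis power_Suc power_add)
   then have "e d ^ n * (e (coeff p k) * z ^ k) = e d * (e d ^ (n - 1 - k) * e (coeff p k) * (e d * z) ^ k)" by (simp add: power_mult_distrib mult_ac)
   then show "e d ^ n * (e (coeff p k) * z ^ k) = e (d * (d ^ (n - 1 - k) * coeff p k * a ^ k))" unfolding a by (simp add: hom_mult hom_power)
  qed
  also have "- ... = e (d * - (\<Sum>k<n. d ^ (n - 1 - k) * coeff p k * a ^ k))" by (simp add: hom_sum hom_uminus sum_distrib_left)
  finally have "a ^ n = d * - (\<Sum>k<n. d ^ (n - 1 - k) * coeff p k * a ^ k)" by (simp only: e_inj)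
  then show ?thesis by (rule dvdI)
 qed
 have "degree d = 0"
 proof (rule ccontr)
  assume "degree d ~= 0"
  then have "0 < degree (map_poly to_ac d)" by simp
  then obtain t where t: "ev t d = 0" unfolding ev_def using alg_closed_imp_poly_has_root by blast
  obtain \<pi> where \<pi>: "!!z. ev z \<pi> = 0 \<longleftrightarrow> z \<in> orb frob t" "lead_coeff \<pi> = 1" "degree \<pi> = fper t"
   using ex_poly_roots_orb[of t] by blast
  have "ev t (a ^ n) = 0" using dvd t by (auto simp: ev.hom_mult elim!: dvdE)
  then have "ev t a = 0" by (simp add: ev.hom_power)
  then obtain a' where a': "a = \<pi> * a'" using ev_eq_0_imp_dvd[OF \<pi>] by (rule_tac dvdE)
  obtain d' where d': "d = \<pi> * d'" using ev_eq_0_imp_dvd[OF \<pi> t] by (rule dvdE)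
  have \<pi>0: "\<pi> ~= 0" using \<pi>(2) by auto
  have "e \<pi> * (e d' * z) = e \<pi> * e a'" using a unfolding a' d' by (simp add: hom_mult mult.assoc)
  then have "P d'" using \<pi>0 unfolding P_def by auto
  then have "d dvd d'" using d(3) by blast
  then have "degree d <= degree d'" using d' d0 by (intro dvd_imp_degree_le) auto
  moreover have "degree d = degree \<pi> + degree d'" using d' d0 by (simp add: degree_mult_eq)
  ultimately show False using \<pi>(3) per_pos_fixed(1)[OF periodic_frob, of t] by simp
 qed
 then have "d = 1" using d(2) by (auto elim!: degree_eq_zeroE simp: one_pCons)
 then show ?thesis using a by simp
qed

end

locale chart = poly_emb e for e :: "'k::{field,finite} poly => 'e::field" +
 fixes N :: "'e set"
 assumes N: "sfield N" and e_N: "range e <= N"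
  and algebraic: "!!z. z \<in> N ==> EX p. p ~= 0 & poly (map_poly e p) z = 0"
begin

abbreviation "B \<equiv> intcl e N"

lemma sring_B: "sring B"
 using sring_integral sfield_sring[OF N] unfolding intcl_def sring_def by blast

lemma e_B: "e a \<in> B"
proof -
 have "lead_coeff [:- a, 1:] = 1 & poly (map_poly e [:- a, 1:]) (e a) = 0" by (simp add: map_poly_pCons_0 hom_uminus)
 then show ?thesis using e_N unfolding intcl_def by blast
qed

lemma B_N: "B <= N"
 unfolding intcl_def by auto

lemma horner_B:
 assumes "z \<in> N" "poly (map_poly e p) z = 0" "0 < degree p" "k <= degree p"
 shows "horner p z k \<in> B"
 using horner_integral[OF assms(2-4)] sring_sum[OF sfield_sring[OF N], of "{k..degree p}"] e_N
  sring_mult[OF sfield_sring[OF N]] sring_power[OF sfield_sring[OF N] assms(1)] unfolding intcl_def horner_def by (auto simp: image_subset_iff)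

lemma algebraic_deg:
 assumes "z \<in> N"
 obtains p where "p ~= 0" "poly (map_poly e p) z = 0" "0 < degree p"
proof -
 obtain p where p: "p ~= 0" "poly (map_poly e p) z = 0" using algebraic[OF assms] by blast
 have "0 < degree p"
 proof (rule ccontr)
  assume "\<not> 0 < degree p"
  then obtain a where a: "p = [:a:]" by (auto elim: degree_eq_zeroE)
  then show False using p by (simp add: map_poly_pCons_0)
 qed
 then show ?thesis using p that by blast
qed

text \<open>The Horner coefficient next to the top shows that the leading coefficient of any
  relation for z is a denominator.\<close>

lemma ex_denominator:
 assumes "z \<in> N"
 obtains a where "a ~= 0" "e a * z \<in> B"
proof -
 obtain p where p: "p ~= 0" "poly (map_poly e p) z = 0" "0 < degree p" using algebraic_deg[OF assms] .
 define k where "k = degree p - 1"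
 have k: "k < degree p" "Suc k = degree p" using p(3) by (auto simp: k_def)
 have "horner p z k = e (coeff p k) + z * e (lead_coeff p)" using horner_step[OF k(1)] horner_top[of p z] k(2) by simp
 then have "e (lead_coeff p) * z = horner p z k - e (coeff p k)" by (simp add: mult.commute)
 also have "... \<in> B" using horner_B[OF assms p(2,3), of k] k e_B sring_diff[OF sring_B] by simp
 finally show ?thesis using that[of "lead_coeff p"] p(1) by simp
qed

lemma B_fraction: "z \<in> B ==> b ~= 0 ==> e b * z = e a ==> z \<in> range e"
 unfolding intcl_def using integral_fraction by blast

end


section \<open>Prime ideals and residue fields\<close>

definition prime_set :: "'r::comm_ring_1 set => 'r set => bool" where
 "prime_set B P \<longleftrightarrow> P <= B & 0 \<in> P & (ALL a:P. ALL b:P. a - b \<in> P) & (ALL a:B. ALL b:P. a * b \<in> P) & 1 \<notin> P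
   & (ALL a:B. ALL b:B. a * b \<in> P --> a \<in> P \<or> b \<in> P)"

lemma ring_of_type_simps [simp]:
 "carrier ring_of_type_algebra = UNIV" "a \<otimes>\<^bsub>ring_of_type_algebra\<^esub> b = a * b" "\<one>\<^bsub>ring_of_type_algebra\<^esub> = 1"
 "\<zero>\<^bsub>ring_of_type_algebra\<^esub> = 0" "a \<oplus>\<^bsub>ring_of_type_algebra\<^esub> b = a + b" by (simp_all add: ring_of_type_algebra_def)

lemma subring_of_type_UNIV: "subring_of_type UNIV = (ring_of_type_algebra :: 'a::comm_ring_1 ring)"
 by (simp add: ring_of_type_algebra_def)

lemma cring_subring_of_type:
 assumes B: "sring B"
 shows "cring (subring_of_type B)"
proof (rule cringI)
 show "abelian_group (subring_of_type B)" by (rule abelian_groupI) (auto simp: sring_add[OF B] sring_0[OF B] ac_simps intro!: bexI[OF _ sring_uminus[OF B]])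
 show "Group.comm_monoid (subring_of_type B)" by (rule comm_monoidI) (auto simp: sring_mult[OF B] sring_1[OF B] ac_simps)
qed (auto simp: distrib_right)

lemma a_minus_subring_of_type:
 assumes B: "sring B" and "a \<in> B" "b \<in> B"
 shows "a \<ominus>\<^bsub>subring_of_type B\<^esub> b = a - b" "\<ominus>\<^bsub>subring_of_type B\<^esub> b = - b"
proof -
 interpret cring "subring_of_type B" by (rule cring_subring_of_type[OF B])
 have "- b \<oplus>\<^bsub>subring_of_type B\<^esub> b = \<zero>\<^bsub>subring_of_type B\<^esub>" by simp
 then show m: "\<ominus>\<^bsub>subring_of_type B\<^esub> b = - b" using minus_equality[of "- b" b] sring_uminus[OF B] assms(3) by simp
 show "a \<ominus>\<^bsub>subring_of_type B\<^esub> b = a - b" by (simp add: a_minus_def m)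
qed

lemma primeideal_iff_prime_set:
 assumes B: "sring B"
 shows "primeideal P (subring_of_type B) \<longleftrightarrow> prime_set B P"
proof
 assume "primeideal P (subring_of_type B)"
 then interpret primeideal P "subring_of_type B" .
 have PB: "P <= B" using a_subset by simp
 have "a - b \<in> P" if "a \<in> P" "b \<in> P" for a b
 proof -
  have "- 1 * b \<in> P" using I_l_closed[OF that(2), of "- 1"] sring_uminus[OF B sring_1[OF B]] by simp
  then show ?thesis using additive_subgroup.a_closed[OF is_additive_subgroup that(1), of "- 1 * b"] by simp
 qed
 moreover have "1 \<notin> P" using I_notcarr one_imp_carrier by auto
 ultimately show "prime_set B P" unfolding prime_set_def using PB additive_subgroup.zero_closed[OF is_additive_subgroup] I_l_closed I_prime by auto
next
 assume P: "prime_set B P"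
 show "primeideal P (subring_of_type B)"
 proof (rule primeidealI[OF idealI cring_subring_of_type[OF B]])
  interpret cring "subring_of_type B" by (rule cring_subring_of_type[OF B])
  show "ring (subring_of_type B)" by (rule ring_axioms)
  show "subgroup P (add_monoid (subring_of_type B))"
  proof (rule add.subgroupI)
   show "P <= carrier (subring_of_type B)" "P ~= {}" using P by (auto simp: prime_set_def)
   show "\<ominus>\<^bsub>subring_of_type B\<^esub> a \<in> P" if "a \<in> P" for a
    using P that a_minus_subring_of_type(2)[OF B, of a a] by (auto simp: prime_set_def subset_iff)
   show "a \<oplus>\<^bsub>subring_of_type B\<^esub> b \<in> P" if "a \<in> P" "b \<in> P" for a b
   proof -
    have "a - (0 - b) \<in> P" using P that unfolding prime_set_def by blast
    then show ?thesis by simp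
   qed
  qed
  fix a x assume "a \<in> P" "x \<in> carrier (subring_of_type B)"
  then have "x * a \<in> P" using P by (simp add: prime_set_def)
  then show "x \<otimes>\<^bsub>subring_of_type B\<^esub> a \<in> P" "a \<otimes>\<^bsub>subring_of_type B\<^esub> x \<in> P" by (simp_all add: mult.commute)
 next
  show "carrier (subring_of_type B) ~= P" using P sring_1[OF B] by (auto simp: prime_set_def)
 qed (use P in \<open>auto simp: prime_set_def\<close>)
qed

lemma (in ring) card_dimension:
 assumes "dimension n K E" and "subfield K R"
 shows "card E = card K ^ n"
 using assms
proof (induction rule: dimension.induct)
 case (Suc_dim v E n K)
 note K = \<open>subfield K R\<close>
 note E = space_subgroup_props[OF K Suc_dim(3)]
 have Kc: "K <= carrier R" by (rule subfieldE(3)[OF K])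
 have le: "line_extension K v E = (%(k, u). k \<otimes> v \<oplus> u) ` (K \<times> E)" unfolding set_eq_iff line_extension_mem_iff image_iff by (simp add: Bex_def)
 have inj: "inj_on (%(k, u). k \<otimes> v \<oplus> u) (K \<times> E)"
 proof (rule inj_onI, clarify)
  fix k u k' u' assume a: "k \<in> K" "u \<in> E" "k' \<in> K" "u' \<in> E" "k \<otimes> v \<oplus> u = k' \<otimes> v \<oplus> u'"
  have c: "k \<in> carrier R" "u \<in> carrier R" "k' \<in> carrier R" "u' \<in> carrier R" using a Kc E(1) by auto
  have e: "(k \<ominus> k') \<otimes> v = u' \<oplus> (\<ominus> u)"
  proof -
   have "(k \<ominus> k') \<otimes> v = (k \<otimes> v \<oplus> u) \<oplus> (\<ominus> u) \<oplus> (\<ominus> (k' \<otimes> v))" using c Suc_dim(1) by algebra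
   also have "... = u' \<oplus> (\<ominus> u)" unfolding a(5) using c Suc_dim(1) by algebra
   finally show ?thesis .
  qed
  have "k = k'"
  proof (rule ccontr)
   assume "k ~= k'"
   then have "k \<ominus> k' ~= \<zero>" using c by simp
   moreover have "k \<ominus> k' \<in> K" unfolding a_minus_def using a(1,3) subringE(5,7)[OF subfieldE(1)[OF K]] by blast
   ultimately have "k \<ominus> k' \<in> K - {\<zero>}" by blast
   moreover have "(k \<ominus> k') \<otimes> v \<in> E" unfolding e using a E by blast
   ultimately have "v \<in> E" using E(6) Suc_dim(1) by blast
   then show False using Suc_dim(2) by blast
  qed
  moreover from this have "u = u'" using a(5) c Suc_dim(1) by simp
  ultimately show "k = k' & u = u'" by blast
 qed
 show ?case unfolding le card_image[OF inj] using Suc_dim by (simp add: card_cartesian_product)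
qed simp

text \<open>Since |K| >= 2, the dimensions of subspaces contained in the finite set E are bounded;
  one of maximal dimension is E, as any further vector of E would extend it.\<close>

lemma (in ring) card_eq_power_dim:
 assumes K: "subfield K R" and E: "finite E" "E <= carrier R" "K <= E"
  "!!a b. a \<in> E ==> b \<in> E ==> a \<oplus> b \<in> E" "!!k a. k \<in> K ==> a \<in> E ==> k \<otimes> a \<in> E"
 shows "card E = card K ^ dim K E"
proof -
 have K01: "\<zero> \<in> K" "\<one> \<in> K" "\<zero> ~= \<one>" using subringE(2,3)[OF subfieldE(1)[OF K]] subfieldE(6)[OF K] by auto
 then have K2: "2 <= card K" using card_mono[of K "{\<zero>, \<one>}"] finite_subset[OF E(3,1)] by simp
 have 0: "EX E'. dimension 0 K E' & E' <= E" using K01 E(3) by (intro exI[of _ "{\<zero>}"]) auto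
 have bound: "ALL n. (EX E'. dimension n K E' & E' <= E) --> n <= card E"
 proof (intro allI impI)
  fix n assume "EX E'. dimension n K E' & E' <= E"
  then obtain E' where E': "dimension n K E'" "E' <= E" by blast
  have "n < 2 ^ n" by (rule less_exp)
  also have "... <= card K ^ n" using K2 by (rule power_mono) simp
  also have "... = card E'" using card_dimension[OF E'(1) K] by simp
  also have "... <= card E" using E(1) E'(2) by (rule card_mono)
  finally show "n <= card E" by simp
 qed
 obtain n where n: "EX E'. dimension n K E' & E' <= E" "ALL m. (EX E'. dimension m K E' & E' <= E) --> m <= n" using Nat.ex_has_greatest_nat[OF 0 bound] by blast
 then obtain E' where E': "dimension n K E'" "E' <= E" by blast
 have "E' = E"
 proof (rule ccontr)
  assume "E' ~= E"
  then obtain v where v: "v \<in> E" "v \<notin> E'" using E'(2) by blast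
  have "line_extension K v E' <= E" unfolding line_extension_mem_iff subset_iff using E(4,5) E'(2) v(1) by blast
  moreover have "dimension (Suc n) K (line_extension K v E')" using v E(2) E'(1) by (intro Suc_dim) auto
  ultimately have "Suc n <= n" using n(2) by blast
  then show False by simp
 qed
 then have "dimension n K E" using E'(1) by simp
 then show ?thesis using card_dimension[OF _ K] dimI[OF K] by (simp add: over_def)
qed

locale finite_prime =
 fixes B P :: "'r::comm_ring_1 set" and R :: "'r set"
 assumes B: "sring B" and P: "prime_set B P" and finR: "finite R" "R <= B" and reps: "!!b. b \<in> B ==> EX r:R. b - r \<in> P"
begin

abbreviation "S \<equiv> subring_of_type B"
abbreviation "Q \<equiv> S Quot P"
abbreviation coset where "coset a \<equiv> P +>\<^bsub>S\<^esub> a"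

sublocale S: cring S by (rule cring_subring_of_type[OF B])
sublocale P: primeideal P S using primeideal_iff_prime_set[OF B] P by simp
sublocale Q: domain Q by (rule P.quotient_is_domain)

lemma qcoset_eq: "a \<in> B ==> b \<in> B ==> coset a = coset b \<longleftrightarrow> a - b \<in> P"
 using S.quotient_eq_iff_same_a_r_cos[OF P.is_ideal, of a b] a_minus_subring_of_type(1)[OF B] by simp

lemma carrier_Q: "carrier Q = coset ` B"
 unfolding FactRing_simps by auto

lemma finite_Q: "finite (carrier Q)"
proof -
 have "carrier Q <= coset ` R" unfolding carrier_Q using reps qcoset_eq finR(2) by (auto simp: image_iff subset_iff)
 then show ?thesis using finR(1) finite_subset by blast
qed

lemma qcoset_hom: "coset \<in> Ring.ring_hom S Q"
 by (rule P.rcos_ring_hom)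

lemma qcoset_mult: "a \<in> B ==> b \<in> B ==> coset a \<otimes>\<^bsub>Q\<^esub> coset b = coset (a * b)"
 using ring_hom_mult[OF qcoset_hom] by simp

lemma qcoset_add: "a \<in> B ==> b \<in> B ==> coset a \<oplus>\<^bsub>Q\<^esub> coset b = coset (a + b)"
 using ring_hom_add[OF qcoset_hom] by simp

lemma qcoset_one: "\<one>\<^bsub>Q\<^esub> = coset 1"
 using ring_hom_one[OF qcoset_hom] by simp

lemma qcoset_zero: "\<zero>\<^bsub>Q\<^esub> = coset 0"
proof -
 have "coset 0 \<oplus>\<^bsub>Q\<^esub> coset 0 = coset 0" using qcoset_add[of 0 0] sring_0[OF B] by simp
 moreover have "coset 0 \<in> carrier Q" unfolding carrier_Q using sring_0[OF B] by blast
 ultimately show ?thesis using Q.add.l_cancel_one by auto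
qed

lemma qcoset_power: "a \<in> B ==> coset a [^]\<^bsub>Q\<^esub> (i::nat) = coset (a ^ i)"
 by (induction i) (simp_all add: qcoset_one qcoset_mult sring_power[OF B] mult.commute)

text \<open>A finite subring of \<open>Q\<close> containing \<open>x\<close> also contains its powers, and hence its inverse.\<close>
lemma inverse_in_subring:
 assumes H: "H <= carrier Q" "\<one>\<^bsub>Q\<^esub> \<in> H" "!!a b. a \<in> H ==> b \<in> H ==> a \<otimes>\<^bsub>Q\<^esub> b \<in> H" and a: "a \<in> H" "a ~= \<zero>\<^bsub>Q\<^esub>"
 shows "EX b:H. a \<otimes>\<^bsub>Q\<^esub> b = \<one>\<^bsub>Q\<^esub>"
proof -
 have "inj_on (%b. a \<otimes>\<^bsub>Q\<^esub> b) H"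
 proof (rule inj_onI)
  fix b c assume bc: "b \<in> H" "c \<in> H" "a \<otimes>\<^bsub>Q\<^esub> b = a \<otimes>\<^bsub>Q\<^esub> c"
  have "a \<in> carrier Q" "b \<in> carrier Q" "c \<in> carrier Q" using H(1) a(1) bc(1,2) by auto
  from Q.m_lcancel[OF a(2) this] bc(3) show "b = c" by blast
 qed
 then have "(%b. a \<otimes>\<^bsub>Q\<^esub> b) ` H = H" by (rule endo_inj_surj[OF finite_subset[OF H(1) finite_Q], rotated]) (use H(3)[OF a(1)] in blast)
 then have "\<one>\<^bsub>Q\<^esub> \<in> (%b. a \<otimes>\<^bsub>Q\<^esub> b) ` H" using H(2) by (simp only:)
 then show ?thesis by (auto simp only: image_iff)
qed

lemma field_Q: "field Q"
proof (rule Q.cring_fieldI2)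
 show "\<zero>\<^bsub>Q\<^esub> ~= \<one>\<^bsub>Q\<^esub>" using Q.one_not_zero by simp
qed (use inverse_in_subring[of "carrier Q"] in auto)

text \<open>The unit group of the finite residue field is cyclic. A single \<eta> whose powers cover
  the nonzero residues reduces questions about a homomorphism to its value at \<eta>.\<close>

lemma ex_generator: "\<exists>\<eta>\<in>B. ALL b:B. b \<in> P \<or> (EX i. b - \<eta> ^ i \<in> P)"
proof -
 interpret Q: field Q by (rule field_Q)
 obtain a where a: "a \<in> carrier (Multiplicative_Group.mult_of Q)" "carrier (Multiplicative_Group.mult_of Q) = {a [^]\<^bsub>Q\<^esub> i | i::nat. i \<in> UNIV}"
  by (rule bexE[OF Q.finite_field_mult_group_has_gen[OF finite_Q]])
 then obtain \<eta> where g: "\<eta> \<in> B" "a = coset \<eta>" by (auto simp: carrier_Q)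
 have "b \<in> P \<or> (EX i. b - \<eta> ^ i \<in> P)" if b: "b \<in> B" for b
 proof (cases "coset b = \<zero>\<^bsub>Q\<^esub>")
  case True
  then show ?thesis using qcoset_eq[OF b sring_0[OF B]] by (simp add: qcoset_zero)
 next
  case False
  then have "coset b \<in> carrier (Multiplicative_Group.mult_of Q)" using b by (simp add: carrier_Q)
  then obtain i :: nat where "coset b = coset \<eta> [^]\<^bsub>Q\<^esub> i" using a(2) g(2) by blast
  then show ?thesis using qcoset_eq[OF b sring_power[OF B g(1), of i]] qcoset_power[OF g(1)] by auto
 qed
 then show ?thesis using g(1) by blast
qed

end

lemma card_image_eq:
 assumes "!!a b. a \<in> B ==> b \<in> B ==> f a = f b \<longleftrightarrow> g a = g b"
 shows "card (f ` B) = card (g ` B)"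
proof -
 have "bij_betw (%v. g (inv_into B f v)) (f ` B) (g ` B)" unfolding bij_betw_def
 proof
  have i: "inv_into B f v \<in> B" "f (inv_into B f v) = v" if "v \<in> f ` B" for v using that by (auto simp: inv_into_into f_inv_into_f)
  show "inj_on (%v. g (inv_into B f v)) (f ` B)" using i assms by (intro inj_onI) metis
  have "g (inv_into B f (f b)) = g b" if "b \<in> B" for b using i[of "f b"] assms that by (metis imageI)
  then show "(%v. g (inv_into B f v)) ` f ` B = g ` B" by (force simp: image_iff)
 qed
 then show ?thesis by (rule bij_betw_same_card)
qed

context finite_prime
begin

text \<open>The map x identifies B/P with the image of B, so the residue degree, defined as a
  dimension, can be read off by counting.\<close>

lemma card_residue_degree:
 assumes x: "hom_on B (x :: 'r => 's::comm_ring_1)" and ker: "!!b. b \<in> B ==> x b = 0 \<longleftrightarrow> b \<in> P"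
  and A: "A <= B" "sring A"
 shows "card (x ` B) = card (x ` A) ^ residue_degree A B P" "finite (x ` B)"
proof -
 have xc: "coset a = coset b \<longleftrightarrow> x a = x b" if "a \<in> B" "b \<in> B" for a b
  using qcoset_eq[OF that] ker[OF sring_diff[OF B that]] hom_on_diff[OF B x that] by simp
 have cB: "card (coset ` B) = card (x ` B)" by (rule card_image_eq[OF xc])
 have cA: "card (coset ` A) = card (x ` A)" by (rule card_image_eq) (use xc A in auto)
 let ?K = "coset ` A"
 have Kc: "?K <= carrier Q" unfolding carrier_Q using A by auto
 interpret QF: field Q by (rule field_Q)
 have add_K: "a \<oplus>\<^bsub>Q\<^esub> b \<in> ?K" and mult_K: "a \<otimes>\<^bsub>Q\<^esub> b \<in> ?K" if "a \<in> ?K" "b \<in> ?K" for a b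
  using that A qcoset_add qcoset_mult sring_add[OF A(2)] sring_mult[OF A(2)] by (auto simp: subset_iff)
 have one_K: "\<one>\<^bsub>Q\<^esub> \<in> ?K" unfolding qcoset_one using sring_1[OF A(2)] by blast
 have K: "subfield ?K Q"
 proof (rule QF.subfieldI'[OF Q.subringI[OF Kc one_K _ mult_K add_K]])
  fix h assume "h \<in> ?K"
  then obtain a where a: "a \<in> A" "h = coset a" by blast
  have "coset (- a) \<oplus>\<^bsub>Q\<^esub> h = \<zero>\<^bsub>Q\<^esub>"
   unfolding a(2) qcoset_zero using qcoset_add[of "- a" a] a A sring_uminus[OF A(2)] by (auto simp: subset_iff)
  moreover have "coset (- a) \<in> ?K" using sring_uminus[OF A(2) a(1)] by blast
  ultimately show "\<ominus>\<^bsub>Q\<^esub> h \<in> ?K" using Q.minus_equality[of "coset (- a)" h] Kc \<open>h \<in> ?K\<close> by (auto simp: subset_iff)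
 next
  fix k assume k: "k \<in> ?K - {\<zero>\<^bsub>Q\<^esub>}"
  then obtain b where b: "b \<in> ?K" "k \<otimes>\<^bsub>Q\<^esub> b = \<one>\<^bsub>Q\<^esub>" using inverse_in_subring[OF Kc one_K mult_K] by blast
  then have "inv\<^bsub>Q\<^esub> k = b" using Q.comm_inv_char[of k b] k Kc by blast
  then show "inv\<^bsub>Q\<^esub> k \<in> ?K" using b by simp
 qed
 have rd: "residue_degree A B P = ring.dim Q ?K (carrier Q)" by (simp add: residue_degree_def Let_def)
 have "card (carrier Q) = card ?K ^ ring.dim Q ?K (carrier Q)" by (rule Q.card_eq_power_dim[OF K finite_Q]) (use Kc in auto)
 then show "card (x ` B) = card (x ` A) ^ residue_degree A B P" unfolding rd cA using cB by (simp add: carrier_Q)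
 show "finite (x ` B)"
 proof -
  have "card (coset ` B) ~= 0" using finite_Q[unfolded carrier_Q] sring_1[OF B] by auto
  then show ?thesis unfolding cB by (metis card.infinite)
 qed
qed

end


section \<open>Points with values in the algebraic closure of the constant field\<close>

lemma synthetic_div_over:
 assumes B: "sring B" and "p \<in> poly_over B" "s \<in> B"
 shows "synthetic_div p s \<in> poly_over B"
 using assms(2)
proof (induction p)
 case 0
 then show ?case by simp
next
 case (pCons a p)
 have p: "p \<in> poly_over B" using pCons.prems poly_overD[OF pCons.prems, of "Suc _"] by (simp add: poly_over_def)
 then have "poly p s \<in> B" using sring_poly[OF B] assms(3) by blast
 then show ?case using pCons.IH[OF p] by (simp add: poly_over_def coeff_pCons split: nat.split)
qed

lemma roots_mod_prime:
 fixes B P :: "'r::idom set"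
 assumes B: "sring B" and P: "prime_set B P"
  and "h \<in> poly_over B" "lead_coeff h = 1" "finite S" "S <= B" "!!s. s \<in> S ==> poly h s \<in> P"
  "!!s s'. s \<in> S ==> s' \<in> S ==> s ~= s' ==> s - s' \<notin> P"
 shows "card S <= degree h"
 using assms(3-)
proof (induction "degree h" arbitrary: h S)
 case 0
 then obtain c where "h = [:c:]" by (metis degree_eq_zeroE)
 then have "h = 1" using 0 by (simp add: one_pCons)
 then have "S = {}" using 0 P by (auto simp: prime_set_def)
 then show ?case by simp
next
 case (Suc n)
 show ?case
 proof (cases "S = {}")
  case False
  then obtain s where s: "s \<in> S" by blast
  define g where "g = synthetic_div h s"
  have e: "[:- s, 1:] * g + [:poly h s:] = h" unfolding g_def by (rule synthetic_div_correct')
  have dg: "degree g = n" unfolding g_def using Suc(2) by (simp add: degree_synthetic_div)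
  have sB: "s \<in> B" using s Suc.prems by blast
  have g: "g \<in> poly_over B" unfolding g_def by (rule synthetic_div_over[OF B Suc.prems(1) sB])
  have "coeff h (Suc n) = coeff g n" using e dg coeff_eq_0[of g "Suc n"]
   by (metis (no_types, lifting) Suc_eq_plus1 add.right_neutral add_0 coeff_add coeff_pCons_Suc coeff_0 mult_pCons_left mult_1 smult_1_left mult_zero_left smult_0_left coeff_smult mult_zero_right pCons_0_0 lessI)
  then have lg: "lead_coeff g = 1" using Suc dg by simp
  have "poly g s' \<in> P" if s': "s' \<in> S - {s}" for s'
  proof -
   have "(s' - s) * poly g s' = poly h s' - poly h s" using arg_cong[OF e, of "%p. poly p s'"] by (simp add: algebra_simps)
   also have "... \<in> P" using Suc.prems(5) s s' P unfolding prime_set_def by blast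
   finally have "(s' - s) * poly g s' \<in> P" .
   moreover have "s' - s \<in> B" "poly g s' \<in> B" using s' sB Suc.prems(4) sring_diff[OF B] sring_poly[OF B g] by auto
   moreover have "s' - s \<notin> P" using Suc.prems(6) s s' by blast
   ultimately show ?thesis using P unfolding prime_set_def by blast
  qed
  then have "card (S - {s}) <= degree g" using Suc.prems by (intro Suc.hyps(1)[OF dg[symmetric] g lg]) auto
  then show ?thesis using Suc(2) dg s Suc.prems(3) by simp
 qed simp
qed

text \<open>The points of Spec of the integral closure with values in the algebraic closure of k.
  The value 0 off the integral closure makes equality of functions the equality of points.\<close>

definition pts :: "('k::{field,finite} poly => 'e::field) => 'e set => ('e => 'k alg_closure) set" where
 "pts e N = {x. hom_on (intcl e N) x & (ALL z. z \<notin> intcl e N --> x z = 0) & (ALL c. x (e [:c:]) = to_ac c)}"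

abbreviation pfrob :: "('e => 'k::{field,finite} alg_closure) => 'e => 'k alg_closure" where
 "pfrob x \<equiv> frob o x"

lemma pfrob_pow: "(pfrob ^^ n) x = (frob ^^ n) o x"
 by (induction n) (simp_all add: comp_assoc)

text \<open>The common bound D on the degrees of integral equations is what makes residue rings
  finite.\<close>

locale bchart = chart e N for e :: "'k::{field,finite} poly => 'e::field" and N +
 fixes D :: nat
 assumes bounded: "!!z. z \<in> intcl e N ==> EX p. lead_coeff p = 1 & degree p <= D & poly (map_poly e p) z = 0"
begin

text \<open>Coefficients may be reduced modulo \<pi>, so every element of B is modulo P a root of
  one of finitely many monic polynomials of degree at most D, and each of these has finitely many
  roots in the domain B/P.\<close>

lemma ex_finite_prime:
 assumes P: "prime_set B P" and \<pi>: "\<pi> ~= 0" "e \<pi> \<in> P"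
 shows "EX R. finite_prime B P R"
proof -
 define d where "d = degree \<pi>"
 have mP: "!!a b. a \<in> B ==> b \<in> P ==> a * b \<in> P" and aP: "!!a b. a \<in> P ==> b \<in> P ==> a - b \<in> P" and P1: "1 \<notin> P"
  and P0: "0 \<in> P" and PB: "P <= B"
  using P unfolding prime_set_def by auto
 have d: "0 < d"
 proof (rule ccontr)
  assume "\<not> 0 < d"
  then obtain c where c: "\<pi> = [:c:]" unfolding d_def by (auto elim: degree_eq_zeroE)
  have "e [:inverse c:] * e \<pi> \<in> P" using mP[OF e_B \<pi>(2)] .
  moreover have "[:inverse c:] * \<pi> = 1" using \<pi>(1) c by (simp add: one_pCons)
  then have "e [:inverse c:] * e \<pi> = 1" by (metis hom_mult hom_one)
  ultimately show False using P1 by simp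
 qed
 define Hs where "Hs = {h \<in> box (%i. if i < Suc D then {a :: 'k poly. deg_less d a} else {0}). lead_coeff h = 1}"
 have "finite (box (%i. if i < Suc D then {a :: 'k poly. deg_less d a} else {0}))" by (rule box_card(1)[of "Suc D"]) (use card_deg_less(1)[where 'k='k] in auto)
 then have finH: "finite Hs" unfolding Hs_def by simp
 define rt where "rt = (%h. {b \<in> B. poly (map_poly e h) b \<in> P})"
 define rep where "rep = (%b. SOME r. r \<in> B & b - r \<in> P)"
 have rep: "rep b \<in> B & b - rep b \<in> P" if "b \<in> B" for b unfolding rep_def by (rule someI[of "%r. r \<in> B & b - r \<in> P" b]) (use that P0 in simp)
 have rep_eq: "rep b = rep b'" if bb: "b - b' \<in> P" for b b'
 proof -
  have e: "(b - r) - (b - b') = b' - r" "(b' - r) - (0 - (b - b')) = b - r" for r by (simp_all add: algebra_simps)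
  have "b' - r \<in> P" if "b - r \<in> P" for r using aP[OF that bb] by (simp only: e)
  moreover have "b - r \<in> P" if "b' - r \<in> P" for r using aP[OF that aP[OF P0 bb]] by (simp only: e)
  ultimately have "b - r \<in> P \<longleftrightarrow> b' - r \<in> P" for r by (rule_tac iffI)
  then show ?thesis by (simp only: rep_def)
 qed
 have inc: "s - s' \<notin> P" if s: "s \<in> rep ` B" "s' \<in> rep ` B" "s ~= s'" for s s'
 proof
  assume p: "s - s' \<in> P"
  obtain b b' where b: "b \<in> B" "b' \<in> B" "s = rep b" "s' = rep b'" using s by blast
  have "b - s \<in> P" "b' - s' \<in> P" using rep b by auto
  then have "(b - s) - (0 - (s - s')) - (b' - s') \<in> P" using aP P0 p by metis
  then have "b - b' \<in> P" by simp
  then show False using rep_eq b s(3) by metis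
 qed
 have over: "map_poly e h \<in> poly_over B" for h using e_B by (simp add: poly_over_def coeff_map_poly)
 have fin: "finite (rep ` B \<inter> rt h)" if h: "h \<in> Hs" for h
 proof -
  have lh: "lead_coeff (map_poly e h) = 1"
  proof -
   have "coeff (map_poly e h) (degree h) = 1" using h by (simp add: Hs_def coeff_map_poly)
   then show ?thesis using degree_map_poly_le[of e h] le_degree[of "map_poly e h" "degree h"] by fastforce
  qed
  have "card S <= degree (map_poly e h)" if S: "S <= rep ` B \<inter> rt h" "finite S" for S
  proof (rule roots_mod_prime[OF sring_B P over lh S(2)])
   show "s - s' \<notin> P" if "s \<in> S" "s' \<in> S" "s ~= s'" for s s' by (rule inc) (use S(1) that in auto)
  qed (use S(1) in \<open>auto simp: rt_def\<close>)
  then show ?thesis using finite_if_finite_subsets_card_bdd by blast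
 qed
 have "EX h:Hs. b \<in> rt h" if b: "b \<in> B" for b
 proof -
  obtain p where p: "lead_coeff p = 1" "degree p <= D" "poly (map_poly e p) b = 0" using bounded[OF b] by blast
  define h where "h = map_poly (%a. a mod \<pi>) p"
  have c: "coeff h i = coeff p i mod \<pi>" for i unfolding h_def by (simp add: coeff_map_poly)
  have m1: "(1 :: 'k poly) mod \<pi> = 1" using d by (simp add: mod_poly_less d_def)
  have ch: "coeff h (degree p) = 1" using p(1) m1 by (simp add: c)
  then have "degree h = degree p" unfolding h_def using degree_map_poly_le le_degree by (metis antisym zero_neq_one)
  then have "lead_coeff h = 1" using ch by simp
  moreover have "deg_less d (coeff h i)" for i using degree_mod_less[OF \<pi>(1), of "coeff p i"] d by (auto simp: c deg_less_iff d_def)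
  moreover have "coeff h i = 0" if "\<not> i < Suc D" for i using that p(2) by (simp add: c coeff_eq_0)
  ultimately have hH: "h \<in> Hs" by (simp add: Hs_def box_def)
  define g where "g = map_poly (%a. a div \<pi>) p"
  have pq: "p = smult \<pi> g + h" by (rule poly_eqI) (simp add: c g_def coeff_map_poly)
  have "map_poly e p = smult (e \<pi>) (map_poly e g) + map_poly e h" by (subst pq) (rule poly_eqI, simp add: coeff_map_poly hom_add hom_mult)
  then have "poly (map_poly e p) b = e \<pi> * poly (map_poly e g) b + poly (map_poly e h) b" by simp
  then have "poly (map_poly e h) b = 0 - poly (map_poly e g) b * e \<pi>" using p(3) by (simp add: algebra_simps eq_neg_iff_add_eq_0)
  also have "... \<in> P" using aP[OF P0 mP[OF sring_poly[OF sring_B over b] \<pi>(2)]] .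
  finally show ?thesis using b hH by (auto simp: rt_def)
 qed
 then have "rep ` B <= (\<Union>h\<in>Hs. rep ` B \<inter> rt h)" using rep by blast
 then have "finite (rep ` B)" by (rule finite_subset) (use finH fin in blast)
 then have "finite_prime B P (rep ` B)" by unfold_locales (use sring_B P rep in auto)
 then show ?thesis by blast
qed

definition at_gen :: "'e => 'k poly => 'e" where
 "at_gen \<eta> f = poly (map_poly (%c. e [:c:]) f) \<eta>"

lemma const_hom: "field_hom (%c. e [:c:])"
proof
 show "e [:x + y:] = e [:x:] + e [:y:]" for x y using hom_add[of "[:x:]" "[:y:]"] by simp
 show "e [:x * y:] = e [:x:] * e [:y:]" for x y
 proof -
  have "[:x * y:] = [:x:] * [:y:]" by simp
  then show ?thesis by (simp only: hom_mult)
 qed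
qed (simp_all flip: one_pCons)

lemma at_gen_hom: "comm_ring_hom (at_gen \<eta>)"
 using evk_hom[OF const_hom, of \<eta>] unfolding at_gen_def[abs_def] evk_def[abs_def] .

sublocale at_gen: comm_ring_hom "at_gen \<eta>" for \<eta> by (rule at_gen_hom)

lemma at_gen_B: "\<eta> \<in> B ==> at_gen \<eta> f \<in> B"
 unfolding at_gen_def using e_B by (intro sring_poly[OF sring_B]) (auto simp: poly_over_def coeff_map_poly)

lemma at_gen_X: "at_gen \<eta> (monom 1 i) = \<eta> ^ i"
 unfolding at_gen_def by (simp add: map_poly_monom poly_monom flip: one_pCons)

lemma pts_at_gen:
 assumes x: "x \<in> pts e N" and g: "\<eta> \<in> B"
 shows "x (at_gen \<eta> f) = ev (x \<eta>) f"
proof -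
 have h: "hom_on B x" using x by (simp add: pts_def)
 have "map_poly (%c. e [:c:]) f \<in> poly_over B" using e_B by (auto simp: poly_over_def coeff_map_poly)
 then have "x (at_gen \<eta> f) = poly (map_poly x (map_poly (%c. e [:c:]) f)) (x \<eta>)" unfolding at_gen_def by (rule hom_on_poly[OF sring_B h _ g])
 also have "map_poly x (map_poly (%c. e [:c:]) f) = map_poly to_ac f" using x by (intro poly_eqI) (simp add: coeff_map_poly coeff_map_poly_hom_on[OF sring_B h] pts_def)
 finally show ?thesis by (simp add: ev_def)
qed

lemma pts_e: "x \<in> pts e N ==> x (e f) = ev (x (e [:0, 1:])) f"
proof -
 have "at_gen (e [:0, 1:]) f = e f"
 proof (induction f)
  case (pCons c f)
  have "e (pCons c f) = e [:c:] + e [:0, 1:] * e f" by (simp flip: hom_add hom_mult)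
  then show ?case using pCons by (simp add: at_gen_def map_poly_pCons_0)
 qed simp
 then show "x \<in> pts e N ==> x (e f) = ev (x (e [:0, 1:])) f" using pts_at_gen[of x "e [:0, 1:]" f] e_B by simp
qed

definition ker :: "('e => 'k alg_closure) => 'e set" where
 "ker x = {b \<in> B. x b = 0}"

lemma prime_ker: "x \<in> pts e N ==> prime_set B (ker x)"
proof -
 assume "x \<in> pts e N"
 then have h: "hom_on B x" by (simp add: pts_def)
 note rules = hom_on_0[OF sring_B h] hom_on_1[OF sring_B h] hom_on_diff[OF sring_B h] hom_on_mult[OF sring_B h]
 show ?thesis unfolding prime_set_def ker_def by (auto simp: rules sring_0[OF sring_B] sring_diff[OF sring_B] sring_mult[OF sring_B])
qed

lemma ker_base:
 assumes "x \<in> pts e N"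
 obtains \<pi> where "\<pi> ~= 0" "e \<pi> \<in> ker x"
proof -
 obtain \<pi> where \<pi>: "!!z. ev z \<pi> = 0 \<longleftrightarrow> z \<in> orb frob (x (e [:0, 1:]))" "lead_coeff \<pi> = 1" using ex_poly_roots_orb by metis
 have "e \<pi> \<in> ker x" unfolding ker_def using pts_e[OF assms, of \<pi>] \<pi>(1) orb_self e_B by auto
 moreover have "\<pi> ~= 0" using \<pi>(2) by auto
 ultimately show ?thesis by (rule that[rotated])
qed

lemma finite_prime_ker:
 assumes "x \<in> pts e N"
 obtains R where "finite_prime B (ker x) R"
proof -
 obtain \<pi> where "\<pi> ~= 0" "e \<pi> \<in> ker x" by (rule ker_base[OF assms])
 then obtain R where "finite_prime B (ker x) R" using ex_finite_prime[OF prime_ker[OF assms]] by blast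
 then show ?thesis by (rule that)
qed

lemma pfrob_pow_pts: "x \<in> pts e N ==> (frob ^^ n) o x \<in> pts e N"
proof -
 assume x: "x \<in> pts e N"
 then have "hom_on B ((frob ^^ n) o x)" by (intro hom_on_comp[OF _ comm_ring_hom_hom_on[OF frob_pow.comm_ring_hom_axioms] subset_UNIV]) (simp add: pts_def)
 then show ?thesis using x by (simp add: pts_def)
qed

text \<open>Both points are determined by their values at a generator \<eta> of the residue field,
  and equal kernels make the two values satisfy the same polynomials over k.\<close>

lemma same_ker_conj:
 assumes x: "x \<in> pts e N" and y: "y \<in> pts e N" and k: "ker x = ker y"
 obtains i where "y = (frob ^^ i) o x"
proof -
 obtain R where "finite_prime B (ker x) R" using finite_prime_ker[OF x] .
 then interpret fp: finite_prime B "ker x" R .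
 obtain \<eta> where g: "\<eta> \<in> B" "!!b. b \<in> B ==> b \<in> ker x \<or> (EX i. b - \<eta> ^ i \<in> ker x)" using fp.ex_generator by blast
 have hx: "hom_on B x" and hy: "hom_on B y" using x y by (auto simp: pts_def)
 have "ev (y \<eta>) f = 0" if "ev (x \<eta>) f = 0" for f
 proof -
  have "at_gen \<eta> f \<in> ker x" unfolding ker_def using that pts_at_gen[OF x g(1), of f] at_gen_B[OF g(1), of f] by simp
  then have "at_gen \<eta> f \<in> ker y" unfolding k .
  then show ?thesis unfolding ker_def using pts_at_gen[OF y g(1), of f] by simp
 qed
 then obtain i where i: "y \<eta> = (frob ^^ i) (x \<eta>)" using conj_imp_orb[of "x \<eta>" "y \<eta>"] by (auto simp: orb_in)
 have "y b = ((frob ^^ i) o x) b" for b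
 proof (cases "b \<in> B")
  case True
  show ?thesis
  proof (cases "b \<in> ker x")
   case True
   then show ?thesis using k by (auto simp: ker_def)
  next
   case False
   then obtain j where j: "b - \<eta> ^ j \<in> ker x" using g(2) True by blast
   have p: "\<eta> ^ j \<in> B" by (rule sring_power[OF sring_B g(1)])
   have "b - \<eta> ^ j \<in> ker y" using j unfolding k .
   then have "x b = x \<eta> ^ j" "y b = y \<eta> ^ j" using j hom_on_diff[OF sring_B hx True p] hom_on_diff[OF sring_B hy True p]
     hom_on_power[OF sring_B hx g(1), of j] hom_on_power[OF sring_B hy g(1), of j] by (auto simp: ker_def)
   then show ?thesis using i by (simp add: frob_pow.hom_power)
  qed
 qed (use x y in \<open>simp add: pts_def\<close>)
 then show ?thesis using that by blast
qed

text \<open>With d the minimal polynomial of \<eta> modulo P over k, send \<eta> to a root \<xi> of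
  d, and send b to f(\<xi>) whenever b is f(\<eta>) modulo P.\<close>

lemma point_of_prime:
 assumes P: "prime_set B P" and \<pi>: "\<pi> ~= 0" "e \<pi> \<in> P"
 obtains x where "x \<in> pts e N" "ker x = P"
proof -
 obtain R where "finite_prime B P R" using ex_finite_prime[OF assms] by blast
 then interpret fp: finite_prime B P R .
 have mP: "!!a b. a \<in> B ==> b \<in> P ==> a * b \<in> P" and aP: "!!a b. a \<in> P ==> b \<in> P ==> a - b \<in> P" and P1: "1 \<notin> P"
  and P0: "0 \<in> P" and PB: "P <= B" and Pp: "!!a b. a \<in> B ==> b \<in> B ==> a * b \<in> P ==> a \<in> P \<or> b \<in> P"
  using P unfolding prime_set_def by auto
 have aP': "a + b \<in> P" if "a \<in> P" "b \<in> P" for a b using aP[OF that(1) aP[OF P0 that(2)]] by simp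
 obtain \<eta> where g: "\<eta> \<in> B" "!!b. b \<in> B ==> b \<in> P \<or> (EX i. b - \<eta> ^ i \<in> P)" using fp.ex_generator by blast
 define I where "I = (%f. at_gen \<eta> f \<in> P)"
 have I_ideal: "I (a - c * b)" if "I a" "I b" for a b c using that aP mP at_gen_B[OF g(1)] unfolding I_def by (simp add: at_gen.hom_minus at_gen.hom_mult)
 obtain d0 where d0: "I d0" "d0 ~= 0"
 proof -
  have "finite (range (%i. fp.coset (\<eta> ^ i)))" by (rule finite_subset[OF _ fp.finite_Q]) (use fp.carrier_Q sring_power[OF sring_B g(1)] in auto)
  then have "\<not> inj (%i. fp.coset (\<eta> ^ i))" using finite_imageD infinite_UNIV_nat by blast
  then obtain i j :: nat where ij: "i ~= j" "fp.coset (\<eta> ^ i) = fp.coset (\<eta> ^ j)" unfolding inj_def by blast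
  then have "\<eta> ^ i - \<eta> ^ j \<in> P" using fp.qcoset_eq sring_power[OF sring_B g(1)] by blast
  then have "I (monom 1 i - monom 1 j)" unfolding I_def by (simp add: at_gen.hom_minus at_gen_X)
  moreover have "monom (1::'k) i - monom 1 j ~= 0" using ij(1) by (metis coeff_diff coeff_0 coeff_monom diff_zero zero_neq_one)
  ultimately show ?thesis by (rule that)
 qed
 obtain d where d: "I d" "lead_coeff d = 1" "ALL b. I b --> d dvd b" by (rule euclid_ideal[of I d0, OF d0]) (use I_ideal in blast)+
 have "degree d ~= 0"
 proof
  assume "degree d = 0"
  then have "d = 1" using d(2) by (auto elim!: degree_eq_zeroE simp: one_pCons)
  then show False using d(1) P1 by (simp add: I_def)
 qed
 then have "0 < degree (map_poly to_ac d)" by simp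
 then obtain \<xi> where xi: "ev \<xi> d = 0" unfolding ev_def using alg_closed_imp_poly_has_root by blast
 have I1: "ev \<xi> f = 0" if "I f" for f using d(3) that xi by (auto simp: ev.hom_mult elim!: dvdE)
 \<comment> \<open>The minimal polynomial d' of \<xi> divides d. As P is prime, d' or the cofactor
   lies in the ideal I generated by d; the cofactor has too small a degree.\<close>
 have I2: "I f" if f: "ev \<xi> f = 0" for f
 proof -
  have dnz: "d ~= 0" using d(2) by auto
  obtain d' where d': "ev \<xi> d' = 0" "lead_coeff d' = 1" "ALL b. ev \<xi> b = 0 --> d' dvd b"
   by (rule euclid_ideal[of "%f. ev \<xi> f = 0", OF xi dnz]) (auto simp: ev.hom_minus ev.hom_mult)
  obtain c where c: "d = d' * c" using d'(3) xi by (auto elim: dvdE)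
  have "at_gen \<eta> d' * at_gen \<eta> c \<in> P" using d(1) unfolding I_def c by (simp add: at_gen.hom_mult)
  then have "I d' \<or> I c" unfolding I_def using Pp at_gen_B[OF g(1)] by blast
  moreover have "\<not> I c"
  proof
   assume "I c"
   then have "d dvd c" using d(3) by blast
   then have "degree d <= degree c" using c dnz by (intro dvd_imp_degree_le) auto
   moreover have "degree d = degree d' + degree c" using c dnz by (simp add: degree_mult_eq)
   ultimately have "d' = 1" using d'(2) by (auto elim!: degree_eq_zeroE simp: one_pCons)
   then show False using d'(1) by simp
  qed
  ultimately have "I d'" by blast
  moreover obtain c' where c': "f = d' * c'" using d'(3) f by (auto elim: dvdE)
  ultimately show ?thesis unfolding I_def c' using mP[OF at_gen_B[OF g(1)], of "at_gen \<eta> d'" c'] by (simp add: at_gen.hom_mult mult.commute)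
 qed
 have ex: "EX f. b - at_gen \<eta> f \<in> P" if b: "b \<in> B" for b using g(2)[OF b] at_gen_X[of \<eta>] by (metis at_gen.hom_zero diff_zero)
 define x where "x = (%b. if b \<in> B then ev \<xi> (SOME f. b - at_gen \<eta> f \<in> P) else 0)"
 have x: "x b = ev \<xi> f" if "b \<in> B" "b - at_gen \<eta> f \<in> P" for b f
 proof -
  define f' where "f' = (SOME f. b - at_gen \<eta> f \<in> P)"
  have "b - at_gen \<eta> f' \<in> P" unfolding f'_def using someI[of "%f. b - at_gen \<eta> f \<in> P"] that(2) by blast
  then have "(b - at_gen \<eta> f) - (b - at_gen \<eta> f') \<in> P" using aP that(2) by blast
  then have "I (f' - f)" unfolding I_def by (simp add: at_gen.hom_minus)
  then have "ev \<xi> (f' - f) = 0" by (rule I1)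
  then show ?thesis using that(1) unfolding x_def f'_def by (simp add: ev.hom_minus)
 qed
 have "hom_on B x" unfolding hom_on_def
 proof (intro conjI ballI)
  show "x 1 = 1" using x[OF sring_1[OF sring_B], of 1] P0 by simp
  fix a b assume ab: "a \<in> B" "b \<in> B"
  obtain fa fb where f: "a - at_gen \<eta> fa \<in> P" "b - at_gen \<eta> fb \<in> P" using ex ab by blast
  have "(a + b) - at_gen \<eta> (fa + fb) = (a - at_gen \<eta> fa) + (b - at_gen \<eta> fb)" by (simp add: at_gen.hom_add)
  then have "(a + b) - at_gen \<eta> (fa + fb) \<in> P" using aP'[OF f] by (simp only:)
  then show "x (a + b) = x a + x b" using x[OF sring_add[OF sring_B ab]] x[OF ab(1) f(1)] x[OF ab(2) f(2)] by (simp add: ev.hom_add)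
  have "a * b - at_gen \<eta> (fa * fb) = b * (a - at_gen \<eta> fa) + at_gen \<eta> fa * (b - at_gen \<eta> fb)" by (simp add: at_gen.hom_mult algebra_simps)
  then have "a * b - at_gen \<eta> (fa * fb) \<in> P" using aP'[OF mP[OF ab(2) f(1)] mP[OF at_gen_B[OF g(1)] f(2)]] by (simp only:)
  then show "x (a * b) = x a * x b" using x[OF sring_mult[OF sring_B ab]] x[OF ab(1) f(1)] x[OF ab(2) f(2)] by (simp add: ev.hom_mult)
 qed
 moreover have "x (e [:c:]) = to_ac c" for c
 proof -
  have "at_gen \<eta> [:c:] = e [:c:]" unfolding at_gen_def by (cases "c = 0") simp_all
  then show ?thesis using x[OF e_B, of "[:c:]" "[:c:]"] P0 by simp
 qed
 ultimately have xp: "x \<in> pts e N" by (simp add: pts_def x_def)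
 have "x b = 0 \<longleftrightarrow> b \<in> P" if b: "b \<in> B" for b
 proof -
  obtain f where f: "b - at_gen \<eta> f \<in> P" using ex[OF b] by blast
  have g1: "b \<in> P" if "at_gen \<eta> f \<in> P" using aP'[OF f that] by simp
  have g2: "at_gen \<eta> f \<in> P" if "b \<in> P" using aP[OF that f] by simp
  have "ev \<xi> f = 0 \<longleftrightarrow> at_gen \<eta> f \<in> P" using I1[of f] I2[of f] unfolding I_def by blast
  then show ?thesis unfolding x[OF b f] using g1 g2 by blast
 qed
 then have "ker x = P" unfolding ker_def using PB by auto
 with xp show ?thesis by (rule that)
qed

text \<open>The ideal generated by \<pi> is proper because 1/\<pi> is not integral; Zorn's lemma
  gives a maximal ideal above it. The resulting point lies over a conjugate of t, which a power of
  Frobenius moves to t.\<close>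

lemma ex_point_over:
 obtains x where "x \<in> pts e N" "x (e [:0, 1:]) = t"
proof -
 obtain \<pi> where \<pi>: "!!z. ev z \<pi> = 0 \<longleftrightarrow> z \<in> orb frob t" "lead_coeff \<pi> = 1" "degree \<pi> = fper t" using ex_poly_roots_orb[of t] by blast
 define A where "A = {I. I <= B & e \<pi> \<in> I & (ALL a:I. ALL b:I. a - b \<in> I) & (ALL a:B. ALL b:I. a * b \<in> I) & 1 \<notin> I}"
 define I0 where "I0 = (%b. b * e \<pi>) ` B"
 have "I0 \<in> A" unfolding A_def
 proof (intro CollectI conjI ballI)
  show "I0 <= B" unfolding I0_def using sring_mult[OF sring_B] e_B by auto
  show "e \<pi> \<in> I0" unfolding I0_def using sring_1[OF sring_B] by (intro image_eqI[of _ _ 1]) auto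
  show "a - b \<in> I0" if "a \<in> I0" "b \<in> I0" for a b using that sring_diff[OF sring_B] unfolding I0_def by (auto simp flip: left_diff_distrib)
  show "a * b \<in> I0" if "a \<in> B" "b \<in> I0" for a b using that sring_mult[OF sring_B] unfolding I0_def by (auto simp flip: mult.assoc)
  show "1 \<notin> I0"
  proof
   assume "1 \<in> I0"
   then obtain b where b: "b \<in> B" "b * e \<pi> = 1" unfolding I0_def by auto
   then have "e \<pi> * b = e 1" by (simp add: mult.commute)
   then have "b \<in> range e" using B_fraction[OF b(1), of \<pi> 1] \<pi>(2) by force
   then obtain c where "e (c * \<pi>) = e 1" using b(2) by (auto simp: hom_mult)
   then have "c * \<pi> = 1" by (simp only: e_inj)
   then have "degree \<pi> = 0" by (metis degree_1 degree_mult_eq_0 is_unit_iff_degree mult_not_zero one_neq_zero dvd_triv_right)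
   then show False using \<pi>(3) per_pos_fixed(1)[OF periodic_frob, of t] by simp
  qed
 qed
 moreover have "\<Union>C \<in> A" if C: "C ~= {}" "subset.chain A C" for C
 proof -
  have CA: "!!I. I \<in> C ==> I \<in> A" and ch: "!!I I'. I \<in> C ==> I' \<in> C ==> I <= I' \<or> I' <= I" using C(2) unfolding subset.chain_def by auto
  have "a - b \<in> \<Union>C" if "a \<in> \<Union>C" "b \<in> \<Union>C" for a b
  proof -
   obtain I I' where I: "I \<in> C" "a \<in> I" "I' \<in> C" "b \<in> I'" using \<open>a \<in> \<Union>C\<close> \<open>b \<in> \<Union>C\<close> by blast
   define I'' where "I'' = (if I <= I' then I' else I)"
   have "I'' \<in> C" "a \<in> I''" "b \<in> I''" using ch[OF I(1,3)] I by (auto simp: I''_def)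
   then have "a - b \<in> I''" using CA[of I''] by (simp add: A_def)
   then show ?thesis using \<open>I'' \<in> C\<close> by blast
  qed
  moreover have "e \<pi> \<in> \<Union>C" "\<Union>C \<subseteq> B" "1 \<notin> \<Union>C" "ALL a:B. ALL b:\<Union>C. a * b \<in> \<Union>C" using C(1) CA unfolding A_def by blast+
  ultimately show ?thesis unfolding A_def by blast
 qed
 ultimately obtain M where M: "M \<in> A" "!!I. I \<in> A ==> M <= I ==> I = M" using subset_Zorn_nonempty[of A] by blast
 have MB: "M <= B" and Md: "!!a b. a \<in> M ==> b \<in> M ==> a - b \<in> M" and Mm: "!!a b. a \<in> B ==> b \<in> M ==> a * b \<in> M"
  and M1: "1 \<notin> M" and Mp: "e \<pi> \<in> M" using M(1) unfolding A_def by auto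
 have M0: "0 \<in> M" using Md[OF Mp Mp] by simp
 have Mpr: "a \<in> M \<or> b \<in> M" if ab: "a \<in> B" "b \<in> B" "a * b \<in> M" for a b
 proof (rule ccontr)
  assume c: "\<not> (a \<in> M \<or> b \<in> M)"
  define I where "I = (%(m, c). m + a * c) ` (M \<times> B)"
  have I: "m + a * c \<in> I" if "m \<in> M" "c \<in> B" for m c unfolding I_def using that by force
  have Ie: "EX m:M. EX c:B. u = m + a * c" if "u \<in> I" for u using that unfolding I_def by auto
  have aI: "a \<in> I" using I[OF M0 sring_1[OF sring_B]] by simp
  have MI: "M <= I" using I[OF _ sring_0[OF sring_B]] by auto
  have IA: "I \<in> A" if n1: "1 \<notin> I" unfolding A_def
  proof (intro CollectI conjI ballI)
   show "I <= B" unfolding I_def using MB sring_add[OF sring_B] sring_mult[OF sring_B ab(1)] by auto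
   show "e \<pi> \<in> I" using Mp MI by blast
   show "1 \<notin> I" by (rule n1)
   fix u v assume "v \<in> I"
   then obtain m c where mc: "m \<in> M" "c \<in> B" "v = m + a * c" using Ie by blast
   { assume "u \<in> I"
    then obtain m' c' where mc': "m' \<in> M" "c' \<in> B" "u = m' + a * c'" using Ie by blast
    have "(m' - m) + a * (c' - c) \<in> I" by (rule I[OF Md[OF mc'(1) mc(1)] sring_diff[OF sring_B mc'(2) mc(2)]])
    then show "u - v \<in> I" unfolding mc(3) mc'(3) by (simp add: algebra_simps) }
   { assume u: "u \<in> B"
    have "u * m + a * (u * c) \<in> I" by (rule I[OF Mm[OF u mc(1)] sring_mult[OF sring_B u mc(2)]])
    then show "u * v \<in> I" unfolding mc(3) by (simp add: algebra_simps) }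
  qed
  have "1 \<in> I"
  proof (rule ccontr)
   assume "1 \<notin> I"
   then have "I = M" using M(2)[OF IA MI] by blast
   then show False using aI c by blast
  qed
  then have "EX m:M. EX c:B. 1 = m + a * c" by (rule Ie)
  then obtain m c' where mc: "m \<in> M" "c' \<in> B" "1 = m + a * c'" unfolding I_def by blast
  have "b = b * m - (0 - c' * (a * b))" using arg_cong[OF mc(3), of "%z. b * z"] by (simp add: algebra_simps)
  also have "... \<in> M" by (rule Md[OF Mm[OF ab(2) mc(1)] Md[OF M0 Mm[OF mc(2) ab(3)]]])
  finally show False using c by blast
 qed
 have MP: "prime_set B M" unfolding prime_set_def by (intro conjI ballI impI MB M0 M1) (rule Md Mm Mpr; assumption)+
 have "\<pi> ~= 0" using \<pi>(2) by auto
 then obtain y where y: "y \<in> pts e N" "ker y = M" using point_of_prime[OF MP _ Mp] by blast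
 have "ev (y (e [:0, 1:])) \<pi> = 0" using pts_e[OF y(1), of \<pi>] Mp y(2) unfolding ker_def by auto
 then have "y (e [:0, 1:]) \<in> orb frob t" using \<pi>(1) by blast
 then have "t \<in> orb frob (y (e [:0, 1:]))" using orb_eqI[OF periodic_frob] orb_self by metis
 then obtain i where "t = (frob ^^ i) (y (e [:0, 1:]))" by (auto simp: orb_in)
 then show ?thesis using that[OF pfrob_pow_pts[OF y(1), of i]] by simp
qed

end


section \<open>Points and the Galois group\<close>

lemma map_prod_linear_invariant:
 assumes B: "sring B" and h: "hom_on B h" and w: "!!i. i \<in> I ==> w i \<in> B" and \<pi>: "bij_betw \<pi> I I"
  and hw: "!!i. i \<in> I ==> h (w i) = w (\<pi> i)"
 shows "map_poly h (PROD i:I. [:- w i, 1:]) = (PROD i:I. [:- w i, 1:])"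
proof -
 have "map_poly h (PROD i:I. [:- w i, 1:]) = (PROD i:I. [:- h (w i), 1:])" by (rule map_poly_prod_linear[OF B h w])
 also have "... = (PROD i:I. [:- w (\<pi> i), 1:])" by (rule prod.cong) (simp_all add: hw)
 also have "... = (PROD i:I. [:- w i, 1:])" by (rule prod.reindex_bij_betw[OF \<pi>])
 finally show ?thesis .
qed

lemma prod_linear_over:
 assumes "sring B" "!!i. i \<in> I ==> w i \<in> B"
 shows "(PROD i:I. [:- w i, 1:]) \<in> poly_over B"
 using assms by (intro sring_prod[OF sring_poly_over[OF assms(1)]] linear_poly_over[OF assms(1)]) auto

text \<open>
 Applying the hypothesis to \<open>p = \<Sum> b\<^sub>i U\<^sup>i\<close>, where \<open>b\<^sub>i\<close> separates \<open>y\<close> from the \<open>i\<close>-th of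
 the given homomorphisms, avoids any approximation theorem.
\<close>
lemma hom_separation:
 fixes y :: "'b::comm_ring_1 => 'o::idom"
 assumes B: "sring B" and y: "hom_on B y" and H: "finite H" and z: "!!s. s \<in> H ==> hom_on B (z s)"
  and prod: "!!p. p \<in> poly_over B ==> (PROD s:H. map_poly y p - map_poly (z s) p) = 0"
 shows "EX s:H. ALL b:B. y b = z s b"
proof (rule ccontr)
 assume "\<not> (EX s:H. ALL b:B. y b = z s b)"
 then obtain b where b: "!!s. s \<in> H ==> b s \<in> B & y (b s) ~= z s (b s)" by metis
 obtain h where h: "bij_betw h {..<card H} H" using ex_bij_betw_nat_finite[OF H] by (auto simp: atLeast0LessThan)
 define p where "p = (\<Sum>i<card H. monom (b (h i)) i)"
 have c: "coeff p i = (if i < card H then b (h i) else 0)" for i unfolding p_def by (simp add: coeff_sum sum.delta)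
 have "p \<in> poly_over B" unfolding poly_over_def using b bij_betwE[OF h] sring_0[OF B] by (auto simp: c)
 then obtain s where s: "s \<in> H" "map_poly y p - map_poly (z s) p = 0" using prod[of p] H by (auto simp: prod_zero_iff)
 have "s \<in> h ` {..<card H}" using h s(1) by (simp add: bij_betw_def)
 then obtain i where i: "i < card H" "h i = s" by auto
 have "coeff (map_poly y p) i = coeff (map_poly (z s) p) i" using s(2) by simp
 then have "y (b s) = z s (b s)" using i by (simp add: coeff_map_poly_hom_on[OF B y] coeff_map_poly_hom_on[OF B z[OF s(1)]] c)
 then show False using b[OF s(1)] by blast
qed

text \<open>The embedding \<open>e0\<close> is a parameter because k[T] is embedded in k(T) both by
  T and by 1/T, with the same N and \<iota>.\<close>

locale point_galois = galois_emb \<nu> N \<iota> for \<nu> :: "'f::field => 'e::field" and N and \<iota> :: "'f => 'a::field" +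
 fixes e0 :: "'k::{field,finite} poly => 'f"
 assumes e0: "poly_emb e0" and frac: "!!c. EX a b. b ~= 0 & e0 b * c = e0 a"
begin

sublocale e0: poly_emb e0 by (rule e0)
sublocale \<nu>: field_hom \<nu> by (rule \<nu>)
sublocale \<iota>: field_hom \<iota> by (rule \<iota>)

abbreviation "eN \<equiv> \<nu> o e0"
abbreviation "eK \<equiv> \<iota> o e0"
abbreviation "BN \<equiv> intcl eN N"
abbreviation "BK \<equiv> intcl eK UNIV"

lemma clear_denominators: "EX b q. b ~= 0 & smult (e0 b) p = map_poly e0 q"
proof (induction p)
 case 0
 show ?case by (rule exI[of _ 1], rule exI[of _ 0]) simp
next
 case (pCons c p)
 then obtain b q where q: "b ~= 0" "smult (e0 b) p = map_poly e0 q" by blast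
 obtain a d where d: "d ~= 0" "e0 d * c = e0 a" using frac by blast
 have "smult (e0 (d * b)) (pCons c p) = pCons (e0 (a * b)) (smult (e0 d) (smult (e0 b) p))" using d(2) by (simp add: e0.hom_mult mult.commute mult.left_commute)
 also have "... = map_poly e0 (pCons (a * b) (smult d q))" unfolding q(2) by (rule poly_eqI) (simp add: coeff_pCons coeff_map_poly e0.hom_mult split: nat.split)
 finally show ?case using d(1) q(1) by (intro exI[of _ "d * b"] exI[of _ "pCons (a * b) (smult d q)"]) simp
qed

lemma algebraic_if:
 assumes h: "field_hom h" and p: "p ~= 0" "evk h z p = 0"
 shows "EX q. q ~= 0 & poly (map_poly (h o e0) q) z = 0"
proof -
 interpret h: field_hom h by fact
 obtain b q where q: "b ~= 0" "smult (e0 b) p = map_poly e0 q" using clear_denominators by blast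
 have "map_poly (h o e0) q = map_poly h (map_poly e0 q)" by (simp add: map_poly_map_poly)
 also have "... = smult (h (e0 b)) (map_poly h p)" unfolding q(2)[symmetric] by (rule poly_eqI) (simp add: coeff_map_poly h.hom_mult)
 finally have "poly (map_poly (h o e0) q) z = 0" using p(2) by (simp add: evk_def)
 moreover have "q ~= 0" using q p(1) by auto
 ultimately show ?thesis by blast
qed

lemma poly_emb_comp: "field_hom h ==> poly_emb (h o e0)"
proof -
 assume "field_hom h"
 then interpret h: field_hom h .
 show ?thesis by unfold_locales (simp_all add: e0.hom_add e0.hom_mult h.hom_add h.hom_mult)
qed

lemma bij_comp_J: "\<mu> \<in> G ==> bij_betw (%j. \<mu> o j) J J"
proof -
 assume s: "\<mu> \<in> G"
 have inj: "inj_on (%j. \<mu> o j) J" using fun.inj_map[OF G_inj[OF s]] by (rule inj_on_subset) simp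
 moreover have "(%j. \<mu> o j) ` J = J" using comp_J[OF s] inj by (intro endo_inj_surj fin_J) auto
 ultimately show ?thesis by (simp add: bij_betw_def)
qed

lemma bij_comp_G: "\<mu> \<in> G ==> bij_betw (%\<tau>. \<mu> o \<tau>) G G"
proof -
 assume s: "\<mu> \<in> G"
 have inj: "inj_on (%j. \<mu> o j) G" using fun.inj_map[OF G_inj[OF s]] by (rule inj_on_subset) simp
 moreover have "(%j. \<mu> o j) ` G = G" using G_comp[OF s] inj by (intro endo_inj_surj fin_G) auto
 ultimately show ?thesis by (simp add: bij_betw_def)
qed

lemma J_evk: "j \<in> J ==> j (evk \<iota> z p) = evk \<nu> (j z) p"
proof -
 assume j: "j \<in> J"
 interpret j: field_hom j by (rule J_hom[OF j])
 show ?thesis by (rule hom_on_evk[OF \<iota> sring_UNIV]) (simp_all add: J_base[OF j] comm_ring_hom_hom_on[OF j.comm_ring_hom_axioms])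
qed

sublocale N: chart eN N
proof (intro chart.intro chart_axioms.intro poly_emb_comp[OF \<nu>] N)
 show "range eN <= N" using base_N by auto
 fix z assume z: "z \<in> N"
 obtain p where p: "conj_poly z = map_poly \<nu> p" using fixed_poly[OF conj_poly_over[OF z] map_conj_poly[OF z]] .
 have "evk \<nu> z p = 0" unfolding evk_def p[symmetric] using poly_conj_poly conj_self by blast
 moreover have "p ~= 0"
 proof
  assume "p = 0"
  then have "conj_poly z = 0" using p by simp
  then show False unfolding conj_poly_def using conj_finite[of z] by (auto simp: prod_zero_iff)
 qed
 ultimately show "EX p. p ~= 0 & poly (map_poly eN p) z = 0" using algebraic_if[OF \<nu>] by blast
qed

sublocale K: poly_emb eK by (rule poly_emb_comp[OF \<iota>])

lemma G_eN: "\<mu> \<in> G ==> \<mu> (eN a) = eN a" and J_eK: "j \<in> J ==> j (eK a) = eN a"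
 by (simp_all add: G_base J_base)

lemma G_BN:
 assumes s: "\<mu> \<in> G" and z: "z \<in> BN"
 shows "\<mu> z \<in> BN"
proof -
 obtain p where p: "lead_coeff p = 1" "poly (map_poly eN p) z = 0" and zN: "z \<in> N" using z unfolding intcl_def by blast
 have "map_poly eN p \<in> poly_over N" using base_N by (auto simp: poly_over_def coeff_map_poly)
 then have "\<mu> (poly (map_poly eN p) z) = poly (map_poly \<mu> (map_poly eN p)) (\<mu> z)" by (rule hom_on_poly[OF sN G_hom[OF s] _ zN])
 also have "map_poly \<mu> (map_poly eN p) = map_poly eN p" by (rule poly_eqI) (simp add: coeff_map_poly coeff_map_poly_hom_on[OF sN G_hom[OF s]] G_base[OF s])
 finally have "poly (map_poly eN p) (\<mu> z) = 0" using p(2) hom_on_0[OF sN G_hom[OF s]] by (simp only:)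
 moreover have "\<mu> z \<in> N" using G_N[OF s] zN by blast
 ultimately show ?thesis using p(1) unfolding intcl_def by blast
qed

lemma J_BK_iff:
 assumes j: "j \<in> J"
 shows "j z \<in> BN \<longleftrightarrow> z \<in> BK"
proof -
 interpret j: field_hom j by (rule J_hom[OF j])
 have "poly (map_poly eN p) (j z) = j (poly (map_poly eK p) z)" for p
 proof -
  have "map_poly eN p = map_poly j (map_poly eK p)" using J_eK[OF j] by (simp add: map_poly_map_poly o_def)
  then show ?thesis by (simp add: j.poly_map_poly)
 qed
 then show ?thesis using J_N[OF j] unfolding intcl_def by simp
qed

lemma fixed_BN:
 assumes "z \<in> BN" "!!\<mu>. \<mu> \<in> G ==> \<mu> z = z"
 shows "z \<in> range eN"
proof -
 have "z \<in> N" using assms(1) N.B_N by blast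
 then obtain c where c: "z = \<nu> c" using fixed assms(2) by blast
 obtain a b where ab: "b ~= 0" "e0 b * c = e0 a" using frac by blast
 then have "eN b * z = eN a" unfolding c by (simp flip: \<nu>.hom_mult)
 then show ?thesis using N.B_fraction[OF assms(1) ab(1)] by blast
qed

lemmas sBN = N.sring_B

lemma fixed_poly_BN:
 assumes P: "P \<in> poly_over BN" and inv: "!!\<mu>. \<mu> \<in> G ==> map_poly \<mu> P = P"
 obtains q where "P = map_poly eN q"
proof -
 have r: "coeff P i \<in> range eN" for i
 proof (rule fixed_BN[OF poly_overD[OF P]])
  fix \<mu> assume s: "\<mu> \<in> G"
  show "\<mu> (coeff P i) = coeff P i" using arg_cong[OF inv[OF s], of "%p. coeff p i"] by (simp add: coeff_map_poly_hom_on[OF sN G_hom[OF s]])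
 qed
 have inj: "inj eN" by (auto intro: injI)
 have "the_inv eN 0 = 0" using the_inv_f_f[OF inj, of 0] by simp
 then have "P = map_poly eN (map_poly (the_inv eN) P)" using r f_the_inv_into_f[OF inj] by (intro poly_eqI) (simp add: coeff_map_poly)
 then show ?thesis by (rule that)
qed

lemma conj_descent:
 assumes w: "w \<in> BN"
 obtains f where "conj_poly w = map_poly eN f" "lead_coeff f = 1" "degree f = card (conj w)" "0 < card (conj w)"
proof -
 have CB: "u \<in> BN" if "u \<in> conj w" for u using that G_BN[OF _ w] by (auto simp: conj_def)
 have wN: "w \<in> N" using w N.B_N by blast
 have over: "conj_poly w \<in> poly_over BN" unfolding conj_poly_def by (rule prod_linear_over[OF sBN CB])
 obtain f where f: "conj_poly w = map_poly eN f" using fixed_poly_BN[OF over map_conj_poly[OF wN]] .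
 have d: "degree f = card (conj w)" using arg_cong[OF f, of degree] by (simp add: degree_map_poly conj_poly_def degree_prod_eq_sum_degree)
 have "lead_coeff (map_poly eN f) = 1" unfolding f[symmetric] conj_poly_def by (simp add: lead_coeff_prod)
 then have "eN (lead_coeff f) = eN 1" by (simp add: degree_map_poly coeff_map_poly)
 then have "lead_coeff f = 1" by (simp only: N.e_inj)
 moreover have "0 < card (conj w)" using conj_finite[of w] conj_self[of w] card_gt_0_iff by blast
 ultimately show ?thesis using that f d by blast
qed

lemma J_product:
 assumes "z \<in> BK"
 shows "EX q. (PROD j:J. [:- j z, 1:]) = map_poly eN q"
proof -
 let ?P = "PROD j:J. [:- j z, 1:]"
 have jz: "j z \<in> BN" if "j \<in> J" for j using J_BK_iff[OF that] assms by simp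
 have over: "?P \<in> poly_over BN" by (rule prod_linear_over[OF sBN jz])
 have inv: "map_poly \<mu> ?P = ?P" if s: "\<mu> \<in> G" for \<mu>
  by (rule map_prod_linear_invariant[OF sBN hom_on_subset[OF G_hom[OF s] N.B_N] jz bij_comp_J[OF s]]) simp_all
 obtain q where "?P = map_poly eN q" by (rule fixed_poly_BN[OF over inv])
 then show ?thesis by (rule exI)
qed

sublocale K: bchart eK UNIV "card J"
proof (intro bchart.intro chart.intro chart_axioms.intro bchart_axioms.intro K.poly_emb_axioms)
 show "sfield UNIV" by (simp add: sfield_def sring_UNIV)
 obtain j where j: "j \<in> J" using J_ne by blast
 interpret j: field_hom j by (rule J_hom[OF j])
 show "EX p. p ~= 0 & poly (map_poly eK p) z = 0" for z
 proof -
  obtain p where p: "p ~= 0" "poly (map_poly eN p) (j z) = 0" using N.algebraic[OF J_N[OF j]] by blast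
  have "map_poly eN p = map_poly j (map_poly eK p)" using J_eK[OF j] by (simp add: map_poly_map_poly o_def)
  then have "j (poly (map_poly eK p) z) = 0" using p(2) by (simp add: j.poly_map_poly)
  then show ?thesis using p(1) by auto
 qed
 show "EX p. lead_coeff p = 1 & degree p <= card J & poly (map_poly eK p) z = 0" if z: "z \<in> BK" for z
 proof -
  obtain q where q: "(PROD j:J. [:- j z, 1:]) = map_poly eN q" using J_product[OF z] by blast
  have d: "degree q = card J" using arg_cong[OF q, of degree] by (simp add: degree_prod_eq_sum_degree degree_map_poly)
  have "lead_coeff (map_poly eN q) = 1" unfolding q[symmetric] by (simp add: lead_coeff_prod)
  then have "eN (lead_coeff q) = eN 1" by (simp add: degree_map_poly coeff_map_poly)
  then have l: "lead_coeff q = 1" by (simp only: N.e_inj)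
  have "poly (map_poly eN q) (j z) = 0" unfolding q[symmetric] using j fin_J by (auto simp: poly_prod intro!: prod_zero bexI[of _ j])
  moreover have "map_poly eN q = map_poly j (map_poly eK q)" using J_eK[OF j] by (simp add: map_poly_map_poly o_def)
  ultimately have "j (poly (map_poly eK q) z) = 0" by (simp only: j.poly_map_poly)
  then have "poly (map_poly eK q) z = 0" by (simp only: j.hom_0_iff)
  then show ?thesis using d l by (intro exI[of _ q]) simp
 qed
qed simp

sublocale N: bchart eN N "card G"
proof (intro bchart.intro bchart_axioms.intro N.chart_axioms)
 fix z assume "z \<in> BN"
 then obtain f where f: "conj_poly z = map_poly eN f" "lead_coeff f = 1" "degree f = card (conj z)" by (rule conj_descent)
 have "poly (map_poly eN f) z = 0" unfolding f(1)[symmetric] using poly_conj_poly conj_self by blast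
 moreover have "degree f <= card G" using f(3) card_image_le[OF fin_G, of "%\<mu>. \<mu> z"] by (simp add: conj_def)
 ultimately show "EX p. lead_coeff p = 1 & degree p <= card G & poly (map_poly eN p) z = 0" using f(2) by blast
qed

abbreviation "T \<equiv> [:0, 1:] :: 'k poly"

lemma pts_N_hom: "x \<in> pts eN N ==> hom_on BN x" and pts_K_hom: "y \<in> pts eK UNIV ==> hom_on BK y"
 by (simp_all add: pts_def)

text \<open>The polynomial Q annihilates p, and y sees its coefficients as x sees those of the
  product of the U - s(p). Hence the product of the differences y(p) - x(s(p)) vanishes for every p,
  and \<open>hom_separation\<close> applies.\<close>

lemma point_factors:
 assumes x: "x \<in> pts eN N" and A: "sring A" and y: "hom_on A y" and M: "finite M"
  and m: "!!s. s \<in> M ==> hom_on A s" "!!s. s \<in> M ==> s ` A <= BN"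
  and Q: "!!p P. p \<in> poly_over A ==> P = (PROD s:M. [:- map_poly s p, 1:]) ==> P \<in> poly_over (poly_over BN)
   ==> EX Q:poly_over (poly_over A). poly Q p = 0 & (ALL i k. y (coeff (coeff Q i) k) = x (coeff (coeff P i) k))"
 shows "EX s:M. ALL b:A. y b = x (s b)"
proof -
 note hx = pts_N_hom[OF x]
 have "EX s:M. ALL b:A. y b = (x o s) b"
 proof (rule hom_separation[OF A y M])
  show "hom_on A (x o s)" if "s \<in> M" for s by (rule hom_on_comp[OF m(1)[OF that] hx m(2)[OF that]])
  fix p assume p: "p \<in> poly_over A"
  define P where "P = (PROD s:M. [:- map_poly s p, 1:])"
  note sp = sring_poly_over[OF sBN] and spA = sring_poly_over[OF A]
  have mp: "map_poly s p \<in> poly_over BN" if "s \<in> M" for s using p m(2)[OF that] by (auto simp: poly_over_def coeff_map_poly_hom_on[OF A m(1)[OF that]])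
  have over: "P \<in> poly_over (poly_over BN)" unfolding P_def by (rule prod_linear_over[OF sp mp])
  obtain Q where Q: "Q \<in> poly_over (poly_over A)" "poly Q p = 0" "!!i k. y (coeff (coeff Q i) k) = x (coeff (coeff P i) k)" using Q[OF p P_def over] by blast
  have "0 = poly (map_poly (map_poly y) Q) (map_poly y p)" using hom_on_poly[OF spA hom_on_map_poly[OF A y] Q(1) p] Q(2) by (simp only: map_poly_0)
  also have "map_poly (map_poly y) Q = map_poly (map_poly x) P" by (intro poly_eqI) (simp add: Q(3) coeff_map_poly_hom_on[OF sp hom_on_map_poly[OF sBN hx]]
     coeff_map_poly_hom_on[OF spA hom_on_map_poly[OF A y]] coeff_map_poly_hom_on[OF sBN hx] coeff_map_poly_hom_on[OF A y])
  also have "... = (PROD s:M. [:- map_poly x (map_poly s p), 1:])" unfolding P_def by (rule map_poly_prod_linear[OF sp hom_on_map_poly[OF sBN hx] mp])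
  also have "poly ... (map_poly y p) = (PROD s:M. map_poly y p - map_poly (x o s) p)" unfolding poly_prod
  proof (rule prod.cong[OF refl])
   fix s assume "s \<in> M"
   then have "map_poly x (map_poly s p) = map_poly (x o s) p" using hom_on_0[OF sBN hx] hom_on_0[OF A m(1)] by (simp add: map_poly_map_poly)
   then show "poly [:- map_poly x (map_poly s p), 1:] (map_poly y p) = map_poly y p - map_poly (x o s) p" by simp
  qed
  finally show "(PROD s:M. map_poly y p - map_poly (x o s) p) = 0" by simp
 qed
 then show ?thesis by simp
qed

lemma prod_conj_fixed:
 assumes A: "sring A" and p: "p \<in> poly_over A" and m: "!!s. s \<in> M ==> hom_on A s" "!!s. s \<in> M ==> s ` A <= BN"
  and s: "\<mu> \<in> G" "bij_betw (%s. \<mu> o s) M M"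
 shows "\<mu> (coeff (coeff (PROD s:M. [:- map_poly s p, 1:]) i) k) = coeff (coeff (PROD s:M. [:- map_poly s p, 1:]) i) k"
proof -
 note sp = sring_poly_over[OF sBN]
 have h: "hom_on BN \<mu>" using hom_on_subset[OF G_hom[OF s(1)] N.B_N] .
 have "map_poly (map_poly \<mu>) (PROD s:M. [:- map_poly s p, 1:]) = (PROD s:M. [:- map_poly s p, 1:])"
 proof (rule map_prod_linear_invariant[OF sp hom_on_map_poly[OF sBN h] _ s(2)])
  show "map_poly s p \<in> poly_over BN" if "s \<in> M" for s using p m(2)[OF that] by (auto simp: poly_over_def coeff_map_poly_hom_on[OF A m(1)[OF that]])
  show "map_poly \<mu> (map_poly s p) = map_poly (\<mu> o s) p" if "s \<in> M" for s using hom_on_0[OF sBN h] hom_on_0[OF A m(1)[OF that]] by (simp add: map_poly_map_poly)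
 qed
 from arg_cong[OF this, of "%P. coeff (coeff P i) k"] show ?thesis by (simp add: coeff_map_poly_hom_on[OF sp hom_on_map_poly[OF sBN h]] coeff_map_poly_hom_on[OF sBN h])
qed

text \<open>The coefficients of the product of the U - \<mu>(p) over H are H-invariant, so x and x'
  agree on them; this gives transitivity of H on the points above a given point of the
  invariants.\<close>

lemma point_conjugate:
 assumes x: "x \<in> pts eN N" and x': "hom_on BN x'" and H: "H <= G" "id \<in> H" "!!\<mu>. \<mu> \<in> H ==> bij_betw (%\<tau>. \<mu> o \<tau>) H H"
  and agree: "!!z. z \<in> BN ==> (!!\<mu>. \<mu> \<in> H ==> \<mu> z = z) ==> x' z = x z"
 shows "\<exists>\<mu>\<in>H. ALL b:BN. x' b = x (\<mu> b)"
proof -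
 have fH: "finite H" using H(1) fin_G finite_subset by blast
 have h: "hom_on BN \<mu>" "\<mu> ` BN <= BN" if "\<mu> \<in> H" for \<mu> using hom_on_subset[OF G_hom N.B_N] G_BN that H(1) by blast+
 show ?thesis
 proof (rule point_factors[OF x sBN x' fH h])
  fix p P assume p: "p \<in> poly_over BN" "P = (\<Prod>\<mu>\<in>H. [:- map_poly \<mu> p, 1:])" "P \<in> poly_over (poly_over BN)"
  have "poly P p = 0" unfolding p(2) poly_prod using fH H(2) by (intro prod_zero bexI[of _ id]) (simp_all add: map_poly_id)
  moreover have "x' (coeff (coeff P i) k) = x (coeff (coeff P i) k)" for i k
  proof (rule agree)
   show "coeff (coeff P i) k \<in> BN" using p(3) by (simp add: poly_over_def)
   show "\<mu> (coeff (coeff P i) k) = coeff (coeff P i) k" if "\<mu> \<in> H" for \<mu>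
    unfolding p(2) by (rule prod_conj_fixed[OF sBN p(1) h _ H(3)[OF that]]) (use that H(1) in auto)
  qed
  ultimately show "EX Q:poly_over (poly_over BN). poly Q p = 0 & (ALL i k. x' (coeff (coeff Q i) k) = x (coeff (coeff P i) k))" using p(3) by blast
 qed
qed

text \<open>The coefficients of the product over all embeddings are integral and G-invariant, hence
  in k[T], so y and x agree on them as soon as they agree on T.\<close>

lemma point_lift:
 assumes x: "x \<in> pts eN N" and y: "y \<in> pts eK UNIV" and t: "y (eK T) = x (eN T)"
 shows "EX j:J. ALL b:BK. y b = x (j b)"
proof -
 note sBK = K.sring_B
 have jh: "hom_on BK j" "j ` BK <= BN" if "j \<in> J" for j
 proof -
  interpret j: field_hom j by (rule J_hom[OF that])
  show "hom_on BK j" by (rule comm_ring_hom_hom_on[OF j.comm_ring_hom_axioms])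
  show "j ` BK <= BN" using J_BK_iff[OF that] by auto
 qed
 have inj: "inj eN" by (auto intro: injI)
 \<comment> \<open>\<open>u\<close> carries elements of k[T] from N back to K.\<close>
 define u where "u = (%z. eK (the_inv eN z))"
 have u: "u (eN a) = eK a" for a unfolding u_def using the_inv_f_f[OF inj, of a] by simp
 have u0: "u 0 = 0" using u[of 0] by simp
 show ?thesis
 proof (rule point_factors[OF x sBK pts_K_hom[OF y] fin_J jh])
  fix p P assume p: "p \<in> poly_over BK" "P = (PROD j:J. [:- map_poly j p, 1:])" "P \<in> poly_over (poly_over BN)"
  have rg: "EX a. coeff (coeff P i) k = eN a" for i k
  proof -
   have "coeff (coeff P i) k \<in> range eN"
   proof (rule fixed_BN)
    show "coeff (coeff P i) k \<in> BN" using p(3) by (simp add: poly_over_def)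
    show "\<mu> (coeff (coeff P i) k) = coeff (coeff P i) k" if "\<mu> \<in> G" for \<mu> unfolding p(2) by (rule prod_conj_fixed[OF sBK p(1) jh that bij_comp_J[OF that]])
   qed
   then show ?thesis by blast
  qed
  define Q where "Q = map_poly (map_poly u) P"
  have cQ: "coeff (coeff Q i) k = u (coeff (coeff P i) k)" for i k unfolding Q_def by (simp add: coeff_map_poly u0)
  have "u (coeff (coeff P i) k) \<in> BK" for i k using rg[of i k] u K.e_B by auto
  then have overQ: "Q \<in> poly_over (poly_over BK)" by (simp add: poly_over_def cQ)
  obtain j where j: "j \<in> J" using J_ne by blast
  interpret j: field_hom j by (rule J_hom[OF j])
  interpret mj: map_poly_comm_ring_hom j ..
  have Qj: "map_poly (map_poly j) Q = P"
  proof (intro poly_eqI)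
   fix i k
   obtain a where "coeff (coeff P i) k = eN a" using rg by blast
   then show "coeff (coeff (map_poly (map_poly j) Q) i) k = coeff (coeff P i) k" using u J_eK[OF j] by (simp add: coeff_map_poly cQ)
  qed
  have "map_poly j (poly Q p) = poly P (map_poly j p)"
   unfolding Qj[symmetric] by (rule hom_on_poly[OF sring_UNIV comm_ring_hom_hom_on[OF mj.comm_ring_hom_axioms]]) (simp_all add: poly_over_def)
  also have "... = 0" unfolding p(2) poly_prod using fin_J j by (intro prod_zero bexI[of _ j]) simp_all
  finally have "poly Q p = 0" by (simp add: map_poly_eq_0_iff)
  moreover have "y (coeff (coeff Q i) k) = x (coeff (coeff P i) k)" for i k
  proof -
   obtain a where a: "coeff (coeff P i) k = eN a" using rg by blast
   have "y (eK a) = x (eN a)" using K.pts_e[OF y, of a] N.pts_e[OF x, of a] t by simp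
   then show ?thesis using a u by (simp add: cQ)
  qed
  ultimately show "EX Q:poly_over (poly_over BK). poly Q p = 0 & (ALL i k. y (coeff (coeff Q i) k) = x (coeff (coeff P i) k))" using overQ by blast
 qed
qed

end



section \<open>Fixed points of Frobenius and the character on embeddings\<close>

text \<open>On a transitive set the elements carrying f(j) to j are as many as those carrying j0 to
  j, by composing with an element from j0 to f(j); and each h carries j0 to exactly one j.\<close>

lemma card_transporters:
 fixes I :: "('e => 'e) set" and F :: "('a => 'e) set"
 assumes I: "finite I" "!!a b. a \<in> I ==> b \<in> I ==> a o b \<in> I" "!!a. a \<in> I ==> EX b:I. a o b = id & b o a = id"
  and F: "finite F" "!!j j'. j \<in> F ==> j' \<in> F ==> EX i:I. j' = i o j" "!!i j. i \<in> I ==> j \<in> F ==> i o j \<in> F"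
  and f: "f ` F <= F" "F ~= {}"
 shows "(SUM j:F. card {h \<in> I. h o f j = j}) = card I"
proof -
 obtain j0 where j0: "j0 \<in> F" using f(2) by blast
 have "card {h \<in> I. h o f j = j} = card {h \<in> I. h o j0 = j}" if j: "j \<in> F" for j
 proof -
  have "f j \<in> F" using f(1) j by blast
  then obtain k where k: "k \<in> I" "f j = k o j0" using F(2)[OF j0] by blast
  obtain k' where k': "k' \<in> I" "k o k' = id" "k' o k = id" using I(3)[OF k(1)] by blast
  have c: "h o k' o k = h" "h o k o k' = h" for h :: "'e => 'e" using k' by (simp_all add: comp_assoc)
  have d: "h o k o j0 = h o f j" "h o k' o f j = h o j0" for h :: "'e => 'e" using fun_cong[OF arg_cong[OF c(1)[of h], of "(o)"], of j0] by (simp_all add: k(2) comp_assoc)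
  have "bij_betw (%h. h o k) {h \<in> I. h o f j = j} {h \<in> I. h o j0 = j}" by (rule bij_betw_byWitness[where f' = "%h. h o k'"])
    (use I(2) k(1) k'(1) c d in auto)
  then show ?thesis by (rule bij_betw_same_card)
 qed
 then have "(SUM j:F. card {h \<in> I. h o f j = j}) = (SUM j:F. card {h \<in> I. h o j0 = j})" by (rule sum.cong[OF refl])
 also have "... = (SUM j:F. SUM h:{h \<in> I. h o j0 = j}. 1)" by simp
 also have "... = (SUM h:I. 1)" by (rule sum.group[OF I(1) F(1)]) (use F(3) j0 in auto)
 finally show ?thesis by simp
qed

definition fix_pts :: "('k::{field,finite} poly => 'e::field) => nat => 'k alg_closure => ('e => 'k alg_closure) set" where
 "fix_pts e n t = {y \<in> pts e UNIV. y (e [:0, 1:]) = t & (frob ^^ n) o y = y}"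

definition inertia :: "('f::field => 'e::field) => 'e set => ('k::{field,finite} poly => 'f) => ('e => 'k alg_closure) => ('e => 'e) set" where
 "inertia \<nu> N e0 x = {g \<in> gal \<nu> N. ALL b:intcl (\<nu> o e0) N. x (g b) = x b}"

text \<open>The permutation character of the Galois group on the embeddings of K.\<close>

definition emb_char :: "('f::field => 'a::field) => ('f => 'e::field) => 'e set => ('e => 'e) => nat" where
 "emb_char \<iota> \<nu> N \<mu> = card {j \<in> embs \<iota> \<nu> N. \<mu> o j = j}"

context point_galois
begin

definition rest :: "('e => 'k alg_closure) => ('a => 'e) => 'a => 'k alg_closure" where
 "rest x j b = (if b \<in> BK then x (j b) else 0)"

lemma rest_pts:
 assumes x: "x \<in> pts eN N" and j: "j \<in> J"
 shows "rest x j \<in> pts eK UNIV" "rest x j (eK T) = x (eN T)"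
proof -
 interpret j: field_hom j by (rule J_hom[OF j])
 note hx = pts_N_hom[OF x]
 have jB: "j b \<in> BN" if "b \<in> BK" for b using J_BK_iff[OF j] that by simp
 have "hom_on BK (rest x j)" unfolding hom_on_def rest_def using K.sring_B
  by (auto simp: sring_add sring_mult sring_1 j.hom_add j.hom_mult jB hom_on_1[OF sBN hx] hom_on_add[OF sBN hx] hom_on_mult[OF sBN hx])
 moreover have "rest x j (eK [:c:]) = to_ac c" for c using K.e_B[of "[:c:]"] J_eK[OF j, of "[:c:]"] x by (simp add: rest_def pts_def)
 ultimately show "rest x j \<in> pts eK UNIV" by (simp add: pts_def rest_def)
 show "rest x j (eK T) = x (eN T)" using K.e_B[of T] J_eK[OF j, of T] by (simp add: rest_def)
qed

lemma G_inv: "a \<in> G ==> EX b:G. a o b = id & b o a = id"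
 using G_inverse by metis

text \<open>The points of K below x are the inertia orbits of embeddings. If j' = \<tau> o j
  restricts x to the same point, then x o \<tau> and x agree on j(BK), which contains all invariants
  in BN of the stabiliser H of j. So x o \<tau> = x o \<mu> on BN with \<mu> in H, and \<tau>
  composed with the inverse of \<mu> is an inertia element carrying j to j'.\<close>

lemma rest_eq:
 assumes x: "x \<in> pts eN N" and j: "j \<in> J" "j' \<in> J"
 shows "rest x j = rest x j' \<longleftrightarrow> (EX i:inertia \<nu> N e0 x. j' = i o j)"
proof
 assume "EX i:inertia \<nu> N e0 x. j' = i o j"
 then obtain i where i: "i \<in> inertia \<nu> N e0 x" "j' = i o j" by blast
 then show "rest x j = rest x j'" using J_BK_iff[OF j(1)] by (auto simp: rest_def inertia_def)
next
 assume eq: "rest x j = rest x j'"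
 obtain \<tau> where t: "\<tau> \<in> G" "j' = \<tau> o j" using transitive[OF j] by blast
 have tB: "hom_on BN \<tau>" "\<tau> ` BN <= BN" using hom_on_subset[OF G_hom[OF t(1)] N.B_N] G_BN[OF t(1)] by auto
 define H where "H = {\<mu> \<in> G. \<mu> o j = j}"
 have "\<exists>\<mu>\<in>H. ALL b:BN. (x o \<tau>) b = x (\<mu> b)"
 proof (rule point_conjugate[OF x])
  show "hom_on BN (x o \<tau>)" by (rule hom_on_comp[OF tB(1) pts_N_hom[OF x] tB(2)])
  show "H <= G" "id \<in> H" using G_id by (auto simp: H_def)
  fix \<mu> assume s: "\<mu> \<in> H"
  then obtain \<rho> where r: "\<rho> \<in> G" "\<mu> o \<rho> = id" "\<rho> o \<mu> = id" using G_inv unfolding H_def by blast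
  have "\<rho> o j = \<rho> o (\<mu> o j)" using s by (simp add: H_def)
  also have "... = j" using r by (simp flip: comp_assoc)
  finally have rj: "\<rho> o j = j" .
  show "bij_betw (%\<tau>. \<mu> o \<tau>) H H" by (rule bij_betw_byWitness[where f' = "%\<tau>. \<rho> o \<tau>"])
    (use r s rj G_comp in \<open>auto simp: H_def comp_assoc simp flip: comp_assoc[of \<mu> \<rho>] comp_assoc[of \<rho> \<mu>]\<close>)
 next
  fix z assume z: "z \<in> BN" "!!\<mu>. \<mu> \<in> H ==> \<mu> z = z"
  have "z \<in> range j" by (rule stabilizer[OF j(1)]) (use z N.B_N in \<open>auto simp: H_def\<close>)
  then obtain b where b: "z = j b" by blast
  then have "b \<in> BK" using z(1) J_BK_iff[OF j(1)] by simp
  then show "(x o \<tau>) z = x z" using fun_cong[OF eq, of b] t(2) b by (simp add: rest_def)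
 qed
 then obtain \<mu> where s: "\<mu> \<in> G" "\<mu> o j = j" "!!b. b \<in> BN ==> x (\<tau> b) = x (\<mu> b)" by (auto simp: H_def)
 obtain \<rho> where r: "\<rho> \<in> G" "\<mu> o \<rho> = id" "\<rho> o \<mu> = id" using G_inv[OF s(1)] by blast
 have "x ((\<tau> o \<rho>) b) = x b" if "b \<in> BN" for b using s(3)[OF G_BN[OF r(1) that]] fun_cong[OF r(2), of b] by simp
 then have "\<tau> o \<rho> \<in> inertia \<nu> N e0 x" using G_comp[OF t(1) r(1)] by (simp add: inertia_def)
 moreover have "(\<tau> o \<rho>) o j = j'"
 proof -
  have "\<rho> o j = \<rho> o (\<mu> o j)" using s(2) by simp
  also have "... = j" using r by (simp flip: comp_assoc)
  finally show ?thesis using t(2) by (simp add: comp_assoc)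
 qed
 ultimately show "EX i:inertia \<nu> N e0 x. j' = i o j" by blast
qed

lemma ex_frobenius:
 assumes x: "x \<in> pts eN N" and t: "(frob ^^ n) (x (eN T)) = x (eN T)"
 shows "\<exists>\<mu>\<in>G. ALL b:BN. (frob ^^ n) (x b) = x (\<mu> b)"
proof -
 have "\<exists>\<mu>\<in>G. ALL b:BN. ((frob ^^ n) o x) b = x (\<mu> b)"
 proof (rule point_conjugate[OF x _ order_refl G_id bij_comp_G])
  show "hom_on BN ((frob ^^ n) o x)" by (rule pts_N_hom[OF N.pfrob_pow_pts[OF x]])
  fix z assume "z \<in> BN" "!!\<mu>. \<mu> \<in> G ==> \<mu> z = z"
  then obtain a where "z = eN a" using fixed_BN by blast
  then show "((frob ^^ n) o x) z = x z" using N.pts_e[OF x, of a] t by (simp add: frob_ev)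
 qed
 then show ?thesis by simp
qed

lemma inertia_group:
 assumes x: "x \<in> pts eN N"
 shows "finite (inertia \<nu> N e0 x)" "a \<in> inertia \<nu> N e0 x ==> b \<in> inertia \<nu> N e0 x ==> a o b \<in> inertia \<nu> N e0 x"
  "a \<in> inertia \<nu> N e0 x ==> EX b:inertia \<nu> N e0 x. a o b = id & b o a = id"
proof -
 show "finite (inertia \<nu> N e0 x)" unfolding inertia_def using fin_G by simp
 show "a o b \<in> inertia \<nu> N e0 x" if "a \<in> inertia \<nu> N e0 x" "b \<in> inertia \<nu> N e0 x" using that G_comp G_BN by (auto simp: inertia_def)
 assume a: "a \<in> inertia \<nu> N e0 x"
 then obtain b where b: "b \<in> G" "a o b = id" "b o a = id" using G_inv unfolding inertia_def by blast
 have "x (b z) = x z" if "z \<in> BN" for z using a G_BN[OF b(1) that] fun_cong[OF b(2), of z] by (auto simp: inertia_def)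
 then show "EX b:inertia \<nu> N e0 x. a o b = id & b o a = id" using b by (auto simp: inertia_def)
qed

text \<open>Frob^n acts on the inertia orbits of embeddings through \<mu>. An orbit fixed by it
  contributes |I| pairs (h, j) with h \<mu> j = j, any other orbit none; counting these pairs by h
  gives the sum of characters. Averaging over I is what keeps the formula exact at ramified
  points.\<close>

theorem card_fix_pts:
 assumes x: "x \<in> pts eN N" and \<mu>: "\<mu> \<in> G" "!!b. b \<in> BN ==> (frob ^^ n) (x b) = x (\<mu> b)"
 shows "card (inertia \<nu> N e0 x) * card (fix_pts eK n (x (eN T))) = (SUM h:inertia \<nu> N e0 x. emb_char \<iota> \<nu> N (h o \<mu>))"
  "finite (fix_pts eK n (x (eN T)))"
proof -
 let ?I = "inertia \<nu> N e0 x" and ?Y = "fix_pts eK n (x (eN T))"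
 note I = inertia_group[OF x]
 have IG: "i \<in> G" if "i \<in> ?I" for i using that by (simp add: inertia_def)
 have fr: "(frob ^^ n) o rest x j = rest x (\<mu> o j)" if "j \<in> J" for j using \<mu>(2) J_BK_iff[OF that] by (auto simp: rest_def fun_eq_iff)
 define F where "F = (%y. {j \<in> J. rest x j = y})"
 have lift: "F y ~= {}" if y: "y \<in> pts eK UNIV" "y (eK T) = x (eN T)" for y
 proof -
  obtain j where j: "j \<in> J" "!!b. b \<in> BK ==> y b = x (j b)" using point_lift[OF x y] by blast
  have "rest x j = y" using j(2) y(1) by (auto simp: rest_def pts_def fun_eq_iff)
  then show ?thesis using j(1) by (auto simp: F_def)
 qed
 have YJ: "?Y <= rest x ` J" using lift by (fastforce simp: fix_pts_def F_def)
 then show fY: "finite ?Y" using fin_J finite_surj by blast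
 have count: "(SUM j:F y. card {h \<in> ?I. h o (\<mu> o j) = j}) = card ?I" if y: "y \<in> ?Y" for y
 proof (rule card_transporters[OF I])
  show "finite (F y)" unfolding F_def using fin_J by simp
  show "EX i:?I. j' = i o j" if "j \<in> F y" "j' \<in> F y" for j j' using rest_eq[OF x, of j j'] that by (simp add: F_def)
  show "i o j \<in> F y" if "i \<in> ?I" "j \<in> F y" for i j using rest_eq[OF x, of j "i o j"] that comp_J[OF IG[OF that(1)], of j] by (auto simp: F_def)
  show "(%j. \<mu> o j) ` F y <= F y" using y fr comp_J[OF \<mu>(1)] by (auto simp: F_def fix_pts_def)
  show "F y ~= {}" using lift y by (simp add: fix_pts_def)
 qed
 have zero: "{h \<in> ?I. h o (\<mu> o j) = j} = {}" if j: "j \<in> J" "rest x j \<notin> ?Y" for j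
 proof (rule ccontr)
  assume "{h \<in> ?I. h o (\<mu> o j) = j} ~= {}"
  then have "rest x (\<mu> o j) = rest x j" using rest_eq[OF x comp_J[OF \<mu>(1) j(1)] j(1)] by (auto simp: eq_commute)
  then show False using j fr[OF j(1)] rest_pts[OF x j(1)] by (simp add: fix_pts_def)
 qed
 have "card ?I * card ?Y = (SUM y:?Y. SUM j:F y. card {h \<in> ?I. h o (\<mu> o j) = j})" by (simp add: count)
 also have "... = (SUM y:?Y. SUM j:{j \<in> {j \<in> J. rest x j \<in> ?Y}. rest x j = y}. card {h \<in> ?I. h o (\<mu> o j) = j})" by (intro sum.cong refl) (auto simp: F_def)
 also have "... = (SUM j:{j \<in> J. rest x j \<in> ?Y}. card {h \<in> ?I. h o (\<mu> o j) = j})" by (rule sum.group) (use fin_J fY in auto)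
 also have "... = (SUM j:J. card {h \<in> ?I. h o (\<mu> o j) = j})"
 proof (rule sum.mono_neutral_left[OF fin_J], blast, rule ballI)
  fix j assume "j \<in> J - {j \<in> J. rest x j \<in> ?Y}"
  then have "{h \<in> ?I. h o (\<mu> o j) = j} = {}" by (intro zero) auto
  then show "card {h \<in> ?I. h o (\<mu> o j) = j} = 0" by (simp only: card.empty)
 qed
 also have "... = (SUM j:J. SUM h:?I. if h o (\<mu> o j) = j then 1 else 0)" using I(1) by (simp add: sum.If_cases Int_def)
 also have "... = (SUM h:?I. SUM j:J. if h o (\<mu> o j) = j then 1 else 0)" by (rule sum.swap)
 also have "... = (SUM h:?I. emb_char \<iota> \<nu> N (h o \<mu>))" using fin_J by (simp add: sum.If_cases Int_def emb_char_def comp_assoc)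
 finally show "card ?I * card ?Y = (SUM h:?I. emb_char \<iota> \<nu> N (h o \<mu>))" .
qed

lemma finite_fix_pts: "finite (fix_pts eK n t)" and fix_pts_empty: "(frob ^^ n) t ~= t ==> fix_pts eK n t = {}"
proof -
 show e: "fix_pts eK n t = {}" if "(frob ^^ n) t ~= t"
 proof (rule ccontr)
  assume "fix_pts eK n t ~= {}"
  then obtain y where "y (eK T) = t" "(frob ^^ n) o y = y" by (auto simp: fix_pts_def)
  then show False using that by (metis comp_apply)
 qed
 obtain x where x: "x \<in> pts eN N" "x (eN T) = t" by (rule N.ex_point_over)
 show "finite (fix_pts eK n t)"
 proof (cases "(frob ^^ n) t = t")
  case True
  then show ?thesis using ex_frobenius[OF x(1)] card_fix_pts(2)[OF x(1)] x(2) by blast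
 qed (simp add: e)
qed

end

text \<open>Both extensions share N, hence the point x, its inertia group and the lift \<mu> of
  Frobenius; only the characters could differ.\<close>

lemma card_fix_pts_eq:
 assumes "point_galois \<nu> N \<iota> e0" "point_galois \<nu> N \<iota>' e0"
  and \<chi>: "!!\<mu>. \<mu> \<in> gal \<nu> N ==> emb_char \<iota> \<nu> N \<mu> = emb_char \<iota>' \<nu> N \<mu>"
 shows "card (fix_pts (\<iota> o e0) n t) = card (fix_pts (\<iota>' o e0) n t)"
proof -
 interpret a: point_galois \<nu> N \<iota> e0 by fact
 interpret b: point_galois \<nu> N \<iota>' e0 by fact
 show ?thesis
 proof (cases "(frob ^^ n) t = t")
  case True
  obtain x where x: "x \<in> pts (\<nu> o e0) N" "x ((\<nu> o e0) [:0, 1:]) = t" by (rule a.N.ex_point_over)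
  obtain \<mu> where s: "\<mu> \<in> gal \<nu> N" "!!b. b \<in> intcl (\<nu> o e0) N ==> (frob ^^ n) (x b) = x (\<mu> b)"
   using a.ex_frobenius[OF x(1), of n] x(2) True by (simp only:) blast
  have "(SUM h:inertia \<nu> N e0 x. emb_char \<iota> \<nu> N (h o \<mu>)) = (SUM h:inertia \<nu> N e0 x. emb_char \<iota>' \<nu> N (h o \<mu>))"
   by (intro sum.cong refl \<chi> a.G_comp[OF _ s(1)]) (simp add: inertia_def)
  then have "card (inertia \<nu> N e0 x) * card (fix_pts (\<iota> o e0) n t) = card (inertia \<nu> N e0 x) * card (fix_pts (\<iota>' o e0) n t)"
   using a.card_fix_pts(1)[OF x(1) s] b.card_fix_pts(1)[OF x(1) s] x(2) by (simp only:)
  moreover have "id \<in> inertia \<nu> N e0 x" using a.G_id by (simp add: inertia_def)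
  then have "card (inertia \<nu> N e0 x) ~= 0" using a.inertia_group(1)[OF x(1)] by auto
  ultimately show ?thesis by simp
 next
  case False
  then show ?thesis using a.fix_pts_empty b.fix_pts_empty by simp
 qed
qed



section \<open>Periods of points and counting by orbits\<close>

lemma card_range_ev: "card (range (ev t)) = CARD('k) ^ fper (t :: 'k::{field,finite} alg_closure)"
proof -
 obtain \<pi> where \<pi>: "!!z. ev z \<pi> = 0 \<longleftrightarrow> z \<in> orb frob t" "lead_coeff \<pi> = 1" "degree \<pi> = fper t" using ex_poly_roots_orb[of t] by blast
 have d: "0 < degree \<pi>" using \<pi>(3) per_pos_fixed(1)[OF periodic_frob, of t] by simp
 have p0: "ev t \<pi> = 0" using \<pi>(1)[of t] orb_self[of t frob] by simp
 have "inj_on (ev t) {f. deg_less (fper t) f}"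
 proof (rule inj_onI)
  fix f g assume fg: "f \<in> {f. deg_less (fper t) f}" "g \<in> {f. deg_less (fper t) f}" "ev t f = ev t g"
  then have "ev t (f - g) = 0" by (simp add: ev.hom_minus)
  then obtain w where w: "f - g = \<pi> * w" using ev_eq_0_imp_dvd[OF \<pi>] by (rule_tac dvdE)
  have "deg_less (degree \<pi>) (w * \<pi>)" using deg_less_diff[of "fper t" f g] fg w \<pi>(3) by (simp add: mult.commute)
  then have "w = 0" by (rule deg_less_monic_mult_eq_0[OF \<pi>(2) d])
  then show "f = g" using w by simp
 qed
 then have "card (ev t ` {f. deg_less (fper t) f}) = CARD('k) ^ fper t" by (simp add: card_image card_deg_less(2))
 moreover have "ev t ` {f. deg_less (fper t) f} = range (ev t)"
 proof (intro equalityI subsetI)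
  fix z assume "z \<in> range (ev t)"
  then obtain f where f: "z = ev t f" by blast
  obtain Q R where "f = Q * \<pi> + R" "deg_less (degree \<pi>) R" by (rule poly_div_monic[OF \<pi>(2) d])
  then show "z \<in> ev t ` {f. deg_less (fper t) f}" using f p0 \<pi>(3) by (auto simp: ev.hom_add ev.hom_mult)
 qed auto
 ultimately show ?thesis by simp
qed

context bchart
begin

text \<open>The period of x and its image are those of the single value x(\<eta>), for \<eta> a
  generator of the residue field.\<close>

lemma periodic_pfrob: "x \<in> pts e N ==> periodic pfrob x"
 and card_point_image: "x \<in> pts e N ==> card (x ` B) = CARD('k) ^ per pfrob x"
proof -
 assume x: "x \<in> pts e N"
 note hx = hom_on_power[OF sring_B] hom_on_diff[OF sring_B]
 have h: "hom_on B x" using x by (simp add: pts_def)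
 obtain R where "finite_prime B (ker x) R" using finite_prime_ker[OF x] .
 then interpret fp: finite_prime B "ker x" R .
 obtain \<eta> where g: "\<eta> \<in> B" "!!b. b \<in> B ==> b \<in> ker x \<or> (EX i. b - \<eta> ^ i \<in> ker x)" using fp.ex_generator by blast
 have val: "x b = 0 \<or> (EX i. x b = x \<eta> ^ i)" for b
 proof (cases "b \<in> B")
  case True
  then consider "b \<in> ker x" | i where "b - \<eta> ^ i \<in> ker x" using g(2) by blast
  then show ?thesis
  proof cases
   case 2
   then have "x b = x (\<eta> ^ i)" using hom_on_diff[OF sring_B h True sring_power[OF sring_B g(1)], of i] by (simp add: ker_def)
   then show ?thesis using hom_on_power[OF sring_B h g(1)] by auto
  qed (simp add: ker_def)
 qed (use x in \<open>simp add: pts_def\<close>)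
 have "(pfrob ^^ n) x = x \<longleftrightarrow> (frob ^^ n) (x \<eta>) = x \<eta>" for n
 proof
  assume "(frob ^^ n) (x \<eta>) = x \<eta>"
  then have "(frob ^^ n) (x b) = x b" for b using val[of b] by (auto simp: frob_pow.hom_power)
  then show "(pfrob ^^ n) x = x" by (auto simp: pfrob_pow)
 qed (auto simp: pfrob_pow dest: fun_cong)
 then have p: "periodic pfrob x \<longleftrightarrow> periodic frob (x \<eta>)" "per pfrob x = fper (x \<eta>)" unfolding per_def periodic_def by simp_all
 show "periodic pfrob x" using p(1) periodic_frob by blast
 have "x ` B = range (ev (x \<eta>))"
 proof (intro equalityI subsetI)
  fix z assume "z \<in> x ` B"
  then consider "z = 0" | i where "z = x \<eta> ^ i" using val by auto
  then show "z \<in> range (ev (x \<eta>))"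
  proof cases
   case 2
   then have "z = ev (x \<eta>) (monom 1 i)" by (simp add: ev_def map_poly_monom poly_monom)
   then show ?thesis by blast
  qed (metis ev.hom_zero rangeI)
 next
  fix z assume "z \<in> range (ev (x \<eta>))"
  then obtain f where "z = ev (x \<eta>) f" by blast
  then have "z = x (at_gen \<eta> f)" by (simp only: pts_at_gen[OF x g(1)])
  then show "z \<in> x ` B" using at_gen_B[OF g(1)] by (rule image_eqI)
 qed
 then show "card (x ` B) = CARD('k) ^ per pfrob x" using card_range_ev p(2) by simp
qed

end

lemma card_fixed_eq_sum_per:
 assumes "!!y. y \<in> X ==> periodic \<phi> y" "0 < n" "finite {y \<in> X. (\<phi> ^^ n) y = y}"
 shows "card {y \<in> X. (\<phi> ^^ n) y = y} = (\<Sum>d | d dvd n. card {y \<in> X. per \<phi> y = d})"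
proof -
 let ?F = "{y \<in> X. (\<phi> ^^ n) y = y}"
 have iff: "(\<phi> ^^ n) y = y \<longleftrightarrow> per \<phi> y dvd n" if "y \<in> X" for y using funpow_fixed_iff[OF assms(1)[OF that]] .
 have "card ?F = (SUM y:?F. 1)" by simp
 also have "... = (\<Sum>d | d dvd n. SUM y:{y \<in> ?F. per \<phi> y = d}. 1)" by (rule sum.group[symmetric]) (use assms iff in auto)
 also have "... = (\<Sum>d | d dvd n. card {y \<in> X. per \<phi> y = d})" by (intro sum.cong refl, simp, intro arg_cong[of _ _ card]) (use iff in auto)
 finally show ?thesis .
qed

text \<open>Moebius inversion over the divisors of n, done as an induction on the period.\<close>

lemma card_per_eqI:
 assumes "!!y. y \<in> X ==> periodic \<phi> y" "!!n. 0 < n ==> finite {y \<in> X. (\<phi> ^^ n) y = y}"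
  and "!!y. y \<in> X' ==> periodic \<psi> y" "!!n. 0 < n ==> finite {y \<in> X'. (\<psi> ^^ n) y = y}"
  and eq: "!!n. 0 < n ==> card {y \<in> X. (\<phi> ^^ n) y = y} = card {y \<in> X'. (\<psi> ^^ n) y = y}" and "0 < n"
 shows "card {y \<in> X. per \<phi> y = n} = card {y \<in> X'. per \<psi> y = n}"
 using \<open>0 < n\<close>
proof (induction n rule: less_induct)
 case (less n)
 have D: "{d. d dvd n} = insert n {d. d dvd n & d ~= n}" "finite {d. d dvd n & d ~= n}" using less.prems by auto
 have "card {y \<in> X. per \<phi> y = d} = card {y \<in> X'. per \<psi> y = d}" if "d dvd n & d ~= n" for d
 proof (rule less.IH)
  have "d <= n" using that less.prems by (intro dvd_imp_le) auto
  then show "d < n" using that by simp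
  show "0 < d" using that less.prems by (cases d) auto
 qed
 then have "(\<Sum>d | d dvd n & d ~= n. card {y \<in> X. per \<phi> y = d}) = (\<Sum>d | d dvd n & d ~= n. card {y \<in> X'. per \<psi> y = d})" by simp
 then show ?case using eq[OF less.prems] card_fixed_eq_sum_per[OF assms(1) less.prems assms(2)[OF less.prems]]
   card_fixed_eq_sum_per[OF assms(3) less.prems assms(4)[OF less.prems]] D by simp
qed

lemma card_orbit_quotient:
 assumes X: "!!y. y \<in> X ==> periodic \<phi> y" "!!y. y \<in> X ==> \<phi> y \<in> X"
  and f: "!!y y'. y \<in> X ==> y' \<in> X ==> f y = f y' \<longleftrightarrow> y' \<in> orb \<phi> y" and fin: "finite {y \<in> X. per \<phi> y = d}"
 shows "card {y \<in> X. per \<phi> y = d} = d * card (f ` {y \<in> X. per \<phi> y = d})"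
proof -
 let ?A = "{y \<in> X. per \<phi> y = d}"
 have pw: "(\<phi> ^^ i) y \<in> X" if "y \<in> X" for i y using that X(2) by (induction i) auto
 have "card ?A = (SUM y:?A. 1)" by simp
 also have "... = (SUM v:f ` ?A. SUM y:{y \<in> ?A. f y = v}. 1)" by (rule sum.group[symmetric]) (use fin in auto)
 also have "... = (SUM v:f ` ?A. d)"
 proof (rule sum.cong[OF refl])
  fix v assume "v \<in> f ` ?A"
  then obtain y where y: "y \<in> ?A" "v = f y" by blast
  have "{y' \<in> ?A. f y' = v} = orb \<phi> y"
  proof (intro equalityI subsetI)
   fix y' assume "y' \<in> {y' \<in> ?A. f y' = v}"
   then have y': "y' \<in> X" "f y = f y'" using y by auto
   then show "y' \<in> orb \<phi> y" using f[of y y'] y by simp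
  next
   fix y' assume y': "y' \<in> orb \<phi> y"
   then obtain i where i: "y' = (\<phi> ^^ i) y" by (auto simp: orb_in)
   have "y' \<in> X" "per \<phi> y' = d" using pw y per_funpow[OF X(1)] i by auto
   moreover have "f y = f y'" using f[of y y'] y' y \<open>y' \<in> X\<close> by simp
   ultimately show "y' \<in> {y' \<in> ?A. f y' = v}" using y by simp
  qed
  then show "(SUM y:{y \<in> ?A. f y = v}. 1) = d" using card_orb[OF X(1), of y] y by simp
 qed
 finally show ?thesis by simp
qed


section \<open>The field of constants\<close>

context
 fixes h :: "'k::{field,finite} => 'a::field"
 assumes h: "field_hom h"
begin

interpretation h: field_hom h by (rule h)

lemma power_CARD_pow_hom: "field_hom (%x :: 'a. x ^ (CARD('k) ^ n))"
proof -
 have "(x + y) ^ (CARD('k) ^ n) = x ^ (CARD('k) ^ n) + y ^ (CARD('k) ^ n)" for x y :: 'a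
  by (induction n) (simp_all add: power_CARD_add[OF h] power_mult mult.commute[of "CARD('k)"])
 then show ?thesis using zero_less_card_finite[where 'a='k] by unfold_locales (simp_all add: power_mult_distrib power_0_left)
qed

text \<open>The powers x^(q^n) are roots of one polynomial over k, so two agree. This trades
  algebraicity for a Frobenius equation, under which the field operations are immediate.\<close>

lemma algebraic_iff_power_fixed:
 "(EX p. p ~= 0 & poly (map_poly h p) x = 0) \<longleftrightarrow> (\<exists>n>0. x ^ (CARD('k) ^ n) = x)"
proof
 assume "EX p. p ~= 0 & poly (map_poly h p) x = 0"
 then obtain p where p: "p ~= 0" "poly (map_poly h p) x = 0" by blast
 interpret q: field_hom "%x :: 'a. x ^ (CARD('k) ^ n)" for n by (rule power_CARD_pow_hom)
 have cq: "c ^ (CARD('k) ^ n) = c" for c :: 'k and n by (induction n) (simp_all add: power_mult power_CARD_eq_same mult.commute[of "CARD('k)"])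
 have root: "poly (map_poly h p) (x ^ (CARD('k) ^ n)) = 0" for n
 proof -
  have "map_poly (%x. x ^ (CARD('k) ^ n)) (map_poly h p) = map_poly h p" by (rule poly_eqI) (simp add: coeff_map_poly cq flip: h.hom_power)
  then have "poly (map_poly h p) (x ^ (CARD('k) ^ n)) = (poly (map_poly h p) x) ^ (CARD('k) ^ n)"
   using q.poly_map_poly[where n = n and p = "map_poly h p" and x = x] by (simp only:)
  then show ?thesis using p(2) by simp
 qed
 have "finite {z. poly (map_poly h p) z = 0}" by (rule poly_roots_finite) (use p(1) in simp)
 moreover have "range (%n. x ^ (CARD('k) ^ n)) <= {z. poly (map_poly h p) z = 0}" using root by blast
 ultimately have "finite (range (%n. x ^ (CARD('k) ^ n)))" by (rule finite_subset[rotated])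
 then have "\<not> inj (%n. x ^ (CARD('k) ^ n))" using finite_imageD infinite_UNIV_nat by blast
 then obtain i j where "i < j" "x ^ (CARD('k) ^ i) = x ^ (CARD('k) ^ j)" unfolding inj_def by (metis linorder_neqE_nat)
 moreover then have "CARD('k) ^ j = CARD('k) ^ (j - i) * CARD('k) ^ i" by (simp flip: power_add)
 ultimately have "0 < j - i" "(x ^ (CARD('k) ^ (j - i))) ^ (CARD('k) ^ i) = x ^ (CARD('k) ^ i)" by (simp_all add: power_mult)
 then show "\<exists>n>0. x ^ (CARD('k) ^ n) = x" using q.eq_iff[where n = i] by blast
next
 assume "\<exists>n>0. x ^ (CARD('k) ^ n) = x"
 then obtain n where n: "0 < n" "x ^ (CARD('k) ^ n) = x" by blast
 have "1 < CARD('k) ^ n" using n CARD_ge_2[where 'k='k] by (intro one_less_power) auto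
 then have "coeff (monom 1 (CARD('k) ^ n) - monom 1 1 :: 'k poly) (CARD('k) ^ n) ~= coeff 0 (CARD('k) ^ n)" by simp
 then have "monom 1 (CARD('k) ^ n) - monom 1 1 ~= (0 :: 'k poly)" by metis
 moreover have "poly (map_poly h (monom 1 (CARD('k) ^ n) - monom 1 1)) x = 0"
 proof -
  have "map_poly h (monom 1 (CARD('k) ^ n) - monom 1 1) = monom 1 (CARD('k) ^ n) - monom 1 1" by (rule poly_eqI) (simp add: coeff_map_poly h.hom_minus)
  then show ?thesis using n by (simp add: poly_monom)
 qed
 ultimately show "EX p. p ~= 0 & poly (map_poly h p) x = 0" by blast
qed

lemma sfield_algebraic: "sfield {x. EX p. p ~= 0 & poly (map_poly h p) x = 0}" (is "sfield ?C")
proof -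
 have C: "x \<in> ?C \<longleftrightarrow> (\<exists>n>0. x ^ (CARD('k) ^ n) = x)" for x using algebraic_iff_power_fixed by simp
 interpret q: field_hom "%x :: 'a. x ^ (CARD('k) ^ n)" for n by (rule power_CARD_pow_hom)
 have iter: "x ^ (CARD('k) ^ (n * m)) = x" if "x ^ (CARD('k) ^ n) = x" for x :: 'a and n m by (induction m) (simp_all add: that power_add power_mult)
 have two: "\<exists>n>0. x ^ (CARD('k) ^ n) = x & y ^ (CARD('k) ^ n) = y" if "x \<in> ?C" "y \<in> ?C" for x y
 proof -
  obtain n m where "0 < n" "x ^ (CARD('k) ^ n) = x" "0 < m" "y ^ (CARD('k) ^ m) = y" using \<open>x \<in> ?C\<close> \<open>y \<in> ?C\<close> C by blast
  then show ?thesis using iter[of x n m] iter[of y m n] by (intro exI[of _ "n * m"]) (simp add: mult.commute)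
 qed
 have "sring ?C"
 proof (rule sringI)
  show "1 \<in> ?C" unfolding C by (intro exI[of _ 1]) simp
  fix x y assume "x \<in> ?C" "y \<in> ?C"
  then obtain n where n: "0 < n" "x ^ (CARD('k) ^ n) = x" "y ^ (CARD('k) ^ n) = y" using two by blast
  show "x - y \<in> ?C" unfolding C using n q.hom_minus[where n = n and x = x and y = y] by (intro exI[of _ n]) simp
  show "x * y \<in> ?C" unfolding C using n by (intro exI[of _ n]) (simp add: power_mult_distrib)
 qed
 moreover have "inverse x \<in> ?C" if "x \<in> ?C" for x using that unfolding C by (auto simp: power_inverse)
 ultimately show ?thesis by (simp add: sfield_def)
qed

end


section \<open>Places as orbits of points\<close>

text \<open>The local ring at the kernel of y; Frobenius conjugate points have the same one. The
  residue map extending y to it is \<open>vext\<close>.\<close>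

definition vr :: "('k::{field,finite} poly => 'a::field) => ('a => 'k alg_closure) => 'a set" where
 "vr e y = {b / c | b c. b \<in> intcl e UNIV & c \<in> intcl e UNIV & y c ~= 0}"

definition vext :: "('k::{field,finite} poly => 'a::field) => ('a => 'k alg_closure) => 'a => 'k alg_closure" where
 "vext e y z = (THE r. EX b:intcl e UNIV. EX c:intcl e UNIV. y c ~= 0 & z = b / c & r = y b / y c)"

lemma subring_iff_sring: "subring V (ring_of_type_algebra :: 'a::comm_ring_1 ring) \<longleftrightarrow> sring V"
proof
 interpret ring "ring_of_type_algebra :: 'a ring" using cring.axioms(1)[OF cring_subring_of_type[OF sring_UNIV]] subring_of_type_UNIV by metis
 have m: "\<ominus>\<^bsub>ring_of_type_algebra\<^esub> b = - b" for b :: 'a using a_minus_subring_of_type(2)[OF sring_UNIV, of b b] by (simp add: subring_of_type_UNIV)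
 show "sring V" if V: "subring V ring_of_type_algebra"
 proof (rule sringI)
  show "1 \<in> V" using subringE(3)[OF V] by simp
  fix a b assume ab: "a \<in> V" "b \<in> V"
  show "a * b \<in> V" using subringE(6)[OF V ab] by simp
  show "a - b \<in> V" using subringE(7)[OF V ab(1) subringE(5)[OF V ab(2)]] by (simp add: m)
 qed
 show "subring V ring_of_type_algebra" if V: "sring V" by (rule subringI) (auto simp: m sring_1[OF V] sring_uminus[OF V] sring_mult[OF V] sring_add[OF V])
qed

locale place_chart = bchart e "UNIV :: 'a set" D for e :: "'k::{field,finite} poly => 'a::field" and D +
 fixes \<iota> :: "'k poly fract => 'a"
 assumes const_e: "const_embed \<iota> c = e [:c:]"
begin

lemma const_embed_hom: "field_hom (const_embed \<iota>)"
 using const_hom const_e by presburger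

text \<open>As long as all coefficients vanish at t, the minimal polynomial of t divides out, and
  the degree of the leading coefficient drops.\<close>

lemma primitive_relation:
 obtains p i where "poly (map_poly e p) x = 0" "ev t (coeff p i) ~= 0"
proof -
 obtain \<pi> where \<pi>: "!!z. ev z \<pi> = 0 \<longleftrightarrow> z \<in> orb frob t" "lead_coeff \<pi> = 1" "degree \<pi> = fper t" using ex_poly_roots_orb[of t] by blast
 have d: "0 < degree \<pi>" using \<pi>(3) per_pos_fixed(1)[OF periodic_frob, of t] by simp
 have \<pi>0: "\<pi> ~= 0" using \<pi>(2) by auto
 have "EX p i. poly (map_poly e p) x = 0 & ev t (coeff p i) ~= 0" if "p ~= 0" "poly (map_poly e p) x = 0" for p using that
 proof (induction "degree (lead_coeff p)" arbitrary: p rule: less_induct)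
  case less
  show ?case
  proof (cases "EX i. ev t (coeff p i) ~= 0")
   case False
   define p' where "p' = map_poly (%a. a div \<pi>) p"
   have "\<pi> * (coeff p i div \<pi>) = coeff p i" for i using False ev_eq_0_imp_dvd[OF \<pi>, of "coeff p i"] by auto
   then have p: "p = smult \<pi> p'" unfolding p'_def by (intro poly_eqI) (simp add: coeff_map_poly)
   have p'0: "p' ~= 0" using p less.prems(1) by auto
   have "lead_coeff p = \<pi> * lead_coeff p'" unfolding p by (simp add: \<pi>0)
   then have "degree (lead_coeff p') < degree (lead_coeff p)" using p'0 \<pi>0 d by (simp add: degree_mult_eq)
   moreover have "poly (map_poly e p') x = 0"
   proof -
    have "map_poly e p = smult (e \<pi>) (map_poly e p')" unfolding p by (rule poly_eqI) (simp add: coeff_map_poly hom_mult)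
    then show ?thesis using less.prems(2) \<pi>0 by simp
   qed
   ultimately show ?thesis using less.hyps[of p'] p'0 by blast
  qed (use less.prems in blast)
 qed
 moreover obtain p where "p ~= 0" "poly (map_poly e p) x = 0" using algebraic[of x] by auto
 ultimately obtain p' i where "poly (map_poly e p') x = 0" "ev t (coeff p' i) ~= 0" by blast
 then show ?thesis by (rule that)
qed

context
 fixes y assumes y: "y \<in> pts e UNIV"
begin

lemma y_hom: "hom_on B y"
 using y by (simp add: pts_def)

lemmas y_simps = hom_on_0[OF sring_B y_hom] hom_on_1[OF sring_B y_hom] hom_on_add[OF sring_B y_hom]
 hom_on_diff[OF sring_B y_hom] hom_on_mult[OF sring_B y_hom] sring_1[OF sring_B] sring_0[OF sring_B]
 sring_add[OF sring_B] sring_diff[OF sring_B] sring_mult[OF sring_B] e_B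

lemma vrI: "b \<in> B ==> c \<in> B ==> y c ~= 0 ==> b / c \<in> vr e y"
 unfolding vr_def by blast

lemma vrE:
 assumes "z \<in> vr e y"
 obtains b c where "b \<in> B" "c \<in> B" "y c ~= 0" "c ~= 0" "z = b / c" using assms y_simps(1) unfolding vr_def by blast

lemma B_vr: "b \<in> B ==> b \<in> vr e y"
 using vrI[of b 1] by (simp add: y_simps)

lemma sring_vr: "sring (vr e y)"
proof (rule sringI)
 show "1 \<in> vr e y" by (rule B_vr) (simp add: y_simps)
 fix a b assume "a \<in> vr e y" "b \<in> vr e y"
 then obtain p q r s where *: "p \<in> B" "q \<in> B" "y q ~= 0" "q ~= 0" "a = p / q" "r \<in> B" "s \<in> B" "y s ~= 0" "s ~= 0" "b = r / s" by (elim vrE)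
 have "a * b = (p * r) / (q * s)" "a - b = (p * s - r * q) / (q * s)" using * by (simp_all add: diff_frac_eq)
 then show "a * b \<in> vr e y" "a - b \<in> vr e y" using * by (auto intro!: vrI simp: y_simps)
qed

text \<open>Seidenberg's argument. With b_k = a_k + x b_(k+1): if some b_(k+1) is nonzero at y, then
  x = (b_k - a_k) / b_(k+1). Otherwise all b_k vanish at y, and for an index i with a_i nonzero at y
  the integral element x b_(i+1) = b_i - a_i does not vanish there, so 1/x = b_(i+1) / (x
  b_(i+1)).\<close>

lemma vr_valuation: "x \<in> vr e y \<or> inverse x \<in> vr e y"
proof -
 obtain p i where p: "poly (map_poly e p) x = 0" "ev (y (e [:0, 1:])) (coeff p i) ~= 0" by (rule primitive_relation)
 let ?b = "horner p x"
 have i: "i <= degree p" using p(2) by (intro le_degree) auto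
 have ya: "y (e (coeff p i)) ~= 0" unfolding pts_e[OF y, of "coeff p i"] by (rule p(2))
 have d: "0 < degree p"
 proof (rule ccontr)
  assume "\<not> 0 < degree p"
  then obtain a where "p = [:a:]" by (auto elim: degree_eq_zeroE)
  then show False using p by (cases i) (auto simp: map_poly_pCons_0)
 qed
 have bB: "?b k \<in> B" if "k <= degree p" for k by (rule horner_B) (use p d that in auto)
 have st: "x * ?b (Suc k) = ?b k - e (coeff p k)" if "k < degree p" for k using horner_step[OF that, of x] by simp
 have b0: "?b 0 = 0" using p(1) poly_map_poly_lessThan[of e "Suc (degree p)" p x] by (simp add: horner_def coeff_eq_0 atLeast0AtMost lessThan_Suc_atMost)
 show ?thesis
 proof (cases "\<exists>k<degree p. y (?b (Suc k)) ~= 0")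
  case True
  then obtain k where k: "k < degree p" "y (?b (Suc k)) ~= 0" by blast
  have "?b (Suc k) ~= 0" using k(2) y_simps(1) by auto
  then have "x = (?b k - e (coeff p k)) / ?b (Suc k)" using st[OF k(1)] by (simp add: field_simps)
  moreover have "(?b k - e (coeff p k)) / ?b (Suc k) \<in> vr e y" using k bB by (intro vrI) (auto simp: y_simps)
  ultimately show ?thesis by simp
 next
  case False
  then have z: "y (?b k) = 0" if "k <= degree p" for k using that b0 y_simps(1) by (cases k) auto
  have "i ~= degree p" using z[of i] ya horner_top[of p x] by auto
  then have k: "i < degree p" using i by simp
  have "y (x * ?b (Suc i)) ~= 0" unfolding st[OF k] using z[of i] k ya bB[of i] by (simp add: y_simps)
  moreover have "x * ?b (Suc i) \<in> B" unfolding st[OF k] using k bB[of i] by (simp add: y_simps)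
  moreover from calculation(1) have "inverse x = ?b (Suc i) / (x * ?b (Suc i))" using y_simps(1) by (auto simp: field_simps)
  ultimately show ?thesis using vrI[OF bB[of "Suc i"], of "x * ?b (Suc i)"] k by simp
 qed
qed

lemma vext_eq:
 assumes "b \<in> B" "c \<in> B" "y c ~= 0"
 shows "vext e y (b / c) = y b / y c"
 unfolding vext_def
proof (rule the_equality)
 show "EX b':B. EX c':B. y c' ~= 0 & b / c = b' / c' & y b / y c = y b' / y c'" using assms by blast
 fix r assume "EX b':B. EX c':B. y c' ~= 0 & b / c = b' / c' & r = y b' / y c'"
 then obtain b' c' where *: "b' \<in> B" "c' \<in> B" "y c' ~= 0" "b / c = b' / c'" "r = y b' / y c'" by blast
 have "c ~= 0" "c' ~= 0" using assms(3) *(3) y_simps(1) by auto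
 then have "b * c' = b' * c" using *(4) by (simp add: frac_eq_eq)
 then have "y b * y c' = y b' * y c" using y_simps(5)[of b c'] y_simps(5)[of b' c] assms *(1,2) by simp
 then show "r = y b / y c" using * assms(3) by (simp add: frac_eq_eq)
qed

lemma vext_B: "b \<in> B ==> vext e y b = y b"
 using vext_eq[of b 1] by (simp add: y_simps)

lemma vext_hom: "hom_on (vr e y) (vext e y)"
 unfolding hom_on_def
proof (intro conjI ballI)
 show "vext e y 1 = 1" using vext_B[of 1] by (simp add: y_simps)
 fix a b assume "a \<in> vr e y" "b \<in> vr e y"
 then obtain p q r s where *: "p \<in> B" "q \<in> B" "y q ~= 0" "q ~= 0" "a = p / q" "r \<in> B" "s \<in> B" "y s ~= 0" "s ~= 0" "b = r / s" by (elim vrE)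
 have "a * b = (p * r) / (q * s)" "a + b = (p * s + r * q) / (q * s)" using * by (simp_all add: add_frac_eq)
 then show "vext e y (a * b) = vext e y a * vext e y b" "vext e y (a + b) = vext e y a + vext e y b"
  using * vext_eq[of "p * r" "q * s"] vext_eq[of "p * s + r * q" "q * s"] vext_eq[of p q] vext_eq[of r s] by (simp_all add: y_simps add_frac_eq)
qed

lemma vext_0_iff: "v \<in> vr e y ==> vext e y v = 0 \<longleftrightarrow> v \<in> vr e y - Units (subring_of_type (vr e y))"
proof -
 assume v: "v \<in> vr e y"
 obtain b c where bc: "b \<in> B" "c \<in> B" "y c ~= 0" "c ~= 0" "v = b / c" by (rule vrE[OF v])
 have "v \<in> Units (subring_of_type (vr e y)) \<longleftrightarrow> (EX w:vr e y. w * v = 1)" using v by (auto simp: Units_def mult.commute)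
 also have "... \<longleftrightarrow> vext e y v ~= 0"
 proof
  assume "EX w:vr e y. w * v = 1"
  then obtain w where "w \<in> vr e y" "w * v = 1" by blast
  then show "vext e y v ~= 0" using hom_on_mult[OF sring_vr vext_hom, of w v] hom_on_1[OF sring_vr vext_hom] v by auto
 next
  assume "vext e y v ~= 0"
  then have yb: "y b ~= 0" using vext_eq[of b c] bc by simp
  then have "b ~= 0" using y_simps(1) by auto
  then show "EX w:vr e y. w * v = 1" using bc yb by (intro bexI[OF _ vrI[of c b]]) auto
 qed
 finally show ?thesis using v by blast
qed

lemma vr_place: "vr e y \<in> places \<iota>"
proof -
 obtain \<pi> where \<pi>: "\<pi> ~= 0" "e \<pi> \<in> ker y" by (rule ker_base[OF y])
 have "inverse (e \<pi>) \<notin> vr e y"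
 proof
  assume "inverse (e \<pi>) \<in> vr e y"
  then obtain b c where bc: "b \<in> B" "c \<in> B" "y c ~= 0" "c ~= 0" "inverse (e \<pi>) = b / c" by (rule vrE)
  then have "c = b * e \<pi>" using \<pi>(1) by (simp add: field_simps)
  then show False using bc \<pi>(2) by (simp add: y_simps ker_def)
 qed
 then show ?thesis unfolding places_def using vr_valuation sring_vr B_vr e_B by (auto simp: subring_iff_sring const_e)
qed

lemma vext_image: "finite (vext e y ` vr e y)" "card (vext e y ` vr e y) = CARD('k) ^ per pfrob y"
proof -
 let ?d = "per pfrob y"
 note per = per_pos_fixed[OF periodic_pfrob[OF y]]
 have fr: "(frob ^^ ?d) (y b) = y b" for b using fun_cong[OF per(2), of b] by (simp add: pfrob_pow)
 have "(frob ^^ ?d) (vext e y v) = vext e y v" if v: "v \<in> vr e y" for v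
 proof -
  obtain b c where bc: "b \<in> B" "c \<in> B" "y c ~= 0" "c ~= 0" "v = b / c" by (rule vrE[OF v])
  then show ?thesis using fr vext_eq[OF bc(1-3)] by (simp add: divide_inverse frob_pow.hom_mult frob_pow.hom_inverse)
 qed
 then have sub: "vext e y ` vr e y <= {z. (frob ^^ ?d) z = z}" by blast
 then show fin: "finite (vext e y ` vr e y)" using card_frob_fixed_le(1)[OF per(1)] by (rule finite_subset)
 have "y ` B <= vext e y ` vr e y" using vext_B B_vr by force
 then have "CARD('k) ^ ?d <= card (vext e y ` vr e y)" using card_mono[OF fin] card_point_image[OF y] by metis
 moreover have "card (vext e y ` vr e y) <= CARD('k) ^ ?d" using card_mono[OF card_frob_fixed_le(1)[OF per(1)] sub] card_frob_fixed_le(2)[OF per(1), where 'k='k] by linarith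
 ultimately show "card (vext e y ` vr e y) = CARD('k) ^ ?d" by simp
qed

end

lemma vr_eq_iff:
 assumes y: "y \<in> pts e UNIV" "y' \<in> pts e UNIV"
 shows "vr e y = vr e y' \<longleftrightarrow> y' \<in> orb pfrob y"
proof
 assume "y' \<in> orb pfrob y"
 then obtain i where "y' = (frob ^^ i) o y" by (auto simp: orb_in pfrob_pow)
 then show "vr e y = vr e y'" by (simp add: vr_def)
next
 assume eq: "vr e y = vr e y'"
 have "y z = 0 \<longleftrightarrow> z \<in> vr e y - Units (subring_of_type (vr e y))" if "z \<in> B" "y \<in> pts e UNIV" for y z
  using vext_0_iff[OF that(2) B_vr[OF that(2,1)]] vext_B[OF that(2,1)] by simp
 then have "y z = 0 \<longleftrightarrow> y' z = 0" if "z \<in> B" for z using that y eq by simp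
 then have "ker y = ker y'" unfolding ker_def by blast
 then obtain i where "y' = (frob ^^ i) o y" by (rule same_ker_conj[OF y])
 then show "y' \<in> orb pfrob y" by (auto simp: orb_in pfrob_pow)
qed

text \<open>A valuation ring V containing T contains B, being integrally closed. Its maximal ideal
  meets B in a prime that meets k[T] nontrivially, since otherwise V would contain all fractions.
  This prime is the kernel of a point y; the local ring of y lies in V, and being itself a valuation
  ring with the same nonunits in B it equals V.\<close>

lemma places_eq_vr: "{V \<in> places \<iota>. e [:0, 1:] \<in> V} = vr e ` pts e UNIV"
proof (intro equalityI subsetI)
 fix V assume "V \<in> vr e ` pts e UNIV"
 then show "V \<in> {V \<in> places \<iota>. e [:0, 1:] \<in> V}" using vr_place B_vr e_B by auto
next
 fix V assume "V \<in> {V \<in> places \<iota>. e [:0, 1:] \<in> V}"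
 then have V: "sring V" "V ~= UNIV" "!!x. x \<in> V \<or> inverse x \<in> V" and cV: "!!c. e [:c:] \<in> V" and TV: "e [:0, 1:] \<in> V"
  unfolding places_def by (auto simp: subring_iff_sring const_e)
 have eV: "e f \<in> V" for f
 proof (induction f)
  case (pCons c f)
  have "e (pCons c f) = e [:c:] + e [:0, 1:] * e f" by (simp flip: hom_add hom_mult)
  then show ?case using pCons cV TV sring_add[OF V(1)] sring_mult[OF V(1)] by simp
 qed (simp add: sring_0[OF V(1)])
 have BV: "z \<in> V" if "z \<in> B" for z
 proof (rule ccontr)
  assume z: "z \<notin> V"
  then have iz: "inverse z \<in> V" "z ~= 0" using V(3)[of z] sring_0[OF V(1)] by auto
  obtain p where p: "lead_coeff p = 1" "poly (map_poly e p) z = 0" using \<open>z \<in> B\<close> by (auto simp: intcl_def)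
  define n where "n = degree p"
  note r = monic_root_power[OF p]
  obtain n' where n': "degree p = Suc n'" using r(1) by (cases "degree p") auto
  have "z = z ^ Suc n' * inverse z ^ n'" using iz(2) by (simp add: power_inverse field_simps)
  also have "... = - (\<Sum>k<Suc n'. e (coeff p k) * (z ^ k * inverse z ^ n'))"
   using r(2) unfolding n' by (simp add: sum_distrib_right mult.assoc del: sum.lessThan_Suc power_Suc)
  also have "(\<Sum>k<Suc n'. e (coeff p k) * (z ^ k * inverse z ^ n')) = (\<Sum>k<Suc n'. e (coeff p k) * inverse z ^ (n' - k))"
  proof (rule sum.cong[OF refl])
   fix k assume "k \<in> {..<Suc n'}"
   then have "n' = k + (n' - k)" by auto
   then have "z ^ k * inverse z ^ n' = z ^ k * (inverse z ^ k * inverse z ^ (n' - k))" by (metis power_add)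
   then show "e (coeff p k) * (z ^ k * inverse z ^ n') = e (coeff p k) * inverse z ^ (n' - k)" using iz(2) by (simp add: power_inverse)
  qed
  also have "- ... \<in> V" using iz(1) eV by (intro sring_uminus[OF V(1)] sring_sum[OF V(1)] sring_mult[OF V(1)] sring_power[OF V(1)]) auto
  finally show False using z by contradiction
 qed
 define M where "M = {v \<in> V. v = 0 \<or> inverse v \<notin> V}"
 have Mi: "inverse v \<in> V" "v ~= 0" if "v \<in> V - M" for v using that by (auto simp: M_def)
 have MV: "v * m \<in> M" if "v \<in> V" "m \<in> M" for v m
 proof (cases "v * m = 0")
  case False
  then have "inverse m = v * inverse (v * m)" by (simp add: field_simps)
  moreover have "inverse m \<notin> V" using that(2) False by (simp add: M_def)
  ultimately have "inverse (v * m) \<notin> V" using sring_mult[OF V(1) that(1), of "inverse (v * m)"] by metis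
  then show ?thesis using that sring_mult[OF V(1)] by (simp add: M_def)
 next
  case True
  then show ?thesis unfolding True by (simp add: M_def sring_0[OF V(1)])
 qed
 have MD: "a - b \<in> M" if ab: "a \<in> M" "b \<in> M" for a b
 proof (cases "b = 0")
  case False
  note VD = sring_diff[OF V(1) _ sring_1[OF V(1)]] sring_diff[OF V(1) sring_1[OF V(1)]]
  have aV: "a \<in> V" "b \<in> V" using ab by (auto simp: M_def)
  show ?thesis
  proof (cases "a = 0")
   case True
   then show ?thesis using MV[of "- 1" b] ab sring_uminus[OF V(1) sring_1[OF V(1)]] by simp
  next
   case a0: False
   consider "a / b \<in> V" | "b / a \<in> V" using V(3)[of "a / b"] by (auto simp: inverse_divide)
   then show ?thesis
   proof cases
    case 1
    have "(a / b - 1) * b \<in> M" by (rule MV[OF VD(1)[OF 1] ab(2)])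
    moreover have "(a / b - 1) * b = a - b" using False by (simp add: left_diff_distrib)
    ultimately show ?thesis by (simp only:)
   next
    case 2
    have "(1 - b / a) * a \<in> M" by (rule MV[OF VD(2)[OF 2] ab(1)])
    moreover have "(1 - b / a) * a = a - b" using a0 by (simp add: left_diff_distrib)
    ultimately show ?thesis by (simp only:)
   qed
  qed
 qed (use ab in simp)
 have "1 \<notin> M" using sring_1[OF V(1)] by (simp add: M_def)
 define P where "P = M \<inter> B"
 have pP: "a \<in> P \<or> b \<in> P" if ab: "a \<in> B" "b \<in> B" "a * b \<in> P" for a b
 proof (rule ccontr)
  assume "\<not> (a \<in> P \<or> b \<in> P)"
  then have i: "inverse a \<in> V" "inverse b \<in> V" "a ~= 0" "b ~= 0" using ab BV Mi[of a] Mi[of b] by (auto simp: P_def)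
  then have "inverse (a * b) \<in> V" using sring_mult[OF V(1) i(1,2)] by simp
  then show False using ab(3) i by (simp add: P_def M_def)
 qed
 have P: "prime_set B P" unfolding prime_set_def
 proof (intro conjI ballI impI)
  show "P <= B" "0 \<in> P" "1 \<notin> P" using \<open>1 \<notin> M\<close> by (auto simp: P_def M_def sring_0[OF V(1)] sring_0[OF sring_B])
  show "a - b \<in> P" if "a \<in> P" "b \<in> P" for a b using that MD sring_diff[OF sring_B] by (simp add: P_def)
  show "a * b \<in> P" if "a \<in> B" "b \<in> P" for a b using that MV BV sring_mult[OF sring_B] by (simp add: P_def)
  show "a \<in> P \<or> b \<in> P" if "a \<in> B" "b \<in> B" "a * b \<in> P" for a b by (rule pP[OF that])
 qed
 have "\<exists>\<pi>. \<pi> ~= 0 & e \<pi> \<in> P"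
 proof (rule ccontr)
  assume "\<not> (\<exists>\<pi>. \<pi> ~= 0 & e \<pi> \<in> P)"
  then have inv: "inverse (e f) \<in> V" if "f ~= 0" for f using that eV Mi(1)[of "e f"] e_B by (auto simp: P_def)
  have "x \<in> V" for x
  proof -
   obtain a where a: "a ~= 0" "e a * x \<in> B" by (rule ex_denominator[of x]) simp_all
   have "inverse (e a) * (e a * x) \<in> V" by (rule sring_mult[OF V(1) inv[OF a(1)] BV[OF a(2)]])
   then show ?thesis using a(1) by (simp flip: mult.assoc)
  qed
  then show False using V(2) by blast
 qed
 then obtain \<pi> where "\<pi> ~= 0" "e \<pi> \<in> P" by blast
 then obtain y where y: "y \<in> pts e UNIV" "ker y = P" using point_of_prime[OF P] by blast
 have y0: "y b = 0 \<longleftrightarrow> b \<in> M" if "b \<in> B" for b using y(2) that by (auto simp: ker_def P_def)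
 have "vr e y <= V"
 proof
  fix z assume "z \<in> vr e y"
  then obtain b c where bc: "b \<in> B" "c \<in> B" "y c ~= 0" "c ~= 0" "z = b / c" by (rule vrE[OF y(1)])
  then have "inverse c \<in> V" using Mi(1)[of c] y0 BV by blast
  then show "z \<in> V" using sring_mult[OF V(1) BV[OF bc(1)]] bc(5) by (simp add: divide_inverse)
 qed
 moreover have "V <= vr e y"
 proof
  fix v assume v: "v \<in> V"
  show "v \<in> vr e y"
  proof (rule ccontr)
   assume n: "v \<notin> vr e y"
   then have v0: "v ~= 0" using B_vr[OF y(1) sring_0[OF sring_B]] by auto
   have "inverse v \<in> vr e y" using vr_valuation[OF y(1), of v] n by blast
   then obtain b c where bc: "b \<in> B" "c \<in> B" "y c ~= 0" "c ~= 0" "inverse v = b / c" by (rule vrE[OF y(1)])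
   have "y b = 0"
   proof (rule ccontr)
    assume "y b ~= 0"
    then have "c / b \<in> vr e y" by (rule vrI[OF y(1) bc(2,1)])
    moreover have "v = c / b" using bc(5) by (metis inverse_divide inverse_inverse_eq)
    ultimately show False using n by simp
   qed
   then have "b \<in> M" using y0[OF bc(1)] by simp
   moreover have "b = c * inverse v" using bc by simp
   then have "v * b = c" using v0 by simp
   ultimately have "c \<in> M" using MV[OF v, of b] by simp
   then show False using y0[OF bc(2)] bc(3) by simp
  qed
 qed
 ultimately show "V \<in> vr e ` pts e UNIV" using y(1) by blast
qed

text \<open>The residue field has q^per(y) elements by its points, and |C|^deg elements by its
  dimension over the field C of constants, where |C| = q^r.\<close>

lemma place_weight:
 assumes y: "y \<in> pts e UNIV"
 shows "constant_degree \<iota> * place_degree \<iota> (vr e y) = per pfrob y"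
proof -
 let ?V = "vr e y" and ?Y = "vext e y" and ?C = "constant_field \<iota>"
 interpret c: field_hom "const_embed \<iota>" by (rule const_embed_hom)
 have CF: "sfield ?C" unfolding constant_field_def by (rule sfield_algebraic[OF const_embed_hom])
 have CV: "?C <= ?V"
 proof
  fix x assume "x \<in> ?C"
  then obtain n where n: "0 < n" "x ^ (CARD('k) ^ n) = x" using algebraic_iff_power_fixed[OF const_embed_hom] unfolding constant_field_def by blast
  show "x \<in> ?V"
  proof (rule ccontr)
   assume x: "x \<notin> ?V"
   then have i: "inverse x \<in> ?V" "x ~= 0" using vr_valuation[OF y, of x] B_vr[OF y sring_0[OF sring_B]] by auto
   \<comment> \<open>Writing the exponent as m + 2, the equation x^(m + 2) = x gives x = (1/x)^m, so
     a constant lies in every valuation ring containing its inverse.\<close>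
   have "2 <= CARD('k) ^ n" using n(1) CARD_ge_2[where 'k='k] self_le_power[of "CARD('k)" n] by linarith
   then obtain m where m: "CARD('k) ^ n = Suc (Suc m)" using le_Suc_ex[of 2 "CARD('k) ^ n"] by auto
   have "x * (x * x ^ m) = x * 1" using n(2) unfolding m by simp
   then have "x * x ^ m = 1" using i(2) by (simp only: mult_cancel_left) simp
   then have "x = inverse x ^ m" using i(2) by (metis inverse_unique inverse_inverse_eq power_inverse mult.commute)
   then show False using x sring_power[OF sring_vr[OF y] i(1), of m] by simp
  qed
 qed
 define M where "M = ?V - Units (subring_of_type ?V)"
 have M: "?Y v = 0 \<longleftrightarrow> v \<in> M" if "v \<in> ?V" for v unfolding M_def by (rule vext_0_iff[OF y that])
 note V = sring_vr[OF y] and Yh = vext_hom[OF y]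
 define R where "R = (%w. SOME v. v \<in> ?V & ?Y v = w) ` (?Y ` ?V)"
 have R: "(SOME v. v \<in> ?V & ?Y v = ?Y b) \<in> ?V & ?Y (SOME v. v \<in> ?V & ?Y v = ?Y b) = ?Y b" if "b \<in> ?V" for b by (rule someI_ex) (use that in blast)
 interpret fp: finite_prime ?V M R
 proof
  show "sring ?V" by (rule V)
  have "M = {v \<in> ?V. ?Y v = 0}" using M by (auto simp: M_def)
  then show "prime_set ?V M" by (auto simp: prime_set_def sring_0[OF V] sring_diff[OF V] sring_mult[OF V] hom_on_0[OF V Yh] hom_on_1[OF V Yh]
     hom_on_diff[OF V Yh] hom_on_mult[OF V Yh])
  show "finite R" "R <= ?V" unfolding R_def using vext_image(1)[OF y] R by auto
  fix b assume b: "b \<in> ?V"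
  let ?r = "SOME v. v \<in> ?V & ?Y v = ?Y b"
  have "?Y (b - ?r) = 0" "b - ?r \<in> ?V" using hom_on_diff[OF V Yh b, of ?r] sring_diff[OF V b] R[OF b] by auto
  then have "b - ?r \<in> M" using M by blast
  then show "EX r:R. b - r \<in> M" unfolding R_def using b by blast
 qed
 have cV: "card (?Y ` ?V) = card (?Y ` ?C) ^ residue_degree ?C ?V M" by (rule fp.card_residue_degree(1)[OF Yh M CV sfield_sring[OF CF]])
 have injC: "inj_on ?Y ?C" using hom_on_inj[OF CF hom_on_subset[OF Yh CV]] by (auto intro: inj_onI)
 have fC: "finite ?C" using finite_imageD[OF finite_subset[OF image_mono[OF CV] vext_image(1)[OF y]] injC] .
 interpret R: ring "ring_of_type_algebra :: 'a ring" using cring.axioms(1)[OF cring_subring_of_type[OF sring_UNIV]] subring_of_type_UNIV by metis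
 have kC: "range (const_embed \<iota>) <= ?C"
 proof
  fix x assume "x \<in> range (const_embed \<iota>)"
  then obtain a where "x = const_embed \<iota> a" by blast
  then have "x ^ (CARD('k) ^ 1) = x" by (simp add: power_CARD_eq_same flip: c.hom_power)
  then have "\<exists>n>0. x ^ (CARD('k) ^ n) = x" by blast
  then show "x \<in> ?C" unfolding constant_field_def mem_Collect_eq algebraic_iff_power_fixed[OF const_embed_hom] .
 qed
 have K: "subfield (range (const_embed \<iota>)) (ring_of_type_algebra :: 'a ring)"
 proof -
  interpret F: field "ring_of_type_algebra :: 'a ring"
  proof (rule cring.cring_fieldI2)
   show "cring (ring_of_type_algebra :: 'a ring)" using cring_subring_of_type[OF sring_UNIV] subring_of_type_UNIV by metis
   show "EX b:carrier ring_of_type_algebra. a \<otimes>\<^bsub>ring_of_type_algebra\<^esub> b = \<one>\<^bsub>ring_of_type_algebra\<^esub>"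
    if "a ~= \<zero>\<^bsub>ring_of_type_algebra\<^esub>" for a :: 'a using that by (intro bexI[of _ "inverse a"]) auto
  qed simp
  have "sring (range (const_embed \<iota>))" by (rule sringI) (auto simp flip: c.hom_one c.hom_minus c.hom_mult)
  then have sr: "subring (range (const_embed \<iota>)) (ring_of_type_algebra :: 'a ring)" by (simp add: subring_iff_sring)
  show ?thesis
  proof (rule F.subfieldI'[OF sr])
   fix k assume "k \<in> range (const_embed \<iota>) - {\<zero>\<^bsub>ring_of_type_algebra :: 'a ring\<^esub>}"
   then obtain a where a: "k = const_embed \<iota> a" "k ~= 0" by auto
   have "inv\<^bsub>ring_of_type_algebra\<^esub> k = inverse k" using F.comm_inv_char[of k "inverse k"] a(2) by simp
   then show "inv\<^bsub>ring_of_type_algebra\<^esub> k \<in> range (const_embed \<iota>)" unfolding a(1) by (simp flip: c.hom_inverse)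
  qed
 qed
 have "card ?C = card (range (const_embed \<iota>)) ^ ring.dim ring_of_type_algebra (range (const_embed \<iota>)) ?C" by (rule R.card_eq_power_dim[OF K fC])
   (use kC in \<open>auto simp: sring_add[OF sfield_sring[OF CF]] sring_mult[OF sfield_sring[OF CF]]\<close>)
 then have "card ?C = CARD('k) ^ constant_degree \<iota>" by (simp add: constant_degree_def card_image[OF c.inj_f])
 then have "CARD('k) ^ per pfrob y = CARD('k) ^ (constant_degree \<iota> * place_degree \<iota> ?V)"
  using cV vext_image(2)[OF y] card_image[OF injC] by (simp add: place_degree_def M_def power_mult)
 then show ?thesis using CARD_ge_2[where 'k='k] by (simp add: power_inject_exp)
qed

end



section \<open>From fixed points to the zeta function\<close>

definition place_weight :: "('k::{field,finite} poly fract => 'a::field) => 'a set => nat" where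
 "place_weight \<iota> V = constant_degree \<iota> * place_degree \<iota> V"

text \<open>A weight-preserving bijection of places extends to multisets and preserves norms.
  Reindexing the sum along it is valid for every s, also where the series does not converge.\<close>

lemma weil_zeta_eqI:
 fixes \<iota> :: "'k::{field,finite} poly fract => 'a::field" and \<kappa> :: "'k poly fract => 'b::field"
 assumes eq: "!!d. card {V \<in> places \<iota>. place_weight \<iota> V = d} = card {V \<in> places \<kappa>. place_weight \<kappa> V = d}"
  and fin: "!!d. finite {V \<in> places \<iota>. place_weight \<iota> V = d}" "!!d. finite {V \<in> places \<kappa>. place_weight \<kappa> V = d}"
 shows "weil_zeta \<iota> = weil_zeta \<kappa>"
proof -
 define A B where "A = (%d. {V \<in> places \<iota>. place_weight \<iota> V = d})" and "B = (%d. {V \<in> places \<kappa>. place_weight \<kappa> V = d})"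
 have "ALL d. EX h. bij_betw h (A d) (B d)" unfolding A_def B_def using finite_same_card_bij[OF fin eq] by blast
 then obtain h where h: "!!d. bij_betw (h d) (A d) (B d)" by metis
 define \<beta> \<gamma> where "\<beta> = (%V. h (place_weight \<iota> V) V)"
  and "\<gamma> = (%W. inv_into (A (place_weight \<kappa> W)) (h (place_weight \<kappa> W)) W)"
 have \<beta>1: "\<beta> V \<in> places \<kappa>" "place_weight \<kappa> (\<beta> V) = place_weight \<iota> V" and g: "\<gamma> (\<beta> V) = V" if "V \<in> places \<iota>" for V
 proof -
  have V: "V \<in> A (place_weight \<iota> V)" using that by (simp add: A_def)
  then show b: "\<beta> V \<in> places \<kappa>" "place_weight \<kappa> (\<beta> V) = place_weight \<iota> V"
   using bij_betwE[OF h, of "place_weight \<iota> V"] by (auto simp: \<beta>_def B_def)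
  show "\<gamma> (\<beta> V) = V" unfolding \<gamma>_def b(2) unfolding \<beta>_def by (rule bij_betw_inv_into_left[OF h V])
 qed
 have g': "\<beta> (\<gamma> W) = W" "\<gamma> W \<in> places \<iota>" if "W \<in> places \<kappa>" for W
 proof -
  have W: "W \<in> B (place_weight \<kappa> W)" using that by (simp add: B_def)
  have "\<gamma> W \<in> A (place_weight \<kappa> W)" unfolding \<gamma>_def using bij_betwE[OF bij_betw_inv_into[OF h]] W by blast
  then show "\<gamma> W \<in> places \<iota>" and "\<beta> (\<gamma> W) = W" using bij_betw_inv_into_right[OF h W] by (auto simp: A_def \<beta>_def \<gamma>_def)
 qed
 have bE: "bij_betw (image_mset \<beta>) (effective_divisors \<iota>) (effective_divisors \<kappa>)"
 proof (rule bij_betw_byWitness[where f' = "image_mset \<gamma>"])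
  show "ALL D:effective_divisors \<iota>. image_mset \<gamma> (image_mset \<beta> D) = D"
  proof
   fix D assume "D \<in> effective_divisors \<iota>"
   then have "image_mset (\<gamma> o \<beta>) D = image_mset id D" by (intro image_mset_cong) (auto simp: effective_divisors_def g)
   then show "image_mset \<gamma> (image_mset \<beta> D) = D" by (simp add: multiset.map_comp)
  qed
  show "ALL D:effective_divisors \<kappa>. image_mset \<beta> (image_mset \<gamma> D) = D"
  proof
   fix D assume "D \<in> effective_divisors \<kappa>"
   then have "image_mset (\<beta> o \<gamma>) D = image_mset id D" by (intro image_mset_cong) (auto simp: effective_divisors_def g')
   then show "image_mset \<beta> (image_mset \<gamma> D) = D" by (simp add: multiset.map_comp)
  qed
 qed (auto simp: effective_divisors_def intro!: \<beta>1 g'(2) dest: subsetD)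
 have norm: "divisor_norm \<kappa> (image_mset \<beta> D) = divisor_norm \<iota> D" if "D \<in> effective_divisors \<iota>" for D
 proof -
  have "constant_degree \<kappa> * divisor_degree \<kappa> (image_mset \<beta> D) = (\<Sum>V\<in>#D. place_weight \<kappa> (\<beta> V))"
   by (simp add: divisor_degree_def place_weight_def sum_mset_distrib_left image_mset.compositionality o_def)
  also have "... = (\<Sum>V\<in>#D. place_weight \<iota> V)"
   by (intro arg_cong[of _ _ sum_mset] image_mset_cong) (use that \<beta>1 in \<open>auto simp: effective_divisors_def\<close>)
  also have "... = constant_degree \<iota> * divisor_degree \<iota> D"
   by (simp add: divisor_degree_def place_weight_def sum_mset_distrib_left image_mset.compositionality o_def)
  finally show ?thesis by (simp add: divisor_norm_def)
 qed
 show ?thesis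
 proof
  fix s
  have "weil_zeta \<iota> s = (\<Sum>\<^sub>\<infinity>D\<in>effective_divisors \<iota>. of_nat (divisor_norm \<kappa> (image_mset \<beta> D)) powr - s)"
   unfolding weil_zeta_def by (rule infsum_cong) (simp add: norm)
  also have "... = weil_zeta \<kappa> s" unfolding weil_zeta_def by (rule infsum_reindex_bij_betw[OF bE])
  finally show "weil_zeta \<iota> s = weil_zeta \<kappa> s" .
 qed
qed

text \<open>S is UNIV in the chart T and {0} in the chart 1/T, where only the places at which T has
  a pole are to be counted.\<close>

definition pts_in :: "('k::{field,finite} poly => 'e::field) => 'k alg_closure set => ('e => 'k alg_closure) set" where
 "pts_in e S = {y \<in> pts e UNIV. y (e [:0, 1:]) \<in> S}"

lemma card_fixed_pts_in:
 assumes "0 < n" "!!t. finite (fix_pts e n t)"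
 shows "card {y \<in> pts_in e S. (pfrob ^^ n) y = y} = (\<Sum>t | t \<in> S & (frob ^^ n) t = t. card (fix_pts e n t))"
  "finite {y \<in> pts_in e S. (pfrob ^^ n) y = y}"
proof -
 let ?T = "{t. t \<in> S & (frob ^^ n) t = t}"
 have fT: "finite ?T" using card_frob_fixed_le(1)[OF assms(1)] by (rule finite_subset[rotated]) auto
 have e: "{y \<in> pts_in e S. (pfrob ^^ n) y = y} = (\<Union>t\<in>?T. fix_pts e n t)" by (auto simp: pts_in_def fix_pts_def pfrob_pow) (metis comp_apply)
 show "finite {y \<in> pts_in e S. (pfrob ^^ n) y = y}" unfolding e using fT assms(2) by blast
 show "card {y \<in> pts_in e S. (pfrob ^^ n) y = y} = (SUM t:?T. card (fix_pts e n t))"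
  unfolding e by (rule card_UN_disjoint) (use fT assms(2) in \<open>auto simp: fix_pts_def\<close>)
qed

text \<open>A place of weight d is a Frobenius orbit of d points of period d.\<close>

lemma (in place_chart) card_places_weight:
 assumes S: "!!t. t \<in> S ==> frob t \<in> S" and fin: "!!t n. finite (fix_pts e n t)" and d: "0 < d"
 shows "card {y \<in> pts_in e S. per pfrob y = d} = d * card {V \<in> vr e ` pts_in e S. place_weight \<iota> V = d}"
  "finite {V \<in> vr e ` pts_in e S. place_weight \<iota> V = d}"
proof -
 have P: "y \<in> pts e UNIV" if "y \<in> pts_in e S" for y using that by (simp add: pts_in_def)
 have e: "{V \<in> vr e ` pts_in e S. place_weight \<iota> V = d} = vr e ` {y \<in> pts_in e S. per pfrob y = d}" using place_weight P by (auto simp: place_weight_def)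
 have "{y \<in> pts_in e S. per pfrob y = d} <= {y \<in> pts_in e S. (pfrob ^^ d) y = y}" using per_pos_fixed(2)[OF periodic_pfrob[OF P]] by auto
 then have f: "finite {y \<in> pts_in e S. per pfrob y = d}" using card_fixed_pts_in(2)[OF d fin] by (rule finite_subset)
 then show "finite {V \<in> vr e ` pts_in e S. place_weight \<iota> V = d}" unfolding e by (rule finite_imageI)
 show "card {y \<in> pts_in e S. per pfrob y = d} = d * card {V \<in> vr e ` pts_in e S. place_weight \<iota> V = d}" unfolding e
 proof (rule card_orbit_quotient[OF periodic_pfrob[OF P] _ _ f])
  show "pfrob y \<in> pts_in e S" if "y \<in> pts_in e S" for y using that pfrob_pow_pts[of y 1] S by (auto simp: pts_in_def)
  show "vr e y = vr e y' \<longleftrightarrow> y' \<in> orb pfrob y" if "y \<in> pts_in e S" "y' \<in> pts_in e S" for y y' by (rule vr_eq_iff[OF P[OF that(1)] P[OF that(2)]])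
 qed
qed

lemma card_places_weight_eq:
 fixes e :: "'k::{field,finite} poly => 'a::field" and e' :: "'k poly => 'b::field"
 assumes "place_chart e D \<iota>" "place_chart e' D' \<kappa>" and S: "!!t. t \<in> S ==> frob t \<in> S"
  and fin: "!!t n. finite (fix_pts e n t)" "!!t n. finite (fix_pts e' n t)"
  and eq: "!!t n. card (fix_pts e n t) = card (fix_pts e' n t)"
 shows "card {V \<in> vr e ` pts_in e S. place_weight \<iota> V = d} = card {V \<in> vr e' ` pts_in e' S. place_weight \<kappa> V = d}"
  "finite {V \<in> vr e ` pts_in e S. place_weight \<iota> V = d}" "finite {V \<in> vr e' ` pts_in e' S. place_weight \<kappa> V = d}"
proof -
 interpret a: place_chart e D \<iota> by fact
 interpret b: place_chart e' D' \<kappa> by fact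
 have A: "y \<in> pts e UNIV" if "y \<in> pts_in e S" for y using that by (simp add: pts_in_def)
 have B: "y \<in> pts e' UNIV" if "y \<in> pts_in e' S" for y using that by (simp add: pts_in_def)
 have "{V \<in> vr e ` pts_in e S. place_weight \<iota> V = 0} = {}" "{V \<in> vr e' ` pts_in e' S. place_weight \<kappa> V = 0} = {}"
  using per_pos_fixed(1)[OF a.periodic_pfrob[OF A]] per_pos_fixed(1)[OF b.periodic_pfrob[OF B]]
  by (auto simp only: place_weight_def a.place_weight[OF A] b.place_weight[OF B] less_irrefl image_iff) (metis less_irrefl)+
 note zero = this
 show "card {V \<in> vr e ` pts_in e S. place_weight \<iota> V = d} = card {V \<in> vr e' ` pts_in e' S. place_weight \<kappa> V = d}"
 proof (cases "d = 0")
  case True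
  show ?thesis unfolding True zero by simp
 next
  case False
  have "card {y \<in> pts_in e S. per pfrob y = d} = card {y \<in> pts_in e' S. per pfrob y = d}"
   by (rule card_per_eqI[OF a.periodic_pfrob[OF A] card_fixed_pts_in(2)[OF _ fin(1)] b.periodic_pfrob[OF B] card_fixed_pts_in(2)[OF _ fin(2)]])
    (simp_all only: card_fixed_pts_in(1)[OF _ fin(1)] card_fixed_pts_in(1)[OF _ fin(2)] eq, use False in simp_all)
  then show ?thesis using a.card_places_weight(1)[OF S fin(1), of d] b.card_places_weight(1)[OF S fin(2), of d] False by simp
 qed
 show "finite {V \<in> vr e ` pts_in e S. place_weight \<iota> V = d}" by (cases "d = 0") (simp only: zero finite.emptyI, rule a.card_places_weight(2)[OF S fin(1)], simp_all)
 show "finite {V \<in> vr e' ` pts_in e' S. place_weight \<kappa> V = d}"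
  by (cases "d = 0") (simp only: zero finite.emptyI, rule b.card_places_weight(2)[OF S fin(2)], simp_all)
qed

text \<open>The second chart covers the places at which \<open>T\<close> has a pole: there \<open>1/T\<close> vanishes.\<close>
lemma places_two_charts:
 assumes "place_chart e D \<iota>" "place_chart e2 D2 \<iota>" and inv: "e2 [:0, 1:] = inverse (e [:0, 1:])"
 shows "places \<iota> = vr e ` pts_in e UNIV \<union> vr e2 ` pts_in e2 {0}" "vr e ` pts_in e UNIV \<inter> vr e2 ` pts_in e2 {0} = {}"
proof -
 interpret a: place_chart e D \<iota> by fact
 interpret b: place_chart e2 D2 \<iota> by fact
 let ?T = "e [:0, 1:]" and ?S = "e2 [:0, 1:]"
 have U: "pts_in e UNIV = pts e UNIV" "pts_in e2 UNIV = pts e2 UNIV" by (auto simp: pts_in_def)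
 have T0: "?T ~= 0" by simp
 have z: "y ?S = 0 \<longleftrightarrow> ?T \<notin> vr e2 y" if y: "y \<in> pts e2 UNIV" for y
 proof -
  have "inverse ?S = ?T" using inv by simp
  have m: "vext e2 y (?S * ?T) = vext e2 y ?S * vext e2 y ?T" if "?T \<in> vr e2 y" by (rule hom_on_mult[OF b.sring_vr[OF y] b.vext_hom[OF y] b.B_vr[OF y b.e_B] that])
  have "vext e2 y (?S * ?T) = 1" using inv T0 hom_on_1[OF b.sring_vr[OF y] b.vext_hom[OF y]] by simp
  then have "y ?S ~= 0" if "?T \<in> vr e2 y" using m[OF that] b.vext_B[OF y b.e_B, of "[:0, 1:]"] by auto
  moreover have "?T \<in> vr e2 y" if "y ?S ~= 0" using b.vrI[OF y sring_1[OF b.sring_B] b.e_B that] inv by (simp add: divide_inverse)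
  ultimately show ?thesis by blast
 qed
 have i: "?S \<in> V" if "V \<in> places \<iota>" "?T \<notin> V" for V using that inv unfolding places_def by force
 have e2: "vr e2 ` pts_in e2 {0} = {V \<in> places \<iota>. ?T \<notin> V}"
 proof (intro equalityI subsetI)
  fix V assume "V \<in> vr e2 ` pts_in e2 {0}"
  then show "V \<in> {V \<in> places \<iota>. ?T \<notin> V}" using z b.vr_place by (auto simp: pts_in_def)
 next
  fix V assume V: "V \<in> {V \<in> places \<iota>. ?T \<notin> V}"
  then have "V \<in> vr e2 ` pts e2 UNIV" using i b.places_eq_vr by blast
  then show "V \<in> vr e2 ` pts_in e2 {0}" using z V by (auto simp: pts_in_def)
 qed
 show "places \<iota> = vr e ` pts_in e UNIV \<union> vr e2 ` pts_in e2 {0}" "vr e ` pts_in e UNIV \<inter> vr e2 ` pts_in e2 {0} = {}"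
  unfolding e2 U a.places_eq_vr[symmetric] by auto
qed

theorem weil_zeta_eq_if_fix_pts_eq:
 fixes e :: "'k::{field,finite} poly => 'a::field" and e' :: "'k poly => 'b::field"
 assumes a: "place_chart e D \<iota>" "place_chart e2 D2 \<iota>" "e2 [:0, 1:] = inverse (e [:0, 1:])"
  and b: "place_chart e' D' \<kappa>" "place_chart e2' D2' \<kappa>" "e2' [:0, 1:] = inverse (e' [:0, 1:])"
  and fin: "!!t n. finite (fix_pts e n t)" "!!t n. finite (fix_pts e' n t)" "!!t n. finite (fix_pts e2 n t)" "!!t n. finite (fix_pts e2' n t)"
  and eq: "!!t n. card (fix_pts e n t) = card (fix_pts e' n t)" "!!t n. card (fix_pts e2 n t) = card (fix_pts e2' n t)"
 shows "weil_zeta \<iota> = weil_zeta \<kappa>"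
proof (rule weil_zeta_eqI)
 fix d
 note p = places_two_charts[OF a] and p' = places_two_charts[OF b]
 note c1 = card_places_weight_eq[OF a(1) b(1) _ fin(1,2) eq(1), of UNIV d, simplified]
 have c2: "card {V \<in> vr e2 ` pts_in e2 {0}. place_weight \<iota> V = d} = card {V \<in> vr e2' ` pts_in e2' {0}. place_weight \<kappa> V = d}"
  "finite {V \<in> vr e2 ` pts_in e2 {0}. place_weight \<iota> V = d}" "finite {V \<in> vr e2' ` pts_in e2' {0}. place_weight \<kappa> V = d}"
  using card_places_weight_eq[OF a(2) b(2) _ fin(3,4) eq(2), of "{0}" d] by simp_all
 have s: "{V \<in> places \<iota>. place_weight \<iota> V = d}
   = {V \<in> vr e ` pts_in e UNIV. place_weight \<iota> V = d} \<union> {V \<in> vr e2 ` pts_in e2 {0}. place_weight \<iota> V = d}"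
  "{V \<in> places \<kappa>. place_weight \<kappa> V = d}
   = {V \<in> vr e' ` pts_in e' UNIV. place_weight \<kappa> V = d} \<union> {V \<in> vr e2' ` pts_in e2' {0}. place_weight \<kappa> V = d}"
  unfolding p(1) p'(1) by blast+
 show "finite {V \<in> places \<iota>. place_weight \<iota> V = d}" "finite {V \<in> places \<kappa>. place_weight \<kappa> V = d}" unfolding s using c1 c2 by simp_all
 show "card {V \<in> places \<iota>. place_weight \<iota> V = d} = card {V \<in> places \<kappa>. place_weight \<kappa> V = d}" unfolding s
 proof (subst (1 2) card_Un_disjoint)
  show "{V \<in> vr e ` pts_in e UNIV. place_weight \<iota> V = d} \<inter> {V \<in> vr e2 ` pts_in e2 {0}. place_weight \<iota> V = d} = {}"
   "{V \<in> vr e' ` pts_in e' UNIV. place_weight \<kappa> V = d} \<inter> {V \<in> vr e2' ` pts_in e2' {0}. place_weight \<kappa> V = d} = {}" using p(2) p'(2) by blast+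
 qed (simp_all only: c1 c2)
qed


section \<open>Primes of the base and splitting types\<close>

text \<open>The prime of k[T] cut out by t; the nonzero primes correspond to the Frobenius orbits of
  t.\<close>

definition ideal_at :: "'k::{field,finite} alg_closure => 'k poly set" where
 "ideal_at t = {f. ev t f = 0}"

lemma prime_set_ideal_at: "prime_set UNIV (ideal_at t)"
 unfolding prime_set_def ideal_at_def by (auto simp: ev.hom_minus ev.hom_mult)

lemma base_primes_eq: "(base_primes :: 'k::{field,finite} poly set set) = range ideal_at"
proof (intro equalityI subsetI)
 fix P :: "'k poly set" assume "P \<in> base_primes"
 then have "primeideal P (ring_of_type_algebra :: 'k poly ring)" and ne: "P ~= {0}" by (auto simp: base_primes_def)
 then have P: "prime_set UNIV P" using primeideal_iff_prime_set[OF sring_UNIV, of P] by (simp add: subring_of_type_UNIV)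
 then have P0: "0 \<in> P" and Pm: "!!a b. b \<in> P ==> a * b \<in> P" and Pd: "!!a b. a \<in> P ==> b \<in> P ==> a - b \<in> P"
  and P1: "1 \<notin> P" and Pp: "!!a b. a * b \<in> P ==> a \<in> P \<or> b \<in> P" unfolding prime_set_def by auto
 obtain d0 where d0: "d0 \<in> P" "d0 ~= 0" using ne P0 by blast
 obtain d where d: "d \<in> P" "lead_coeff d = 1" "ALL b. b \<in> P --> d dvd b" by (rule euclid_ideal[of "%b. b \<in> P" d0, OF d0]) (use Pd Pm in blast)+
 have dn: "d ~= 0" using d(2) by auto
 have "degree d ~= 0"
 proof
  assume "degree d = 0"
  then have "d = 1" using d(2) by (auto elim!: degree_eq_zeroE simp: one_pCons)
  then show False using d(1) P1 by simp
 qed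
 then have "0 < degree (map_poly to_ac d)" by simp
 then obtain t where t: "ev t d = 0" unfolding ev_def using alg_closed_imp_poly_has_root by blast
 obtain \<pi> where \<pi>: "!!z. ev z \<pi> = 0 \<longleftrightarrow> z \<in> orb frob t" "lead_coeff \<pi> = 1" "degree \<pi> = fper t" using ex_poly_roots_orb[of t] by blast
 obtain w where w: "d = \<pi> * w" using ev_eq_0_imp_dvd[OF \<pi> t] by (rule dvdE)
 have "w \<notin> P"
 proof
  assume "w \<in> P"
  then have "degree d <= degree w" using d(3) w dn by (intro dvd_imp_degree_le) auto
  moreover have "degree d = degree \<pi> + degree w" using w dn by (simp add: degree_mult_eq)
  ultimately show False using \<pi>(3) per_pos_fixed(1)[OF periodic_frob, of t] by simp
 qed
 then have p: "\<pi> \<in> P" using Pp[of \<pi> w] d(1) w by simp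
 have "f \<in> P \<longleftrightarrow> ev t f = 0" for f
 proof
  assume "f \<in> P"
  then show "ev t f = 0" using d(3) t by (auto simp: ev.hom_mult elim!: dvdE)
 next
  assume "ev t f = 0"
  then obtain v where "f = \<pi> * v" using ev_eq_0_imp_dvd[OF \<pi>] by (rule_tac dvdE)
  then show "f \<in> P" using Pm[OF p, of v] by (simp add: mult.commute)
 qed
 then have "P = ideal_at t" by (auto simp: ideal_at_def)
 then show "P \<in> range ideal_at" by blast
next
 fix P :: "'k poly set" assume "P \<in> range ideal_at"
 then obtain t where t: "P = ideal_at t" by blast
 obtain \<pi> :: "'k poly" where \<pi>: "!!z. ev z \<pi> = 0 \<longleftrightarrow> z \<in> orb frob t" "lead_coeff \<pi> = 1" using ex_poly_roots_orb by metis
 have "\<pi> \<in> P" "\<pi> ~= 0" using \<pi>(1)[of t] \<pi>(2) orb_self[of t frob] by (auto simp: t ideal_at_def)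
 moreover have "primeideal P (ring_of_type_algebra :: 'k poly ring)"
  using primeideal_iff_prime_set[OF sring_UNIV, of P] prime_set_ideal_at[of t] t by (simp add: subring_of_type_UNIV)
 ultimately show "P \<in> base_primes" by (auto simp: base_primes_def)
qed

lemma ideal_at_eq_iff: "ideal_at t = ideal_at t' \<longleftrightarrow> t' \<in> orb frob t"
proof
 assume "ideal_at t = ideal_at t'"
 then show "t' \<in> orb frob t" by (intro conj_imp_orb) (auto simp: ideal_at_def set_eq_iff)
next
 assume "t' \<in> orb frob t"
 then show "ideal_at t = ideal_at t'" using ev_eq_0_orb unfolding ideal_at_def by blast
qed

lemma base_norm_ideal_at: "base_norm (ideal_at t) = CARD('k) ^ fper (t :: 'k::{field,finite} alg_closure)"
proof -
 obtain \<pi> where \<pi>: "!!z. ev z \<pi> = 0 \<longleftrightarrow> z \<in> orb frob t" "lead_coeff \<pi> = 1" "degree \<pi> = fper t" using ex_poly_roots_orb[of t] by blast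
 have d: "0 < degree \<pi>" using \<pi>(3) per_pos_fixed(1)[OF periodic_frob, of t] by simp
 have p0: "ev t \<pi> = 0" using \<pi>(1)[of t] orb_self[of t frob] by simp
 interpret fp: finite_prime UNIV "ideal_at t" "{f. deg_less (fper t) f}"
 proof
  show "sring (UNIV :: 'k poly set)" "prime_set UNIV (ideal_at t)" by (rule sring_UNIV, rule prime_set_ideal_at)
  show "finite {f :: 'k poly. deg_less (fper t) f}" "{f. deg_less (fper t) f} <= UNIV" using card_deg_less(1) by auto
  fix b :: "'k poly"
  obtain Q R where "b = Q * \<pi> + R" "deg_less (degree \<pi>) R" by (rule poly_div_monic[OF \<pi>(2) d])
  then show "EX r:{f. deg_less (fper t) f}. b - r \<in> ideal_at t" using p0 \<pi>(3) by (intro bexI[of _ R]) (auto simp: ideal_at_def ev.hom_mult)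
 qed
 have "base_norm (ideal_at t) = card (fp.coset ` UNIV)" unfolding base_norm_def using fp.carrier_Q by (simp add: subring_of_type_UNIV)
 also have "... = card (range (ev t))" by (rule card_image_eq) (use fp.qcoset_eq in \<open>auto simp: ideal_at_def ev.hom_minus\<close>)
 finally show ?thesis using card_range_ev by simp
qed

locale point_fract = point_galois \<nu> N \<iota> to_fract
 for \<nu> :: "'k::{field,finite} poly fract => 'e::field" and N and \<iota> :: "'k poly fract => 'a::field"
begin

abbreviation fibre_at :: "'k alg_closure => ('a => 'k alg_closure) set" where
 "fibre_at t \<equiv> {y \<in> pts eK UNIV. y (eK T) = t}"

lemma poly_embed_eq: "poly_embed \<iota> = eK" and integral_closure_eq: "integral_closure \<iota> = BK"
 by (simp_all add: poly_embed_def[abs_def] o_def integral_closure_def intcl_def)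

lemma finite_fibre_at: "finite (fibre_at t)"
proof -
 obtain x where x: "x \<in> pts eN N" "x (eN T) = t" by (rule N.ex_point_over)
 have "fibre_at t <= rest x ` J"
 proof
  fix y assume y: "y \<in> fibre_at t"
  then obtain j where j: "j \<in> J" "!!b. b \<in> BK ==> y b = x (j b)" using point_lift[OF x(1), of y] x(2) by auto
  then have "y = rest x j" using y by (auto simp: rest_def pts_def fun_eq_iff)
  then show "y \<in> rest x ` J" using j(1) by blast
 qed
 then show ?thesis using fin_J finite_surj by blast
qed

lemma vimage_ker: "y \<in> pts eK UNIV ==> eK -` K.ker y = ideal_at (y (eK T))"
proof -
 assume y: "y \<in> pts eK UNIV"
 have "eK f \<in> K.ker y \<longleftrightarrow> ev (y (eK T)) f = 0" for f using K.e_B[of f] by (simp only: K.ker_def mem_Collect_eq K.pts_e[OF y, of f] simp_thms)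
 then show ?thesis by (simp only: vimage_def ideal_at_def)
qed

text \<open>A prime above comes from a point over some conjugate of t; a power of Frobenius moves
  that point over t itself and leaves its kernel unchanged.\<close>

lemma primes_above_ideal_at: "primes_above \<iota> (ideal_at t) = K.ker ` fibre_at t"
proof (intro equalityI subsetI)
 fix P assume "P \<in> primes_above \<iota> (ideal_at t)"
 then have P: "prime_set BK P" "eK -` P = ideal_at t" by (auto simp: primes_above_def poly_embed_eq integral_closure_eq primeideal_iff_prime_set[OF K.sring_B])
 obtain \<pi> where \<pi>: "!!z. ev z \<pi> = 0 \<longleftrightarrow> z \<in> orb frob t" "lead_coeff \<pi> = 1" using ex_poly_roots_orb by metis
 have "\<pi> \<in> ideal_at t" "\<pi> ~= 0" using \<pi>(1)[of t] \<pi>(2) orb_self[of t frob] by (auto simp: ideal_at_def)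
 then have "eK \<pi> \<in> P" unfolding P(2)[symmetric] by simp
 then obtain y where y: "y \<in> pts eK UNIV" "K.ker y = P" using K.point_of_prime[OF P(1) \<open>\<pi> ~= 0\<close>] by blast
 have "ideal_at (y (eK T)) = ideal_at t" using vimage_ker[OF y(1)] P(2) y(2) by (simp only:)
 then obtain i where i: "t = (frob ^^ i) (y (eK T))" unfolding ideal_at_eq_iff orb_in by blast
 let ?y = "(frob ^^ i) o y"
 have "?y \<in> fibre_at t" using K.pfrob_pow_pts[OF y(1)] i by simp
 moreover have "K.ker ?y = P" using y(2) by (auto simp: K.ker_def)
 ultimately show "P \<in> K.ker ` fibre_at t" by blast
next
 fix P assume "P \<in> K.ker ` fibre_at t"
 then obtain y where y: "y \<in> pts eK UNIV" "y (eK T) = t" "P = K.ker y" by blast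
 have "eK -` P = ideal_at t" using vimage_ker[OF y(1)] y(2,3) by (simp only:)
 then show "P \<in> primes_above \<iota> (ideal_at t)" using K.prime_ker[OF y(1)] y(3)
  by (simp add: primes_above_def poly_embed_eq integral_closure_eq primeideal_iff_prime_set[OF K.sring_B])
qed

text \<open>The residue field upstairs has q^per(y) elements, that of t has q^fper(t), and the
  inertia degree is the exponent between them.\<close>

lemma inertia_degree_ker:
 assumes y: "y \<in> fibre_at t"
 shows "per pfrob y = fper t * inertia_degree \<iota> (K.ker y)"
proof -
 have y': "y \<in> pts eK UNIV" "y (eK T) = t" using y by auto
 obtain R where "finite_prime BK (K.ker y) R" using K.finite_prime_ker[OF y'(1)] .
 then interpret fp: finite_prime BK "K.ker y" R .
 have "sring (range eK)"
 proof (rule sringI)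
  show "1 \<in> range eK" by (rule range_eqI[of _ _ 1]) simp
  fix a b assume "a \<in> range eK" "b \<in> range eK"
  then obtain f g where "a = eK f" "b = eK g" by blast
  then show "a - b \<in> range eK" "a * b \<in> range eK" by (metis K.hom_minus rangeI, metis K.hom_mult rangeI)
 qed
 then have "card (y ` BK) = card (y ` range eK) ^ residue_degree (range eK) BK (K.ker y)"
  by (intro fp.card_residue_degree(1)[OF pts_K_hom[OF y'(1)]] image_subsetI K.e_B) (simp add: K.ker_def)
 moreover have "y o eK = ev t" using K.pts_e[OF y'(1)] unfolding y'(2) by (intro HOL.ext) (simp only: o_apply[of y])
 then have "y ` range eK = range (ev t)" by (metis image_comp)
 ultimately have "CARD('k) ^ per pfrob y = CARD('k) ^ (fper t * inertia_degree \<iota> (K.ker y))" using K.card_point_image[OF y'(1)] card_range_ev[of t]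
  by (simp add: inertia_degree_def poly_embed_eq integral_closure_eq power_mult)
 then show ?thesis using CARD_ge_2[where 'k='k] by (simp add: power_inject_exp)
qed

text \<open>Inertia degree 1 means that the period of y equals that of t. Such a prime has a single
  point over t: two points with the same kernel differ by a power of Frobenius fixing t, and this
  power then fixes the point.\<close>

lemma count_splitting_type: "count (mset (splitting_type \<iota> (ideal_at t))) 1 = card (fix_pts eK (fper t) t)"
proof -
 let ?A = "primes_above \<iota> (ideal_at t)" and ?d = "fper t"
 have d: "0 < ?d" by (rule per_pos_fixed(1)[OF periodic_frob])
 have fin: "finite ?A" unfolding primes_above_ideal_at using finite_fibre_at by (rule finite_imageI)
 have fx: "fix_pts eK ?d t = {y \<in> fibre_at t. inertia_degree \<iota> (K.ker y) = 1}"
 proof -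
  have "(frob ^^ ?d) o y = y \<longleftrightarrow> inertia_degree \<iota> (K.ker y) = 1" if y: "y \<in> fibre_at t" for y
  proof -
   have p: "periodic pfrob y" using K.periodic_pfrob y by blast
   have "(frob ^^ ?d) o y = y \<longleftrightarrow> per pfrob y dvd ?d" using funpow_fixed_iff[OF p, of ?d] by (simp add: pfrob_pow)
   then show ?thesis using inertia_degree_ker[OF y] d by auto
  qed
  then show ?thesis by (auto simp: fix_pts_def)
 qed
 have inj: "inj_on K.ker (fix_pts eK ?d t)"
 proof (rule inj_onI)
  fix y y' assume yy: "y \<in> fix_pts eK ?d t" "y' \<in> fix_pts eK ?d t" "K.ker y = K.ker y'"
  then obtain i where i: "y' = (frob ^^ i) o y" using K.same_ker_conj[of y y'] by (auto simp: fix_pts_def)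
  have "(frob ^^ i) t = t" using yy(1,2) fun_cong[OF i, of "eK T"] by (simp add: fix_pts_def)
  then obtain m where "i = ?d * m" using funpow_fixed_iff[OF periodic_frob, of i t] by (auto elim: dvdE)
  moreover have "(pfrob ^^ ?d) y = y" using yy(1) by (simp add: fix_pts_def pfrob_pow)
  ultimately have "(pfrob ^^ i) y = y" using funpow_mult_fixed by metis
  then show "y = y'" using i by (simp add: pfrob_pow)
 qed
 have "count (mset (splitting_type \<iota> (ideal_at t))) 1 = count (image_mset (inertia_degree \<iota>) (mset_set ?A)) 1" by (simp add: splitting_type_def)
 also have "... = (SUM P:{P \<in> ?A. inertia_degree \<iota> P = 1}. count (mset_set ?A) P)" unfolding count_image_mset using fin by (intro sum.cong) auto
 also have "... = (SUM P:{P \<in> ?A. inertia_degree \<iota> P = 1}. 1)" using fin by (intro sum.cong) auto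
 also have "... = card {P \<in> ?A. inertia_degree \<iota> P = 1}" by simp
 also have "{P \<in> ?A. inertia_degree \<iota> P = 1} = K.ker ` fix_pts eK ?d t" unfolding primes_above_ideal_at fx by auto
 finally show ?thesis using card_image[OF inj] by simp
qed

end


section \<open>Logarithmic asymptotics\<close>

text \<open>The series equals -C ln(1 - v) + O(1) on [1/2, 1): a pole of order C at v = 1, seen
  through the logarithm, with v = q^(1 - s).\<close>

definition log_asymp :: "nat => (nat => real) => real => bool" where
 "log_asymp q a C \<longleftrightarrow> (EX K. ALL v:{1/2..<1}. EX s. (%d. a d * (v / q) ^ d / real d) sums s & \<bar>s + C * ln (1 - v)\<bar> <= K)"

lemma log_asymp_linear:
 assumes "log_asymp q a C" "log_asymp q b D"
 shows "log_asymp q (%d. a d + c * b d) (C + c * D)"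
proof -
 obtain K where K: "ALL v:{1/2..<1}. EX s. (%d. a d * (v / q) ^ d / real d) sums s & \<bar>s + C * ln (1 - v)\<bar> <= K" using assms(1) unfolding log_asymp_def by blast
 obtain L where L: "ALL v:{1/2..<1}. EX s. (%d. b d * (v / q) ^ d / real d) sums s & \<bar>s + D * ln (1 - v)\<bar> <= L" using assms(2) unfolding log_asymp_def by blast
 show ?thesis unfolding log_asymp_def
 proof (rule exI[of _ "K + \<bar>c\<bar> * L"], rule ballI)
  fix v :: real assume v: "v \<in> {1/2..<1}"
  obtain s where s: "(%d. a d * (v / q) ^ d / real d) sums s" "\<bar>s + C * ln (1 - v)\<bar> <= K" using K v by blast
  obtain u where u: "(%d. b d * (v / q) ^ d / real d) sums u" "\<bar>u + D * ln (1 - v)\<bar> <= L" using L v by blast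
  have "(%d. (a d + c * b d) * (v / q) ^ d / real d) sums (s + c * u)"
   using sums_add[OF s(1) sums_mult[OF u(1), of c]] by (simp add: distrib_right add_divide_distrib mult.assoc)
  moreover have "\<bar>s + c * u + (C + c * D) * ln (1 - v)\<bar> <= K + \<bar>c\<bar> * L"
  proof -
   have "s + c * u + (C + c * D) * ln (1 - v) = (s + C * ln (1 - v)) + c * (u + D * ln (1 - v))" by (simp add: algebra_simps)
   also have "\<bar>...\<bar> <= \<bar>s + C * ln (1 - v)\<bar> + \<bar>c\<bar> * \<bar>u + D * ln (1 - v)\<bar>" by (simp add: abs_mult[symmetric])
   also have "... <= K + \<bar>c\<bar> * L" using s(2) u(2) by (intro add_mono mult_left_mono) auto
   finally show ?thesis .
  qed
  ultimately show "EX r. (%d. (a d + c * b d) * (v / q) ^ d / real d) sums r & \<bar>r + (C + c * D) * ln (1 - v)\<bar> <= K + \<bar>c\<bar> * L" by blast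
 qed
qed

lemma log_asymp_sum:
 assumes "finite I" "!!i. i \<in> I ==> log_asymp q (a i) (C i)"
 shows "log_asymp q (%d. SUM i:I. a i d) (SUM i:I. C i)"
 using assms
proof (induction I)
 case empty
 show ?case unfolding log_asymp_def by (intro exI[of _ 0] ballI exI[of _ 0]) simp
next
 case (insert i I)
 then show ?case using log_asymp_linear[of q "a i" "C i" "%d. SUM i:I. a i d" "SUM i:I. C i" 1] by simp
qed

lemma log_asymp_perturb:
 assumes a: "log_asymp q a C" and E: "!!d. 0 < d ==> \<bar>b d - a d\<bar> <= E d" "summable (%d. E d / q ^ d)" and q: "0 < q"
 shows "log_asymp q b C"
proof -
 obtain K where K: "ALL v:{1/2..<1}. EX s. (%d. a d * (v / q) ^ d / real d) sums s & \<bar>s + C * ln (1 - v)\<bar> <= K" using a unfolding log_asymp_def by blast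
 show ?thesis unfolding log_asymp_def
 proof (rule exI[of _ "K + (\<bar>E 0\<bar> + \<bar>\<Sum>d. E d / q ^ d\<bar>)"], rule ballI)
  fix v :: real assume v: "v \<in> {1/2..<1}"
  obtain s where s: "(%d. a d * (v / q) ^ d / real d) sums s" "\<bar>s + C * ln (1 - v)\<bar> <= K" using K v by blast
  let ?r = "%d. (b d - a d) * (v / q) ^ d / real d"
  have le: "\<bar>?r d\<bar> <= E d / q ^ d" if d: "0 < d" for d
  proof -
   have "(v / q) ^ d / real d <= 1 / q ^ d"
   proof -
    have "(v / q) ^ d / real d <= (v / q) ^ d / 1" using v d by (intro divide_left_mono) auto
    also have "... <= 1 / q ^ d" using v q by (simp add: power_divide divide_right_mono power_le_one)
    finally show ?thesis .
   qed
   then have "\<bar>b d - a d\<bar> * ((v / q) ^ d / real d) <= E d * (1 / q ^ d)" using E(1)[OF d] v by (intro mult_mono) auto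
   then show ?thesis using v by (simp add: abs_mult)
  qed
  \<comment> \<open>The hypothesis says nothing about E 0, while the term d = 0 of the series
    vanishes by division by zero; so that term is removed from the majorant.\<close>
  obtain M where M: "(%d. if d = 0 then 0 else E d / q ^ d) sums M" "\<bar>M\<bar> <= \<bar>E 0\<bar> + \<bar>\<Sum>d. E d / q ^ d\<bar>"
  proof
   have "(%d. E d / q ^ d - (if d = 0 then E 0 else 0)) sums ((\<Sum>d. E d / q ^ d) - E 0)" by (intro sums_diff summable_sums[OF E(2)] sums_single)
   then show "(%d. if d = 0 then 0 else E d / q ^ d) sums ((\<Sum>d. E d / q ^ d) - E 0)" by (rule sums_cong[THEN iffD1, rotated]) simp
  qed simp
  have le': "\<bar>?r d\<bar> <= (if d = 0 then 0 else E d / q ^ d)" for d using le by simp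
  have "summable (%d. \<bar>?r d\<bar>)" by (rule summable_comparison_test'[OF sums_summable[OF M(1)], of 0]) (simp only: real_norm_def abs_idempotent le')
  then have "\<bar>suminf ?r\<bar> <= (\<Sum>d. \<bar>?r d\<bar>)" "summable ?r" by (rule summable_rabs, rule summable_rabs_cancel)
  moreover have "(\<Sum>d. \<bar>?r d\<bar>) <= M" using suminf_le[OF le' \<open>summable (%d. \<bar>?r d\<bar>)\<close> sums_summable[OF M(1)]] sums_unique[OF M(1)] by simp
  ultimately have r: "?r sums suminf ?r" "\<bar>suminf ?r\<bar> <= \<bar>E 0\<bar> + \<bar>\<Sum>d. E d / q ^ d\<bar>" using M(2) by (auto intro: summable_sums)
  have "(%d. b d * (v / q) ^ d / real d) sums (s + suminf ?r)" using sums_add[OF s(1) r(1)] by (simp add: left_diff_distrib diff_divide_distrib)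
  moreover have "\<bar>s + suminf ?r + C * ln (1 - v)\<bar> <= K + (\<bar>E 0\<bar> + \<bar>\<Sum>d. E d / q ^ d\<bar>)" using s(2) r(2) by linarith
  ultimately show "EX r. (%d. b d * (v / q) ^ d / real d) sums r & \<bar>r + C * ln (1 - v)\<bar> <= K + (\<bar>E 0\<bar> + \<bar>\<Sum>d. E d / q ^ d\<bar>)" by blast
 qed
qed

lemma finite_ev_eq_0: "\<Delta> ~= 0 ==> finite {t :: 'k::{field,finite} alg_closure. ev t \<Delta> = 0}"
 unfolding ev_def by (rule poly_roots_finite) simp

context curve
begin

text \<open>A point of period d over a t of smaller period has that period at most d/2, so there are
  O(q^(d/2)) such points. The others lie over t of period d and are the elements of the fibre fixed
  by Frob^d.\<close>

lemma count_same_degree: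
 assumes d: "0 < d"
 shows "\<bar>(\<Sum>t | fper t = d & ev t \<Delta> ~= 0. real (card {z \<in> fibre t. (frob ^^ d) z = z})) - real (count d)\<bar>
  <= 2 * real n * real CARD('k) ^ (d div 2)"
proof -
 let ?q = "CARD('k)"
 let ?P1 = "Sigma {t. fper t = d & ev t \<Delta> ~= 0} (%t. {z \<in> fibre t. (frob ^^ d) z = z})"
 let ?P2 = "{y \<in> points. per frob2 y = d & fper (fst y) ~= d}"
 have fd: "finite {t :: 'k alg_closure. fper t = d & ev t \<Delta> ~= 0}" using finite_fper[of d, where 'k='k] by simp
 have iff: "per frob2 (t, z) = d \<longleftrightarrow> (frob ^^ d) z = z" if "fper t = d" for t z
  using funpow_fixed_iff[OF periodic_frob2, of d "(t, z)"] fper_dvd_frob2[of t z] that per_pos_fixed(2)[OF periodic_frob, of t] by (auto simp: frob2_pow dvd_antisym)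
 have tz: "(t, z) \<in> {y \<in> points. per frob2 y = d} \<longleftrightarrow> (t, z) \<in> ?P1 \<union> ?P2" for t z
  using iff[of t z] by (cases "fper t = d") (simp_all add: points_iff)
 have P: "{y \<in> points. per frob2 y = d} = ?P1 \<union> ?P2"
 proof (rule Set.set_eqI)
  show "y \<in> {y \<in> points. per frob2 y = d} \<longleftrightarrow> y \<in> ?P1 \<union> ?P2" for y using tz[of "fst y" "snd y"] by (simp only: prod.collapse)
 qed
 have f2: "finite ?P2" and f1: "finite ?P1" using finite_points_per[of d] P by (auto intro: finite_subset)
 have "count d = card ?P1 + card ?P2" unfolding count_def P using f1 f2 by (intro card_Un_disjoint) auto
 moreover have "card ?P1 = (\<Sum>t | fper t = d & ev t \<Delta> ~= 0. card {z \<in> fibre t. (frob ^^ d) z = z})" using fd fibre_finite by (intro card_SigmaI) auto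
 moreover have "card ?P2 <= 2 * n * ?q ^ (d div 2)"
 proof -
  let ?T = "\<Union>i\<in>{..d div 2}. {t :: 'k alg_closure. fper t = i}"
  have "?P2 <= Sigma ?T fibre"
  proof
   fix y assume y: "y \<in> ?P2"
   obtain t z where tz: "y = (t, z)" by fastforce
   obtain k where k: "d = fper t * k" using fper_dvd_frob2[of t z] y tz by (auto elim: dvdE)
   then have "2 <= k" using y tz d by (cases k) auto
   then have "fper t * 2 <= d" unfolding k by (rule mult_le_mono2)
   then show "y \<in> Sigma ?T fibre" using y tz by (auto simp: points_iff)
  qed
  moreover have fT: "finite ?T" using finite_fper by blast
  ultimately have "card ?P2 <= card (Sigma ?T fibre)" using fibre_finite by (intro card_mono) auto
  also have "... = (SUM t:?T. card (fibre t))" using fT fibre_finite by (intro card_SigmaI) auto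
  also have "... <= (SUM t:?T. n)" by (intro sum_mono card_fibre_le)
  also have "... <= (\<Sum>i\<le>d div 2. ?q ^ i) * n"
  proof -
   have "card ?T <= (\<Sum>i\<le>d div 2. card {t :: 'k alg_closure. fper t = i})" by (rule card_UN_le) simp
   also have "... <= (\<Sum>i\<le>d div 2. ?q ^ i)" by (intro sum_mono card_fper_le)
   finally show ?thesis by simp
  qed
  also have "(\<Sum>i\<le>m. ?q ^ i) <= 2 * ?q ^ m" for m
  proof (induction m)
   case (Suc m)
   have "2 * ?q ^ m <= ?q * ?q ^ m" using CARD_ge_2[where 'k='k] by (intro mult_le_mono1)
   then show ?case using Suc unfolding sum.atMost_Suc power_Suc by linarith
  qed simp
  then have "(\<Sum>i\<le>d div 2. ?q ^ i) * n <= 2 * ?q ^ (d div 2) * n" by (rule mult_le_mono1)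
  finally show ?thesis by (simp add: mult_ac)
 qed
 then have "real (card ?P2) <= real (2 * n * ?q ^ (d div 2))" by (simp only: of_nat_le_iff)
 ultimately show ?thesis by simp
qed

text \<open>The sum differs from \<open>count d\<close> by O(q^(d/2)) and by bounded values at the
  finitely many zeros of \<Delta>, both summable after division by q^d.\<close>

theorem log_asymp_fibres:
 assumes H: "!!t. ev t \<Delta> ~= 0 ==> H t = real (card {z \<in> fibre t. (frob ^^ fper t) z = z})" and M: "!!t. \<bar>H t\<bar> <= M"
 shows "log_asymp CARD('k) (%d. \<Sum>t | fper t = d. H t) 1"
proof -
 let ?q = "real CARD('k)"
 obtain K where K: "ALL v:{1/2..<1}. summable (%d. real (count d) * (v / CARD('k)) ^ d / real d) & \<bar>log_count v + ln (1 - v)\<bar> <= K" using log_count_asymp by blast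
 have c: "log_asymp CARD('k) (%d. real (count d)) 1" unfolding log_asymp_def
 proof (rule exI[of _ K], rule ballI)
  fix v :: real assume "v \<in> {1/2..<1}"
  then have "summable (%d. real (count d) * (v / CARD('k)) ^ d / real d)" "\<bar>log_count v + ln (1 - v)\<bar> <= K" using K by auto
  then show "EX s. (%d. real (count d) * (v / CARD('k)) ^ d / real d) sums s & \<bar>s + 1 * ln (1 - v)\<bar> <= K"
   unfolding log_count_def by (intro exI[of _ "\<Sum>d. real (count d) * (v / CARD('k)) ^ d / real d"] conjI) (rule summable_sums, simp_all)
 qed
 define bad where "bad = (%d. {t :: 'k alg_closure. fper t = d & ev t \<Delta> = 0})"
 have fb: "finite (bad d)" for d unfolding bad_def using finite_fper[of d, where 'k='k] by simp
 have E: "\<bar>(\<Sum>t | fper t = d. H t) - real (count d)\<bar> <= real (card (bad d)) * M + 2 * real n * ?q ^ (d div 2)" if d: "0 < d" for d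
 proof -
  have s: "{t :: 'k alg_closure. fper t = d} = {t. fper t = d & ev t \<Delta> ~= 0} \<union> bad d" by (auto simp: bad_def)
  have "(\<Sum>t | fper t = d. H t) = (\<Sum>t | fper t = d & ev t \<Delta> ~= 0. H t) + (SUM t:bad d. H t)"
   unfolding s using finite_fper[of d, where 'k='k] fb by (intro sum.union_disjoint) (auto simp: bad_def)
  also have "(\<Sum>t | fper t = d & ev t \<Delta> ~= 0. H t) = (\<Sum>t | fper t = d & ev t \<Delta> ~= 0. real (card {z \<in> fibre t. (frob ^^ d) z = z}))"
   by (intro sum.cong refl) (use H in auto)
  finally have "(\<Sum>t | fper t = d. H t) = ... + (SUM t:bad d. H t)" .
  moreover have "\<bar>SUM t:bad d. H t\<bar> <= real (card (bad d)) * M" using order_trans[OF sum_abs sum_bounded_above[of "bad d" "%t. \<bar>H t\<bar>" M]] M by blast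
  ultimately show ?thesis using count_same_degree[OF d] by linarith
 qed
 have "finite (fper ` {t :: 'k alg_closure. ev t \<Delta> = 0})" using finite_ev_eq_0[OF Delta] by blast
 then have "summable (%d. real (card (bad d)) * M / ?q ^ d)" by (rule summable_finite) (auto simp: bad_def card_eq_0_iff)
 moreover have "summable (%d. 2 * real n * ?q ^ (d div 2) / ?q ^ d)"
 proof (rule summable_comparison_test'[where N = 0])
  have q: "2 <= ?q" using CARD_ge_2[where 'k='k] by simp
  then have "1 < sqrt ?q" by simp
  then show "summable (%d. 2 * real n * (1 / sqrt ?q) ^ d)" by (intro summable_mult summable_geometric) simp
  fix d :: nat
  have "?q ^ (d div 2) / ?q ^ d <= (1 / sqrt ?q) ^ d"
  proof -
   have "?q ^ (d div 2) * sqrt ?q ^ d <= ?q ^ (d div 2) * sqrt ?q ^ (2 * (d - d div 2))" using q by (intro mult_left_mono power_increasing) auto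
   also have "... = ?q ^ (d div 2) * ?q ^ (d - d div 2)" by (simp add: power_mult)
   also have "... = ?q ^ d" by (simp flip: power_add)
   finally show ?thesis using q by (simp add: field_simps power_divide)
  qed
  then show "norm (2 * real n * ?q ^ (d div 2) / ?q ^ d) <= 2 * real n * (1 / sqrt ?q) ^ d"
   using mult_left_mono[of "?q ^ (d div 2) / ?q ^ d" "(1 / sqrt ?q) ^ d" "2 * real n"] by simp
 qed
 ultimately have "summable (%d. (real (card (bad d)) * M + 2 * real n * ?q ^ (d div 2)) / ?q ^ d)" by (simp add: add_divide_distrib summable_add)
 then have S: "summable (%d. (real (card (bad d)) * M + 2 * real n * ?q ^ (d div 2)) / CARD('k) ^ d)" by simp
 show ?thesis by (rule log_asymp_perturb[OF c E S]) simp_all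
qed

end



text \<open>Any choice of Frobenius elements will do, including at the finitely many ramified \<open>t\<close>.\<close>
definition frob_elt :: "('f::field => 'e::field) => 'e set => ('k::{field,finite} poly => 'f) => 'k alg_closure => 'e => 'e" where
 "frob_elt \<nu> N e0 t = (SOME \<mu>. \<mu> \<in> gal \<nu> N & (EX x:pts (\<nu> o e0) N. x ((\<nu> o e0) [:0, 1:]) = t &
   (ALL b:intcl (\<nu> o e0) N. (frob ^^ fper t) (x b) = x (\<mu> b))))"

text \<open>Chebotarev's theorem for the single function F, with logarithmic weights.\<close>

definition equidist :: "('f::field => 'e::field) => 'e set => ('k::{field,finite} poly => 'f) => (('e => 'e) => real) => bool" where
 "equidist \<nu> N e0 F \<longleftrightarrow> log_asymp CARD('k) (%d. \<Sum>t | fper t = d. F (frob_elt \<nu> N e0 t)) ((\<Sum>\<mu>\<in>gal \<nu> N. F \<mu>) / card (gal \<nu> N))"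

lemma equidist_linear:
 assumes "equidist \<nu> N e0 F" "equidist \<nu> N e0 H"
 shows "equidist \<nu> N e0 (%\<mu>. F \<mu> + c * H \<mu>)"
 using log_asymp_linear[OF assms[unfolded equidist_def], of c] unfolding equidist_def by (simp add: sum.distrib sum_distrib_left add_divide_distrib)

lemma equidist_sum:
 assumes "finite I" "!!i. i \<in> I ==> equidist \<nu> N e0 (F i)"
 shows "equidist \<nu> N e0 (%\<mu>. SUM i:I. F i \<mu>)"
proof -
 have s: "(\<Sum>\<mu>\<in>A. SUM i:I. F i \<mu>) = (SUM i:I. \<Sum>\<mu>\<in>A. F i \<mu>)" "(SUM t:D. SUM i:I. F i (f t)) = (SUM i:I. SUM t:D. F i (f t))"
  for A and D :: "'k alg_closure set" and f by (rule sum.swap)+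
 show ?thesis using log_asymp_sum[OF assms(1) assms(2)[unfolded equidist_def]] unfolding equidist_def s sum_divide_distrib by simp
qed

context point_galois
begin

lemma frob_elt:
 obtains x where "frob_elt \<nu> N e0 t \<in> G" "x \<in> pts eN N" "x (eN T) = t"
  "ALL b:BN. (frob ^^ fper t) (x b) = x (frob_elt \<nu> N e0 t b)"
proof -
 obtain x where x: "x \<in> pts eN N" "x (eN T) = t" by (rule N.ex_point_over)
 have "(frob ^^ fper t) (x (eN T)) = x (eN T)" unfolding x(2) by (rule per_pos_fixed(2)[OF periodic_frob])
 then have "\<exists>\<mu>. \<mu> \<in> G & (EX x:pts eN N. x (eN T) = t & (ALL b:BN. (frob ^^ fper t) (x b) = x (\<mu> b)))"
  using ex_frobenius[OF x(1), of "fper t"] x by blast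
 then have "frob_elt \<nu> N e0 t \<in> G & (EX x:pts eN N. x (eN T) = t & (ALL b:BN. (frob ^^ fper t) (x b) = x (frob_elt \<nu> N e0 t b)))"
  unfolding frob_elt_def by (rule someI_ex)
 then show ?thesis using that by blast
qed

lemma equidist_cong: "(!!\<mu>. \<mu> \<in> G ==> F \<mu> = H \<mu>) ==> equidist \<nu> N e0 F ==> equidist \<nu> N e0 H"
proof -
 assume a: "!!\<mu>. \<mu> \<in> G ==> F \<mu> = H \<mu>" "equidist \<nu> N e0 F"
 have "F (frob_elt \<nu> N e0 t) = H (frob_elt \<nu> N e0 t)" for t :: "'k alg_closure" by (rule frob_elt[of t]) (rule a(1))
 moreover have "(\<Sum>\<mu>\<in>G. F \<mu>) = (\<Sum>\<mu>\<in>G. H \<mu>)" by (rule sum.cong) (simp_all add: a(1))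
 ultimately show ?thesis using a(2) by (simp add: equidist_def)
qed

text \<open>Burnside's lemma for a transitive action: on average one element is fixed.\<close>

lemma card_fixed_conj: "(\<Sum>\<mu>\<in>G. card {u \<in> conj w. \<mu> u = u}) = card G"
proof -
 have "card {\<mu> \<in> G. \<mu> u = u} = card {\<mu> \<in> G. \<mu> w = u}" if u: "u \<in> conj w" for u
 proof -
  obtain \<tau> where t: "\<tau> \<in> G" "u = \<tau> w" using u by (auto simp: conj_def)
  obtain \<rho> where r: "\<rho> \<in> G" "\<tau> o \<rho> = id" "\<rho> o \<tau> = id" using G_inv[OF t(1)] by blast
  have "\<rho> u = w" using t(2) fun_cong[OF r(3), of w] by simp
  then have "bij_betw (%\<mu>. \<mu> o \<tau>) {\<mu> \<in> G. \<mu> u = u} {\<mu> \<in> G. \<mu> w = u}"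
   by (intro bij_betw_byWitness[where f' = "%\<mu>. \<mu> o \<rho>"]) (use t r G_comp in \<open>auto simp: comp_assoc\<close>)
  then show ?thesis by (rule bij_betw_same_card)
 qed
 note eq = this
 have "(\<Sum>\<mu>\<in>G. card {u \<in> conj w. \<mu> u = u}) = (\<Sum>\<mu>\<in>G. SUM u:conj w. if \<mu> u = u then 1 else 0)"
  using conj_finite[of w] by (simp add: sum.If_cases Int_def)
 also have "... = (SUM u:conj w. \<Sum>\<mu>\<in>G. if \<mu> u = u then 1 else 0)" by (rule sum.swap)
 also have "... = (SUM u:conj w. \<Sum>\<mu>\<in>{\<mu> \<in> G. \<mu> w = u}. 1)" using fin_G eq by (simp add: sum.If_cases Int_def)
 also have "... = (\<Sum>\<mu>\<in>G. 1)" by (rule sum.group[OF fin_G conj_finite]) (auto simp: conj_def)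
 finally show ?thesis by simp
qed

text \<open>The minimal polynomial f of w over k[T] is the curve. Away from \<Delta> a point x over
  t maps the orbit of w bijectively onto the fibre, taking the Frobenius element to Frob^fper(t). So
  the logarithmic count of points on the curve is the sought average over Frobenius elements, and
  both averages are 1.\<close>

lemma equidist_conj:
 assumes w: "w \<in> BN"
 shows "equidist \<nu> N e0 (%\<mu>. real (card {u \<in> conj w. \<mu> u = u}))"
proof -
 let ?C = "conj w"
 have CB: "u \<in> BN" if "u \<in> ?C" for u using that G_BN[OF _ w] by (auto simp: conj_def)
 obtain f where f: "conj_poly w = map_poly eN f" and lf: "lead_coeff f = 1" and df: "degree f = card ?C" and C0: "0 < card ?C" by (rule conj_descent[OF w])
 \<comment> \<open>The product over ordered pairs of distinct conjugates is the discriminant up to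
   sign; it is integral and G-invariant, hence in k[T].\<close>
 define D where "D = {p \<in> ?C \<times> ?C. fst p ~= snd p}"
 define P where "P = (PROD p:D. fst p - snd p)"
 have fD: "finite D" unfolding D_def using conj_finite[of w] by simp
 have DB: "fst p \<in> BN" "snd p \<in> BN" if "p \<in> D" for p using that CB by (auto simp: D_def)
 have "P \<in> BN" unfolding P_def by (intro sring_prod[OF sBN] sring_diff[OF sBN] DB)
 moreover have "\<mu> P = P" if s: "\<mu> \<in> G" for \<mu>
 proof -
  note h = hom_on_subset[OF G_hom[OF s] N.B_N]
  have "\<mu> P = (PROD p:D. \<mu> (fst p - snd p))" unfolding P_def by (rule hom_on_prod[OF sBN h sring_diff[OF sBN DB]])
  also have "... = (PROD p:D. fst (map_prod \<mu> \<mu> p) - snd (map_prod \<mu> \<mu> p))" by (rule prod.cong[OF refl]) (simp add: hom_on_diff[OF sBN h DB])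
  also have "... = P" unfolding P_def
  proof (rule prod.reindex_bij_betw)
   have inj: "inj_on (map_prod \<mu> \<mu>) D" using prod.inj_map[OF G_inj[OF s] G_inj[OF s]] by (rule inj_on_subset) simp
   have "map_prod \<mu> \<mu> ` D <= D" using conj_step[OF s] injD[OF G_inj[OF s]] by (fastforce simp: D_def)
   then show "bij_betw (map_prod \<mu> \<mu>) D D" using endo_inj_surj[OF fD _ inj] inj by (simp add: bij_betw_def)
  qed
  finally show ?thesis .
 qed
 ultimately obtain \<Delta> where \<Delta>: "P = eN \<Delta>" using fixed_BN by blast
 have "P ~= 0" unfolding P_def using fD by (auto simp: prod_zero_iff D_def)
 then have \<Delta>0: "\<Delta> ~= 0" using \<Delta> by auto
 have mp: "map_poly (ev (x (eN T))) f = (PROD u:?C. [:- x u, 1:])" if x: "x \<in> pts eN N" for x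
 proof -
  have "map_poly x (map_poly eN f) = map_poly (ev (x (eN T))) f"
  proof (rule poly_eqI)
   show "coeff (map_poly x (map_poly eN f)) i = coeff (map_poly (ev (x (eN T))) f) i" for i
    using N.pts_e[OF x, of "coeff f i"] by (simp add: coeff_map_poly_hom_on[OF sBN pts_N_hom[OF x]] coeff_map_poly)
  qed
  moreover have "map_poly x (conj_poly w) = (PROD u:?C. [:- x u, 1:])" unfolding conj_poly_def by (rule map_poly_prod_linear[OF sBN pts_N_hom[OF x] CB])
  ultimately show ?thesis using f by (simp only:)
 qed
 have inj: "inj_on x ?C" if x: "x \<in> pts eN N" "ev (x (eN T)) \<Delta> ~= 0" for x
 proof (rule inj_onI, rule ccontr)
  fix u u' assume u: "u \<in> ?C" "u' \<in> ?C" "x u = x u'" "u ~= u'"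
  note h = pts_N_hom[OF x(1)]
  have "x P = (PROD p:D. x (fst p - snd p))" unfolding P_def by (rule hom_on_prod[OF sBN h sring_diff[OF sBN DB]])
  also have "... = 0"
  proof (rule prod_zero[OF fD], rule bexI[of _ "(u, u')"])
   show "x (fst (u, u') - snd (u, u')) = 0" using hom_on_diff[OF sBN h CB[OF u(1)] CB[OF u(2)]] u(3) by simp
  qed (use u in \<open>simp add: D_def\<close>)
  finally show False using x(2) N.pts_e[OF x(1), of \<Delta>] \<Delta> by simp
 qed
 have roots: "{z. poly (map_poly (ev (x (eN T))) f) z = 0} = x ` ?C" if x: "x \<in> pts eN N" for x
  unfolding mp[OF x] using conj_finite[of w] by (auto simp: poly_prod prod_zero_iff)
 interpret c: curve f \<Delta>
 proof
  show "lead_coeff f = 1" "0 < degree f" "\<Delta> ~= 0" using lf df C0 \<Delta>0 by auto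
  fix t assume t: "ev t \<Delta> ~= 0"
  obtain x where x: "x \<in> pts eN N" "x (eN T) = t" by (rule N.ex_point_over)
  then show "card {z. poly (map_poly (ev t) f) z = 0} = degree f" using roots[OF x(1)] card_image[OF inj[OF x(1)]] t df by simp
 next
  fix b :: "'k poly poly" assume b: "b ~= 0" "deg_less (degree f) b"
  obtain h where h: "bij_betw h {..<card ?C} ?C" using ex_bij_betw_nat_finite[OF conj_finite[of w]] by (auto simp: atLeast0LessThan)
  have "eN (poly_norm f b) = (\<Prod>i<degree f. poly (map_poly eN b) (h i))"
  proof (rule poly_norm_prod[OF N.comm_ring_hom_axioms lf _ b(2)])
   show "poly (map_poly eN f) (h i) = 0" if "i < degree f" for i unfolding f[symmetric] poly_conj_poly using bij_betwE[OF h] that df by simp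
  qed (use df C0 h in \<open>auto simp: bij_betw_def\<close>)
  \<comment> \<open>If b vanished at one conjugate of w it would vanish at all of them, which is too
    many for its degree.\<close>
  moreover have "poly (map_poly eN b) u ~= 0" if u: "u \<in> ?C" for u
  proof
   assume z: "poly (map_poly eN b) u = 0"
   have "poly (map_poly eN b) v = 0" if v: "v \<in> ?C" for v
   proof -
    obtain \<mu> where s: "\<mu> \<in> G" "v = \<mu> u" using v conj_eqI[OF u] by (auto simp: conj_def)
    have "map_poly \<mu> (map_poly eN b) = map_poly eN b" by (rule poly_eqI) (simp add: coeff_map_poly coeff_map_poly_hom_on[OF sN G_hom[OF s(1)]] G_base[OF s(1)])
    moreover have "\<mu> (poly (map_poly eN b) u) = poly (map_poly \<mu> (map_poly eN b)) (\<mu> u)"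
     by (rule hom_on_poly[OF sN G_hom[OF s(1)]]) (use base_N CB[OF u] N.B_N in \<open>auto simp: poly_over_def coeff_map_poly\<close>)
    ultimately show ?thesis using z s hom_on_0[OF sN G_hom[OF s(1)]] by simp
   qed
   then have "card ?C <= card {v. poly (map_poly eN b) v = 0}" using b by (intro card_mono poly_roots_finite) auto
   also have "... <= degree b" using card_poly_roots_bound[of "map_poly eN b"] b by (simp add: degree_map_poly)
   also have "... < degree f" using b(2) df C0 by (simp add: deg_less_iff)
   finally show False using df by simp
  qed
  ultimately have "eN (poly_norm f b) ~= 0" using bij_betwE[OF h] df by (simp add: prod_zero_iff)
  then show "poly_norm f b ~= 0" by auto
 qed
 let ?F = "%\<mu>. real (card {u \<in> ?C. \<mu> u = u})"
 have "log_asymp CARD('k) (%d. \<Sum>t | fper t = d. ?F (frob_elt \<nu> N e0 t)) 1"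
 proof (rule c.log_asymp_fibres)
  fix t assume t: "ev t \<Delta> ~= 0"
  obtain x where x: "frob_elt \<nu> N e0 t \<in> G" "x \<in> pts eN N" "x (eN T) = t"
   "ALL b:BN. (frob ^^ fper t) (x b) = x (frob_elt \<nu> N e0 t b)" by (rule frob_elt[of t])
  have i: "inj_on x ?C" by (rule inj[OF x(2)]) (use x(3) t in simp)
  have "{z \<in> c.fibre t. (frob ^^ fper t) z = z} = x ` {u \<in> ?C. frob_elt \<nu> N e0 t u = u}"
   using roots[OF x(2)] x(3,4) CB inj_onD[OF i] conj_step[OF x(1)] by (fastforce simp: c.fibre_def)
  then show "?F (frob_elt \<nu> N e0 t) = real (card {z \<in> c.fibre t. (frob ^^ fper t) z = z})"
   using card_image[OF inj_on_subset[OF i, of "{u \<in> ?C. frob_elt \<nu> N e0 t u = u}"]] by simp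
 next
  fix t show "\<bar>?F (frob_elt \<nu> N e0 t)\<bar> <= real (card ?C)" using conj_finite[of w] by (simp add: card_mono)
 qed
 moreover have "(\<Sum>\<mu>\<in>G. ?F \<mu>) = card G" unfolding card_fixed_conj[of w, symmetric] by simp
 ultimately show ?thesis using card_G_pos by (simp add: equidist_def)
qed

lemma equidist_stable:
 assumes W: "finite W" "W <= BN" "!!\<mu> w. \<mu> \<in> G ==> w \<in> W ==> \<mu> w \<in> W"
 shows "equidist \<nu> N e0 (%\<mu>. real (card {u \<in> W. \<mu> u = u}))"
proof -
 have cW: "conj w <= W" if "w \<in> W" for w using W(3) that by (auto simp: conj_def)
 have "real (card {u \<in> W. \<mu> u = u}) = (SUM o':conj ` W. real (card {u \<in> o'. \<mu> u = u}))" for \<mu> :: "'e => 'e"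
 proof -
  have "{u \<in> W. \<mu> u = u} = (\<Union>o'\<in>conj ` W. {u \<in> o'. \<mu> u = u})" using cW conj_self by blast
  then have "card {u \<in> W. \<mu> u = u} = (SUM o':conj ` W. card {u \<in> o'. \<mu> u = u})"
  proof (subst card_UN_disjoint[symmetric])
   have "conj i = conj j" if "u \<in> conj i" "u \<in> conj j" for i j u using conj_eqI[OF that(1)] conj_eqI[OF that(2)] by simp
   then show "ALL i:conj ` W. ALL j:conj ` W. i ~= j --> {u \<in> i. \<mu> u = u} \<inter> {u \<in> j. \<mu> u = u} = {}" by blast
  qed (use W(1) conj_finite in auto)
  then show ?thesis by simp
 qed
 then show ?thesis using equidist_sum[of "conj ` W" \<nu> N e0 "%o' \<mu>. real (card {u \<in> o'. \<mu> u = u})"] W(1,2) equidist_conj by auto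
qed

lemma ex_integral_separator:
 assumes "inj_on (%j. j \<alpha>) J"
 obtains \<beta> where "\<beta> \<in> BK" "inj_on (%j. j \<beta>) J"
proof -
 obtain a where a: "a ~= 0" "eK a * \<alpha> \<in> BK" by (rule K.ex_denominator[of \<alpha>]) simp_all
 have "inj_on (%j. j (eK a * \<alpha>)) J"
 proof (rule inj_onI)
  fix j j' assume j: "j \<in> J" "j' \<in> J" "j (eK a * \<alpha>) = j' (eK a * \<alpha>)"
  interpret j: field_hom j by (rule J_hom[OF j(1)])
  interpret j': field_hom j' by (rule J_hom[OF j(2)])
  have "eN a * j \<alpha> = eN a * j' \<alpha>" using j(3) J_eK[OF j(1), of a] J_eK[OF j(2), of a] by (simp add: j.hom_mult j'.hom_mult)
  then show "j = j'" using a(1) inj_onD[OF assms _ j(1,2)] by simp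
 qed
 with a(2) show ?thesis by (rule that)
qed

end

lemma infinite_UNIV_poly: "infinite (UNIV :: 'k::field poly set)"
proof
 assume "finite (UNIV :: 'k poly set)"
 then have "finite (range (%i. monom (1::'k) i))" by (rule finite_subset[rotated]) simp
 moreover have "inj (%i. monom (1::'k) i)" by (rule injI) (metis degree_monom_eq zero_neq_one)
 ultimately show False using finite_imageD infinite_UNIV_nat by blast
qed

text \<open>The product of the characters counts the fixed elements of J x J'. This set is realised
  inside BN by the elements j(\<beta>) + c j'(\<beta>'), which are distinct for some c in k[T]:
  every collision of two pairs excludes at most one c.\<close>

lemma equidist_char_mult:
 fixes \<nu> :: "'f::field => 'e::field" and e0 :: "'k::{field,finite} poly => 'f"
 assumes "point_galois \<nu> N \<iota> e0" "point_galois \<nu> N \<iota>' e0"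
  and "inj_on (%j. j \<alpha>) (embs \<iota> \<nu> N)" "inj_on (%j. j \<alpha>') (embs \<iota>' \<nu> N)"
 shows "equidist \<nu> N e0 (%\<mu>. real (emb_char \<iota> \<nu> N \<mu>) * real (emb_char \<iota>' \<nu> N \<mu>))"
proof -
 interpret a: point_galois \<nu> N \<iota> e0 by fact
 interpret b: point_galois \<nu> N \<iota>' e0 by fact
 let ?J = "embs \<iota> \<nu> N" and ?J' = "embs \<iota>' \<nu> N" and ?B = "intcl (\<nu> o e0) N"
 obtain \<beta> where \<beta>: "\<beta> \<in> intcl (\<iota> o e0) UNIV" "inj_on (%j. j \<beta>) ?J" by (rule a.ex_integral_separator[OF assms(3)])
 obtain \<beta>' where \<beta>': "\<beta>' \<in> intcl (\<iota>' o e0) UNIV" "inj_on (%j. j \<beta>') ?J'" by (rule b.ex_integral_separator[OF assms(4)])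
 define \<phi> where "\<phi> = (%c p. fst p \<beta> + \<nu> (e0 c) * snd p \<beta>')"
 define bad where "bad = (%(p, p'). {c. p ~= p' & \<phi> c p = \<phi> c p'})"
 have "finite (bad pp)" if pp: "pp \<in> (?J \<times> ?J') \<times> (?J \<times> ?J')" for pp
 proof -
  obtain i i' j j' where e: "pp = ((i, i'), (j, j'))" "i \<in> ?J" "i' \<in> ?J'" "j \<in> ?J" "j' \<in> ?J'" using pp by auto
  have "ALL c:bad pp. ALL c':bad pp. c = c'"
  proof (intro ballI)
   fix c c' assume c: "c \<in> bad pp" "c' \<in> bad pp"
   then have ne: "(i, i') ~= (j, j')" and q: "i \<beta> - j \<beta> = \<nu> (e0 c) * (j' \<beta>' - i' \<beta>')" "i \<beta> - j \<beta> = \<nu> (e0 c') * (j' \<beta>' - i' \<beta>')"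
    by (auto simp: bad_def e(1) \<phi>_def algebra_simps)
   have "j' \<beta>' - i' \<beta>' ~= 0" using ne q(1) inj_onD[OF \<beta>(2) _ e(2,4)] inj_onD[OF \<beta>'(2) _ e(5,3)] by auto
   then have "\<nu> (e0 c) = \<nu> (e0 c')" using q by simp
   then show "c = c'" by simp
  qed
  then show ?thesis by (metis finite.simps is_singletonI' is_singleton_def finite.emptyI finite.insertI)
 qed
 then have "finite (\<Union>pp\<in>(?J \<times> ?J') \<times> (?J \<times> ?J'). bad pp)" using a.fin_J b.fin_J by blast
 moreover note infinite_UNIV_poly[where 'k='k]
 ultimately obtain c where c: "c \<notin> (\<Union>pp\<in>(?J \<times> ?J') \<times> (?J \<times> ?J'). bad pp)" using ex_new_if_finite by metis
 have inj: "inj_on (\<phi> c) (?J \<times> ?J')"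
 proof (rule inj_onI, rule ccontr)
  fix p p' assume p: "p \<in> ?J \<times> ?J'" "p' \<in> ?J \<times> ?J'" "\<phi> c p = \<phi> c p'" "p ~= p'"
  then have "c \<in> bad (p, p')" by (simp add: bad_def)
  then show False using c p(1,2) by blast
 qed
 define W where "W = \<phi> c ` (?J \<times> ?J')"
 have act: "\<mu> (\<phi> c (j, j')) = \<phi> c (\<mu> o j, \<mu> o j')" if "\<mu> \<in> gal \<nu> N" "j \<in> ?J" "j' \<in> ?J'" for \<mu> j j'
 proof -
  have "j \<beta> \<in> N" "j' \<beta>' \<in> N" "\<nu> (e0 c) \<in> N" using a.J_N[OF that(2)] b.J_N[OF that(3)] a.base_N by auto
  then show ?thesis unfolding \<phi>_def
   by (simp add: hom_on_add[OF a.sN a.G_hom[OF that(1)]] hom_on_mult[OF a.sN a.G_hom[OF that(1)]] sring_mult[OF a.sN] a.G_base[OF that(1)])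
 qed
 have "equidist \<nu> N e0 (%\<mu>. real (card {u \<in> W. \<mu> u = u}))"
 proof (rule a.equidist_stable)
  show "finite W" unfolding W_def using a.fin_J b.fin_J by simp
  show "W <= ?B" unfolding W_def \<phi>_def using a.J_BK_iff b.J_BK_iff \<beta>(1) \<beta>'(1) a.N.e_B[of c] by (auto intro!: sring_add[OF a.sBN] sring_mult[OF a.sBN])
  show "\<mu> w \<in> W" if "\<mu> \<in> gal \<nu> N" "w \<in> W" for \<mu> w using that act[OF that(1)] a.comp_J[OF that(1)] b.comp_J[OF that(1)] by (auto simp: W_def)
 qed
 moreover have "real (card {u \<in> W. \<mu> u = u}) = real (emb_char \<iota> \<nu> N \<mu>) * real (emb_char \<iota>' \<nu> N \<mu>)" if s: "\<mu> \<in> gal \<nu> N" for \<mu>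
 proof -
  have "{u \<in> W. \<mu> u = u} = \<phi> c ` ({j \<in> ?J. \<mu> o j = j} \<times> {j \<in> ?J'. \<mu> o j = j})"
  proof -
   have "\<mu> (\<phi> c (j, j')) = \<phi> c (j, j') \<longleftrightarrow> \<mu> o j = j & \<mu> o j' = j'" if "j \<in> ?J" "j' \<in> ?J'" for j j'
    using act[OF s that] inj_on_eq_iff[OF inj, of "(\<mu> o j, \<mu> o j')" "(j, j')"] a.comp_J[OF s that(1)] b.comp_J[OF s that(2)] that by simp
   then show ?thesis by (auto simp: W_def)
  qed
  moreover have "inj_on (\<phi> c) ({j \<in> ?J. \<mu> o j = j} \<times> {j \<in> ?J'. \<mu> o j = j})" by (rule inj_on_subset[OF inj]) blast
  ultimately have "card {u \<in> W. \<mu> u = u} = card ({j \<in> ?J. \<mu> o j = j} \<times> {j \<in> ?J'. \<mu> o j = j})" by (simp only: card_image)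
  then show ?thesis by (simp add: card_cartesian_product emb_char_def)
 qed
 ultimately show ?thesis by (rule a.equidist_cong[rotated])
qed


section \<open>Arithmetic equivalence and characters\<close>

context
 fixes A :: "'k::{field,finite} poly set set" and s :: real
 assumes A: "A <= base_primes" and s: "1 < s"
begin

private definition "PP d = ideal_at ` {t :: 'k alg_closure. fper t = d & ideal_at t \<in> A}"

private lemma card_PP: "real (card (PP d)) = real (card {t :: 'k alg_closure. fper t = d & ideal_at t \<in> A}) / real d"
 and finite_PP: "finite (PP d)"
proof -
 let ?X = "{t :: 'k alg_closure. ideal_at t \<in> A}"
 have e: "{t \<in> ?X. fper t = d} = {t. fper t = d & ideal_at t \<in> A}" by auto
 have f: "finite {t \<in> ?X. fper t = d}" using finite_fper[of d, where 'k='k] by (rule finite_subset[rotated]) auto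
 then show "finite (PP d)" unfolding PP_def e by (rule finite_imageI)
 have fr: "ideal_at (frob t) = ideal_at t" for t :: "'k alg_closure" using ideal_at_eq_iff[of t "frob t"] by (simp add: orb_in exI[of _ 1])
 have p0: "fper t ~= 0" for t :: "'k alg_closure" using per_pos_fixed(1)[OF periodic_frob, of t] by simp
 have "card {t \<in> ?X. fper t = d} = d * card (ideal_at ` {t \<in> ?X. fper t = d})" by (rule card_orbit_quotient[OF periodic_frob _ ideal_at_eq_iff f]) (simp add: fr)
 then have "card {t \<in> ?X. fper t = d} = d * card (PP d)" by (simp only: PP_def e)
 moreover have "card {t \<in> ?X. fper t = d} = 0" if "d = 0" by (simp add: that p0)
 moreover have "PP 0 = {}" by (simp add: PP_def p0)
 ultimately show "real (card (PP d)) = real (card {t :: 'k alg_closure. fper t = d & ideal_at t \<in> A}) / real d" unfolding e by (cases "d = 0") auto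
qed

private lemma norm_PP: "p \<in> PP d ==> base_norm p = CARD('k) ^ d" and PP_A: "p \<in> PP d ==> p \<in> A" by (auto simp: PP_def base_norm_ideal_at)

text \<open>The substitution v = q^(1 - s) turns the norm sum over primes of degree below D into a
  power series in v/q; dividing by d passes from elements t to their orbits.\<close>

private lemma sum_PP:
 "(SUM p:(\<Union>d<D. PP d). real (base_norm p) powr - s)
   = (\<Sum>d<D. real (card {t :: 'k alg_closure. fper t = d & ideal_at t \<in> A}) * (CARD('k) powr (1 - s) / CARD('k)) ^ d / real d)"
proof -
 have q: "1 < CARD('k)" using CARD_ge_2[where 'k='k] by simp
 have "(SUM p:(\<Union>d<D. PP d). real (base_norm p) powr - s) = (\<Sum>d<D. SUM p:PP d. real (base_norm p) powr - s)"
 proof (rule sum.UNION_disjoint)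
  have "i = j" if "p \<in> PP i" "p \<in> PP j" for p i j using norm_PP[OF that(1)] norm_PP[OF that(2)] q by simp
  then show "ALL i:{..<D}. ALL j:{..<D}. i ~= j --> PP i \<inter> PP j = {}" by blast
 qed (simp_all add: finite_PP)
 also have "... = (\<Sum>d<D. real (card (PP d)) * (CARD('k) powr (1 - s) / CARD('k)) ^ d)"
 proof (rule sum.cong[OF refl])
  fix d
  have "real CARD('k) powr (1 - s) / CARD('k) = CARD('k) powr - s" using q by (simp add: powr_diff powr_minus field_simps)
  then have "real (base_norm p) powr - s = (CARD('k) powr (1 - s) / CARD('k)) ^ d" if "p \<in> PP d" for p
   using q by (simp add: norm_PP[OF that] powr_realpow[symmetric] powr_powr mult.commute)
  then show "(SUM p:PP d. real (base_norm p) powr - s) = real (card (PP d)) * (CARD('k) powr (1 - s) / CARD('k)) ^ d" by simp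
 qed
 finally show ?thesis unfolding card_PP by simp
qed

text \<open>At most q^d elements have period d and they form orbits of size d, so with v = q^(1 - s)
  the sum is dominated by that of v^d / d.\<close>

lemma base_primes_sum_bound:
 "(%p. real (base_norm p) powr - s) summable_on A" "(\<Sum>\<^sub>\<infinity>p\<in>A. real (base_norm p) powr - s) <= - ln (1 - CARD('k) powr (1 - s))"
 "(\<Sum>d<D. real (card {t :: 'k alg_closure. fper t = d & ideal_at t \<in> A}) * (CARD('k) powr (1 - s) / CARD('k)) ^ d / real d)
   <= (\<Sum>\<^sub>\<infinity>p\<in>A. real (base_norm p) powr - s)"
proof -
 define v where "v = CARD('k) powr (1 - s)"
 have q: "1 < real CARD('k)" using CARD_ge_2[where 'k='k] by simp
 have v: "0 <= v" "v < 1" unfolding v_def using q s powr_less_mono[of "1 - s" 0 "CARD('k)"] by simp_all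
 have b: "(SUM p:F. real (base_norm p) powr - s) <= - ln (1 - v)" if F: "finite F" "F <= A" for F
 proof -
  have "EX d. p \<in> PP d" if p: "p \<in> F" for p
  proof -
   obtain t where "p = ideal_at t" using p F(2) A base_primes_eq by blast
   then have "p \<in> PP (fper t)" using p F(2) by (auto simp: PP_def)
   then show ?thesis by blast
  qed
  then obtain h where h: "!!p. p \<in> F ==> p \<in> PP (h p)" by metis
  define D where "D = Suc (SUM p:F. h p)"
  have "h p < D" if "p \<in> F" for p unfolding D_def using member_le_sum[of p F h] that F(1) by simp
  then have "F <= (\<Union>d<D. PP d)" using h by blast
  then have "(SUM p:F. real (base_norm p) powr - s) <= (SUM p:(\<Union>d<D. PP d). real (base_norm p) powr - s)" by (intro sum_mono2) (auto simp: finite_PP)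
  also have "... <= (\<Sum>d<D. v ^ d / real d)" unfolding sum_PP v_def[symmetric]
  proof (rule sum_mono)
   fix d
   have "card {t :: 'k alg_closure. fper t = d & ideal_at t \<in> A} <= CARD('k) ^ d"
    using card_mono[OF finite_fper[of d, where 'k='k], of "{t. fper t = d & ideal_at t \<in> A}"] card_fper_le[of d, where 'k='k] by force
   then have "real (card {t :: 'k alg_closure. fper t = d & ideal_at t \<in> A}) <= CARD('k) ^ d" by (simp flip: of_nat_power)
   then have "real (card {t :: 'k alg_closure. fper t = d & ideal_at t \<in> A}) * (v / CARD('k)) ^ d <= CARD('k) ^ d * (v / CARD('k)) ^ d"
    using v by (intro mult_right_mono) auto
   also have "... = v ^ d" using q by (simp flip: power_mult_distrib)
   finally show "real (card {t :: 'k alg_closure. fper t = d & ideal_at t \<in> A}) * (v / CARD('k)) ^ d / real d <= v ^ d / real d" by (rule divide_right_mono) simp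
  qed
  also have "... <= (\<Sum>d=1..D. v ^ d / real d)"
  proof -
   have "(\<Sum>d<D. v ^ d / real d) = (SUM d:{1..<D}. v ^ d / real d)" by (rule sum.mono_neutral_right) auto
   also have "... <= (\<Sum>d=1..D. v ^ d / real d)" using v by (intro sum_mono2) auto
   finally show ?thesis .
  qed
  also have "... <= - ln (1 - v)" by (rule sum_power_div_le_ln[OF v])
  finally show ?thesis .
 qed
 show S: "(%p. real (base_norm p) powr - s) summable_on A" by (rule nonneg_bdd_above_summable_on) (use b in \<open>auto intro!: bdd_aboveI[of _ "- ln (1 - v)"]\<close>)
 show "(\<Sum>\<^sub>\<infinity>p\<in>A. real (base_norm p) powr - s) <= - ln (1 - CARD('k) powr (1 - s))" unfolding v_def[symmetric] by (rule infsum_le_finite_sums[OF S b])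
 show "(\<Sum>d<D. real (card {t :: 'k alg_closure. fper t = d & ideal_at t \<in> A}) * (CARD('k) powr (1 - s) / CARD('k)) ^ d / real d)
   <= (\<Sum>\<^sub>\<infinity>p\<in>A. real (base_norm p) powr - s)"
  unfolding sum_PP[symmetric] by (rule finite_sum_le_infsum[OF S]) (use finite_PP PP_A in auto)
qed

end

text \<open>Choose for each \<mu> other than id an integral element moved by \<mu>, and let P be the
  product of the differences. A nontrivial inertia element at x makes x(P) = 0, so x also kills the
  constant coefficient of the characteristic product of P, a nonzero element of k[T].\<close>

lemma (in point_galois) ex_ramification_bound:
 obtains \<Delta> where "\<Delta> ~= 0" "ALL x:pts eN N. ev (x (eN T)) \<Delta> ~= 0 --> inertia \<nu> N e0 x = {id}"
proof -
 have "EX z:BN. \<mu> z ~= z" if s: "\<mu> \<in> G - {id}" for \<mu>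
 proof -
  obtain z where z: "\<mu> z ~= z" using s by (auto simp: fun_eq_iff)
  then have zN: "z \<in> N" using G_off s by auto
  obtain a where a: "a ~= 0" "eN a * z \<in> BN" by (rule N.ex_denominator[OF zN])
  have "\<mu> (eN a * z) = eN a * \<mu> z" using hom_on_mult[OF sN G_hom, of \<mu> "eN a" z] s zN base_N G_eN[of \<mu> a] by auto
  then have "\<mu> (eN a * z) ~= eN a * z" using z a(1) by simp
  then show ?thesis using a(2) by blast
 qed
 then obtain z where z: "!!\<mu>. \<mu> \<in> G - {id} ==> z \<mu> \<in> BN & \<mu> (z \<mu>) ~= z \<mu>" by metis
 define P where "P = (\<Prod>\<mu>\<in>G - {id}. \<mu> (z \<mu>) - z \<mu>)"
 have zB: "\<mu> (z \<mu>) - z \<mu> \<in> BN" if "\<mu> \<in> G - {id}" for \<mu> using z[OF that] G_BN that sring_diff[OF sBN] by simp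
 have PB: "P \<in> BN" unfolding P_def by (rule sring_prod[OF sBN zB])
 have P0: "P ~= 0" unfolding P_def using fin_G z by (auto simp: prod_zero_iff)
 obtain f where f: "conj_poly P = map_poly eN f" by (rule conj_descent[OF PB])
 obtain c g where cg: "f = pCons c g" by (rule pCons_cases)
 have "0 \<notin> conj P"
 proof
  assume "0 \<in> conj P"
  then obtain \<mu> where "\<mu> \<in> G" "\<mu> P = \<mu> 0" using hom_on_0[OF sN G_hom] by (auto simp: conj_def)
  then show False using P0 injD[OF G_inj] by blast
 qed
 then have "poly (map_poly eN f) 0 ~= 0" unfolding f[symmetric] poly_conj_poly .
 then have c0: "c ~= 0" unfolding cg by (auto simp: map_poly_pCons_0)
 have gB: "poly (map_poly eN g) P \<in> BN" by (rule sring_poly[OF sBN _ PB]) (use N.e_B in \<open>simp add: poly_over_def coeff_map_poly\<close>)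
 have "poly (map_poly eN f) P = 0" unfolding f[symmetric] poly_conj_poly by (rule conj_self)
 then have eq: "eN c + P * poly (map_poly eN g) P = 0" unfolding cg by (simp add: map_poly_pCons_0)
 show ?thesis
 proof (rule that[OF c0], intro ballI impI, rule ccontr)
  fix x assume x: "x \<in> pts eN N" "ev (x (eN T)) c ~= 0" "inertia \<nu> N e0 x ~= {id}"
  note h = pts_N_hom[OF x(1)]
  have "id \<in> inertia \<nu> N e0 x" using G_id by (simp add: inertia_def)
  then obtain \<mu> where s: "\<mu> \<in> G - {id}" "ALL b:BN. x (\<mu> b) = x b" using x(3) unfolding inertia_def by blast
  have "x P = (\<Prod>\<mu>\<in>G - {id}. x (\<mu> (z \<mu>) - z \<mu>))" unfolding P_def by (rule hom_on_prod[OF sBN h zB])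
  also have "... = 0"
  proof (rule prod_zero)
   have "x (\<mu> (z \<mu>) - z \<mu>) = 0" using s z[OF s(1)] G_BN hom_on_diff[OF sBN h, of "\<mu> (z \<mu>)" "z \<mu>"] by simp
   then show "\<exists>\<mu>\<in>G - {id}. x (\<mu> (z \<mu>) - z \<mu>) = 0" using s(1) by blast
  qed (use fin_G in simp)
  finally have "x P = 0" .
  then have "x (eN c) = 0" using arg_cong[OF eq, of x] hom_on_add[OF sBN h N.e_B[of c] sring_mult[OF sBN PB gB]] hom_on_mult[OF sBN h PB gB] hom_on_0[OF sBN h] by simp
  then show False using x(2) N.pts_e[OF x(1), of c] by simp
 qed
qed

text \<open>F is the square of the difference of the characters, C its group average and M a bound
  for it. Bounding the Frobenius average of F by its support gives C (-ln(1 - v)) <= M times the sum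
  over S, up to a constant; this is incompatible with C > 0 when S has density zero, and F is
  nonnegative.\<close>

theorem emb_char_eq:
 fixes \<nu> :: "'k::{field,finite} poly fract => 'e::field"
 assumes pg: "point_fract \<nu> N \<iota>" "point_fract \<nu> N \<iota>'"
  and sep: "inj_on (%j. j \<alpha>) (embs \<iota> \<nu> N)" "inj_on (%j. j \<alpha>') (embs \<iota>' \<nu> N)"
  and ae: "arithmetically_equivalent \<iota> \<iota>'" and \<mu>: "\<mu> \<in> gal \<nu> N"
 shows "emb_char \<iota> \<nu> N \<mu> = emb_char \<iota>' \<nu> N \<mu>"
proof -
 interpret a: point_fract \<nu> N \<iota> by fact
 interpret b: point_fract \<nu> N \<iota>' by fact
 let ?q = "real CARD('k)" and ?G = "gal \<nu> N"
 let ?\<chi> = "%\<mu>. real (emb_char \<iota> \<nu> N \<mu>)" and ?\<chi>' = "%\<mu>. real (emb_char \<iota>' \<nu> N \<mu>)"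
 have q: "1 < ?q" using CARD_ge_2[where 'k='k] by simp
 note pa = a.point_galois_axioms and pb = b.point_galois_axioms
 obtain S where S: "has_dirichlet_density S 0" "!!p. p \<in> base_primes - S ==> splitting_type \<iota> p = splitting_type \<iota>' p"
  using ae unfolding arithmetically_equivalent_def by blast
 then have SB: "S <= base_primes" by (simp add: has_dirichlet_density_def)
 define F where "F = (%\<mu>. (?\<chi> \<mu> - ?\<chi>' \<mu>)^2)"
 define C where "C = (\<Sum>\<mu>\<in>?G. F \<mu>) / card ?G"
 have "equidist \<nu> N to_fract (%\<mu>. (?\<chi> \<mu> * ?\<chi> \<mu> + (-2) * (?\<chi> \<mu> * ?\<chi>' \<mu>)) + 1 * (?\<chi>' \<mu> * ?\<chi>' \<mu>))"
  by (intro equidist_linear equidist_char_mult[OF pa pa sep(1) sep(1)] equidist_char_mult[OF pa pb sep] equidist_char_mult[OF pb pb sep(2) sep(2)])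
 moreover have "(%\<mu>. (?\<chi> \<mu> * ?\<chi> \<mu> + (-2) * (?\<chi> \<mu> * ?\<chi>' \<mu>)) + 1 * (?\<chi>' \<mu> * ?\<chi>' \<mu>)) = F"
  unfolding F_def by (simp add: power2_eq_square algebra_simps)
 ultimately have "equidist \<nu> N to_fract F" by (simp only:)
 then obtain K where K: "ALL v:{1/2..<1}. EX s. (%d. (\<Sum>t | fper t = d. F (frob_elt \<nu> N to_fract t)) * (v / ?q) ^ d / real d) sums s & \<bar>s + C * ln (1 - v)\<bar> <= K"
  unfolding equidist_def log_asymp_def C_def by blast
 define M where "M = (real (card (embs \<iota> \<nu> N)) + real (card (embs \<iota>' \<nu> N)))^2"
 have M: "F \<mu> <= M" "0 <= F \<mu>" for \<mu>
 proof -
  have "?\<chi> \<mu> <= real (card (embs \<iota> \<nu> N))" "?\<chi>' \<mu> <= real (card (embs \<iota>' \<nu> N))"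
   unfolding emb_char_def using a.fin_J b.fin_J by (simp_all add: card_mono)
  then have "\<bar>?\<chi> \<mu> - ?\<chi>' \<mu>\<bar> <= \<bar>real (card (embs \<iota> \<nu> N)) + real (card (embs \<iota>' \<nu> N))\<bar>" by linarith
  then show "F \<mu> <= M" unfolding F_def M_def by (simp only: abs_le_square_iff)
 qed (simp add: F_def)
 obtain \<Delta> where \<Delta>: "\<Delta> ~= 0" "ALL x:pts (\<nu> o to_fract) N. ev (x ((\<nu> o to_fract) [:0, 1:])) \<Delta> ~= 0 --> inertia \<nu> N to_fract x = {id}"
  by (rule a.ex_ramification_bound)
 define bad where "bad = {t :: 'k alg_closure. ev t \<Delta> = 0}"
 have fb: "finite bad" unfolding bad_def by (rule finite_ev_eq_0[OF \<Delta>(1)])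
 \<comment> \<open>With trivial inertia the number of fixed points over t is the character at the
   Frobenius element, and it is also the number of entries 1 of the splitting type.\<close>
 have F0: "F (frob_elt \<nu> N to_fract t) = 0" if t: "ideal_at t \<notin> S" "t \<notin> bad" for t
 proof -
  let ?\<mu> = "frob_elt \<nu> N to_fract t"
  obtain x where x: "?\<mu> \<in> ?G" "x \<in> pts (\<nu> o to_fract) N" "x ((\<nu> o to_fract) [:0, 1:]) = t"
   "ALL b:intcl (\<nu> o to_fract) N. (frob ^^ fper t) (x b) = x (?\<mu> b)" by (rule a.frob_elt[of t])
  have I: "inertia \<nu> N to_fract x = {id}" using bspec[OF \<Delta>(2) x(2)] x(3) t(2) by (simp add: bad_def)
  have "card (fix_pts (\<iota> o to_fract) (fper t) t) = emb_char \<iota> \<nu> N ?\<mu>" "card (fix_pts (\<iota>' o to_fract) (fper t) t) = emb_char \<iota>' \<nu> N ?\<mu>"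
   using a.card_fix_pts(1)[OF x(2,1), of "fper t"] b.card_fix_pts(1)[OF x(2,1), of "fper t"] x(3,4) I by simp_all
  moreover have "ideal_at t \<in> base_primes - S" using t(1) base_primes_eq by blast
  then have "splitting_type \<iota> (ideal_at t) = splitting_type \<iota>' (ideal_at t)" by (rule S(2))
  ultimately show ?thesis using a.count_splitting_type[of t] b.count_splitting_type[of t] by (simp add: F_def)
 qed
 let ?I = "%(A :: 'k poly set set) s. \<Sum>\<^sub>\<infinity>p\<in>A. real (base_norm p) powr - s"
 \<comment> \<open>F at Frobenius elements is at most M and is supported on t with
   \<open>ideal_at t\<close> in S or t in \<open>bad\<close>; each t in \<open>bad\<close> enters
   with weight at most 1.\<close>
 have upper: "- C * ln (1 - v) <= K + M * (?I S s + real (card bad))" if v: "v \<in> {1/2..<1}" and s: "1 < s" "?q powr (1 - s) = v" for v s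
 proof -
  let ?H = "%d. \<Sum>t | fper t = d. F (frob_elt \<nu> N to_fract t)"
  let ?n = "%d. real (card {t :: 'k alg_closure. fper t = d & ideal_at t \<in> S})" and ?b = "%d. real (card {t \<in> bad. fper t = d})"
  have u: "0 <= v / ?q" "v / ?q <= 1" using v q by auto
  have H: "?H d <= M * (?n d + ?b d)" for d
  proof -
   have "?H d = (SUM t:{t. fper t = d & ideal_at t \<in> S} \<union> {t \<in> bad. fper t = d}. F (frob_elt \<nu> N to_fract t))"
    by (rule sum.mono_neutral_right) (use finite_fper F0 in auto)
   also have "... <= real (card ({t. fper t = d & ideal_at t \<in> S} \<union> {t \<in> bad. fper t = d})) * M" by (rule sum_bounded_above) (rule M(1))
   also have "... <= (?n d + ?b d) * M" using card_Un_le[of "{t. fper t = d & ideal_at t \<in> S}" "{t \<in> bad. fper t = d}"] by (intro mult_right_mono) (auto simp: M_def)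
   finally show ?thesis by (simp add: mult.commute)
  qed
  obtain r where r: "(%d. ?H d * (v / ?q) ^ d / real d) sums r" "\<bar>r + C * ln (1 - v)\<bar> <= K" using K v by blast
  have "(\<Sum>d<D. ?H d * (v / ?q) ^ d / real d) <= M * (?I S s + real (card bad))" for D
  proof -
   have "(\<Sum>d<D. ?H d * (v / ?q) ^ d / real d) <= (\<Sum>d<D. M * (?n d * (v / ?q) ^ d / real d + ?b d))"
   proof (rule sum_mono)
    fix d
    have w: "0 <= (v / ?q) ^ d" "(v / ?q) ^ d / real d <= 1"
    proof -
     show "0 <= (v / ?q) ^ d" using u by simp
     show "(v / ?q) ^ d / real d <= 1" using power_le_one[OF u, of d] by (cases "d = 0") (auto simp: divide_le_eq intro: order_trans)
    qed
    have "?H d * ((v / ?q) ^ d / real d) <= M * (?n d + ?b d) * ((v / ?q) ^ d / real d)" by (rule mult_right_mono[OF H]) (use w in simp)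
    also have "... = M * (?n d * (v / ?q) ^ d / real d + ?b d * ((v / ?q) ^ d / real d))" by (simp add: algebra_simps)
    also have "... <= M * (?n d * (v / ?q) ^ d / real d + ?b d)" using w mult_left_mono[OF w(2), of "?b d"] by (intro mult_left_mono add_left_mono) (auto simp: M_def)
    finally show "?H d * (v / ?q) ^ d / real d <= M * (?n d * (v / ?q) ^ d / real d + ?b d)" by simp
   qed
   also have "... = M * ((\<Sum>d<D. ?n d * (v / ?q) ^ d / real d) + (\<Sum>d<D. ?b d))" by (simp only: sum_distrib_left[symmetric] sum.distrib)
   also have "... <= M * (?I S s + real (card bad))"
   proof (intro mult_left_mono add_mono)
    show "(\<Sum>d<D. ?n d * (v / ?q) ^ d / real d) <= ?I S s" using base_primes_sum_bound(3)[OF SB s(1)] unfolding s(2) .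
    have "(\<Sum>d<D. card {t \<in> bad. fper t = d}) = card (\<Union>d<D. {t \<in> bad. fper t = d})" by (rule card_UN_disjoint[symmetric]) (use fb in auto)
    also have "... <= card bad" using fb by (intro card_mono) auto
    finally show "(\<Sum>d<D. ?b d) <= real (card bad)" by (simp flip: of_nat_sum)
   qed (simp add: M_def)
   finally show ?thesis .
  qed
  then have "r <= M * (?I S s + real (card bad))" using sums_unique[OF r(1)] suminf_le_const[OF sums_summable[OF r(1)]] by simp
  then show ?thesis using r(2) by linarith
 qed
 have "C <= 0"
 proof (rule ccontr)
  assume "\<not> C <= 0"
  then have C: "0 < C" by simp
  have M0: "0 <= M" by (simp add: M_def)
  \<comment> \<open>Then M \<epsilon> <= C / 2, so the sum over S absorbs at most half of the main
    term C (-ln(1 - v)).\<close>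
  define \<epsilon> where "\<epsilon> = C / (2 * (M + 1))"
  have e: "0 < \<epsilon>" "M * \<epsilon> <= C / 2" unfolding \<epsilon>_def using C M0 by (simp_all add: field_simps)
  have "\<forall>\<^sub>F s in at_right 1. ?I S s / ?I base_primes s < \<epsilon>" using S(1) order_tendstoD(2)[OF _ e(1)] unfolding has_dirichlet_density_def by blast
  then obtain s1 where s1: "1 < s1" "!!s. 1 < s ==> s < s1 ==> ?I S s / ?I base_primes s < \<epsilon>" unfolding eventually_at_right_field by blast
  define B where "B = \<bar>K\<bar> + M * real (card bad)"
  \<comment> \<open>With v = 1 - \<delta> this ensures v >= 1/2, s < s1 and -ln(1 - v) > 2 B / C +
    1; the halving makes the inequalities strict.\<close>
  define \<delta> where "\<delta> = Min {1/2, 1 - ?q powr (1 - s1), exp (- (2 * B / C + 1))} / 2"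
  have "?q powr (1 - s1) < 1" using powr_less_mono[of "1 - s1" 0 ?q] q s1(1) by simp
  then have d: "0 < \<delta>" "\<delta> < 1/2" "\<delta> < 1 - ?q powr (1 - s1)" "\<delta> < exp (- (2 * B / C + 1))" unfolding \<delta>_def by (auto simp: min_def)
  define v where "v = 1 - \<delta>"
  have v: "v \<in> {1/2..<1}" "0 < v" "?q powr (1 - s1) < v" using d by (auto simp: v_def)
  define s where "s = 1 - ln v / ln ?q"
  have lq: "0 < ln ?q" using q by simp
  have qs: "?q powr (1 - s) = v" unfolding s_def powr_def using v q lq by simp
  have "1 < s" using v lq by (simp add: s_def divide_neg_pos)
  have "s < s1"
  proof (rule ccontr)
   assume "\<not> s < s1"
   then have "?q powr (1 - s) <= ?q powr (1 - s1)" using q by (intro powr_mono) auto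
   then show False using qs v(3) by simp
  qed
  \<comment> \<open>A single prime makes the denominator of the density quotient positive, so the
    quotient can be multiplied out.\<close>
  have "ideal_at 0 \<in> (base_primes :: 'k poly set set)" using base_primes_eq by blast
  then have "real (base_norm (ideal_at (0 :: 'k alg_closure))) powr - s <= ?I base_primes s"
   using finite_sum_le_infsum[OF base_primes_sum_bound(1)[OF order_refl \<open>1 < s\<close>], of "{ideal_at (0 :: 'k alg_closure)}"] by simp
  moreover have "0 < real (base_norm (ideal_at (0 :: 'k alg_closure))) powr - s" by (simp add: base_norm_ideal_at)
  ultimately have pos: "0 < ?I base_primes s" by linarith
  have "?I S s <= \<epsilon> * ?I base_primes s" using s1(2)[OF \<open>1 < s\<close> \<open>s < s1\<close>] pos by (simp add: pos_divide_less_eq less_imp_le)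
  also have "... <= \<epsilon> * (- ln (1 - v))"
   using base_primes_sum_bound(2)[of "base_primes :: 'k poly set set", OF order_refl \<open>1 < s\<close>] e(1) unfolding qs by (intro mult_left_mono) auto
  finally have "M * ?I S s <= (M * \<epsilon>) * (- ln (1 - v))" using mult_left_mono[OF _ M0] by (fastforce simp: mult.assoc)
  also have "... <= C / 2 * (- ln (1 - v))" using e(2) v by (intro mult_right_mono) (auto simp: v_def)
  finally have "C * (- ln (1 - v)) <= 2 * B" using upper[OF v(1) \<open>1 < s\<close> qs] by (simp add: B_def algebra_simps)
  moreover have "2 * B / C + 1 < - ln (1 - v)" using d(1,4) ln_less_cancel_iff[of \<delta> "exp (- (2 * B / C + 1))"] by (simp add: v_def)
  then have "C * (2 * B / C + 1) < C * (- ln (1 - v))" using C by (intro mult_strict_left_mono)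
  ultimately show False using C by (simp add: distrib_left)
 qed
 then have "(\<Sum>\<mu>\<in>?G. F \<mu>) <= 0" using a.card_G_pos by (simp add: C_def divide_le_0_iff)
 then have "(\<Sum>\<mu>\<in>?G. F \<mu>) = 0" using sum_nonneg[of ?G F] M(2) by (simp add: antisym)
 then have "F \<mu> = 0" using sum_nonneg_eq_0_iff[OF a.fin_G, of F] M(2) \<mu> by simp
 then show ?thesis by (simp add: F_def)
qed



section \<open>Separable generators, the chart at infinity and the conclusion\<close>

text \<open>Turns finite dimension into finite generation as a ring, the form in which the primitive
  element theorem can use it.\<close>

lemma (in ring) dimension_generators:
 assumes "dimension n K E" and "\<zero> = z"
 shows "EX A. finite A & (ALL C. z \<in> C & K <= C & A <= C & (ALL a:C. ALL b:C. a \<otimes> b \<in> C & a \<oplus> b \<in> C) --> E <= C)"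
 using assms
proof (induction rule: dimension.induct)
 case (zero_dim K)
 then show ?case by (intro exI[of _ "{}"]) auto
next
 case (Suc_dim v E n K)
 then obtain A where A: "finite A" "!!C. z \<in> C & K <= C & A <= C & (ALL a:C. ALL b:C. a \<otimes> b \<in> C & a \<oplus> b \<in> C) ==> E <= C" by blast
 have "line_extension K v E <= C"
  if C: "z \<in> C & K <= C & insert v A <= C & (ALL a:C. ALL b:C. a \<otimes> b \<in> C & a \<oplus> b \<in> C)" for C
 proof
  fix u assume "u \<in> line_extension K v E"
  then obtain k w where u: "k \<in> K" "w \<in> E" "u = k \<otimes> v \<oplus> w" unfolding line_extension_mem_iff by blast
  have "w \<in> C" using A(2)[of C] C u(2) by blast
  then show "u \<in> C" using u C by blast
 qed
 then show ?case using A(1) by (intro exI[of _ "insert v A"]) blast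
qed

lemma infinite_UNIV_poly_fract: "infinite (UNIV :: 'k::field poly fract set)"
proof
 assume "finite (UNIV :: 'k poly fract set)"
 then have "finite (range (to_fract :: 'k poly => _))" by (rule finite_subset[rotated]) simp
 moreover have "inj (to_fract :: 'k poly => _)" by (rule injI) simp
 ultimately show False using finite_imageD infinite_UNIV_poly by blast
qed

text \<open>The primitive element theorem is stated over an algebraically closed field, so it is
  applied inside the algebraic closure of K, with the generator kept in the image of K.\<close>

lemma ex_separable_generator:
 fixes \<iota> :: "'k::{field,finite} poly fract => 'a::field"
 assumes fse: "finite_separable_extension \<iota>"
 obtains \<alpha> m where "field_hom \<iota>" "minpoly_of \<iota> \<alpha> m" "evk \<iota> \<alpha> (pderiv m) ~= 0" "0 < degree m" "adj \<iota> \<alpha> = UNIV"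
proof -
 interpret R: ring "ring_of_type_algebra :: 'a ring" using cring.axioms(1)[OF cring_subring_of_type[OF sring_UNIV]] subring_of_type_UNIV by metis
 have rh: "\<iota> \<in> Ring.ring_hom ring_of_type_algebra ring_of_type_algebra" using fse by (simp add: finite_separable_extension_def)
 have iadd: "\<iota> (x + y) = \<iota> x + \<iota> y" and imul: "\<iota> (x * y) = \<iota> x * \<iota> y" and i1: "\<iota> 1 = 1" for x y
  using ring_hom_add[OF rh, of x y] ring_hom_mult[OF rh, of x y] ring_hom_one[OF rh] by simp_all
 have "\<iota> 0 = \<iota> 0 + \<iota> 0" using iadd[of 0 0] by (simp only: add_0_left)
 then have i0: "\<iota> 0 = 0" by (simp only: add_cancel_right_right)
 have \<iota>: "field_hom \<iota>" by unfold_locales (simp_all add: iadd imul i1 i0)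
 interpret i: field_hom \<iota> by (rule \<iota>)
 interpret e: comm_ring_hom "evk \<iota> x" for x by (rule evk_hom[OF \<iota>])
 let ?\<kappa> = "to_ac o \<iota>"
 have \<kappa>: "field_hom ?\<kappa>" by unfold_locales (simp_all add: i.hom_add i.hom_mult)
 have ek: "evk ?\<kappa> (to_ac x) p = to_ac (evk \<iota> x p)" for x p
 proof -
  have "map_poly ?\<kappa> p = map_poly to_ac (map_poly \<iota> p)" by (simp add: map_poly_map_poly)
  then show ?thesis by (simp add: evk_def to_ac.poly_map_poly)
 qed
 have sp: "EX p. evk \<iota> x p = 0 & evk \<iota> x (pderiv p) ~= 0" for x
 proof -
  obtain p where p: "lead_coeff p = 1" "evk \<iota> x p = 0" "coprime p (pderiv p)" using fse unfolding finite_separable_extension_def separable_poly_def evk_def by blast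
  have "p ~= 0" using p(1) by auto
  then obtain m where m: "minpoly_of \<iota> x m" using ex_minpoly_of[OF \<iota> p(2)] by blast
  have "evk \<iota> x (pderiv p) ~= 0"
  proof
   assume "evk \<iota> x (pderiv p) = 0"
   then have "m dvd p" "m dvd pderiv p" using m p(2) unfolding minpoly_of_def by blast+
   then have "m dvd 1" using coprime_common_divisor[OF p(3)] by blast
   then have "evk \<iota> x 1 = 0" using m unfolding minpoly_of_def by blast
   then show False by simp
  qed
  then show ?thesis using p(2) by blast
 qed
 obtain n where "R.dimension n (range \<iota>) UNIV" using fse unfolding finite_separable_extension_def R.finite_dimension_def by blast
 then obtain A where A: "finite A" "!!C. 0 \<in> C & range \<iota> <= C & A <= C & (ALL a:C. ALL b:C. a * b \<in> C & a + b \<in> C) ==> UNIV <= C"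
  using R.dimension_generators[of n "range \<iota>" UNIV 0] by auto
 have "\<exists>\<gamma>\<in>range to_ac. sepp ?\<kappa> \<gamma> & to_ac ` A <= adj ?\<kappa> \<gamma>"
 proof (rule primitive_element_finite[OF \<kappa> infinite_UNIV_poly_fract])
  show "finite (to_ac ` A)" using A(1) by simp
  show "sepp ?\<kappa> b" if "b \<in> to_ac ` A" for b using that sp unfolding sepp_def by (force simp: ek)
  show "0 \<in> range (to_ac :: 'a => _)" by (rule range_eqI[of _ _ 0]) simp
  show "x + ?\<kappa> c * y \<in> range to_ac" if "x \<in> range to_ac" "y \<in> to_ac ` A" for x y c using that by (auto simp flip: to_ac_mult to_ac_add)
 qed
 then obtain \<alpha> where \<alpha>: "to_ac ` A <= adj ?\<kappa> (to_ac \<alpha>)" by blast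
 have sr: "sring (adj \<iota> \<alpha>)" by (rule sring_adj[OF \<iota>])
 have "A <= adj \<iota> \<alpha>"
 proof
  fix a assume "a \<in> A"
  then obtain p where "to_ac a = evk ?\<kappa> (to_ac \<alpha>) p" using \<alpha> unfolding adj_def by blast
  then have "a = evk \<iota> \<alpha> p" by (simp add: ek)
  then show "a \<in> adj \<iota> \<alpha>" unfolding adj_def by blast
 qed
 then have "UNIV <= adj \<iota> \<alpha>" using base_adj[OF \<iota>, of _ \<alpha>] sring_0[OF sr] sring_add[OF sr] sring_mult[OF sr] by (intro A(2)) auto
 moreover have "sepp \<iota> \<alpha>" using sp by (auto simp: sepp_def)
 then obtain m where "minpoly_of \<iota> \<alpha> m" "evk \<iota> \<alpha> (pderiv m) ~= 0" "0 < degree m" by (rule sepp_minpoly[OF \<iota>])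
 ultimately show ?thesis using \<iota> that by auto
qed

text \<open>The embedding f -> f(1/T), whose image is the coordinate ring k[1/T] of the line around
  infinity.\<close>

definition poly_at_inverse :: "'k::field poly => 'k poly fract" where
 "poly_at_inverse f = poly (map_poly (%c. to_fract [:c:]) f) (inverse (to_fract [:0, 1:]))"

lemma const_fract_hom: "field_hom (%c :: 'k::field. to_fract [:c:])"
 by unfold_locales (simp_all flip: to_fract_add to_fract_mult, simp_all add: one_pCons[symmetric])

text \<open>T^(deg f) f(1/T) is the reflected polynomial of f, so injectivity and the representation
  by fractions are inherited from k[T].\<close>

lemma poly_at_inverse:
 fixes c :: "'k::{field,finite} poly fract"
 shows "poly_emb (poly_at_inverse :: 'k poly => _)" "EX a b. b ~= 0 & poly_at_inverse b * c = poly_at_inverse a"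
  "poly_at_inverse [:d:] = (to_fract [:d:] :: 'k poly fract)" "poly_at_inverse [:0, 1:] = (inverse (to_fract [:0, 1:]) :: 'k poly fract)"
proof -
 let ?T = "to_fract [:0, 1:] :: 'k poly fract" and ?h = "%c :: 'k. to_fract [:c:]"
 interpret h: field_hom ?h by (rule const_fract_hom)
 have pa: "poly_at_inverse f = poly (map_poly ?h f) (inverse ?T)" for f by (simp add: poly_at_inverse_def)
 interpret m: map_poly_comm_ring_hom ?h ..
 have T: "poly (map_poly ?h f) ?T = to_fract f" for f by (induction f) (simp_all add: map_poly_pCons_0 flip: to_fract_add to_fract_mult)
 have rf: "reflect_poly (map_poly ?h f) = map_poly ?h (reflect_poly f)" for f by (rule poly_eqI) (simp add: coeff_reflect_poly coeff_map_poly degree_map_poly)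
 have c: "poly_at_inverse [:d:] = to_fract [:d:]" for d :: 'k by (simp add: pa map_poly_pCons_0)
 show "poly_at_inverse [:d:] = to_fract [:d:]" by (rule c)
 show t: "poly_at_inverse [:0, 1:] = inverse ?T" by (simp add: pa map_poly_pCons_0 flip: one_pCons)
 show pe: "poly_emb (poly_at_inverse :: 'k poly => _)"
 proof
  show "poly_at_inverse (x + y) = poly_at_inverse x + poly_at_inverse y"
   "poly_at_inverse (x * y) = poly_at_inverse x * poly_at_inverse y" for x y :: "'k poly" unfolding pa by (simp_all add: m.hom_add m.hom_mult)
  show "poly_at_inverse 0 = (0 :: 'k poly fract)" "poly_at_inverse 1 = (1 :: 'k poly fract)" by (simp_all add: pa)
  fix f :: "'k poly" assume "poly_at_inverse f = 0"
  then have "poly (reflect_poly (map_poly ?h f)) ?T = 0" by (simp add: poly_reflect_poly_nz pa)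
  then have "to_fract (reflect_poly f) = 0" by (simp add: T rf)
  then show "f = 0" by simp
 qed
 interpret p: poly_emb "poly_at_inverse :: 'k poly => _" by (rule pe)
 define Q where "Q = (%c :: 'k poly fract. EX a b. b ~= 0 & poly_at_inverse b * c = poly_at_inverse a)"
 have Q: "Q (to_fract f)" for f
 proof -
  have "map_poly ?h (reflect_poly f) = reflect_poly (map_poly ?h f)" by (simp add: rf)
  then have "poly_at_inverse (reflect_poly f) = poly_at_inverse ([:0, 1:] ^ degree f) * to_fract f"
   unfolding p.hom_power t by (simp add: pa poly_reflect_poly_nz degree_map_poly T)
  moreover have "[:0, 1:] ^ degree f ~= (0 :: 'k poly)" by simp
  ultimately show ?thesis unfolding Q_def by metis
 qed
 obtain a b where c: "c = to_fract a / to_fract b" "b ~= 0" using Fract_conv_to_fract by (metis Fract_cases)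
 obtain a1 b1 where 1: "b1 ~= 0" "poly_at_inverse b1 * to_fract a = poly_at_inverse a1" using Q[of a] unfolding Q_def by blast
 obtain a2 b2 where 2: "b2 ~= 0" "poly_at_inverse b2 * to_fract b = poly_at_inverse a2" using Q[of b] unfolding Q_def by blast
 have "a2 ~= 0" using 2 c(2) by auto
 moreover have "poly_at_inverse (a2 * b1) * c = poly_at_inverse (a1 * b2)" unfolding p.hom_mult 1(2)[symmetric] 2(2)[symmetric] using c by simp
 ultimately show "EX a b. b ~= 0 & poly_at_inverse b * c = poly_at_inverse a" using 1(1) by (metis mult_eq_0_iff)
qed

lemma poly_emb_to_fract: "poly_emb (to_fract :: 'k::{field,finite} poly => _)"
 by unfold_locales simp_all

lemma fract_eq_quotient: "\<exists>a b :: 'k::field poly. b ~= 0 & to_fract b * c = to_fract a"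
proof -
 obtain a b where "c = to_fract a / to_fract b" "b ~= (0 :: 'k poly)" using Fract_conv_to_fract by (metis Fract_cases)
 then show ?thesis by (intro exI[of _ a] exI[of _ b]) simp
qed

lemma (in point_galois) place_chartI:
 assumes "!!c. const_embed \<iota>' c = eK [:c:]"
 shows "place_chart eK (card J) \<iota>'"
 by (intro place_chart.intro place_chart_axioms.intro K.bchart_axioms assms)

theorem proposition2:
  fixes \<iota> :: "'k::{field,finite} poly fract \<Rightarrow> 'a::field"
    and \<kappa> :: "'k poly fract \<Rightarrow> 'b::field"
  assumes "finite_separable_extension \<iota>"
    and "finite_separable_extension \<kappa>"
    and "arithmetically_equivalent \<iota> \<kappa>"
  shows "weil_zeta \<iota> = weil_zeta \<kappa>"
proof -
 obtain \<alpha> m where a: "field_hom \<iota>" "minpoly_of \<iota> \<alpha> m" "evk \<iota> \<alpha> (pderiv m) ~= 0" "0 < degree m" "adj \<iota> \<alpha> = UNIV"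
  by (rule ex_separable_generator[OF assms(1)])
 obtain \<beta> m' where b: "field_hom \<kappa>" "minpoly_of \<kappa> \<beta> m'" "evk \<kappa> \<beta> (pderiv m') ~= 0" "0 < degree m'" "adj \<kappa> \<beta> = UNIV"
  by (rule ex_separable_generator[OF assms(2)])
 let ?\<phi> = "to_ac :: 'k poly fract => 'k poly fract alg_closure"
 have \<phi>: "field_hom ?\<phi>" by (rule to_ac_hom)
 interpret e: comm_ring_hom "evk ?\<phi> z" for z by (rule evk_hom[OF \<phi>])
 \<comment> \<open>Roots of both minimal polynomials together, so that one Galois extension receives
   the embeddings of both fields.\<close>
 define B where "B = {z. evk ?\<phi> z m = 0 \<or> evk ?\<phi> z m' = 0}"
 have "m ~= 0" "m' ~= 0" using a(4) b(4) by auto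
 then have "finite {z. evk ?\<phi> z m = 0}" "finite {z. evk ?\<phi> z m' = 0}" unfolding evk_def by (intro poly_roots_finite; simp)+
 then have "finite B" unfolding B_def by (simp add: Collect_disj_eq)
 moreover have "sepp ?\<phi> z" if "z \<in> B" for z
 proof -
  obtain u v where uv: "u * pderiv m + v * m = 1" by (rule minpoly_of_bezout[OF a(1-3)])
  obtain u' v' where uv': "u' * pderiv m' + v' * m' = 1" by (rule minpoly_of_bezout[OF b(1-3)])
  have "evk ?\<phi> z u * evk ?\<phi> z (pderiv m) + evk ?\<phi> z v * evk ?\<phi> z m = 1"
   "evk ?\<phi> z u' * evk ?\<phi> z (pderiv m') + evk ?\<phi> z v' * evk ?\<phi> z m' = 1"
   using arg_cong[OF uv, of "evk ?\<phi> z"] arg_cong[OF uv', of "evk ?\<phi> z"] by (simp_all add: e.hom_add e.hom_mult)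
  then have "evk ?\<phi> z m = 0 --> evk ?\<phi> z (pderiv m) ~= 0" "evk ?\<phi> z m' = 0 --> evk ?\<phi> z (pderiv m') ~= 0" by auto
  then show ?thesis using that unfolding B_def sepp_def by blast
 qed
 ultimately obtain N where N: "galois ?\<phi> N" "B <= N" by (rule ex_galois[OF \<phi> infinite_UNIV_poly_fract]) (auto simp: B_def)
 have root: "EX r. evk ?\<phi> r p = 0" if "0 < degree p" for p unfolding evk_def using that by (intro alg_closed_imp_poly_has_root) simp
 have "galois_emb ?\<phi> N \<iota>" "galois_emb ?\<phi> N \<kappa>"
 proof -
  obtain r r' where "evk ?\<phi> r m = 0" "evk ?\<phi> r' m' = 0" using root a(4) b(4) by blast
  then show "galois_emb ?\<phi> N \<iota>" "galois_emb ?\<phi> N \<kappa>"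
   using N(2) by (auto intro!: ex_galois_emb[OF N(1) a(1,2,5)] ex_galois_emb[OF N(1) b(1,2,5)] simp: B_def)
 qed
 note ge = this
 have pg: "point_galois ?\<phi> N \<iota> to_fract" "point_galois ?\<phi> N \<kappa> to_fract"
  by (intro point_galois.intro point_galois_axioms.intro ge poly_emb_to_fract fract_eq_quotient)+
 \<comment> \<open>N, the embeddings and the characters do not involve \<open>e0\<close>, so the
   equality of characters obtained with T serves the chart 1/T as well.\<close>
 have pg2: "point_galois ?\<phi> N \<iota> poly_at_inverse" "point_galois ?\<phi> N \<kappa> poly_at_inverse"
  by (intro point_galois.intro point_galois_axioms.intro ge poly_at_inverse(1,2))+
 interpret a: point_galois ?\<phi> N \<iota> to_fract by (rule pg)
 interpret b: point_galois ?\<phi> N \<kappa> to_fract by (rule pg)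
 interpret a2: point_galois ?\<phi> N \<iota> poly_at_inverse by (rule pg2)
 interpret b2: point_galois ?\<phi> N \<kappa> poly_at_inverse by (rule pg2)
 have "inj_on (%j. j \<alpha>) (embs \<iota> ?\<phi> N)"
 proof (rule inj_onI, rule HOL.ext)
  fix j j' z assume j: "j \<in> embs \<iota> ?\<phi> N" "j' \<in> embs \<iota> ?\<phi> N" "j \<alpha> = j' \<alpha>"
  obtain p where "z = evk \<iota> \<alpha> p" using a(5) unfolding adj_def by blast
  then show "j z = j' z" using a.J_evk[OF j(1)] a.J_evk[OF j(2)] j(3) by simp
 qed
 moreover have "inj_on (%j. j \<beta>) (embs \<kappa> ?\<phi> N)"
 proof (rule inj_onI, rule HOL.ext)
  fix j j' z assume j: "j \<in> embs \<kappa> ?\<phi> N" "j' \<in> embs \<kappa> ?\<phi> N" "j \<beta> = j' \<beta>"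
  obtain p where "z = evk \<kappa> \<beta> p" using b(5) unfolding adj_def by blast
  then show "j z = j' z" using b.J_evk[OF j(1)] b.J_evk[OF j(2)] j(3) by simp
 qed
 ultimately have \<chi>: "emb_char \<iota> ?\<phi> N \<sigma> = emb_char \<kappa> ?\<phi> N \<sigma>" if "\<sigma> \<in> gal ?\<phi> N" for \<sigma>
  using emb_char_eq[OF point_fract.intro[OF pg(1)] point_fract.intro[OF pg(2)] _ _ assms(3) that] by blast
 show ?thesis
 proof (rule weil_zeta_eq_if_fix_pts_eq)
  show "place_chart (\<iota> o to_fract) (card (embs \<iota> ?\<phi> N)) \<iota>" "place_chart (\<kappa> o to_fract) (card (embs \<kappa> ?\<phi> N)) \<kappa>"
   by (rule a.place_chartI b.place_chartI; simp add: const_embed_def poly_embed_def)+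
  show "place_chart (\<iota> o poly_at_inverse) (card (embs \<iota> ?\<phi> N)) \<iota>" "place_chart (\<kappa> o poly_at_inverse) (card (embs \<kappa> ?\<phi> N)) \<kappa>"
   by (rule a2.place_chartI b2.place_chartI; simp add: const_embed_def poly_embed_def poly_at_inverse(3))+
  show "(\<iota> o poly_at_inverse) [:0, 1:] = inverse ((\<iota> o to_fract) [:0, 1:])" "(\<kappa> o poly_at_inverse) [:0, 1:] = inverse ((\<kappa> o to_fract) [:0, 1:])"
   using a.\<iota>.hom_inverse b.\<iota>.hom_inverse by (simp_all add: poly_at_inverse(4))
 qed (rule a.finite_fix_pts b.finite_fix_pts a2.finite_fix_pts b2.finite_fix_pts card_fix_pts_eq[OF pg \<chi>] card_fix_pts_eq[OF pg2 \<chi>]; assumption)+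
qed

end
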